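(* Assume the setting and notation of the context, with $R_0=[-1/2,1/2]^d$. Suppose that the following hold. (Mean, variance functions and measurement errors) (1) $m$ is $(p+1)$-times continuously partially differentiable on $R_0$. (2) $\eta$ is continuous over $R_0$ and $\inf_{\bm z\in R_0}\eta(\bm z)>0$. (3) $\{\varepsilon_i\}_{i=1}^n$ are i.i.d. with $E[\varepsilon_1]=0$, $E[\varepsilon_1^2]=1$, $E[|\varepsilon_1|^{q_1}]<\infty$ for some integer $q_1>4$, and $\sigma_\varepsilon$ is continuous over $R_0$ with $\inf_{\bm z\in R_0}\sigma_\varepsilon(\bm z)>0$. (Sampling) (4) $A_n/n\to\kappa\in[0,\infty)$. (5) $\{\bm X_i\}_{i=1}^n$ are i.i.d. with density $A_n^{-1}g(\cdot/A_n)$, where $g$ is a probability density with support $R_0$, continuous and positive on $R_0$. (6) $\{\bm X_i\}_{i=1}^n$, $\bm e$ and $\{\varepsilon_i\}_{i=1}^n$ are mutually independent. (Random field and bandwidths) Let $\{A_{n1,j}\}_{n\ge1},\{A_{n2,j}\}_{n\ge1}$ $(1\le j\le d)$ be sequences of positive numbers, and put $A_n^{(1)}=\prod_{j=1}^dA_{n1,j}$, $\overline A_{n1}=\max_jA_{n1,j}$, $\underline A_{n2}=\min_jA_{n2,j}$. (7) $\bm e$ is stationary and $E[|e(\bm 0)|^{q_2}]<\infty$ for some integer $q_2>4$. (8) With $\sigma_{\bm e}(\bm x)=E[e(\bm 0)e(\bm x)]$, $\int_{\mathbb R^d}|\sigma_{\bm e}(\bm v)|d\bm v<\infty$. (9)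 $\min\{A_{n2,j},A_{n1,j}/A_{n2,j},A_{n,j}h_j/A_{n1,j}\}\to\infty$ as $n\to\infty$. (10) $\bm e$ is $\beta$-mixing with coefficients $\beta(a;b)\le\beta_1(a)\varpi_2(b)$ such that, as $n\to\infty$, $h_j\to0$ $(1\le j\le d)$, $$\frac{A_n^{(1)}}{(\overline A_{n1})^d}\sim1,\qquad\frac{A_n^{1/2}(h_1\cdots h_d)^{1/2}}{n^{1/q_2}(\overline A_{n1})^d(\log n)^{1/2+\iota}}\gtrsim1\ \text{ for some }\iota\in(0,\infty),$$ $$\frac{n^dA_n^{1-d/2}(h_1\cdots h_d)^{d/2}}{(\log n)^{d/2}A_n^{(1)}}\,\beta_1(\underline A_{n2})\,\varpi_2(A_nh_1\cdots h_d)\to0.$$ (Kernel) (11) $\int K(\bm z)d\bm z=1$; $K$ is bounded and supported on $[-C_K,C_K]^d\subset[-1/2,1/2]^d$ for some $C_K>0$; $|K(\bm v_1)-K(\bm v_2)|\le L_K|\bm v_1-\bm v_2|$ for some $L_K\in(0,\infty)$ and all $\bm v_1,\bm v_2\in\mathbb R^d$; and the matrix $S$ is non-singular. (12) $q_1\ge q_2$. Let $\mathrm T_n=\prod_{j=1}^d[-1/2+C_Kh_j,\,1/2-C_Kh_j]$. Then for every $1\le j_1\le\dots\le j_L\le d$, $0\le L\le p$, as $n\to\infty$, $$\sup_{\bm z\in\mathrm T_n}\big|\partial_{j_1\dots j_L}\hat m(\bm z)-\partial_{j_1\dots j_L}m(\bm z)\big|=O_p\left(\frac{\sum_{1\le k_1\le\dots\le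 k_{p+1}\le d}\prod_{\ell=1}^{p+1}h_{k_\ell}}{\prod_{\ell=1}^Lh_{j_\ell}}+\sqrt{\frac{\log n}{A_nh_1\cdots h_d\big(\prod_{\ell=1}^Lh_{j_\ell}\big)^2}}\right).$$
   Context: Fix integers $d\ge1$ and $p\ge1$. For $\bm x\in\mathbb R^d$, $|\bm x|=\sum_j|x_j|$; $'$ denotes transpose. For positive sequences, $a_n\lesssim b_n$ means $a_n\le Cb_n$ for all $n$ with $C>0$ independent of $n$ ($b_n\gtrsim a_n$ is the same), and $a_n\sim b_n$ means $a_n\lesssim b_n$ and $b_n\lesssim a_n$. Model. For $1\le j\le d$, $A_{n,j}>0$ with $A_{n,j}\to\infty$; $A_n=\prod_{j=1}^dA_{n,j}$; $R_n=\prod_{j=1}^d[-A_{n,j}/2,A_{n,j}/2]$; for $\bm x\in\mathbb R^d$, $\bm x/A_n:=(x_1/A_{n,1},\dots,x_d/A_{n,d})'$ and $A_n\bm z:=(A_{n,1}z_1,\dots,A_{n,d}z_d)'$ (while $A_n$ alone as a scalar factor denotes the product). One observes at random sites $\bm X_i=\bm X_{n,i}=(X_{i,1},\dots,X_{i,d})'$, $i=1,\dots,n$, $$Y(\bm X_i)=m(\bm X_i/A_n)+\eta(\bm X_i/A_n)e(\bm X_i)+\sigma_\varepsilon(\bm X_i/A_n)\varepsilon_i,$$ where $m:[-1/2,1/2]^d\to\mathbb R$, $\eta,\sigma_\varepsilon:[-1/2,1/2]^d\to(0,\infty)$, $\bm e=\{e(\bm x):\bm x\in\mathbb R^d\}$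 is a stationary random field with $E[e(\bm x)]=0$, $E[e^2(\bm x)]=1$, and $\varepsilon_i$ are i.i.d. random variables with mean $0$ and variance $1$. Mixing. For $T\subset\mathbb R^d$, $\mathcal F_{\bm e}(T)=\sigma(\{e(\bm x):\bm x\in T\})$. For $T_1,T_2\subset\mathbb R^d$, $\bar\beta(T_1,T_2)=\sup\frac12\sum_{j=1}^J\sum_{k=1}^{K'}|P(A_j\cap B_k)-P(A_j)P(B_k)|$, the supremum being over all pairs of finite partitions $\{A_1,\dots,A_J\}$, $\{B_1,\dots,B_{K'}\}$ of the sample space with $A_j\in\mathcal F_{\bm e}(T_1)$, $B_k\in\mathcal F_{\bm e}(T_2)$. With $d(T_1,T_2)=\inf\{|\bm x-\bm y|:\bm x\in T_1,\bm y\in T_2\}$ and $\mathcal R(b)$ the collection of all finite disjoint unions of cubes in $\mathbb R^d$ with total volume not exceeding $b$, set $\beta(a;b)=\sup\{\bar\beta(T_1,T_2):d(T_1,T_2)\ge a,\ T_1,T_2\in\mathcal R(b)\}$, $a,b>0$. Standing assumption: $\beta(a;b)\le\beta_1(a)\varpi_2(b)$ for a non-increasing function $\beta_1$ with $\beta_1(a)\to0$ as $a\to\infty$ and a non-decreasing (possibly unbounded) function $\varpi_2$. Multi-index notation. Tuples $(j_1,\dots,j_L)$ satisfy $1\le j_1\le\dots\le j_L\le d$; for $L=0$ there is one (empty) tuple, and empty products equal $1$. $D$ is the number of tuples with $0\le L\le p$. Vectors in $\mathbb R^D$ are indexed by these tuples, ordered by increasing $L$ and lexicographically for each $L$. Let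 $s_{j_1\dots j_Lk}$ be the number of $\ell$ with $j_\ell=k$ and $\bm s_{j_1\dots j_L}!=\prod_{k=1}^ds_{j_1\dots j_Lk}!$ (equal to $1$ if $L=0$). $\partial_{j_1\dots j_L}m=\partial^Lm/\partial z_{j_1}\cdots\partial z_{j_L}$, equal to $m$ if $L=0$. For $\bm u\in\mathbb R^d$, $(\bm u)_L$ is the column vector $(\prod_{\ell=1}^Lu_{j_\ell})_{1\le j_1\le\dots\le j_L\le d}$ and $\check{\bm u}=((\bm u)_1',\dots,(\bm u)_p')'$, so that $(1,\check{\bm u}')'\in\mathbb R^D$. $S=\int(1,\check{\bm z}')'(1,\check{\bm z}')K(\bm z)d\bm z$. Estimator. Let $K:\mathbb R^d\to\mathbb R$ be a kernel, $h_j=h_{n,j}>0$ bandwidths, $K_{Ah}(\bm x)=K(x_1/(A_{n,1}h_1),\dots,x_d/(A_{n,d}h_d))$, and $\tilde{\bm X}_i=(1,\check{\bm u}_i')'$ with $\bm u_i=\bm X_i/A_n-\bm z$. The local polynomial estimator of order $p$ is the solution of $\hat{\bm\beta}(\bm z)=\arg\min_{\bm\beta\in\mathbb R^D}\sum_{i=1}^n(Y(\bm X_i)-\tilde{\bm X}_i'\bm\beta)^2K_{Ah}(\bm X_i-A_n\bm z)$, i.e. $$\hat{\bm\beta}(\bm z)=\Big[\sum_{i=1}^nK_{Ah}(\bm X_i-A_n\bm z)\tilde{\bm X}_i\tilde{\bm X}_i'\Big]^{-1}\sum_{i=1}^nK_{Ah}(\bm X_i-A_n\bm z)\tilde{\bm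 X}_iY(\bm X_i)=(\hat\beta_{j_1\dots j_L}(\bm z)).$$ The estimator of $\partial_{j_1\dots j_L}m(\bm z)$ is $\partial_{j_1\dots j_L}\hat m(\bm z):=\bm s_{j_1\dots j_L}!\,\hat\beta_{j_1\dots j_L}(\bm z)$ (so $\hat m(\bm z)=\hat\beta_0(\bm z)$). *)

theory Defs
  imports
    "HOL-Probability.Probability"
    "Jordan_Normal_Form.Gauss_Jordan_Elimination"
begin

(* Both vector libraries use the infix dollar sign; here it is the coordinate of real ^ 'd. *)
no_notation vec_index (infixl "$" 100)

text \<open>Throughout, the class \<open>linorder\<close> on the index type provides the order
  of the coordinates that is needed for the tuples \<open>j_1 \<le> \<dots> \<le> j_L\<close>.\<close>

definition norm1 :: "real ^ 'd \<Rightarrow> real" where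
  "norm1 x = (\<Sum>j\<in>UNIV. \<bar>x $ j\<bar>)"

definition cdiv :: "real ^ 'd \<Rightarrow> ('d \<Rightarrow> real) \<Rightarrow> real ^ 'd" where
  "cdiv x a = (\<chi> j. x $ j / a j)"

definition cmult :: "('d \<Rightarrow> real) \<Rightarrow> real ^ 'd \<Rightarrow> real ^ 'd" where
  "cmult a z = (\<chi> j. a j * z $ j)"

definition cprod :: "('d::finite \<Rightarrow> real) \<Rightarrow> real" where
  "cprod a = (\<Prod>j\<in>UNIV. a j)"

definition R0 :: "(real ^ 'd) set" where
  "R0 = cbox (\<chi> j. - 1 / 2) (\<chi> j. 1 / 2)"

definition trimmed_box :: "real \<Rightarrow> ('d \<Rightarrow> real) \<Rightarrow> (real ^ 'd) set" where
  "trimmed_box C h = cbox (\<chi> j. - 1 / 2 + C * h j) (\<chi> j. 1 / 2 - C * h j)"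

text \<open>Partial derivatives on a set \<open>R\<close>; at the boundary of a box they are one-sided.\<close>

definition line_through :: "(real ^ 'd) set \<Rightarrow> 'd \<Rightarrow> real ^ 'd \<Rightarrow> real set" where
  "line_through R j z = {t. z + t *\<^sub>R axis j 1 \<in> R}"

definition partial_deriv ::
    "(real ^ 'd) set \<Rightarrow> 'd \<Rightarrow> (real ^ 'd \<Rightarrow> real) \<Rightarrow> real ^ 'd \<Rightarrow> real" where
  "partial_deriv R j f z =
     vector_derivative (\<lambda>t. f (z + t *\<^sub>R axis j 1)) (at 0 within line_through R j z)"

definition iter_partial ::
    "(real ^ 'd) set \<Rightarrow> 'd list \<Rightarrow> (real ^ 'd \<Rightarrow> real) \<Rightarrow> real ^ 'd \<Rightarrow> real" where
  "iter_partial R js f = foldr (partial_deriv R) js f"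

definition cont_partially_diff_on ::
    "nat \<Rightarrow> (real ^ 'd) set \<Rightarrow> (real ^ 'd \<Rightarrow> real) \<Rightarrow> bool" where
  "cont_partially_diff_on k R f \<longleftrightarrow>
     (\<forall>js j z. length js < k \<longrightarrow> z \<in> R \<longrightarrow>
        (\<lambda>t. iter_partial R js f (z + t *\<^sub>R axis j 1))
          differentiable (at 0 within line_through R j z)) \<and>
     (\<forall>js. length js \<le> k \<longrightarrow> continuous_on R (iter_partial R js f))"

text \<open>Tuples \<open>1 \<le> j_1 \<le> \<dots> \<le> j_L \<le> d\<close> are sorted lists. The list \<open>tuples p\<close> enumerates those
  with \<open>0 \<le> L \<le> p\<close> by increasing \<open>L\<close> and lexicographically for each \<open>L\<close>.\<close>

definition tuples_of_length :: "nat \<Rightarrow> 'd::{finite,linorder} list list" where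
  "tuples_of_length L =
     filter sorted (product_lists (replicate L (sorted_list_of_set UNIV)))"

definition tuples :: "nat \<Rightarrow> 'd::{finite,linorder} list list" where
  "tuples p = concat (map tuples_of_length [0..<Suc p])"

definition tuple_pos :: "nat \<Rightarrow> 'd::{finite,linorder} list \<Rightarrow> nat" where
  "tuple_pos p js = (LEAST k. tuples p ! k = js)"

lemma set_tuples_of_length:
  "set (tuples_of_length L) = {js :: 'd::{finite,linorder} list. sorted js \<and> length js = L}"
  by (auto simp: tuples_of_length_def product_lists_set list_all2_conv_all_nth)

lemma set_tuples: "set (tuples p) = {js :: 'd::{finite,linorder} list. sorted js \<and> length js \<le> p}"
  by (auto simp: tuples_def set_tuples_of_length)

lemma distinct_tuples: "distinct (tuples p :: 'd::{finite,linorder} list list)"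
proof -
  have "distinct (tuples_of_length L :: 'd list list)" for L
    unfolding tuples_of_length_def
    by (intro distinct_filter distinct_product_lists) auto
  then show ?thesis
    unfolding tuples_def
    by (induction p) (auto simp: set_tuples_of_length)
qed

definition prod_tuple :: "('d \<Rightarrow> real) \<Rightarrow> 'd list \<Rightarrow> real" where
  "prod_tuple u js = (\<Prod>j\<leftarrow>js. u j)"

definition tuple_fact :: "'d::finite list \<Rightarrow> real" where
  "tuple_fact js = (\<Prod>k\<in>UNIV. fact (count_list js k))"

definition poly_vec :: "nat \<Rightarrow> real ^ 'd::{finite,linorder} \<Rightarrow> real Matrix.vec" where
  "poly_vec p u =
     Matrix.vec (length (tuples p :: 'd::{finite,linorder} list list)) (\<lambda>k. prod_tuple (vec_nth u) (tuples p ! k))"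

definition moment_matrix :: "nat \<Rightarrow> (real ^ 'd::{finite,linorder} \<Rightarrow> real) \<Rightarrow> real Matrix.mat" where
  "moment_matrix p K =
     (let D = length (tuples p :: 'd::{finite,linorder} list list) in
      Matrix.mat D D (\<lambda>(k, l).
        LINT z|lborel. vec_index (poly_vec p z) k * vec_index (poly_vec p z) l * K z))"

text \<open>The arguments \<open>x\<close> and \<open>y\<close> below are the realized sites \<open>x 1, \<dots>, x n\<close> and
  responses \<open>y 1, \<dots>, y n\<close>. The kernel may take negative values, so the estimator is defined by
  the closed formula (the normal equations) and not as a minimizer; it is \<open>None\<close> where the matrix
  to be inverted is singular.\<close>

definition K_Ah ::
    "(real ^ 'd::{finite,linorder} \<Rightarrow> real) \<Rightarrow> ('d::{finite,linorder} \<Rightarrow> real) \<Rightarrow> ('d::{finite,linorder} \<Rightarrow> real) \<Rightarrow> real ^ 'd::{finite,linorder} \<Rightarrow> real" where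
  "K_Ah K A h x = K (\<chi> j. x $ j / (A j * h j))"

definition lp_matrix ::
    "nat \<Rightarrow> (real ^ 'd::{finite,linorder} \<Rightarrow> real) \<Rightarrow> ('d::{finite,linorder} \<Rightarrow> real) \<Rightarrow> ('d::{finite,linorder} \<Rightarrow> real) \<Rightarrow>
     nat \<Rightarrow> (nat \<Rightarrow> real ^ 'd::{finite,linorder}) \<Rightarrow> real ^ 'd::{finite,linorder} \<Rightarrow> real Matrix.mat" where
  "lp_matrix p K A h n x z =
     (let D = length (tuples p :: 'd::{finite,linorder} list list); w = (\<lambda>i. poly_vec p (cdiv (x i) A - z)) in
      Matrix.mat D D (\<lambda>(k, l).
        \<Sum>i=1..n. K_Ah K A h (x i - cmult A z) * (vec_index (w i) k * vec_index (w i) l)))"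

definition lp_vector ::
    "nat \<Rightarrow> (real ^ 'd::{finite,linorder} \<Rightarrow> real) \<Rightarrow> ('d::{finite,linorder} \<Rightarrow> real) \<Rightarrow> ('d::{finite,linorder} \<Rightarrow> real) \<Rightarrow>
     nat \<Rightarrow> (nat \<Rightarrow> real ^ 'd::{finite,linorder}) \<Rightarrow> (nat \<Rightarrow> real) \<Rightarrow> real ^ 'd::{finite,linorder} \<Rightarrow> real Matrix.vec" where
  "lp_vector p K A h n x y z =
     (let D = length (tuples p :: 'd::{finite,linorder} list list); w = (\<lambda>i. poly_vec p (cdiv (x i) A - z)) in
      Matrix.vec D (\<lambda>k. \<Sum>i=1..n. K_Ah K A h (x i - cmult A z) * vec_index (w i) k * y i))"

definition lp_beta ::
    "nat \<Rightarrow> (real ^ 'd::{finite,linorder} \<Rightarrow> real) \<Rightarrow> ('d::{finite,linorder} \<Rightarrow> real) \<Rightarrow> ('d::{finite,linorder} \<Rightarrow> real) \<Rightarrow>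
     nat \<Rightarrow> (nat \<Rightarrow> real ^ 'd::{finite,linorder}) \<Rightarrow> (nat \<Rightarrow> real) \<Rightarrow> real ^ 'd::{finite,linorder} \<Rightarrow> real Matrix.vec option" where
  "lp_beta p K A h n x y z =
     map_option (\<lambda>B. B *\<^sub>v lp_vector p K A h n x y z) (mat_inverse (lp_matrix p K A h n x z))"

definition lp_deriv ::
    "nat \<Rightarrow> (real ^ 'd::{finite,linorder} \<Rightarrow> real) \<Rightarrow> ('d::{finite,linorder} \<Rightarrow> real) \<Rightarrow> ('d::{finite,linorder} \<Rightarrow> real) \<Rightarrow>
     nat \<Rightarrow> (nat \<Rightarrow> real ^ 'd::{finite,linorder}) \<Rightarrow> (nat \<Rightarrow> real) \<Rightarrow> 'd::{finite,linorder} list \<Rightarrow> real ^ 'd::{finite,linorder} \<Rightarrow> real option" where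
  "lp_deriv p K A h n x y js z =
     map_option (\<lambda>b. tuple_fact js * vec_index b (tuple_pos p js)) (lp_beta p K A h n x y z)"

text \<open>An undefined estimate has infinite error.\<close>

definition est_error :: "real option \<Rightarrow> real \<Rightarrow> ennreal" where
  "est_error r v = (case r of None \<Rightarrow> \<infinity> | Some u \<Rightarrow> ennreal \<bar>u - v\<bar>)"

text \<open>\<open>Z_n = O_p(r_n)\<close> for \<open>[0, \<infinity>]\<close>-valued \<open>Z_n\<close>. The covering event \<open>E\<close> makes the probability an
  outer probability, because suprema over uncountable sets need not be measurable a priori.\<close>

definition bigOp :: "'a measure \<Rightarrow> (nat \<Rightarrow> 'a \<Rightarrow> ennreal) \<Rightarrow> (nat \<Rightarrow> real) \<Rightarrow> bool" where
  "bigOp M Z r \<longleftrightarrow>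
     (\<forall>\<delta>>0. \<exists>C>0. \<forall>\<^sub>F n in sequentially.
        \<exists>E\<in>sets M. measure M E \<le> \<delta> \<and> {\<omega> \<in> space M. Z n \<omega> > ennreal (C * r n)} \<subseteq> E)"

definition gen_sigma :: "'a measure \<Rightarrow> ('i \<Rightarrow> 'a \<Rightarrow> 'b::topological_space) \<Rightarrow> 'i set \<Rightarrow> 'a set set" where
  "gen_sigma M Z I = sigma_sets (space M) {Z i -` B \<inter> space M | i B. i \<in> I \<and> B \<in> sets borel}"

text \<open>Joint measurability is required with respect to the sigma-algebra generated by the field
  itself (as on the canonical path space). This is what makes \<open>e(X_i)\<close> a random variable whose
  conditional law given \<open>X_i = x\<close> is that of \<open>e(x)\<close> when \<open>X_i\<close> is independent of the field. Joint
  measurability with respect to \<open>M\<close> does not suffice for that: adding the indicator of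
  \<open>{X_i = x}\<close> to \<open>e(x)\<close> changes every \<open>e(x)\<close> on a null set only.\<close>

definition random_field :: "'a measure \<Rightarrow> (real ^ 'd \<Rightarrow> 'a \<Rightarrow> real) \<Rightarrow> bool" where
  "random_field M e \<longleftrightarrow>
     (\<forall>x. e x \<in> borel_measurable M) \<and>
     (\<lambda>(x, \<omega>). e x \<omega>) \<in> borel_measurable (borel \<Otimes>\<^sub>M sigma (space M) (gen_sigma M e UNIV))"

definition stationary :: "'a measure \<Rightarrow> (real ^ 'd \<Rightarrow> 'a \<Rightarrow> real) \<Rightarrow> bool" where
  "stationary M e \<longleftrightarrow>
     (\<forall>T v. finite T \<longrightarrow>
        distr M (PiM T (\<lambda>_. borel)) (\<lambda>\<omega>. \<lambda>x\<in>T. e (x + v) \<omega>) =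
        distr M (PiM T (\<lambda>_. borel)) (\<lambda>\<omega>. \<lambda>x\<in>T. e x \<omega>))"

definition beta_bar ::
    "'a measure \<Rightarrow> (real ^ 'd \<Rightarrow> 'a \<Rightarrow> real) \<Rightarrow> (real ^ 'd) set \<Rightarrow> (real ^ 'd) set \<Rightarrow> real" where
  "beta_bar M e T1 T2 =
     Sup {1 / 2 * (\<Sum>A\<in>\<A>. \<Sum>B\<in>\<B>. \<bar>measure M (A \<inter> B) - measure M A * measure M B\<bar>) | \<A> \<B>.
            finite \<A> \<and> partition_on (space M) \<A> \<and> \<A> \<subseteq> gen_sigma M e T1 \<and>
            finite \<B> \<and> partition_on (space M) \<B> \<and> \<B> \<subseteq> gen_sigma M e T2}"

definition set_dist1 :: "(real ^ 'd) set \<Rightarrow> (real ^ 'd) set \<Rightarrow> ereal" where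
  "set_dist1 T1 T2 = (INF (x, y)\<in>T1 \<times> T2. ereal (norm1 (x - y)))"

text \<open>A cube is a product of bounded intervals of the same length, each with or without its
  endpoints.\<close>

definition is_cube :: "(real ^ 'd) set \<Rightarrow> bool" where
  "is_cube Q \<longleftrightarrow>
     (\<exists>I a s. s > 0 \<and> (\<forall>j. {a j<..<a j + s} \<subseteq> I j \<and> I j \<subseteq> {a j..a j + s}) \<and>
              Q = {x. \<forall>j. x $ j \<in> I j})"

definition cube_unions :: "real \<Rightarrow> (real ^ 'd) set set" where
  "cube_unions b =
     {\<Union>\<C> | \<C>. finite \<C> \<and> disjoint \<C> \<and> (\<forall>Q\<in>\<C>. is_cube Q) \<and> (\<Sum>Q\<in>\<C>. measure lborel Q) \<le> b}"

definition beta_mix :: "'a measure \<Rightarrow> (real ^ 'd \<Rightarrow> 'a \<Rightarrow> real) \<Rightarrow> real \<Rightarrow> real \<Rightarrow> real" where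
  "beta_mix M e a b =
     Sup {beta_bar M e T1 T2 | T1 T2.
            set_dist1 T1 T2 \<ge> ereal a \<and> T1 \<in> cube_unions b \<and> T2 \<in> cube_unions b}"

end

theory Submission
  imports Defs "Jordan_Normal_Form.Determinant"
begin

no_notation vec_index (infixl "$" 100)

text \<open>The estimator solves linear normal equations. Rescale the coefficient of each tuple by the product of
the bandwidths along the tuple and divide by \<open>n h_1 \<dots> h_d\<close>. The matrix of the equations is then an
average over the sites of \<open>K W W'\<close>, with \<open>W\<close> the vector of monomials in the rescaled site, and this
average is close to \<open>g(z) S\<close>. Since \<open>S\<close> is invertible and \<open>g\<close> is bounded below on the compact box, the error
of the rescaled coefficients is at most a constant times the averages \<open>\<Sum> K W (Y - Taylor polynomial)\<close>
(\<open>lp_deriv_error\<close>). Such an average has three parts: the Taylor remainder, which gives the bias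
(\<open>multivariate_Taylor\<close>), the noise of the random field, and the independent errors. It remains to show that, with
probability tending to one and uniformly in \<open>z\<close>, design averages are close to their means (\<open>local_average\<close>) and
both noise averages are \<open>O(rate)\<close>, where \<open>rate = sqrt (ln n / (A_n h_1 \<dots> h_d))\<close> (\<open>noise_bound\<close>).

Uniformity in \<open>z\<close> comes from a net of polynomially many points: the kernel is Lipschitz, so a tail bound
\<open>n powr (- k)\<close> at each net point is enough. Exponential inequalities give such a bound once the noise is truncated
at \<open>level n\<close>, which is a little above \<open>n powr (1 / q2)\<close>. By the moment condition the maximum of the \<open>n\<close> noise
variables stays below that level with probability tending to one.

The field noise is the main difficulty. Conditionally on the field the sites are independent, so a Chernoff bound
turns the sum over sites into an integral of a functional of the field over space (\<open>conditional_chernoff\<close>).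
Cover the support of the kernel by cubes of side \<open>side n\<close> and divide the cubes into \<open>2^d\<close> classes by the parity of
their coordinates. Two cubes of one class are at least \<open>side n\<close> apart (\<open>parity_cube_cover\<close>), and the integral
over a class is a sum of block variables, one for each cube. Beta mixing compares the joint law of the
blocks with the product law in total variation (\<open>blocks_almost_independent\<close>, \<open>blocks_mgf\<close>); for independent blocks a
second order expansion of the exponential moment suffices, because the covariance of the field is integrable and
the second moment of a block therefore grows only like its volume (\<open>block_exponential_moment\<close>). The comparison is
made for the bounded function \<open>min 1 (\<Sum> \<dots>)\<close> of the blocks that contains the union bound over the net, so its cost
is paid once for each cell of the size of the kernel and not once for each net point. The total cost is of order
\<open>A_n / side^d\<close> times the mixing coefficient, which tends to zero (\<open>dep_lim\<close>).\<close>

section \<open>Conditional exponential inequalities\<close>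

text \<open>Freezing a sigma-algebra that is independent of i.i.d. sites: the joint law of the sites and the frozen part
is a product, so that Fubini can integrate the sites out one at a time.\<close>

lemma (in prob_space) indep_product_law:
 fixes X :: "'i => 'a => 'b::topological_space"
 assumes N: "space N = space M" "sets N \<subseteq> sets M"
  and X: "indep_vars (%_. borel) X I" "I ~= {}" "finite I"
  and law: "\<And>i. i \<in> I ==> distr M borel (X i) = \<mu>"
  and ind: "indep_set (gen_sigma M X I) (sets N)"
  and H: "H \<in> borel_measurable (PiM I (%_. borel) \<Otimes>\<^sub>M N)"
 shows "(\<integral>\<^sup>+\<omega>. H (\<lambda>i\<in>I. X i \<omega>, \<omega>) \<partial>M) = (\<integral>\<^sup>+\<omega>. \<integral>\<^sup>+x. H (x, \<omega>) \<partial>PiM I (%_. \<mu>) \<partial>M)"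
proof -
 let ?V = "%\<omega>. \<lambda>i\<in>I. X i \<omega>"
 let ?P = "PiM I (%_. borel :: 'b measure)"
 have Xm: "X i \<in> borel_measurable M" if "i \<in> I" for i
  using X(1) that unfolding indep_vars_def by auto
 have Vm: "?V \<in> measurable M ?P"
  using Xm by (intro measurable_restrict) auto
 have idm: "(%\<omega>. \<omega>) \<in> measurable M N"
  using N by (auto simp: measurable_def dest: sets.sets_into_space intro!: sets.Int)
 define G where "G = sigma (space M) {X i -` B \<inter> space M | i B. i \<in> I \<and> B \<in> sets borel}"
 have setsG: "sets G = gen_sigma M X I" and spG: "space G = space M"
  unfolding G_def gen_sigma_def by (auto intro!: sets_measure_of simp: space_measure_of_conv)
 have VG: "?V \<in> measurable G ?P"
 proof (rule measurable_restrict)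
  fix i assume "i \<in> I"
  then show "X i \<in> measurable G borel"
   using spG setsG by (intro measurableI) (auto simp: gen_sigma_def intro!: sigma_sets.Basic)
 qed
 interpret PV: prob_space "distr M ?P ?V" by (rule prob_space_distr[OF Vm])
 interpret PN: prob_space "distr M N (%\<omega>. \<omega>)" by (rule prob_space_distr[OF idm])
 have VN: "(%\<omega>. (?V \<omega>, \<omega>)) \<in> measurable M (?P \<Otimes>\<^sub>M N)" using Vm idm by simp
 have D: "distr M ?P ?V \<Otimes>\<^sub>M distr M N (%\<omega>. \<omega>) = distr M (?P \<Otimes>\<^sub>M N) (%\<omega>. (?V \<omega>, \<omega>))"
 proof (rule pair_measure_eqI)
  show "sigma_finite_measure (distr M ?P ?V)" "sigma_finite_measure (distr M N (%\<omega>. \<omega>))" by unfold_locales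
  show "sets (distr M ?P ?V \<Otimes>\<^sub>M distr M N (%\<omega>. \<omega>)) = sets (distr M (?P \<Otimes>\<^sub>M N) (%\<omega>. (?V \<omega>, \<omega>)))"
   by (simp cong: sets_pair_measure_cong)
  fix A B assume "A \<in> sets (distr M ?P ?V)" "B \<in> sets (distr M N (%\<omega>. \<omega>))"
  then have A: "A \<in> sets ?P" and B: "B \<in> sets N" by auto
  have "?V -` A \<inter> space M \<in> gen_sigma M X I"
   using measurable_sets[OF VG A] unfolding spG setsG .
  from indep_setD[OF ind this B]
  have p: "prob (?V -` A \<inter> space M \<inter> B) = prob (?V -` A \<inter> space M) * prob B" .
  have BM: "B \<inter> space M = B" using B N sets.sets_into_space by blast
  have "emeasure (distr M ?P ?V) A * emeasure (distr M N (%\<omega>. \<omega>)) B = ennreal (prob (?V -` A \<inter> space M)) * ennreal (prob B)"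
   using A B Vm idm BM by (simp add: emeasure_distr emeasure_eq_measure)
  also have "... = emeasure M (?V -` A \<inter> space M \<inter> B)"
   by (simp add: emeasure_eq_measure p ennreal_mult)
  also have "?V -` A \<inter> space M \<inter> B = (%\<omega>. (?V \<omega>, \<omega>)) -` (A \<times> B) \<inter> space M"
   using BM by auto
  also have "emeasure M ... = emeasure (distr M (?P \<Otimes>\<^sub>M N) (%\<omega>. (?V \<omega>, \<omega>))) (A \<times> B)"
   using A B by (intro emeasure_distr[OF VN, symmetric]) auto
  finally show "emeasure (distr M ?P ?V) A * emeasure (distr M N (%\<omega>. \<omega>)) B
   = emeasure (distr M (?P \<Otimes>\<^sub>M N) (%\<omega>. (?V \<omega>, \<omega>))) (A \<times> B)" .
 qed
 have L: "distr M ?P ?V = PiM I (%i. \<mu>)"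
 proof -
  have "distr M ?P ?V = PiM I (%i. distr M borel (X i))"
   using X Xm indep_vars_iff_distr_eq_PiM'[where M'="%_. borel" and X=X and I=I] by auto
  also have "... = PiM I (%i. \<mu>)" by (rule PiM_cong) (auto simp: law)
  finally show ?thesis .
 qed
 interpret PP: pair_sigma_finite "distr M ?P ?V" "distr M N (%\<omega>. \<omega>)" ..
 have H': "H \<in> borel_measurable (distr M ?P ?V \<Otimes>\<^sub>M distr M N (%\<omega>. \<omega>))"
  using H by (simp cong: measurable_cong_sets sets_pair_measure_cong)
 have "(\<integral>\<^sup>+\<omega>. H (?V \<omega>, \<omega>) \<partial>M) = (\<integral>\<^sup>+p. H p \<partial>distr M (?P \<Otimes>\<^sub>M N) (%\<omega>. (?V \<omega>, \<omega>)))"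
  by (rule nn_integral_distr[symmetric]) (use Vm idm H in \<open>auto\<close>)
 also have "... = (\<integral>\<^sup>+\<omega>. \<integral>\<^sup>+x. H (x, \<omega>) \<partial>distr M ?P ?V \<partial>distr M N (%\<omega>. \<omega>))"
  unfolding D[symmetric] by (rule PP.nn_integral_snd[symmetric, simplified]) (use H' in simp)
 also have "... = (\<integral>\<^sup>+\<omega>. \<integral>\<^sup>+x. H (x, \<omega>) \<partial>distr M ?P ?V \<partial>M)"
  by (rule nn_integral_distr[OF idm])
    (use H' in \<open>intro PV.borel_measurable_nn_integral; simp add: measurable_split_conv cong: measurable_cong_sets sets_pair_measure_cong\<close>)
 finally show ?thesis unfolding L .
qed


text \<open>After integration, \<open>1 + y \<le> exp y\<close> turns the right side back into an exponential.\<close>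

lemma exp_le_quadratic:
 fixes x :: real
 assumes "\<bar>x\<bar> <= 1"
 shows "exp x <= 1 + x + x\<^sup>2"
proof (cases "x \<ge> 0")
 case True
 then show ?thesis using exp_bound assms by auto
next
 case False
 have "1 - x <= exp (- x)" using exp_ge_add_one_self[of "- x"] by simp
 moreover have "1 - x > 0" using False by simp
 ultimately have "exp x <= 1 / (1 - x)" by (simp add: exp_minus field_simps)
 also have "... <= 1 + x + x\<^sup>2"
 proof -
  have "(1 + x + x\<^sup>2) * (1 - x) = 1 - x ^ 3"
   by (simp add: power2_eq_square power3_eq_cube algebra_simps)
  moreover have "x ^ 3 <= 0" using False by (simp add: power3_eq_cube mult_nonneg_nonpos)
  ultimately show ?thesis using \<open>1 - x > 0\<close> by (simp add: divide_le_eq)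
 qed
 finally show ?thesis .
qed

lemma (in prob_space) nn_integral_exp_le:
 assumes "f \<in> borel_measurable M" "\<And>x. x \<in> space M ==> \<bar>f x\<bar> <= 1"
 shows "(\<integral>\<^sup>+x. ennreal (exp (f x)) \<partial>M) <= ennreal (exp (\<integral>x. f x + (f x)\<^sup>2 \<partial>M))"
proof -
 have sq: "(f x)\<^sup>2 <= 1" if "x \<in> space M" for x
  using power_mono[OF assms(2)[OF that], of 2] by simp
 have i1: "integrable M f" "integrable M (%x. (f x)\<^sup>2)"
  using assms sq by (auto intro!: integrable_const_bound[of _ 1] AE_I2)
 have "(\<integral>\<^sup>+x. ennreal (exp (f x)) \<partial>M) <= (\<integral>\<^sup>+x. ennreal (1 + (f x + (f x)\<^sup>2)) \<partial>M)"
  using assms(2) exp_le_quadratic by (intro nn_integral_mono ennreal_leI) (auto simp: add.assoc)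
 also have "... = ennreal (\<integral>x. 1 + (f x + (f x)\<^sup>2) \<partial>M)"
 proof (rule nn_integral_eq_integral)
  show "AE x in M. 0 <= 1 + (f x + (f x)\<^sup>2)"
   using assms(2) by (intro AE_I2) (smt (verit) zero_le_power2)
 qed (use i1 in auto)
 also have "... = ennreal (1 + (\<integral>x. f x + (f x)\<^sup>2 \<partial>M))"
  using i1 by (simp add: prob_space)
 also have "... <= ennreal (exp (\<integral>x. f x + (f x)\<^sup>2 \<partial>M))"
  by (intro ennreal_leI) (simp add: exp_ge_add_one_self)
 finally show ?thesis .
qed

text \<open>Markov's inequality is applied conditionally on the frozen sigma-algebra \<open>N\<close>, for all indices at once. The conditional
probability of the union is at most one, which explains the \<open>min 1\<close>: the bound is an expectation of
a bounded functional, and only such functionals can be compared under total variation later on.\<close>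

lemma (in prob_space) conditional_chernoff:
 fixes X :: "'i => 'a => 'b::topological_space" and F :: "'z => 'i => 'b => 'a => real"
 assumes N: "space N = space M" "sets N \<subseteq> sets M"
  and X: "indep_vars (%_. borel) X I" "I ~= {}" "finite I"
  and law: "\<And>i. i \<in> I ==> distr M borel (X i) = \<mu>"
  and ind: "indep_set (gen_sigma M X I) (sets N)"
  and Z: "finite Z"
  and F: "\<And>z i. z \<in> Z ==> i \<in> I ==> (%(x, \<omega>). F z i x \<omega>) \<in> borel_measurable (borel \<Otimes>\<^sub>M N)"
  and lam: "lam > 0"
  and bd: "\<And>z i x \<omega>. z \<in> Z ==> i \<in> I ==> \<omega> \<in> space M ==> \<bar>lam * F z i x \<omega>\<bar> <= 1"
 shows "emeasure M {\<omega>\<in>space M. \<exists>z\<in>Z. t < (\<Sum>i\<in>I. F z i (X i \<omega>) \<omega>)} \<le>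
  (\<integral>\<^sup>+\<omega>. min 1 (\<Sum>z\<in>Z. ennreal (exp (- lam * t +
    (\<Sum>i\<in>I. \<integral>x. lam * F z i x \<omega> + (lam * F z i x \<omega>)\<^sup>2 \<partial>\<mu>)))) \<partial>M)" (is "emeasure M ?S <= _")
proof -
 obtain i0 where i0: "i0 \<in> I" using X by auto
 have Xm: "X i \<in> borel_measurable M" if "i \<in> I" for i
  using X(1) that unfolding indep_vars_def by auto
 interpret \<mu>: prob_space \<mu> using law[OF i0] prob_space_distr[OF Xm[OF i0]] by simp
 have s\<mu>: "sets \<mu> = sets borel" "space \<mu> = UNIV" using law[OF i0] by (auto simp: space_distr[symmetric] sets_distr)
 let ?P = "PiM I (%_. borel :: 'b measure)" and ?Q = "PiM I (%_. \<mu>)"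
 let ?V = "%\<omega>. \<lambda>i\<in>I. X i \<omega>"
 interpret PQ: product_prob_space "%_. \<mu>" I ..
 have sQ: "sets ?Q = sets ?P" by (rule sets_PiM_cong) (auto simp: s\<mu>)
 define B where "B = {p\<in>space (?P \<Otimes>\<^sub>M N). \<exists>z\<in>Z. t < (\<Sum>i\<in>I. F z i (fst p i) (snd p))}"
 have Fm: "(%p. F z i (fst p i) (snd p)) \<in> borel_measurable (?P \<Otimes>\<^sub>M N)" if "z \<in> Z" "i \<in> I" for z i
 proof -
  have "(%p. (fst p i, snd p)) \<in> measurable (?P \<Otimes>\<^sub>M N) (borel \<Otimes>\<^sub>M N)"
   using that by (intro measurable_Pair measurable_compose[OF measurable_fst measurable_component_singleton]) auto
  from measurable_compose[OF this F[OF that]] show ?thesis by simp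
 qed
 have Bm: "B \<in> sets (?P \<Otimes>\<^sub>M N)"
  unfolding B_def using Z Fm
  by (auto intro!: sets.sets_Collect_finite_Ex borel_measurable_less borel_measurable_sum)
 have Vm: "?V \<in> measurable M ?P"
  using Xm by (intro measurable_restrict) auto
 have idm: "(%\<omega>. \<omega>) \<in> measurable M N"
  using N by (auto simp: measurable_def dest: sets.sets_into_space)
 have VN: "(%\<omega>. (?V \<omega>, \<omega>)) \<in> measurable M (?P \<Otimes>\<^sub>M N)" using Vm idm by simp
 have S: "?S = (%\<omega>. (?V \<omega>, \<omega>)) -` B \<inter> space M"
  using measurable_space[OF VN] by (auto simp: B_def)
 have Sm: "?S \<in> sets M" unfolding S by (rule measurable_sets[OF VN Bm])
 have "emeasure M ?S = (\<integral>\<^sup>+\<omega>. indicator B (?V \<omega>, \<omega>) \<partial>M)"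
  unfolding nn_integral_indicator[OF Sm, symmetric]
  by (intro nn_integral_cong) (auto simp: S indicator_def)
 also have "... = (\<integral>\<^sup>+\<omega>. \<integral>\<^sup>+x. indicator B (x, \<omega>) \<partial>?Q \<partial>M)"
  using indep_product_law[OF N X law ind, of "indicator B"] Bm by simp
 also have "... <= (\<integral>\<^sup>+\<omega>. min 1 (\<Sum>z\<in>Z. ennreal (exp (- lam * t +
    (\<Sum>i\<in>I. \<integral>x. lam * F z i x \<omega> + (lam * F z i x \<omega>)\<^sup>2 \<partial>\<mu>)))) \<partial>M)"
 proof (rule nn_integral_mono)
  fix \<omega> assume w: "\<omega> \<in> space M"
  have Fw: "(%x. F z i x \<omega>) \<in> borel_measurable \<mu>" if "z \<in> Z" "i \<in> I" for z i
  proof -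
   have "(%x. (x, \<omega>)) \<in> measurable \<mu> (borel \<Otimes>\<^sub>M N)"
    using w N(1) by (intro measurable_Pair) (auto simp: s\<mu> measurable_ident_sets)
   from measurable_compose[OF this F[OF that]] show ?thesis by simp
  qed
  have 1: "(\<integral>\<^sup>+x. indicator B (x, \<omega>) \<partial>?Q) <= 1"
  proof -
   have "(\<integral>\<^sup>+x. indicator B (x, \<omega>) \<partial>?Q) <= (\<integral>\<^sup>+x. 1 \<partial>?Q)"
    by (intro nn_integral_mono) (auto simp: indicator_def)
   then show ?thesis by (simp add: PQ.emeasure_space_1)
  qed
  have "(\<integral>\<^sup>+x. indicator B (x, \<omega>) \<partial>?Q) \<le>
    (\<integral>\<^sup>+x. (\<Sum>z\<in>Z. ennreal (exp (- lam * t)) * (\<Prod>i\<in>I. ennreal (exp (lam * F z i (x i) \<omega>)))) \<partial>?Q)"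
  proof (rule nn_integral_mono)
   fix x
   show "indicator B (x, \<omega>) <= (\<Sum>z\<in>Z. ennreal (exp (- lam * t)) * (\<Prod>i\<in>I. ennreal (exp (lam * F z i (x i) \<omega>))))"
   proof (cases "(x, \<omega>) \<in> B")
    case True
    then obtain z where z: "z \<in> Z" "t < (\<Sum>i\<in>I. F z i (x i) \<omega>)" by (auto simp: B_def)
    have "1 <= exp (- lam * t) * exp (lam * (\<Sum>i\<in>I. F z i (x i) \<omega>))"
     using z lam by (simp add: exp_add[symmetric])
    also have "... = exp (- lam * t) * (\<Prod>i\<in>I. exp (lam * F z i (x i) \<omega>))"
     using X by (simp add: exp_sum sum_distrib_left)
    finally have "1 <= ennreal (exp (- lam * t)) * (\<Prod>i\<in>I. ennreal (exp (lam * F z i (x i) \<omega>)))"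
     by (simp add: prod_ennreal ennreal_mult[symmetric] prod_nonneg)
    also have "... <= (\<Sum>z\<in>Z. ennreal (exp (- lam * t)) * (\<Prod>i\<in>I. ennreal (exp (lam * F z i (x i) \<omega>))))"
     by (rule member_le_sum) (use z Z in auto)
    finally show ?thesis using True by simp
   qed simp
  qed
  also have "... = (\<Sum>z\<in>Z. \<integral>\<^sup>+x. ennreal (exp (- lam * t)) * (\<Prod>i\<in>I. ennreal (exp (lam * F z i (x i) \<omega>))) \<partial>?Q)"
  proof (rule nn_integral_sum)
   fix z assume z: "z \<in> Z"
   have m: "(%x. ennreal (exp (lam * F z i x \<omega>))) \<in> borel_measurable \<mu>" if "i \<in> I" for i
    using Fw[OF z that] by measurable
   have "(%x. ennreal (exp (lam * F z i (x i) \<omega>))) \<in> borel_measurable ?Q" if "i \<in> I" for i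
    using measurable_compose[OF measurable_component_singleton[of i I "%_. \<mu>"] m] that by simp
   then show "(%x. ennreal (exp (- lam * t)) * (\<Prod>i\<in>I. ennreal (exp (lam * F z i (x i) \<omega>)))) \<in> borel_measurable ?Q"
    by (intro borel_measurable_times_ennreal borel_measurable_const borel_measurable_prod_ennreal)
  qed
  also have "... = (\<Sum>z\<in>Z. ennreal (exp (- lam * t)) * (\<Prod>i\<in>I. \<integral>\<^sup>+x. ennreal (exp (lam * F z i x \<omega>)) \<partial>\<mu>))"
  proof (intro sum.cong refl)
   fix z assume z: "z \<in> Z"
   have m: "(%x. ennreal (exp (lam * F z i x \<omega>))) \<in> borel_measurable \<mu>" if "i \<in> I" for i
    using Fw[OF z that] by measurable
   have "(\<integral>\<^sup>+x. ennreal (exp (- lam * t)) * (\<Prod>i\<in>I. ennreal (exp (lam * F z i (x i) \<omega>))) \<partial>?Q)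
    = ennreal (exp (- lam * t)) * (\<integral>\<^sup>+x. (\<Prod>i\<in>I. ennreal (exp (lam * F z i (x i) \<omega>))) \<partial>?Q)"
   proof (intro nn_integral_cmult borel_measurable_prod_ennreal)
    fix i assume "i \<in> I"
    then show "(%x. ennreal (exp (lam * F z i (x i) \<omega>))) \<in> borel_measurable ?Q"
     using measurable_compose[OF measurable_component_singleton[of i I "%_. \<mu>"] m] by simp
   qed
   then show "(\<integral>\<^sup>+x. ennreal (exp (- lam * t)) * (\<Prod>i\<in>I. ennreal (exp (lam * F z i (x i) \<omega>))) \<partial>?Q)
    = ennreal (exp (- lam * t)) * (\<Prod>i\<in>I. \<integral>\<^sup>+x. ennreal (exp (lam * F z i x \<omega>)) \<partial>\<mu>)"
    using PQ.product_nn_integral_prod[OF X(3) m] by simp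
  qed
  also have "... <= (\<Sum>z\<in>Z. ennreal (exp (- lam * t)) * (\<Prod>i\<in>I. ennreal (exp (\<integral>x. lam * F z i x \<omega> + (lam * F z i x \<omega>)\<^sup>2 \<partial>\<mu>))))"
   using Fw bd[OF _ _ w]
   by (intro sum_mono mult_left_mono prod_mono_ennreal \<mu>.nn_integral_exp_le) auto
  also have "... = (\<Sum>z\<in>Z. ennreal (exp (- lam * t + (\<Sum>i\<in>I. \<integral>x. lam * F z i x \<omega> + (lam * F z i x \<omega>)\<^sup>2 \<partial>\<mu>))))"
   using X by (intro sum.cong refl) (simp add: prod_ennreal ennreal_mult[symmetric] exp_sum[symmetric] exp_add[symmetric])
  finally show "(\<integral>\<^sup>+x. indicator B (x, \<omega>) \<partial>?Q) <= min 1 (\<Sum>z\<in>Z. ennreal (exp (- lam * t +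
    (\<Sum>i\<in>I. \<integral>x. lam * F z i x \<omega> + (lam * F z i x \<omega>)\<^sup>2 \<partial>\<mu>))))"
   using 1 by simp
 qed
 finally show ?thesis .
qed

section \<open>Beta mixing and block variables\<close>

text \<open>The generating events already form a sigma-algebra, so its sets are those of \<open>gen_sigma\<close> itself.\<close>

abbreviation field_algebra :: "'a measure => ('i => 'a => 'b::topological_space) => 'i set => 'a measure" where
 "field_algebra M e T \<equiv> sigma (space M) (gen_sigma M e T)"

lemma space_field_algebra: "space (field_algebra M e T) = space M"
 by (simp add: space_measure_of_conv)

lemma gen_sigma_Pow: "gen_sigma M e T \<subseteq> Pow (space M)"
proof
 fix A assume "A \<in> gen_sigma M e T"
 then have "A \<subseteq> space M"
  unfolding gen_sigma_def by (rule sigma_sets_into_sp[rotated]) auto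
 then show "A \<in> Pow (space M)" by simp
qed

lemma sets_field_algebra: "sets (field_algebra M e T) = gen_sigma M e T"
proof -
 have "sigma_sets (space M) (gen_sigma M e T) = gen_sigma M e T"
  unfolding gen_sigma_def by (rule sigma_sets_sigma_sets_eq) auto
 then show ?thesis by (simp add: sets_measure_of gen_sigma_Pow)
qed

lemma gen_sigma_mono: "T \<subseteq> T' ==> gen_sigma M e T \<subseteq> gen_sigma M e T'"
 unfolding gen_sigma_def by (rule sigma_sets_mono') auto

lemma gen_sigma_sets:
 assumes "\<And>x. x \<in> T ==> e x \<in> borel_measurable M"
 shows "gen_sigma M e T \<subseteq> sets M"
 unfolding gen_sigma_def using assms by (intro sets.sigma_sets_subset) auto

lemma measurable_field_algebra:
 assumes "x \<in> T"
 shows "e x \<in> measurable (field_algebra M e T) borel"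
proof (rule measurableI)
 fix B :: "'c set" assume "B \<in> sets borel"
 then have "e x -` B \<inter> space M \<in> gen_sigma M e T"
  unfolding gen_sigma_def using assms by (intro sigma_sets.Basic) auto
 then show "e x -` B \<inter> space (field_algebra M e T) \<in> sets (field_algebra M e T)"
  by (simp only: space_field_algebra sets_field_algebra)
qed auto

lemma subalgebra_field_algebra:
 assumes "\<And>x. x \<in> T ==> e x \<in> borel_measurable M"
 shows "subalgebra M (field_algebra M e T)"
 using gen_sigma_sets[OF assms] by (simp add: subalgebra_def sets_field_algebra space_field_algebra)

context prob_space begin

lemma partition_sum_prob:
 assumes P: "finite \<A>" "partition_on (space M) \<A>" "\<A> \<subseteq> sets M" and C: "C \<in> sets M"
 shows "(\<Sum>A\<in>\<A>. prob (A \<inter> C)) = prob C"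
proof -
 have U: "(\<Union>A\<in>\<A>. A \<inter> C) = C"
  using partition_onD1[OF P(2)] sets.sets_into_space[OF C] by blast
 have "disjoint_family_on (%A. A \<inter> C) \<A>"
  unfolding disjoint_family_on_def using disjointD[OF partition_onD2[OF P(2)]] by blast
 moreover have "(%A. A \<inter> C) ` \<A> \<subseteq> sets M" using P(3) C by blast
 ultimately have "prob (\<Union>A\<in>\<A>. A \<inter> C) = (\<Sum>A\<in>\<A>. prob (A \<inter> C))"
  using finite_measure_finite_Union[OF P(1)] by blast
 then show ?thesis unfolding U by simp
qed

text \<open>Each summand is dominated by \<open>P(A \<inter> B) + P(A) P(B)\<close>, and both terms sum to one.\<close>

lemma partition_discrepancy_le:
 assumes "finite \<A>" "partition_on (space M) \<A>" "\<A> \<subseteq> sets M"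
  and "finite \<B>" "partition_on (space M) \<B>" "\<B> \<subseteq> sets M"
 shows "(\<Sum>A\<in>\<A>. \<Sum>B\<in>\<B>. \<bar>prob (A \<inter> B) - prob A * prob B\<bar>) <= 2"
proof -
 have s1: "(\<Sum>A\<in>\<C>. prob A) = 1"
  if "finite \<C>" "partition_on (space M) \<C>" "\<C> \<subseteq> sets M" for \<C>
 proof -
  have "(\<Sum>A\<in>\<C>. prob A) = (\<Sum>A\<in>\<C>. prob (A \<inter> space M))"
   using that(3) sets.sets_into_space by (intro sum.cong refl arg_cong[where f=prob]) blast
  then show ?thesis using partition_sum_prob[OF that sets.top] by (simp add: prob_space)
 qed
 note s = s1[OF assms(1-3)] s1[OF assms(4-6)]
 have "\<bar>prob (A \<inter> B) - prob A * prob B\<bar> <= prob (B \<inter> A) + prob A * prob B" for A B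
 proof -
  have "0 <= prob A * prob B" "0 <= prob (A \<inter> B)" by simp_all
  then show ?thesis unfolding Int_commute[of B A] by linarith
 qed
 then have "(\<Sum>A\<in>\<A>. \<Sum>B\<in>\<B>. \<bar>prob (A \<inter> B) - prob A * prob B\<bar>)
   <= (\<Sum>A\<in>\<A>. \<Sum>B\<in>\<B>. prob (B \<inter> A) + prob A * prob B)"
  by (intro sum_mono)
 also have "... = (\<Sum>A\<in>\<A>. prob A + prob A)"
 proof (rule sum.cong[OF refl])
  fix A assume "A \<in> \<A>"
  then have "(\<Sum>B\<in>\<B>. prob (B \<inter> A)) = prob A" using partition_sum_prob[OF assms(4-6)] assms(3) by blast
  then show "(\<Sum>B\<in>\<B>. prob (B \<inter> A) + prob A * prob B) = prob A + prob A"
   by (simp only: sum.distrib sum_distrib_left[symmetric] s mult_1_right)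
 qed
 also have "... = 2" by (simp only: sum.distrib s)
 finally show ?thesis .
qed

lemma discrepancy_set_le_1:
 assumes e: "\<And>x. e x \<in> borel_measurable M"
  and "x \<in> {1 / 2 * (\<Sum>A\<in>\<A>. \<Sum>B\<in>\<B>. \<bar>prob (A \<inter> B) - prob A * prob B\<bar>) | \<A> \<B>.
      finite \<A> \<and> partition_on (space M) \<A> \<and> \<A> \<subseteq> gen_sigma M e T1 \<and>
      finite \<B> \<and> partition_on (space M) \<B> \<and> \<B> \<subseteq> gen_sigma M e T2}"
 shows "x <= 1"
proof -
 obtain \<A> \<B> where x: "x = 1 / 2 * (\<Sum>A\<in>\<A>. \<Sum>B\<in>\<B>. \<bar>prob (A \<inter> B) - prob A * prob B\<bar>)"
  and A: "finite \<A>" "partition_on (space M) \<A>" "\<A> \<subseteq> gen_sigma M e T1"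
  and B: "finite \<B>" "partition_on (space M) \<B>" "\<B> \<subseteq> gen_sigma M e T2"
  using assms(2) unfolding mem_Collect_eq by (elim exE conjE) (rule that)
 show ?thesis
  using partition_discrepancy_le[OF A(1,2) subset_trans[OF A(3) gen_sigma_sets[OF e]]
    B(1,2) subset_trans[OF B(3) gen_sigma_sets[OF e]]] x by simp
qed

lemma discrepancy_mem:
 assumes "finite \<A>" "partition_on (space M) \<A>" "\<A> \<subseteq> gen_sigma M e T1"
  and "finite \<B>" "partition_on (space M) \<B>" "\<B> \<subseteq> gen_sigma M e T2"
 shows "1 / 2 * (\<Sum>A\<in>\<A>. \<Sum>B\<in>\<B>. \<bar>prob (A \<inter> B) - prob A * prob B\<bar>) \<in> {1 / 2 * (\<Sum>A\<in>\<A>. \<Sum>B\<in>\<B>. \<bar>prob (A \<inter> B) - prob A * prob B\<bar>) | \<A> \<B>.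
      finite \<A> \<and> partition_on (space M) \<A> \<and> \<A> \<subseteq> gen_sigma M e T1 \<and>
      finite \<B> \<and> partition_on (space M) \<B> \<and> \<B> \<subseteq> gen_sigma M e T2}"
 by (rule CollectI, rule exI[of _ \<A>], rule exI[of _ \<B>]) (simp only: assms simp_thms)

lemma beta_bar_upper:
 assumes e: "\<And>x. e x \<in> borel_measurable M"
  and "finite \<A>" "partition_on (space M) \<A>" "\<A> \<subseteq> gen_sigma M e T1"
  and "finite \<B>" "partition_on (space M) \<B>" "\<B> \<subseteq> gen_sigma M e T2"
 shows "(\<Sum>A\<in>\<A>. \<Sum>B\<in>\<B>. \<bar>prob (A \<inter> B) - prob A * prob B\<bar>) <= 2 * beta_bar M e T1 T2"
proof -
 have "1/2 * (\<Sum>A\<in>\<A>. \<Sum>B\<in>\<B>. \<bar>prob (A \<inter> B) - prob A * prob B\<bar>) <= beta_bar M e T1 T2"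
  unfolding beta_bar_def
 proof (rule cSup_upper)
  show "bdd_above {1 / 2 * (\<Sum>A\<in>\<A>. \<Sum>B\<in>\<B>. \<bar>prob (A \<inter> B) - prob A * prob B\<bar>) | \<A> \<B>.
      finite \<A> \<and> partition_on (space M) \<A> \<and> \<A> \<subseteq> gen_sigma M e T1 \<and>
      finite \<B> \<and> partition_on (space M) \<B> \<and> \<B> \<subseteq> gen_sigma M e T2}"
   using discrepancy_set_le_1[OF e] by (rule bdd_aboveI)
 qed (rule discrepancy_mem[OF assms(2-)])
 then show ?thesis by simp
qed

lemma beta_bar_le_1:
 assumes e: "\<And>x. e x \<in> borel_measurable M"
 shows "beta_bar M e T1 T2 <= 1"
 unfolding beta_bar_def
proof (rule cSup_least)
 have "partition_on (space M) {space M}" by (rule partition_on_space) (use not_empty in auto)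
 moreover have "space M \<in> gen_sigma M e T" for T unfolding gen_sigma_def by (rule sigma_sets_top)
 ultimately have sp: "finite {space M}" "partition_on (space M) {space M}" "{space M} \<subseteq> gen_sigma M e T" for T by auto
 show "{1 / 2 * (\<Sum>A\<in>\<A>. \<Sum>B\<in>\<B>. \<bar>prob (A \<inter> B) - prob A * prob B\<bar>) | \<A> \<B>.
      finite \<A> \<and> partition_on (space M) \<A> \<and> \<A> \<subseteq> gen_sigma M e T1 \<and>
      finite \<B> \<and> partition_on (space M) \<B> \<and> \<B> \<subseteq> gen_sigma M e T2} ~= {}"
  by (rule ex_in_conv[THEN iffD1], rule exI, rule discrepancy_mem[OF sp sp])
next
 fix x assume "x \<in> {1 / 2 * (\<Sum>A\<in>\<A>. \<Sum>B\<in>\<B>. \<bar>prob (A \<inter> B) - prob A * prob B\<bar>) | \<A> \<B>.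
      finite \<A> \<and> partition_on (space M) \<A> \<and> \<A> \<subseteq> gen_sigma M e T1 \<and>
      finite \<B> \<and> partition_on (space M) \<B> \<and> \<B> \<subseteq> gen_sigma M e T2}"
 then show "x <= 1"
  by (rule discrepancy_set_le_1[OF e])
qed

lemma beta_bar_nonneg:
 assumes e: "\<And>x. e x \<in> borel_measurable M"
 shows "0 <= beta_bar M e T1 T2"
proof -
 have "partition_on (space M) {space M}" by (rule partition_on_space) (use not_empty in auto)
 moreover have "space M \<in> gen_sigma M e T" for T unfolding gen_sigma_def by (rule sigma_sets_top)
 ultimately have "finite {space M}" "partition_on (space M) {space M}" "{space M} \<subseteq> gen_sigma M e T" for T by auto
 from beta_bar_upper[OF e this this, of T1 T2] show ?thesis
  by (simp add: prob_space)
qed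

text \<open>Both suprema range over sets that are bounded by one, so they dominate their members.\<close>

lemma beta_bar_le_beta_mix:
 assumes e: "\<And>x. e x \<in> borel_measurable M"
  and "set_dist1 T1 T2 \<ge> ereal a" "T1 \<in> cube_unions b" "T2 \<in> cube_unions b"
 shows "beta_bar M e T1 T2 <= beta_mix M e a b"
 unfolding beta_mix_def
proof (rule cSup_upper)
 show "bdd_above {beta_bar M e T1 T2 |T1 T2. ereal a <= set_dist1 T1 T2 \<and> T1 \<in> cube_unions b \<and> T2 \<in> cube_unions b}"
  using beta_bar_le_1[OF e] by (intro bdd_aboveI[of _ 1]) auto
qed (use assms in auto)

text \<open>The level sets of finite-valued variables are partitions of the kind over which the supremum is taken.\<close>

lemma finite_valued_discrepancy_le:
 assumes e: "\<And>x. e x \<in> borel_measurable M"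
  and U: "finite (U ` space M)" "\<And>u. U -` {u} \<inter> space M \<in> gen_sigma M e T1"
  and V: "finite (V ` space M)" "\<And>v. V -` {v} \<inter> space M \<in> gen_sigma M e T2"
 shows "(\<Sum>u\<in>U ` space M. \<Sum>v\<in>V ` space M.
   \<bar>prob ((U -` {u} \<inter> space M) \<inter> (V -` {v} \<inter> space M)) - prob (U -` {u} \<inter> space M) * prob (V -` {v} \<inter> space M)\<bar>)
  <= 2 * beta_bar M e T1 T2"
proof -
 have part: "partition_on (space M) ((%u. W -` {u} \<inter> space M) ` (W ` space M))"
  and inj: "inj_on (%u. W -` {u} \<inter> space M) (W ` space M)" for W :: "'a => 'x"
 proof -
  show "partition_on (space M) ((%u. W -` {u} \<inter> space M) ` (W ` space M))"
   by (rule partition_onI) (auto simp: disjnt_def)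
  show "inj_on (%u. W -` {u} \<inter> space M) (W ` space M)"
  proof (rule inj_onI)
   fix u v assume "u \<in> W ` space M" and eq: "W -` {u} \<inter> space M = W -` {v} \<inter> space M"
   then obtain \<omega> where "\<omega> \<in> W -` {u} \<inter> space M" by auto
   then show "u = v" using eq by auto
  qed
 qed
 have "(\<Sum>A\<in>(%u. U -` {u} \<inter> space M) ` (U ` space M). \<Sum>B\<in>(%u. V -` {u} \<inter> space M) ` (V ` space M).
   \<bar>prob (A \<inter> B) - prob A * prob B\<bar>) <= 2 * beta_bar M e T1 T2"
  by (rule beta_bar_upper[OF e]) (use U V part in auto)
 then show ?thesis
  unfolding sum.reindex[OF inj] o_def .
qed

text \<open>Induction on the number of blocks: the new block is separated from the union of the earlier ones, so splitting it off
costs one mixing coefficient in total variation.\<close>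

lemma blocks_almost_independent:
 fixes V :: "'b => 'a => 'v" and \<beta> :: real
 assumes e: "\<And>x. e x \<in> borel_measurable M"
  and "finite J"
  and "\<And>b. b \<in> J ==> finite (V b ` space M)"
  and "\<And>b u. b \<in> J ==> V b -` {u} \<inter> space M \<in> gen_sigma M e (T b)"
  and "\<And>J' b. J' \<subseteq> J ==> b \<in> J ==> b \<notin> J' ==> beta_bar M e (\<Union>(T ` J')) (T b) <= \<beta>"
 shows "(\<Sum>v\<in>PiE J (%b. V b ` space M).
   \<bar>prob {\<omega>\<in>space M. \<forall>b\<in>J. V b \<omega> = v b} - (\<Prod>b\<in>J. prob {\<omega>\<in>space M. V b \<omega> = v b})\<bar>) <= 2 * card J * \<beta>"
 using assms(2-)
proof (induction J rule: finite_induct)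
 case empty
 have "{\<omega>\<in>space M. True} = space M" by auto
 then show ?case by (simp add: prob_space)
next
 case (insert c J)
 let ?R = "%b. V b ` space M"
 define U where "U = (%\<omega>. \<lambda>b\<in>J. V b \<omega>)"
 define p where "p = (%b u. prob {\<omega>\<in>space M. V b \<omega> = u})"
 define q where "q = (%v. prob {\<omega>\<in>space M. \<forall>b\<in>J. V b \<omega> = v b})"
 define pq where "pq = (%v u. prob ({\<omega>\<in>space M. \<forall>b\<in>J. V b \<omega> = v b} \<inter> {\<omega>\<in>space M. V c \<omega> = u}))"
 have IH: "(\<Sum>v\<in>PiE J ?R. \<bar>q v - (\<Prod>b\<in>J. p b (v b))\<bar>) <= 2 * card J * \<beta>"
  unfolding q_def p_def using insert.prems by (intro insert.IH) blast+
 have V: "{\<omega>\<in>space M. V b \<omega> = u} \<in> gen_sigma M e (T b)" if "b \<in> insert c J" for b u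
  using insert.prems(2)[OF that, of u] by (simp add: vimage_def Int_def conj_commute)
 have Vs: "{\<omega>\<in>space M. V b \<omega> = u} \<in> sets M" if "b \<in> insert c J" for b u
  using V[OF that] gen_sigma_sets[of "T b" e M] e by blast
 have fin: "finite (PiE J ?R)" using insert by (intro finite_PiE) auto
 have fc: "finite (?R c)" using insert by auto
 have UE: "U -` {v} \<inter> space M = {\<omega>\<in>space M. \<forall>b\<in>J. V b \<omega> = v b}" if "v \<in> PiE J ?R" for v
  using that unfolding U_def by (auto simp: PiE_def extensional_def fun_eq_iff)
 have Urange: "U ` space M \<subseteq> PiE J ?R" by (auto simp: U_def)
 have Usets: "{\<omega>\<in>space M. \<forall>b\<in>J. V b \<omega> = v b} \<in> gen_sigma M e (\<Union>(T ` J))" for v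
 proof -
  have "{\<omega>\<in>space (field_algebra M e (\<Union>(T ` J))). \<forall>b\<in>J. V b \<omega> = v b} \<in> sets (field_algebra M e (\<Union>(T ` J)))"
  proof (rule sets.sets_Collect_finite_All[OF _ insert.hyps(1)])
   fix b assume "b \<in> J"
   then show "{\<omega>\<in>space (field_algebra M e (\<Union>(T ` J))). V b \<omega> = v b} \<in> sets (field_algebra M e (\<Union>(T ` J)))"
    unfolding space_field_algebra sets_field_algebra
    using V[of b "v b"] gen_sigma_mono[of "T b" "\<Union>(T ` J)" M e] by blast
  qed
  then show ?thesis by (simp add: space_field_algebra sets_field_algebra)
 qed
 have Usets': "U -` {v} \<inter> space M \<in> gen_sigma M e (\<Union>(T ` J))" for v
 proof (cases "v \<in> PiE J ?R")
  case False
  then have "U -` {v} \<inter> space M = {}" using Urange by auto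
  then show ?thesis by (simp add: gen_sigma_def sigma_sets.Empty)
 qed (use UE Usets in auto)
 have step: "(\<Sum>v\<in>PiE J ?R. \<Sum>u\<in>?R c. \<bar>pq v u - q v * p c u\<bar>) <= 2 * \<beta>"
 proof -
  have "(\<Sum>v\<in>PiE J ?R. \<Sum>u\<in>?R c. \<bar>pq v u - q v * p c u\<bar>) = (\<Sum>v\<in>U ` space M. \<Sum>u\<in>?R c. \<bar>pq v u - q v * p c u\<bar>)"
  proof (rule sum.mono_neutral_right[OF fin Urange], rule ballI)
   fix v assume v: "v \<in> PiE J ?R - U ` space M"
   then have "U -` {v} \<inter> space M = {}" by auto
   then have 0: "{\<omega>\<in>space M. \<forall>b\<in>J. V b \<omega> = v b} = {}" using UE[of v] v by simp
   show "(\<Sum>u\<in>?R c. \<bar>pq v u - q v * p c u\<bar>) = 0"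
    unfolding pq_def q_def 0 by simp
  qed
  also have "... = (\<Sum>v\<in>U ` space M. \<Sum>u\<in>?R c.
   \<bar>prob ((U -` {v} \<inter> space M) \<inter> (V c -` {u} \<inter> space M)) - prob (U -` {v} \<inter> space M) * prob (V c -` {u} \<inter> space M)\<bar>)"
  proof (intro sum.cong refl)
   fix v u assume "v \<in> U ` space M"
   then have v: "v \<in> PiE J ?R" using Urange by blast
   have "{\<omega>\<in>space M. V c \<omega> = u} = V c -` {u} \<inter> space M" by auto
   then show "\<bar>pq v u - q v * p c u\<bar> = \<bar>prob ((U -` {v} \<inter> space M) \<inter> (V c -` {u} \<inter> space M))
     - prob (U -` {v} \<inter> space M) * prob (V c -` {u} \<inter> space M)\<bar>"
    by (simp only: pq_def q_def p_def UE[OF v])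
  qed
  also have "... <= 2 * beta_bar M e (\<Union>(T ` J)) (T c)"
   using insert.prems(1,2) Usets' finite_subset[OF Urange fin] by (intro finite_valued_discrepancy_le[OF e]) auto
  also have "... <= 2 * \<beta>" using insert.prems(3)[of J c] insert.hyps by auto
  finally show ?thesis .
 qed
 have pc1: "(\<Sum>u\<in>?R c. p c u) = 1"
 proof -
  have "(\<Sum>u\<in>?R c. p c u) = prob (\<Union>u\<in>?R c. {\<omega>\<in>space M. V c \<omega> = u})"
   unfolding p_def using fc Vs[of c]
   by (intro finite_measure_finite_Union[symmetric]) (auto simp: disjoint_family_on_def)
  also have "(\<Union>u\<in>?R c. {\<omega>\<in>space M. V c \<omega> = u}) = space M" by auto
  finally show ?thesis by (simp add: prob_space)
 qed
 have "(\<Sum>v\<in>PiE (insert c J) ?R.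
   \<bar>prob {\<omega>\<in>space M. \<forall>b\<in>insert c J. V b \<omega> = v b} - (\<Prod>b\<in>insert c J. prob {\<omega>\<in>space M. V b \<omega> = v b})\<bar>)
  = (\<Sum>(u, v)\<in>?R c \<times> PiE J ?R. \<bar>pq v u - p c u * (\<Prod>b\<in>J. p b (v b))\<bar>)"
  unfolding PiE_insert_eq sum.reindex[OF inj_combinator[OF insert.hyps(2), where T="%b. V b ` space M"]] o_def
 proof (intro sum.cong refl, clarify)
  fix u v \<omega>
  have a: "{\<omega>' \<in> space M. \<forall>b\<in>insert c J. V b \<omega>' = (v(c := u)) b}
    = {\<omega>'\<in>space M. \<forall>b\<in>J. V b \<omega>' = v b} \<inter> {\<omega>'\<in>space M. V c \<omega>' = u}"
   using insert.hyps(2) by auto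
  have b: "(\<Prod>b\<in>insert c J. prob {\<omega>'\<in>space M. V b \<omega>' = (v(c := u)) b}) = p c u * (\<Prod>b\<in>J. p b (v b))"
  proof -
   have "(\<Prod>b\<in>J. prob {\<omega>'\<in>space M. V b \<omega>' = (v(c := u)) b}) = (\<Prod>b\<in>J. p b (v b))"
    unfolding p_def using insert.hyps(2) by (intro prod.cong) auto
   then show ?thesis using insert.hyps by (simp add: p_def)
  qed
  show "\<bar>prob {\<omega>' \<in> space M. \<forall>b\<in>insert c J. V b \<omega>' = (v(c := u)) b} -
    (\<Prod>b\<in>insert c J. prob {\<omega>'\<in>space M. V b \<omega>' = (v(c := u)) b})\<bar> = \<bar>pq v u - p c u * (\<Prod>b\<in>J. p b (v b))\<bar>"
   unfolding a b pq_def ..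
 qed
 also have "... = (\<Sum>v\<in>PiE J ?R. \<Sum>u\<in>?R c. \<bar>pq v u - p c u * (\<Prod>b\<in>J. p b (v b))\<bar>)"
  unfolding sum.cartesian_product[symmetric] by (rule sum.swap)
 also have "... <= (\<Sum>v\<in>PiE J ?R. \<Sum>u\<in>?R c. \<bar>pq v u - q v * p c u\<bar> + p c u * \<bar>q v - (\<Prod>b\<in>J. p b (v b))\<bar>)"
 proof (intro sum_mono)
  fix v u
  have "p c u * \<bar>q v - (\<Prod>b\<in>J. p b (v b))\<bar> = \<bar>p c u * q v - p c u * (\<Prod>b\<in>J. p b (v b))\<bar>"
   by (simp add: p_def abs_mult right_diff_distrib[symmetric])
  then show "\<bar>pq v u - p c u * (\<Prod>b\<in>J. p b (v b))\<bar> <= \<bar>pq v u - q v * p c u\<bar> + p c u * \<bar>q v - (\<Prod>b\<in>J. p b (v b))\<bar>"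
   by (simp add: mult.commute)
 qed
 also have "... = (\<Sum>v\<in>PiE J ?R. \<Sum>u\<in>?R c. \<bar>pq v u - q v * p c u\<bar>) + (\<Sum>v\<in>PiE J ?R. \<bar>q v - (\<Prod>b\<in>J. p b (v b))\<bar>)"
  by (simp add: sum.distrib sum_distrib_right[symmetric] pc1)
 also have "... <= 2 * \<beta> + 2 * card J * \<beta>" using step IH by simp
 also have "... = 2 * card (insert c J) * \<beta>" using insert.hyps by (simp add: algebra_simps)
 finally show ?case .
qed

end

context prob_space begin

section \<open>Exponential moments of weakly dependent blocks\<close>

lemma expectation_finite_valued:
 fixes f :: "'c => real"
 assumes R: "finite R" "V ` space M \<subseteq> R" and s: "\<And>u. u \<in> R ==> {\<omega>\<in>space M. V \<omega> = u} \<in> sets M"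
 shows "expectation (%\<omega>. f (V \<omega>)) = (\<Sum>u\<in>R. f u * prob {\<omega>\<in>space M. V \<omega> = u})"
  and "(%\<omega>. f (V \<omega>)) \<in> borel_measurable M"
proof -
 have eq: "f (V \<omega>) = (\<Sum>u\<in>R. f u * indicator {\<omega>\<in>space M. V \<omega> = u} \<omega>)" if "\<omega> \<in> space M" for \<omega>
 proof -
  have "(\<Sum>u\<in>R. f u * indicator {\<omega>\<in>space M. V \<omega> = u} \<omega>) = (\<Sum>u\<in>R. if u = V \<omega> then f u else 0)"
   using that by (intro sum.cong) (auto simp: indicator_def)
  then show ?thesis using R that by (auto simp: sum.delta)
 qed
 have "expectation (%\<omega>. f (V \<omega>)) = expectation (%\<omega>. \<Sum>u\<in>R. f u * indicator {\<omega>\<in>space M. V \<omega> = u} \<omega>)"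
  using eq by (intro Bochner_Integration.integral_cong) auto
 also have "... = (\<Sum>u\<in>R. f u * prob {\<omega>\<in>space M. V \<omega> = u})"
  using s by (subst Bochner_Integration.integral_sum)
   (auto intro!: integrable_real_mult_indicator sum.cong simp: Int_absorb2 subset_eq integrable_mult_left emeasure_eq_measure)
 finally show "expectation (%\<omega>. f (V \<omega>)) = (\<Sum>u\<in>R. f u * prob {\<omega>\<in>space M. V \<omega> = u})" .
 have "(%\<omega>. \<Sum>u\<in>R. f u * indicator {\<omega>\<in>space M. V \<omega> = u} \<omega>) \<in> borel_measurable M"
  using s by (intro borel_measurable_sum borel_measurable_times borel_measurable_const borel_measurable_indicator)
 then show "(%\<omega>. f (V \<omega>)) \<in> borel_measurable M"
  by (subst measurable_cong[OF eq])
qed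

text \<open>A function with values in \<open>[0, 1]\<close> changes its expectation by at most the total variation distance, and under the product
law the exponential of a sum factorizes. The random vector \<open>V b\<close> is indexed by \<open>Z\<close>, so that a union bound
over \<open>Z\<close> fits inside the minimum.\<close>

lemma blocks_mgf_finite:
 fixes V :: "'b => 'a => 'z => real" and \<beta> :: real
 assumes e: "\<And>x. e x \<in> borel_measurable M"
  and J: "finite J"
  and fin: "\<And>b. b \<in> J ==> finite (V b ` space M)"
  and V: "\<And>b u. b \<in> J ==> V b -` {u} \<inter> space M \<in> gen_sigma M e (T b)"
  and \<beta>: "\<And>J' b. J' \<subseteq> J ==> b \<in> J ==> b \<notin> J' ==> beta_bar M e (\<Union>(T ` J')) (T b) <= \<beta>"
  and Z: "finite Z" and c: "\<And>z. z \<in> Z ==> 0 <= c z"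
 shows "expectation (%\<omega>. min 1 (\<Sum>z\<in>Z. c z * exp (\<Sum>b\<in>J. V b \<omega> z)))
  <= (\<Sum>z\<in>Z. c z * (\<Prod>b\<in>J. expectation (%\<omega>. exp (V b \<omega> z)))) + 2 * card J * \<beta>" (is "?E <= _")
  and "(%\<omega>. min 1 (\<Sum>z\<in>Z. c z * exp (\<Sum>b\<in>J. V b \<omega> z))) \<in> borel_measurable M"
proof -
 let ?R = "%b. V b ` space M"
 define \<Phi> where "\<Phi> = (%v. min 1 (\<Sum>z\<in>Z. c z * exp (\<Sum>b\<in>J. v b z)))"
 define U where "U = (%\<omega>. \<lambda>b\<in>J. V b \<omega>)"
 define p where "p = (%b u. prob {\<omega>\<in>space M. V b \<omega> = u})"
 define q where "q = (%v. prob {\<omega>\<in>space M. \<forall>b\<in>J. V b \<omega> = v b})"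
 have Vs: "{\<omega>\<in>space M. V b \<omega> = u} \<in> sets M" if "b \<in> J" for b u
 proof -
  have "V b -` {u} \<inter> space M = {\<omega>\<in>space M. V b \<omega> = u}" by auto
  then show ?thesis using V[OF that, of u] gen_sigma_sets[of "T b" e M] e by auto
 qed
 have finP: "finite (PiE J ?R)" using J fin by (rule finite_PiE)
 have UP: "U ` space M \<subseteq> PiE J ?R" by (auto simp: U_def)
 have UE: "{\<omega>\<in>space M. U \<omega> = v} = {\<omega>\<in>space M. \<forall>b\<in>J. V b \<omega> = v b}" if "v \<in> PiE J ?R" for v
  using that unfolding U_def by (auto simp: PiE_def extensional_def fun_eq_iff)
 have Us: "{\<omega>\<in>space M. U \<omega> = v} \<in> sets M" if "v \<in> PiE J ?R" for v
  unfolding UE[OF that] using Vs J by (intro sets.sets_Collect_finite_All) auto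
 have \<Phi>U: "min 1 (\<Sum>z\<in>Z. c z * exp (\<Sum>b\<in>J. V b \<omega> z)) = \<Phi> (U \<omega>)" for \<omega>
  unfolding \<Phi>_def U_def by simp
 have \<Phi>01: "0 <= \<Phi> v" "\<Phi> v <= 1" for v
  unfolding \<Phi>_def using c by (auto intro!: sum_nonneg)
 show "(%\<omega>. min 1 (\<Sum>z\<in>Z. c z * exp (\<Sum>b\<in>J. V b \<omega> z))) \<in> borel_measurable M"
  unfolding \<Phi>U by (rule expectation_finite_valued(2)[OF finP UP Us])
 have Ev: "expectation (%\<omega>. exp (V b \<omega> z)) = (\<Sum>u\<in>?R b. exp (u z) * p b u)" if "b \<in> J" for b z
  unfolding p_def by (rule expectation_finite_valued(1)[OF fin[OF that] subset_refl Vs[OF that], of "%u. exp (u z)"])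
 have "?E = (\<Sum>v\<in>PiE J ?R. \<Phi> v * prob {\<omega>\<in>space M. U \<omega> = v})"
  unfolding \<Phi>U by (rule expectation_finite_valued(1)[OF finP UP Us])
 also have "... = (\<Sum>v\<in>PiE J ?R. \<Phi> v * q v)"
  unfolding q_def using UE by (intro sum.cong) auto
 also have "... <= (\<Sum>v\<in>PiE J ?R. \<Phi> v * (\<Prod>b\<in>J. p b (v b)) + \<bar>q v - (\<Prod>b\<in>J. p b (v b))\<bar>)"
 proof (intro sum_mono)
  fix v
  have "\<Phi> v * (q v - (\<Prod>b\<in>J. p b (v b))) <= \<Phi> v * \<bar>q v - (\<Prod>b\<in>J. p b (v b))\<bar>"
   using \<Phi>01 by (intro mult_left_mono) auto
  also have "... <= \<bar>q v - (\<Prod>b\<in>J. p b (v b))\<bar>"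
   using \<Phi>01[of v] by (intro mult_left_le_one_le) auto
  finally show "\<Phi> v * q v <= \<Phi> v * (\<Prod>b\<in>J. p b (v b)) + \<bar>q v - (\<Prod>b\<in>J. p b (v b))\<bar>"
   by (simp add: algebra_simps)
 qed
 also have "... = (\<Sum>v\<in>PiE J ?R. \<Phi> v * (\<Prod>b\<in>J. p b (v b))) + (\<Sum>v\<in>PiE J ?R. \<bar>q v - (\<Prod>b\<in>J. p b (v b))\<bar>)"
  by (rule sum.distrib)
 also have "(\<Sum>v\<in>PiE J ?R. \<bar>q v - (\<Prod>b\<in>J. p b (v b))\<bar>) <= 2 * card J * \<beta>"
  unfolding q_def p_def by (rule blocks_almost_independent[OF e J fin V \<beta>])
 also have "(\<Sum>v\<in>PiE J ?R. \<Phi> v * (\<Prod>b\<in>J. p b (v b)))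
   <= (\<Sum>v\<in>PiE J ?R. (\<Sum>z\<in>Z. c z * exp (\<Sum>b\<in>J. v b z)) * (\<Prod>b\<in>J. p b (v b)))"
  unfolding \<Phi>_def by (intro sum_mono mult_right_mono prod_nonneg) (auto simp: p_def)
 also have "... = (\<Sum>v\<in>PiE J ?R. \<Sum>z\<in>Z. c z * (\<Prod>b\<in>J. exp (v b z) * p b (v b)))"
  by (simp add: sum_distrib_right exp_sum J prod.distrib mult.assoc)
 also have "... = (\<Sum>z\<in>Z. c z * (\<Sum>v\<in>PiE J ?R. \<Prod>b\<in>J. exp (v b z) * p b (v b)))"
  by (subst sum.swap) (simp add: sum_distrib_left)
 also have "... = (\<Sum>z\<in>Z. c z * (\<Prod>b\<in>J. \<Sum>u\<in>?R b. exp (u z) * p b u))"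
  by (subst prod_sum_PiE[OF J fin]) auto
 also have "... = (\<Sum>z\<in>Z. c z * (\<Prod>b\<in>J. expectation (%\<omega>. exp (V b \<omega> z))))"
  using Ev by (intro sum.cong refl) simp
 finally show "?E <= (\<Sum>z\<in>Z. c z * (\<Prod>b\<in>J. expectation (%\<omega>. exp (V b \<omega> z)))) + 2 * card J * \<beta>"
  by simp
qed

text \<open>Rounding up to a grid; the upper approximation keeps exponential moments on the right side of the inequality.\<close>

lemma finite_valued_approximation:
 fixes g :: "'z => 'a => real"
 assumes sp: "space F = space M" and Z: "finite Z" and k: "0 < k"
  and g: "\<And>z. z \<in> Z ==> g z \<in> borel_measurable F"
  and g1: "\<And>z \<omega>. z \<in> Z ==> \<bar>g z \<omega>\<bar> <= 1"
 shows "\<exists>V. finite (V ` space M) \<and> (\<forall>u. V -` {u} \<inter> space M \<in> sets F) \<and>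
   (\<forall>z\<in>Z. \<forall>\<omega>. g z \<omega> <= V \<omega> z \<and> V \<omega> z <= g z \<omega> + 1 / k) \<and>
   (\<forall>z\<in>Z. (%\<omega>. V \<omega> z) \<in> borel_measurable F)"
proof -
 define W where "W = (%\<omega>. \<lambda>z\<in>Z. \<lceil>k * g z \<omega>\<rceil>)"
 define V where "V = (%\<omega> z. real_of_int (W \<omega> z) / k)"
 have Wz: "W \<omega> z = \<lceil>k * g z \<omega>\<rceil>" if "z \<in> Z" for \<omega> z using that by (simp add: W_def)
 have low: "g z \<omega> <= V \<omega> z" if "z \<in> Z" for z \<omega>
 proof -
  have "k * g z \<omega> <= real_of_int \<lceil>k * g z \<omega>\<rceil>" by linarith
  then show ?thesis using k by (simp add: V_def Wz[OF that] field_simps)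
 qed
 have up: "V \<omega> z <= g z \<omega> + 1 / k" if "z \<in> Z" for z \<omega>
 proof -
  have "real_of_int \<lceil>k * g z \<omega>\<rceil> <= k * g z \<omega> + 1" by linarith
  then show ?thesis using k by (simp add: V_def Wz[OF that] field_simps)
 qed
 have Wfin: "finite (W ` space M)"
 proof (rule finite_subset)
  show "W ` space M \<subseteq> PiE Z (%_. {- \<lceil>k\<rceil>..\<lceil>k\<rceil>})"
  proof (rule image_subsetI, rule PiE_I)
   fix \<omega> z assume z: "z \<in> Z"
   have "k * \<bar>g z \<omega>\<bar> <= k * 1" using g1[OF z, of \<omega>] k by (intro mult_left_mono) auto
   then have y: "\<bar>k * g z \<omega>\<bar> <= k" using k by (simp add: abs_mult)
   have "real_of_int (- \<lceil>k\<rceil>) <= real_of_int \<lceil>k * g z \<omega>\<rceil>"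
    using y le_of_int_ceiling[of k] le_of_int_ceiling[of "k * g z \<omega>"] by linarith
   then have "- \<lceil>k\<rceil> <= \<lceil>k * g z \<omega>\<rceil>" by (simp only: of_int_le_iff)
   moreover have "\<lceil>k * g z \<omega>\<rceil> <= \<lceil>k\<rceil>" using y by (intro ceiling_mono) linarith
   ultimately show "W \<omega> z \<in> {- \<lceil>k\<rceil>..\<lceil>k\<rceil>}" by (simp add: Wz[OF z])
  qed (simp add: W_def)
  show "finite (PiE Z (%_. {- \<lceil>k\<rceil>..\<lceil>k\<rceil>}))" using Z by (intro finite_PiE) auto
 qed
 have "V ` space M = (%w z. real_of_int (w z) / k) ` (W ` space M)"
  unfolding V_def by (simp add: image_image)
 then have Vfin: "finite (V ` space M)" using Wfin by simp
 have meas: "(%\<omega>. V \<omega> z) \<in> borel_measurable F" if "z \<in> Z" for z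
 proof -
  have [measurable]: "g z \<in> borel_measurable F" by (rule g[OF that])
  show ?thesis unfolding V_def Wz[OF that] by measurable
 qed
 have Vset: "V -` {u} \<inter> space M \<in> sets F" for u
 proof -
  have a: "V \<omega> z = real_of_int undefined / k" if "z \<notin> Z" for \<omega> z
   using that by (simp add: V_def W_def)
  have "V -` {u} \<inter> space M = {\<omega>\<in>space F. (\<forall>z\<in>Z. V \<omega> z = u z) \<and> (\<forall>z. z \<notin> Z --> u z = real_of_int undefined / k)}"
   unfolding sp using a by (auto simp: fun_eq_iff) metis+
  also have "... \<in> sets F"
  proof (rule sets.sets_Collect_conj)
   show "{\<omega>\<in>space F. \<forall>z\<in>Z. V \<omega> z = u z} \<in> sets F"
   proof (rule sets.sets_Collect_finite_All[OF _ Z])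
    fix z assume "z \<in> Z"
    from meas[OF this] show "{\<omega>\<in>space F. V \<omega> z = u z} \<in> sets F"
     by (rule borel_measurable_eq) simp
   qed
  qed (rule sets.sets_Collect_const)
  finally show ?thesis .
 qed
 show ?thesis using Vfin Vset low up meas by blast
qed

text \<open>The finite-valued case applied to rounded block variables. The mesh is below \<open>1 / card J\<close>, so the accumulated rounding
error in the exponent is at most one, which gives the factor \<open>exp 1\<close>.\<close>

lemma blocks_mgf:
 fixes G :: "'b => 'z => 'a => real" and \<beta> :: real
 assumes e: "\<And>x. e x \<in> borel_measurable M"
  and J: "finite J"
  and G: "\<And>b z. b \<in> J ==> z \<in> Z ==> G b z \<in> borel_measurable M"
  and G1: "\<And>b z \<omega>. b \<in> J ==> z \<in> Z ==> \<omega> \<in> space M ==> \<bar>G b z \<omega>\<bar> <= 1"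
  and G': "\<And>b z. b \<in> J ==> z \<in> Z ==> \<exists>g\<in>borel_measurable (field_algebra M e (T b)). AE \<omega> in M. G b z \<omega> = g \<omega>"
  and \<beta>: "\<And>J' b. J' \<subseteq> J ==> b \<in> J ==> b \<notin> J' ==> beta_bar M e (\<Union>(T ` J')) (T b) <= \<beta>"
  and Z: "finite Z" and c: "\<And>z. z \<in> Z ==> 0 <= c z"
 shows "expectation (%\<omega>. min 1 (\<Sum>z\<in>Z. c z * exp (\<Sum>b\<in>J. G b z \<omega>)))
  <= exp 1 * (\<Sum>z\<in>Z. c z * (\<Prod>b\<in>J. expectation (%\<omega>. exp (G b z \<omega>)))) + 2 * card J * \<beta>"
proof -
 from G' obtain g0 where g0: "\<And>b z. b \<in> J ==> z \<in> Z ==> g0 b z \<in> borel_measurable (field_algebra M e (T b))"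
  and g0_AE: "\<And>b z. b \<in> J ==> z \<in> Z ==> AE \<omega> in M. G b z \<omega> = g0 b z \<omega>" by metis
 define g where "g = (%b z \<omega>. max (- 1) (min 1 (g0 b z \<omega>)))"
 have g: "g b z \<in> borel_measurable (field_algebra M e (T b))" if "b \<in> J" "z \<in> Z" for b z
  unfolding g_def using g0[OF that] by (intro borel_measurable_max borel_measurable_min borel_measurable_const)
 have sub: "subalgebra M (field_algebra M e (T b))" for b
  by (rule subalgebra_field_algebra) (rule e)
 have g1: "\<bar>g b z \<omega>\<bar> <= 1" for b z \<omega> unfolding g_def by (simp add: abs_le_iff min_def max_def)
 have gAE: "AE \<omega> in M. G b z \<omega> = g b z \<omega>" if "b \<in> J" "z \<in> Z" for b z
  using g0_AE[OF that] AE_space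
 proof eventually_elim
  case (elim \<omega>)
  then show ?case using G1[OF that, of \<omega>] by (simp add: g_def abs_le_iff min_def max_def)
 qed
 define k :: real where "k = card J + 1"
 have k: "k > 0" by (simp add: k_def add_pos_nonneg)
 have "\<exists>V. \<forall>b\<in>J. finite (V b ` space M) \<and> (\<forall>u. V b -` {u} \<inter> space M \<in> sets (field_algebra M e (T b))) \<and>
   (\<forall>z\<in>Z. \<forall>\<omega>. g b z \<omega> <= V b \<omega> z \<and> V b \<omega> z <= g b z \<omega> + 1 / k) \<and>
   (\<forall>z\<in>Z. (%\<omega>. V b \<omega> z) \<in> borel_measurable (field_algebra M e (T b)))"
  by (rule bchoice, rule ballI, rule finite_valued_approximation[OF space_field_algebra Z k g g1])
 then obtain V where Vfin: "\<And>b. b \<in> J ==> finite (V b ` space M)"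
  and Vset: "\<And>b u. b \<in> J ==> V b -` {u} \<inter> space M \<in> sets (field_algebra M e (T b))"
  and Vlow: "\<And>b z \<omega>. b \<in> J ==> z \<in> Z ==> g b z \<omega> <= V b \<omega> z"
  and Vup: "\<And>b z \<omega>. b \<in> J ==> z \<in> Z ==> V b \<omega> z <= g b z \<omega> + 1 / k"
  and Vm: "\<And>b z. b \<in> J ==> z \<in> Z ==> (%\<omega>. V b \<omega> z) \<in> borel_measurable (field_algebra M e (T b))"
  by blast
 have ub: "card J * (1 / k) <= 1" using k by (simp add: k_def field_simps)
 have m1: "(%\<omega>. min 1 (\<Sum>z\<in>Z. c z * exp (\<Sum>b\<in>J. G b z \<omega>))) \<in> borel_measurable M"
  using G by (intro borel_measurable_min borel_measurable_const borel_measurable_sum borel_measurable_times borel_measurable_exp[THEN measurable_compose[rotated]])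
 have clip: "\<bar>min 1 (\<Sum>z\<in>Z. c z * exp (f z \<omega>))\<bar> <= 1" for f :: "'z => 'a => real" and \<omega>
 proof -
  have "0 <= (\<Sum>z\<in>Z. c z * exp (f z \<omega>))" using c by (intro sum_nonneg) simp
  then show ?thesis by simp
 qed
 note fv = blocks_mgf_finite[OF e J Vfin Vset[unfolded sets_field_algebra] \<beta> Z c]
 have "expectation (%\<omega>. min 1 (\<Sum>z\<in>Z. c z * exp (\<Sum>b\<in>J. G b z \<omega>)))
   <= expectation (%\<omega>. min 1 (\<Sum>z\<in>Z. c z * exp (\<Sum>b\<in>J. V b \<omega> z)))"
 proof (rule integral_mono_AE)
  show "integrable M (%\<omega>. min 1 (\<Sum>z\<in>Z. c z * exp (\<Sum>b\<in>J. G b z \<omega>)))"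
   using clip[of "%z \<omega>. \<Sum>b\<in>J. G b z \<omega>"] by (intro integrable_const_bound[OF _ m1, where B=1] AE_I2) simp
  show "integrable M (%\<omega>. min 1 (\<Sum>z\<in>Z. c z * exp (\<Sum>b\<in>J. V b \<omega> z)))"
   using clip[of "%z \<omega>. \<Sum>b\<in>J. V b \<omega> z"] by (intro integrable_const_bound[OF _ fv(2), where B=1] AE_I2) simp
  have "AE \<omega> in M. \<forall>b\<in>J. \<forall>z\<in>Z. G b z \<omega> = g b z \<omega>"
   using J Z gAE by (simp add: AE_finite_all)
  then show "AE \<omega> in M. min 1 (\<Sum>z\<in>Z. c z * exp (\<Sum>b\<in>J. G b z \<omega>)) <= min 1 (\<Sum>z\<in>Z. c z * exp (\<Sum>b\<in>J. V b \<omega> z))"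
  proof eventually_elim
   case (elim \<omega>)
   have "(\<Sum>z\<in>Z. c z * exp (\<Sum>b\<in>J. G b z \<omega>)) <= (\<Sum>z\<in>Z. c z * exp (\<Sum>b\<in>J. V b \<omega> z))"
    using c elim Vlow by (intro sum_mono mult_left_mono) (auto intro!: sum_mono)
   then show ?case by linarith
  qed
 qed
 also have "... <= (\<Sum>z\<in>Z. c z * (\<Prod>b\<in>J. expectation (%\<omega>. exp (V b \<omega> z)))) + 2 * card J * \<beta>"
  by (rule fv(1))
 also have "(\<Sum>z\<in>Z. c z * (\<Prod>b\<in>J. expectation (%\<omega>. exp (V b \<omega> z))))
   <= (\<Sum>z\<in>Z. c z * (\<Prod>b\<in>J. exp (1 / k) * expectation (%\<omega>. exp (G b z \<omega>))))"
 proof (intro sum_mono mult_left_mono prod_mono conjI c)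
  fix b z assume z: "z \<in> Z" and b: "b \<in> J"
  have bnd: "exp (x::real) <= exp 1" "exp x <= exp 2" if "x <= 1" for x using that by auto
  have iG: "integrable M (%\<omega>. exp (G b z \<omega>))"
   using G[OF b z] G1[OF b z] by (intro integrable_const_bound[of _ "exp 1"] AE_I2) (auto simp: abs_le_iff)
  have "(%\<omega>. exp (V b \<omega> z)) \<in> borel_measurable M"
   by (rule measurable_compose[OF measurable_from_subalg[OF sub Vm[OF b z]] borel_measurable_exp])
  moreover have "V b \<omega> z <= 2" for \<omega>
  proof -
   have "1 / k <= 1" using k by (simp add: k_def)
   then show ?thesis using Vup[OF b z, of \<omega>] g1[of b z \<omega>] by linarith
  qed
  ultimately have iV: "integrable M (%\<omega>. exp (V b \<omega> z))"
   by (intro integrable_const_bound[of _ "exp 2"] AE_I2) auto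
  have "expectation (%\<omega>. exp (V b \<omega> z)) <= expectation (%\<omega>. exp (1 / k) * exp (G b z \<omega>))"
  proof (rule integral_mono_AE[OF iV])
   show "AE \<omega> in M. exp (V b \<omega> z) <= exp (1 / k) * exp (G b z \<omega>)"
    using gAE[OF b z]
   proof eventually_elim
    case (elim \<omega>)
    then show ?case using Vup[OF b z, of \<omega>] by (simp add: exp_add[symmetric] add.commute)
   qed
  qed (use iG in simp)
  then show "expectation (%\<omega>. exp (V b \<omega> z)) <= exp (1 / k) * expectation (%\<omega>. exp (G b z \<omega>))" by simp
  show "0 <= expectation (%\<omega>. exp (V b \<omega> z))" by simp
 qed auto
 also have "... = exp (card J * (1 / k)) * (\<Sum>z\<in>Z. c z * (\<Prod>b\<in>J. expectation (%\<omega>. exp (G b z \<omega>))))"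
  by (simp add: prod.distrib exp_of_nat_mult[symmetric] sum_distrib_left mult_ac)
 also have "... <= exp 1 * (\<Sum>z\<in>Z. c z * (\<Prod>b\<in>J. expectation (%\<omega>. exp (G b z \<omega>))))"
  using ub c by (intro mult_right_mono sum_nonneg mult_nonneg_nonneg prod_nonneg) auto
 finally show ?thesis by simp
qed

text \<open>The integral of a field functional over a set \<open>T\<close> depends on the field only through its values on \<open>T\<close>. Joint measurability
is only known for the whole field, so this is shown up to null sets: the integral agrees with its conditional
expectation given the field on \<open>T\<close>, because the mean square difference is a double integral that vanishes pointwise.\<close>

lemma field_integral_measurable:
 fixes \<Phi> :: "'x => 'a => real"
 assumes e: "\<And>x. e x \<in> borel_measurable M"
  and \<nu>: "finite_measure \<nu>"
  and \<Phi>: "(%(x, \<omega>). \<Phi> x \<omega>) \<in> borel_measurable (\<nu> \<Otimes>\<^sub>M M)"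
  and bd: "\<And>x \<omega>. \<bar>\<Phi> x \<omega>\<bar> <= C"
  and loc: "\<And>x. \<Phi> x \<in> borel_measurable (field_algebra M e T)"
 shows "\<exists>g\<in>borel_measurable (field_algebra M e T). AE \<omega> in M. (\<integral>x. \<Phi> x \<omega> \<partial>\<nu>) = g \<omega>"
proof -
 let ?F = "field_algebra M e T"
 have sub: "subalgebra M ?F" by (rule subalgebra_field_algebra) (rule e)
 interpret finite_measure_subalgebra M ?F using sub by unfold_locales
 interpret \<nu>: finite_measure \<nu> by (rule \<nu>)
 interpret P: pair_sigma_finite \<nu> M ..
 have C: "0 <= C" using bd[of undefined undefined] by linarith
 define I where "I = (%\<omega>. \<integral>x. \<Phi> x \<omega> \<partial>\<nu>)"
 define B where "B = C * measure \<nu> (space \<nu>)"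
 have B0: "0 <= B" unfolding B_def using C by simp
 have \<Phi>': "(%(\<omega>, x). \<Phi> x \<omega>) \<in> borel_measurable (M \<Otimes>\<^sub>M \<nu>)"
  using measurable_compose[OF measurable_pair_swap' \<Phi>] by (simp add: case_prod_beta')
 have Im: "I \<in> borel_measurable M" unfolding I_def
  by (rule \<nu>.borel_measurable_lebesgue_integral[OF \<Phi>'])
 have IB: "\<bar>I \<omega>\<bar> <= B" for \<omega>
 proof (cases "integrable \<nu> (%x. \<Phi> x \<omega>)")
  case True
  have "\<bar>I \<omega>\<bar> <= (\<integral>x. \<bar>\<Phi> x \<omega>\<bar> \<partial>\<nu>)" unfolding I_def using integral_norm_bound[of \<nu> "%x. \<Phi> x \<omega>"] by simp
  also have "... <= (\<integral>x. C \<partial>\<nu>)" using True bd by (intro integral_mono) auto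
  finally show ?thesis by (simp add: B_def mult.commute)
 next
  case False
  then show ?thesis using B0 by (simp add: I_def not_integrable_integral_eq)
 qed
 have Ii: "integrable M I" using IB by (intro integrable_const_bound[OF _ Im, of B]) auto
 define g where "g = (%\<omega>. max (- B) (min B (real_cond_exp M ?F I \<omega>)))"
 have gF: "g \<in> borel_measurable ?F" unfolding g_def by measurable
 have gM: "g \<in> borel_measurable M" by (rule measurable_from_subalg[OF sub gF])
 have gB: "\<bar>g \<omega>\<bar> <= B" for \<omega> unfolding g_def using B0 by auto
 have "AE \<omega> in M. real_cond_exp M ?F I \<omega> <= B"
  by (rule real_cond_exp_le_c[OF Ii]) (rule AE_I2, use IB in \<open>smt (verit)\<close>)
 moreover have "AE \<omega> in M. real_cond_exp M ?F I \<omega> \<ge> - B"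
  by (rule real_cond_exp_ge_c[OF Ii]) (rule AE_I2, use IB in \<open>smt (verit)\<close>)
 ultimately have gAE: "AE \<omega> in M. real_cond_exp M ?F I \<omega> = g \<omega>"
  by eventually_elim (auto simp: g_def)
 have proj: "(\<integral>\<omega>. f \<omega> * (I \<omega> - g \<omega>) \<partial>M) = 0"
  if f: "f \<in> borel_measurable ?F" "\<And>\<omega>. \<bar>f \<omega>\<bar> <= c" for f c
 proof -
  have fM: "f \<in> borel_measurable M" by (rule measurable_from_subalg[OF sub f(1)])
  have c: "0 <= c" using f(2)[of undefined] by linarith
  have i1: "integrable M (%\<omega>. f \<omega> * I \<omega>)" and i2: "integrable M (%\<omega>. f \<omega> * g \<omega>)"
   using fM Im gM f(2) IB gB c B0
   by (auto intro!: integrable_const_bound[of _ "c * B"] AE_I2 mult_mono simp: abs_mult)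
  have "(\<integral>\<omega>. f \<omega> * g \<omega> \<partial>M) = (\<integral>\<omega>. f \<omega> * real_cond_exp M ?F I \<omega> \<partial>M)"
  proof (rule integral_cong_AE)
   show "AE \<omega> in M. f \<omega> * g \<omega> = f \<omega> * real_cond_exp M ?F I \<omega>"
    using gAE by eventually_elim simp
  qed (use fM gM in simp_all)
  also have "... = (\<integral>\<omega>. f \<omega> * I \<omega> \<partial>M)" by (rule real_cond_exp_intg(2)[OF i1 f(1) Im])
  finally show ?thesis using i1 i2 by (simp add: right_diff_distrib)
 qed
 define D where "D = (%\<omega>. I \<omega> - g \<omega>)"
 have Dm: "D \<in> borel_measurable M" unfolding D_def using Im gM by simp
 have DB: "\<bar>D \<omega>\<bar> <= 2 * B" for \<omega> unfolding D_def using IB[of \<omega>] gB[of \<omega>] by linarith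
 have DI: "(\<integral>\<omega>. D \<omega> * I \<omega> \<partial>M) = 0"
 proof -
  have int: "integrable (\<nu> \<Otimes>\<^sub>M M) (%(x, \<omega>). \<Phi> x \<omega> * D \<omega>)"
  proof -
   interpret fp: finite_measure "\<nu> \<Otimes>\<^sub>M M"
    by (rule finite_measure_pair_measure) unfold_locales
   have "(%p. case_prod \<Phi> p * D (snd p)) \<in> borel_measurable (\<nu> \<Otimes>\<^sub>M M)"
    using \<Phi> Dm by measurable
   then show ?thesis using bd DB C B0
    by (intro fp.integrable_const_bound[of _ "C * (2 * B)"] AE_I2)
      (auto simp: case_prod_beta' abs_mult intro!: mult_mono)
  qed
  have "(\<integral>\<omega>. D \<omega> * I \<omega> \<partial>M) = (\<integral>\<omega>. \<integral>x. \<Phi> x \<omega> * D \<omega> \<partial>\<nu> \<partial>M)"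
   unfolding I_def by (simp add: mult.commute)
  also have "... = (\<integral>x. \<integral>\<omega>. \<Phi> x \<omega> * D \<omega> \<partial>M \<partial>\<nu>)"
   by (rule P.Fubini_integral[OF int])
  also have "... = 0" unfolding D_def using proj[OF loc bd] by simp
  finally show ?thesis .
 qed
 have "(\<integral>\<omega>. (D \<omega>)\<^sup>2 \<partial>M) = (\<integral>\<omega>. D \<omega> * I \<omega> - g \<omega> * D \<omega> \<partial>M)"
  by (intro Bochner_Integration.integral_cong refl) (simp add: D_def power2_eq_square algebra_simps)
 also have "... = (\<integral>\<omega>. D \<omega> * I \<omega> \<partial>M) - (\<integral>\<omega>. g \<omega> * D \<omega> \<partial>M)"
  using Dm Im gM DB IB gB B0
  by (intro Bochner_Integration.integral_diff integrable_const_bound[of _ "2 * B * B"] integrable_const_bound[of _ "B * (2 * B)"] AE_I2)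
    (auto simp: abs_mult intro!: mult_mono)
 also have "... = 0" using DI proj[OF gF gB] unfolding D_def by simp
 finally have "(\<integral>\<omega>. (D \<omega>)\<^sup>2 \<partial>M) = 0" .
 moreover have "integrable M (%\<omega>. (D \<omega>)\<^sup>2)"
 proof (intro integrable_const_bound[of _ "(2 * B)\<^sup>2"] AE_I2)
  show "norm ((D \<omega>)\<^sup>2) <= (2 * B)\<^sup>2" for \<omega> using power_mono[OF DB[of \<omega>], of 2] by simp
 qed (use Dm in measurable)
 ultimately have "AE \<omega> in M. (D \<omega>)\<^sup>2 = 0"
  by (subst (asm) integral_nonneg_eq_0_iff_AE) auto
 then have "AE \<omega> in M. I \<omega> = g \<omega>" by eventually_elim (simp add: D_def)
 then show ?thesis using gF unfolding I_def by blast
qed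

end

section \<open>Block integrals of the truncated field\<close>

text \<open>Values above the level are set to zero rather than clipped, so that truncation can only decrease powers.\<close>

definition truncation :: "real => real => real" where
 "truncation \<tau> y = (if \<bar>y\<bar> <= \<tau> then y else 0)"

lemma truncation_measurable [measurable]: "truncation \<tau> \<in> borel_measurable borel"
 unfolding truncation_def by measurable

lemma abs_truncation_le: "0 <= \<tau> ==> \<bar>truncation \<tau> y\<bar> <= \<tau>"
 by (simp add: truncation_def)

lemma (in finite_measure) abs_integral_le:
 fixes h :: "'a => real"
 assumes "\<And>x. \<bar>h x\<bar> <= C"
 shows "\<bar>\<integral>x. h x \<partial>M\<bar> <= C * measure M (space M)"
proof (cases "integrable M h")
 case True
 have "\<bar>\<integral>x. h x \<partial>M\<bar> <= (\<integral>x. \<bar>h x\<bar> \<partial>M)" using integral_norm_bound[of M h] by simp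
 also have "... <= (\<integral>x. C \<partial>M)" using True assms by (intro integral_mono) auto
 finally show ?thesis by (simp add: mult.commute)
next
 case False
 have "0 <= C" using assms[of undefined] by linarith
 then show ?thesis using False by (simp add: not_integrable_integral_eq)
qed

context prob_space begin

lemma bounded_Fubini:
 fixes h :: "'x => 'a => real"
 assumes \<nu>: "finite_measure \<nu>"
  and h: "(%(x, \<omega>). h x \<omega>) \<in> borel_measurable (\<nu> \<Otimes>\<^sub>M M)"
  and bd: "\<And>x \<omega>. \<bar>h x \<omega>\<bar> <= C"
 shows "(\<integral>\<omega>. \<integral>x. h x \<omega> \<partial>\<nu> \<partial>M) = (\<integral>x. \<integral>\<omega>. h x \<omega> \<partial>M \<partial>\<nu>)"
  and "(%\<omega>. \<integral>x. h x \<omega> \<partial>\<nu>) \<in> borel_measurable M"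
  and "(%x. \<integral>\<omega>. h x \<omega> \<partial>M) \<in> borel_measurable \<nu>"
proof -
 interpret \<nu>: finite_measure \<nu> by (rule \<nu>)
 interpret P: pair_sigma_finite \<nu> M ..
 interpret fp: finite_measure "\<nu> \<Otimes>\<^sub>M M" by (rule finite_measure_pair_measure) unfold_locales
 have "integrable (\<nu> \<Otimes>\<^sub>M M) (%(x, \<omega>). h x \<omega>)"
  using bd by (intro fp.integrable_const_bound[OF _ h, of C] AE_I2) auto
 then show "(\<integral>\<omega>. \<integral>x. h x \<omega> \<partial>\<nu> \<partial>M) = (\<integral>x. \<integral>\<omega>. h x \<omega> \<partial>M \<partial>\<nu>)"
  by (rule P.Fubini_integral)
 have h': "(%(\<omega>, x). h x \<omega>) \<in> borel_measurable (M \<Otimes>\<^sub>M \<nu>)"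
  using measurable_compose[OF measurable_pair_swap' h] by (simp add: case_prod_beta')
 show "(%\<omega>. \<integral>x. h x \<omega> \<partial>\<nu>) \<in> borel_measurable M"
  by (rule \<nu>.borel_measurable_lebesgue_integral[OF h'])
 show "(%x. \<integral>\<omega>. h x \<omega> \<partial>M) \<in> borel_measurable \<nu>"
  by (rule borel_measurable_lebesgue_integral[OF h])
qed

text \<open>A second order expansion of the exponential. The first moment is the small truncation bias, and the second moment of the
block is the double integral of the covariance, hence of the order of the volume \<open>v\<close> and not of its square.\<close>

lemma block_exponential_moment:
 fixes \<nu> :: "'x measure" and y :: "'x => 'a => real"
 assumes \<nu>: "finite_measure \<nu>" and v: "measure \<nu> (space \<nu>) <= v"
  and y: "(%(x, \<omega>). y x \<omega>) \<in> borel_measurable (\<nu> \<Otimes>\<^sub>M M)" "\<And>x \<omega>. \<bar>y x \<omega>\<bar> <= \<tau>"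
  and u: "u \<in> borel_measurable \<nu>" "\<And>x. \<bar>u x\<bar> <= L1"
  and s: "s \<in> borel_measurable \<nu>" "\<And>x. 0 <= s x" "\<And>x. s x <= L2"
  and L: "L1 * \<tau> * v <= 1/2" "L2 * \<tau>\<^sup>2 * v <= 1/2"
  and mean: "\<And>x. x \<in> space \<nu> ==> \<bar>expectation (y x)\<bar> <= b1"
  and var: "\<And>x. x \<in> space \<nu> ==> expectation (%\<omega>. (y x \<omega>)\<^sup>2) <= 1"
  and cov: "\<And>x. x \<in> space \<nu> ==> (\<integral>x'. \<bar>expectation (%\<omega>. y x \<omega> * y x' \<omega>)\<bar> \<partial>\<nu>) <= V1"
  and b: "0 <= b1" "0 <= V1"
 defines "G \<equiv> %\<omega>. \<integral>x. u x * y x \<omega> + s x * (y x \<omega>)\<^sup>2 \<partial>\<nu>"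
 shows "expectation (%\<omega>. exp (G \<omega>)) <= exp (v * (L1 * b1 + 3 * L2 + 2 * L1\<^sup>2 * V1))"
  and "\<And>\<omega>. \<omega> \<in> space M ==> \<bar>G \<omega>\<bar> <= 1" and "G \<in> borel_measurable M"
proof -
 interpret \<nu>: finite_measure \<nu> by (rule \<nu>)
 have pos: "0 <= \<tau>" "0 <= L1" "0 <= L2" "0 <= v"
  using y(2)[of undefined undefined] u(2)[of undefined] s(2,3)[of undefined] v measure_nonneg[of \<nu> "space \<nu>"]
  by linarith+
 have \<tau>2: "(y x \<omega>)\<^sup>2 <= \<tau>\<^sup>2" for x \<omega> using power_mono[OF y(2)[of x \<omega>], of 2] by simp
 have ub: "\<bar>u x * y x \<omega>\<bar> <= L1 * \<tau>" for x \<omega>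
  using u(2)[of x] y(2)[of x \<omega>] pos by (simp add: abs_mult mult_mono)
 have sb: "\<bar>s x * (y x \<omega>)\<^sup>2\<bar> <= L2 * \<tau>\<^sup>2" for x \<omega>
  using s(2,3)[of x] \<tau>2[of x \<omega>] pos by (simp add: abs_mult mult_mono)
 have uy: "(%(x, \<omega>). u x * y x \<omega>) \<in> borel_measurable (\<nu> \<Otimes>\<^sub>M M)"
  and sy: "(%(x, \<omega>). s x * (y x \<omega>)\<^sup>2) \<in> borel_measurable (\<nu> \<Otimes>\<^sub>M M)"
  using y(1) u(1) s(1) unfolding case_prod_beta' by measurable
 define G1 where "G1 = (%\<omega>. \<integral>x. u x * y x \<omega> \<partial>\<nu>)"
 define G2 where "G2 = (%\<omega>. \<integral>x. s x * (y x \<omega>)\<^sup>2 \<partial>\<nu>)"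
 note F1 = bounded_Fubini[OF \<nu> uy ub, folded G1_def]
 note F2 = bounded_Fubini[OF \<nu> sy sb, folded G2_def]
 have sec: "(%x. u x * y x \<omega>) \<in> borel_measurable \<nu>" "(%x. s x * (y x \<omega>)\<^sup>2) \<in> borel_measurable \<nu>" if "\<omega> \<in> space M" for \<omega>
  using measurable_Pair_compose_split[OF uy _ measurable_const[OF that], of "%x. x" \<nu>]
   measurable_Pair_compose_split[OF sy _ measurable_const[OF that], of "%x. x" \<nu>] by simp_all
 have G: "G \<omega> = G1 \<omega> + G2 \<omega>" if "\<omega> \<in> space M" for \<omega>
  unfolding G_def G1_def G2_def
  using ub sb sec[OF that]
  by (intro Bochner_Integration.integral_add \<nu>.integrable_const_bound[of _ "L1 * \<tau>"] \<nu>.integrable_const_bound[of _ "L2 * \<tau>\<^sup>2"] AE_I2) auto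
 have m\<nu>: "C * measure \<nu> (space \<nu>) <= C * v" if "0 <= C" for C :: real
  using v that by (rule mult_left_mono)
 have G1b: "\<bar>G1 \<omega>\<bar> <= 1/2" for \<omega>
  using \<nu>.abs_integral_le[of "%x. u x * y x \<omega>", OF ub] m\<nu>[of "L1 * \<tau>"] L pos unfolding G1_def by simp
 have G2b: "\<bar>G2 \<omega>\<bar> <= 1/2" for \<omega>
  using \<nu>.abs_integral_le[of "%x. s x * (y x \<omega>)\<^sup>2", OF sb] m\<nu>[of "L2 * \<tau>\<^sup>2"] L pos unfolding G2_def by simp
 have G2p: "0 <= G2 \<omega>" for \<omega> unfolding G2_def using s(2) by (intro Bochner_Integration.integral_nonneg) auto
 show Gb: "\<bar>G \<omega>\<bar> <= 1" if "\<omega> \<in> space M" for \<omega>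
  using G[OF that] G1b[of \<omega>] G2b[of \<omega>] by linarith
 show Gm: "G \<in> borel_measurable M"
  using F1(2) F2(2) by (subst measurable_cong[OF G]) auto
 have i1: "integrable M G1" "integrable M G2" "integrable M (%\<omega>. (G1 \<omega>)\<^sup>2)" "integrable M (%\<omega>. exp (G \<omega>))"
 proof -
  show "integrable M G1" using G1b by (intro integrable_const_bound[OF _ F1(2), of "1/2"] AE_I2) auto
  show "integrable M G2" using G2b by (intro integrable_const_bound[OF _ F2(2), of "1/2"] AE_I2) auto
  show "integrable M (%\<omega>. (G1 \<omega>)\<^sup>2)"
  proof (intro integrable_const_bound[of _ "(1/2)^2"] AE_I2)
   show "norm ((G1 \<omega>)\<^sup>2) <= (1/2)^2" for \<omega> using power_mono[OF G1b[of \<omega>], of 2] by simp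
  qed (use F1(2) in measurable)
  show "integrable M (%\<omega>. exp (G \<omega>))"
   using Gm Gb by (intro integrable_const_bound[of _ "exp 1"] AE_I2) (auto simp: abs_le_iff)
 qed
 have E1: "expectation G1 <= L1 * b1 * v"
 proof -
  have "expectation G1 = (\<integral>x. u x * expectation (y x) \<partial>\<nu>)" using F1(1) by simp
  also have "... = (\<integral>x. (if x \<in> space \<nu> then u x * expectation (y x) else 0) \<partial>\<nu>)"
   by (intro Bochner_Integration.integral_cong) auto
  also have "... <= L1 * b1 * measure \<nu> (space \<nu>)"
   using u(2) mean pos b by (intro order_trans[OF abs_ge_self \<nu>.abs_integral_le]) (auto simp: abs_mult intro!: mult_mono)
  also have "... <= L1 * b1 * v" using b pos by (intro m\<nu>) auto
  finally show ?thesis .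
 qed
 have E2: "expectation G2 <= L2 * v"
 proof -
  have "expectation G2 = (\<integral>x. s x * expectation (%\<omega>. (y x \<omega>)\<^sup>2) \<partial>\<nu>)" using F2(1) by simp
  also have "... = (\<integral>x. (if x \<in> space \<nu> then s x * expectation (%\<omega>. (y x \<omega>)\<^sup>2) else 0) \<partial>\<nu>)"
   by (intro Bochner_Integration.integral_cong) auto
  also have "... <= L2 * measure \<nu> (space \<nu>)"
  proof (intro order_trans[OF abs_ge_self \<nu>.abs_integral_le])
   fix x
   have "s x * expectation (%\<omega>. (y x \<omega>)\<^sup>2) <= L2 * 1" if "x \<in> space \<nu>"
    using s(2,3)[of x] var[OF that] pos by (intro mult_mono) auto
   then show "\<bar>if x \<in> space \<nu> then s x * expectation (%\<omega>. (y x \<omega>)\<^sup>2) else 0\<bar> <= L2"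
    using s(2)[of x] pos by (auto simp: abs_mult)
  qed
  also have "... <= L2 * v" using pos by (intro m\<nu>) auto
  finally show ?thesis .
 qed
 have E3: "expectation (%\<omega>. (G1 \<omega>)\<^sup>2) <= L1\<^sup>2 * V1 * v"
 proof -
  have b1': "\<bar>(u x * y x \<omega>) * G1 \<omega>\<bar> <= (L1 * \<tau>) * (1/2)" for x \<omega>
   unfolding abs_mult[of "u x * y x \<omega>"] using ub G1b pos by (intro mult_mono) auto
  have b2': "\<bar>(u x' * y x' \<omega>) * (u x * y x \<omega>)\<bar> <= (L1 * \<tau>) * (L1 * \<tau>)" for x x' \<omega>
   unfolding abs_mult[of "u x' * y x' \<omega>"] using ub pos by (intro mult_mono) auto
  have m1: "(%(x, \<omega>). (u x * y x \<omega>) * G1 \<omega>) \<in> borel_measurable (\<nu> \<Otimes>\<^sub>M M)"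
   using uy F1(2) unfolding case_prod_beta' by measurable
  have m2: "(%(x', \<omega>). (u x' * y x' \<omega>) * (u x * y x \<omega>)) \<in> borel_measurable (\<nu> \<Otimes>\<^sub>M M)" if "x \<in> space \<nu>" for x
  proof -
   have "(%\<omega>. u x * y x \<omega>) \<in> borel_measurable M"
    using measurable_Pair_compose_split[OF uy measurable_const[OF that], of "%\<omega>. \<omega>" M] by simp
   then show ?thesis using uy unfolding case_prod_beta' by measurable
  qed
  have inner: "expectation (%\<omega>. (u x * y x \<omega>) * G1 \<omega>) <= L1\<^sup>2 * V1" if x: "x \<in> space \<nu>" for x
  proof -
   have mc: "(%x'. expectation (%\<omega>. (u x' * y x' \<omega>) * (u x * y x \<omega>))) \<in> borel_measurable \<nu>"
    by (rule bounded_Fubini(3)[OF \<nu> m2[OF x] b2'])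
   have "expectation (%\<omega>. (u x * y x \<omega>) * G1 \<omega>) = expectation (%\<omega>. \<integral>x'. (u x' * y x' \<omega>) * (u x * y x \<omega>) \<partial>\<nu>)"
    unfolding G1_def by (simp add: mult.commute)
   also have "... = (\<integral>x'. expectation (%\<omega>. (u x' * y x' \<omega>) * (u x * y x \<omega>)) \<partial>\<nu>)"
    by (rule bounded_Fubini(1)[OF \<nu> m2[OF x] b2'])
   also have "... <= (\<integral>x'. L1\<^sup>2 * \<bar>expectation (%\<omega>. y x \<omega> * y x' \<omega>)\<bar> \<partial>\<nu>)"
   proof (rule integral_mono_AE)
    have "\<bar>expectation (%\<omega>. (u x' * y x' \<omega>) * (u x * y x \<omega>))\<bar> <= (L1 * \<tau>) * (L1 * \<tau>)" for x'
     using abs_integral_le[of "%\<omega>. (u x' * y x' \<omega>) * (u x * y x \<omega>)", OF b2'] by (simp add: prob_space)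
    then show "integrable \<nu> (%x'. expectation (%\<omega>. (u x' * y x' \<omega>) * (u x * y x \<omega>)))"
     using mc by (intro \<nu>.integrable_const_bound[of _ "(L1 * \<tau>) * (L1 * \<tau>)"] AE_I2) auto
    have yb: "\<bar>y x' \<omega> * y x \<omega>\<bar> <= \<tau> * \<tau>" for x' \<omega> unfolding abs_mult using y(2) pos by (intro mult_mono) auto
    have ym: "(%(x', \<omega>). y x' \<omega> * y x \<omega>) \<in> borel_measurable (\<nu> \<Otimes>\<^sub>M M)"
    proof -
     have "(%\<omega>. y x \<omega>) \<in> borel_measurable M"
      using measurable_Pair_compose_split[OF y(1) measurable_const[OF x], of "%\<omega>. \<omega>" M] by simp
     then show ?thesis using y(1) unfolding case_prod_beta' by measurable
    qed
    have "(%x'. expectation (%\<omega>. y x' \<omega> * y x \<omega>)) \<in> borel_measurable \<nu>"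
     by (rule bounded_Fubini(3)[OF \<nu> ym yb])
    moreover have "\<bar>expectation (%\<omega>. y x' \<omega> * y x \<omega>)\<bar> <= \<tau> * \<tau>" for x'
     using abs_integral_le[of "%\<omega>. y x' \<omega> * y x \<omega>", OF yb] by (simp add: prob_space)
    ultimately have "integrable \<nu> (%x'. expectation (%\<omega>. y x' \<omega> * y x \<omega>))"
     by (intro \<nu>.integrable_const_bound[of _ "\<tau> * \<tau>"] AE_I2) auto
    then show "integrable \<nu> (%x'. L1\<^sup>2 * \<bar>expectation (%\<omega>. y x \<omega> * y x' \<omega>)\<bar>)"
     by (simp add: mult.commute[of "y x _"])
    show "AE x' in \<nu>. expectation (%\<omega>. (u x' * y x' \<omega>) * (u x * y x \<omega>)) <= L1\<^sup>2 * \<bar>expectation (%\<omega>. y x \<omega> * y x' \<omega>)\<bar>"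
    proof (rule AE_I2)
     fix x'
     have "expectation (%\<omega>. (u x' * y x' \<omega>) * (u x * y x \<omega>)) = (u x' * u x) * expectation (%\<omega>. y x \<omega> * y x' \<omega>)"
      by (simp add: mult_ac flip: integral_mult_right_zero)
     also have "... <= \<bar>u x' * u x\<bar> * \<bar>expectation (%\<omega>. y x \<omega> * y x' \<omega>)\<bar>"
      by (simp add: abs_mult[symmetric])
     also have "... <= L1\<^sup>2 * \<bar>expectation (%\<omega>. y x \<omega> * y x' \<omega>)\<bar>"
      using u(2)[of x] u(2)[of x'] pos by (intro mult_right_mono) (auto simp: abs_mult power2_eq_square intro!: mult_mono)
     finally show "expectation (%\<omega>. (u x' * y x' \<omega>) * (u x * y x \<omega>)) <= L1\<^sup>2 * \<bar>expectation (%\<omega>. y x \<omega> * y x' \<omega>)\<bar>" .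
    qed
   qed
   also have "... <= L1\<^sup>2 * V1" using cov[OF x] by (simp add: mult_left_mono)
   finally show ?thesis .
  qed
  have "expectation (%\<omega>. (G1 \<omega>)\<^sup>2) = expectation (%\<omega>. \<integral>x. (u x * y x \<omega>) * G1 \<omega> \<partial>\<nu>)"
   unfolding power2_eq_square by (subst (1) G1_def) simp
  also have "... = (\<integral>x. expectation (%\<omega>. (u x * y x \<omega>) * G1 \<omega>) \<partial>\<nu>)"
   by (rule bounded_Fubini(1)[OF \<nu> m1 b1'])
  also have "... <= (\<integral>x. L1\<^sup>2 * V1 \<partial>\<nu>)"
  proof (rule integral_mono_AE)
   have "\<bar>expectation (%\<omega>. (u x * y x \<omega>) * G1 \<omega>)\<bar> <= (L1 * \<tau>) * (1/2)" for x
    using abs_integral_le[of "%\<omega>. (u x * y x \<omega>) * G1 \<omega>", OF b1'] by (simp add: prob_space)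
   then show "integrable \<nu> (%x. expectation (%\<omega>. (u x * y x \<omega>) * G1 \<omega>))"
    using bounded_Fubini(3)[OF \<nu> m1 b1'] by (intro \<nu>.integrable_const_bound[of _ "(L1 * \<tau>) * (1/2)"] AE_I2) auto
  qed (use inner in auto)
  also have "... = L1\<^sup>2 * V1 * measure \<nu> (space \<nu>)" by (simp add: mult.commute)
  also have "... <= L1\<^sup>2 * V1 * v" using b by (intro m\<nu>) auto
  finally show ?thesis .
 qed
 have "expectation (%\<omega>. exp (G \<omega>)) <= expectation (%\<omega>. 1 + G1 \<omega> + 3 * G2 \<omega> + 2 * (G1 \<omega>)\<^sup>2)"
 proof (rule integral_mono)
  fix \<omega> assume w: "\<omega> \<in> space M"
  have "exp (G \<omega>) <= 1 + G \<omega> + (G \<omega>)\<^sup>2" by (rule exp_le_quadratic[OF Gb[OF w]])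
  also have "(G \<omega>)\<^sup>2 <= 2 * (G1 \<omega>)\<^sup>2 + 2 * (G2 \<omega>)\<^sup>2"
   unfolding G[OF w] using sum_squares_bound[of "G1 \<omega>" "G2 \<omega>"] by (simp add: power2_sum)
  also have "(G2 \<omega>)\<^sup>2 <= G2 \<omega> * 1"
   unfolding power2_eq_square using G2p[of \<omega>] G2b[of \<omega>] by (intro mult_left_mono) auto
  finally show "exp (G \<omega>) <= 1 + G1 \<omega> + 3 * G2 \<omega> + 2 * (G1 \<omega>)\<^sup>2" using G[OF w] by simp
 qed (use i1 in auto)
 also have "... = 1 + expectation G1 + 3 * expectation G2 + 2 * expectation (%\<omega>. (G1 \<omega>)\<^sup>2)"
  using i1 by (simp add: prob_space)
 also have "... <= 1 + v * (L1 * b1 + 3 * L2 + 2 * L1\<^sup>2 * V1)"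
  using E1 E2 E3 by (simp add: algebra_simps)
 also have "... <= exp (v * (L1 * b1 + 3 * L2 + 2 * L1\<^sup>2 * V1))" by (rule exp_ge_add_one_self)
 finally show "expectation (%\<omega>. exp (G \<omega>)) <= exp (v * (L1 * b1 + 3 * L2 + 2 * L1\<^sup>2 * V1))" .
qed

end

section \<open>Sums over random sites in separated cubes\<close>

lemma integral_translate_le:
 fixes \<sigma> :: "real ^ 'd::finite => real"
 assumes \<sigma>: "integrable lborel \<sigma>" and B: "B \<in> sets borel"
 shows "(\<integral>y. indicator B y * \<bar>\<sigma> (y - x)\<bar> \<partial>lborel) <= (\<integral>v. \<bar>\<sigma> v\<bar> \<partial>lborel)"
  and "integrable lborel (%y. indicator B y * \<bar>\<sigma> (y - x)\<bar>)"
proof -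
 have d: "lborel = distr lborel borel (%y. - x + y)"
  by (rule lborel_distr_plus[symmetric])
 have m: "(%v. \<bar>\<sigma> v\<bar>) \<in> borel_measurable borel" using borel_measurable_integrable[OF \<sigma>] by simp
 have i: "integrable lborel (%v. \<bar>\<sigma> v\<bar>)" using \<sigma> by simp
 have i2: "integrable lborel (%y. \<bar>\<sigma> (- x + y)\<bar>)"
  using i by (subst (asm) d) (subst (asm) integrable_distr_eq, use m in auto)
 have eq: "(\<integral>v. \<bar>\<sigma> v\<bar> \<partial>lborel) = (\<integral>y. \<bar>\<sigma> (- x + y)\<bar> \<partial>lborel)"
  by (subst d) (subst integral_distr, use m in auto)
 show i3: "integrable lborel (%y. indicator B y * \<bar>\<sigma> (y - x)\<bar>)"
  using integrable_real_mult_indicator[OF _ i2, of B] B by (simp add: mult.commute)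
 show "(\<integral>y. indicator B y * \<bar>\<sigma> (y - x)\<bar> \<partial>lborel) <= (\<integral>v. \<bar>\<sigma> v\<bar> \<partial>lborel)"
  unfolding eq using i2 i3 by (intro integral_mono) (auto simp: indicator_def)
qed

lemma min_one_ennreal: "0 <= r ==> min 1 (ennreal r) = ennreal (min 1 r)"
 by (cases "r <= 1") (auto simp: min_def simp flip: ennreal_1)

text \<open>The central estimate for the field. The field is frozen and the sites integrated out; the exponent becomes an
integral over the cubes, which is split into one block for each cube; the blocks are decoupled by mixing,
and each contributes its own exponential moment. The mixing cost is independent of the size of \<open>Z\<close>.\<close>

lemma (in prob_space) field_sum_tail:
 fixes e :: "real ^ 'd::finite => 'a => real" and X :: "'i => 'a => real ^ 'd"
  and \<beta> \<tau> lam C0 C1 t b1 b2 v :: real and \<Q> :: "(real ^ 'd) set set"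
 assumes e: "random_field M e"
  and X: "indep_vars (%_. borel) X I" "I ~= {}" "finite I"
  and law: "\<And>i. i \<in> I ==> distr M borel (X i) = density lborel (%x. ennreal (w x))"
  and w: "w \<in> borel_measurable borel" "\<And>x. 0 <= w x" "\<And>x. w x <= C1"
  and ind: "indep_set (gen_sigma M X I) (gen_sigma M e UNIV)"
  and Q: "finite \<Q>" "disjoint \<Q>" "\<And>Q. Q \<in> \<Q> ==> Q \<in> sets borel"
   "\<And>Q. Q \<in> \<Q> ==> emeasure lborel Q = ennreal v" "0 <= v"
  and \<beta>: "\<And>\<Q>' Q. \<Q>' \<subseteq> \<Q> ==> Q \<in> \<Q> ==> Q \<notin> \<Q>' ==> beta_bar M e (\<Union>\<Q>') Q <= \<beta>"
  and Z: "finite Z"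
  and f: "\<And>z. z \<in> Z ==> f z \<in> borel_measurable borel" "\<And>z x. z \<in> Z ==> \<bar>f z x\<bar> <= C0"
   "\<And>z x. z \<in> Z ==> f z x ~= 0 ==> x \<in> \<Union>\<Q>"
  and pos: "0 < lam" "0 <= \<tau>" "0 <= C0" "0 <= C1" "0 <= b1" "0 <= b2"
  and small: "lam * C0 * \<tau> <= 1" "card I * lam * C0 * C1 * \<tau> * v <= 1/2"
  and mean: "\<And>x. \<bar>expectation (%\<omega>. truncation \<tau> (e x \<omega>))\<bar> <= b1"
  and var: "\<And>x. expectation (%\<omega>. (truncation \<tau> (e x \<omega>))\<^sup>2) <= 1"
  and cov: "\<And>x y. \<bar>expectation (%\<omega>. truncation \<tau> (e x \<omega>) * truncation \<tau> (e y \<omega>))\<bar> <= \<bar>\<sigma> (y - x)\<bar> + b2"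
  and \<sigma>: "integrable lborel \<sigma>"
 shows "measure M {\<omega>\<in>space M. \<exists>z\<in>Z. t < (\<Sum>i\<in>I. f z (X i \<omega>) * truncation \<tau> (e (X i \<omega>) \<omega>))}
  <= exp 1 * card Z * exp (- lam * t + card \<Q> * v * (card I * lam * C0 * C1 * b1
     + 3 * (card I * lam\<^sup>2 * C0\<^sup>2 * C1)
     + 2 * (card I * lam * C0 * C1)\<^sup>2 * ((\<integral>x. \<bar>\<sigma> x\<bar> \<partial>lborel) + b2 * v)))
   + 2 * card \<Q> * \<beta>"
proof -
 define N where "N = field_algebra M e UNIV"
 have em: "e x \<in> borel_measurable M" for x using e by (simp add: random_field_def)
 have N: "space N = space M" "sets N \<subseteq> sets M" "sets N = gen_sigma M e UNIV"
  unfolding N_def using gen_sigma_sets[of UNIV e M] em by (auto simp: space_field_algebra sets_field_algebra)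
 define y where "y = (%x \<omega>. truncation \<tau> (e x \<omega>))"
 have yN: "(%(x, \<omega>). y x \<omega>) \<in> borel_measurable (borel \<Otimes>\<^sub>M N)"
  using e measurable_compose[OF _ truncation_measurable] unfolding random_field_def y_def N_def case_prod_beta' by blast
 have idm: "(%\<omega>. \<omega>) \<in> measurable M N"
  using N(1,2) by (auto simp: measurable_def dest: sets.sets_into_space)
 have idN: "(%p. (fst p, snd p)) \<in> measurable (borel \<Otimes>\<^sub>M M) (borel \<Otimes>\<^sub>M N)"
  by (intro measurable_Pair measurable_fst measurable_compose[OF measurable_snd idm])
 have yM: "(%(x, \<omega>). y x \<omega>) \<in> borel_measurable (borel \<Otimes>\<^sub>M M)"
  using measurable_compose[OF idN yN] by (simp add: case_prod_beta')
 have y\<tau>: "\<bar>y x \<omega>\<bar> <= \<tau>" for x \<omega> unfolding y_def by (rule abs_truncation_le[OF pos(2)])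
 let ?\<mu> = "density lborel (%x. ennreal (w x))"
 let ?n = "real (card I)"
 define L1 where "L1 = ?n * lam * C0 * C1"
 define L2 where "L2 = ?n * lam\<^sup>2 * C0\<^sup>2 * C1"
 have L0: "0 <= L1" "0 <= L2" unfolding L1_def L2_def using pos by auto
 define u where "u = (%z x. ?n * lam * f z x * w x)"
 define s where "s = (%z x. ?n * lam\<^sup>2 * (f z x)\<^sup>2 * w x)"
 have um: "u z \<in> borel_measurable borel" "s z \<in> borel_measurable borel" if "z \<in> Z" for z
  unfolding u_def s_def using f(1)[OF that] w(1) by measurable
 have ub: "\<bar>u z x\<bar> <= L1" if "z \<in> Z" for z x
 proof -
  have "\<bar>f z x\<bar> * w x <= C0 * C1" using f(2)[OF that] w pos by (intro mult_mono) auto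
  then have "(?n * lam) * (\<bar>f z x\<bar> * w x) <= (?n * lam) * (C0 * C1)" using pos by (intro mult_left_mono) auto
  then show ?thesis unfolding u_def L1_def using pos w(2)[of x] by (simp add: abs_mult mult_ac)
 qed
 have sb: "s z x <= L2" if "z \<in> Z" for z x
 proof -
  have "(f z x)\<^sup>2 <= C0\<^sup>2" using power_mono[OF f(2)[OF that, of x], of 2] by simp
  then have "(f z x)\<^sup>2 * w x <= C0\<^sup>2 * C1" using w pos by (intro mult_mono) auto
  then have "(?n * lam\<^sup>2) * ((f z x)\<^sup>2 * w x) <= (?n * lam\<^sup>2) * (C0\<^sup>2 * C1)" using pos by (intro mult_left_mono) auto
  then show ?thesis unfolding s_def L2_def by (simp add: mult_ac)
 qed
 have s0: "0 <= s z x" for z x unfolding s_def using w(2) by simp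
 have small2: "L1 * \<tau> * v <= 1/2" "L2 * \<tau>\<^sup>2 * v <= 1/2"
 proof -
  show 1: "L1 * \<tau> * v <= 1/2" using small(2) by (simp add: L1_def)
  have "L2 * \<tau>\<^sup>2 * v = (L1 * \<tau> * v) * (lam * C0 * \<tau>)" unfolding L1_def L2_def by (simp add: power2_eq_square)
  also have "... <= (L1 * \<tau> * v) * 1" using small(1) L0 pos Q(5) by (intro mult_left_mono) auto
  finally show "L2 * \<tau>\<^sup>2 * v <= 1/2" using 1 by simp
 qed
 let ?\<nu> = "%Q. density lborel (%x. ennreal (indicator Q x))"
 have \<nu>e: "emeasure (?\<nu> Q) (space (?\<nu> Q)) = ennreal v" if "Q \<in> \<Q>" for Q
  using Q(3,4)[OF that] by (subst emeasure_density) (auto simp: ennreal_indicator)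
 have \<nu>f: "finite_measure (?\<nu> Q)" if "Q \<in> \<Q>" for Q
  using \<nu>e[OF that] by (intro finite_measureI) simp
 have \<nu>v: "measure (?\<nu> Q) (space (?\<nu> Q)) = v" if "Q \<in> \<Q>" for Q
  using \<nu>e[OF that] Q(5) by (simp add: measure_def)
 have \<nu>i: "(\<integral>x. h x \<partial>?\<nu> Q) = (\<integral>x. indicator Q x * h x \<partial>lborel)"
  if "Q \<in> \<Q>" "h \<in> borel_measurable borel" for Q and h :: "real ^ 'd => real"
  using Q(3)[OF that(1)] that(2) by (subst integral_density) auto
 define G where "G = (%Q z \<omega>. \<integral>x. u z x * y x \<omega> + s z x * (y x \<omega>)\<^sup>2 \<partial>?\<nu> Q)"
 have ym: "(%(x, \<omega>). y x \<omega>) \<in> borel_measurable (?\<nu> Q \<Otimes>\<^sub>M M)" for Q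
  using yM by (simp cong: measurable_cong_sets sets_pair_measure_cong)
 have covQ: "(\<integral>x'. \<bar>expectation (%\<omega>. y x \<omega> * y x' \<omega>)\<bar> \<partial>?\<nu> Q) <= (\<integral>x. \<bar>\<sigma> x\<bar> \<partial>lborel) + b2 * v" if "Q \<in> \<Q>" for Q x
 proof -
  have m1: "(%(x', \<omega>). y x \<omega> * y x' \<omega>) \<in> borel_measurable (?\<nu> Q \<Otimes>\<^sub>M M)"
  proof -
   have "y x \<in> borel_measurable M" unfolding y_def using em by measurable
   then show ?thesis using ym unfolding case_prod_beta' by measurable
  qed
  have b: "\<bar>y x \<omega> * y x' \<omega>\<bar> <= \<tau> * \<tau>" for x' \<omega>
   unfolding abs_mult using y\<tau> pos by (intro mult_mono) auto
  have m2: "(%x'. expectation (%\<omega>. y x \<omega> * y x' \<omega>)) \<in> borel_measurable borel"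
   using bounded_Fubini(3)[OF \<nu>f[OF that] m1 b] by simp
  have i1: "integrable lborel (%x'. b2 * indicator Q x')"
   using Q(3,4)[OF that] by (intro integrable_mult_right integrable_real_indicator) auto
  note i2 = integral_translate_le(2)[OF \<sigma> Q(3)[OF that], of x]
  have eb: "(\<integral>x'. b2 * indicator Q x' \<partial>lborel) = b2 * v"
   using Q(3,4,5) that by (simp add: measure_def)
  have "(\<integral>x'. \<bar>expectation (%\<omega>. y x \<omega> * y x' \<omega>)\<bar> \<partial>?\<nu> Q) = (\<integral>x'. indicator Q x' * \<bar>expectation (%\<omega>. y x \<omega> * y x' \<omega>)\<bar> \<partial>lborel)"
   using m2 by (intro \<nu>i[OF that]) simp
  also have "... <= (\<integral>x'. indicator Q x' * \<bar>\<sigma> (x' - x)\<bar> + b2 * indicator Q x' \<partial>lborel)"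
  proof (rule integral_mono')
   show "integrable lborel (%x'. indicator Q x' * \<bar>\<sigma> (x' - x)\<bar> + b2 * indicator Q x')" using i1 i2 by simp
   fix x'
   show "indicator Q x' * \<bar>expectation (%\<omega>. y x \<omega> * y x' \<omega>)\<bar> <= indicator Q x' * \<bar>\<sigma> (x' - x)\<bar> + b2 * indicator Q x'"
    using cov[of x x'] unfolding y_def by (auto simp: indicator_def)
   show "0 <= indicator Q x' * \<bar>\<sigma> (x' - x)\<bar> + b2 * indicator Q x'" using pos by simp
  qed
  also have "... = (\<integral>x'. indicator Q x' * \<bar>\<sigma> (x' - x)\<bar> \<partial>lborel) + b2 * v"
   using i1 i2 eb by simp
  also have "... <= (\<integral>x. \<bar>\<sigma> x\<bar> \<partial>lborel) + b2 * v"
   using integral_translate_le(1)[OF \<sigma> Q(3)[OF that], of x] by simp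
  finally show ?thesis .
 qed
 have V0: "0 <= (\<integral>x. \<bar>\<sigma> x\<bar> \<partial>lborel) + b2 * v" using pos Q(5) by simp
 define \<kappa> where "\<kappa> = v * (L1 * b1 + 3 * L2 + 2 * L1\<^sup>2 * ((\<integral>x. \<bar>\<sigma> x\<bar> \<partial>lborel) + b2 * v))"
 have G: "expectation (%\<omega>. exp (G Q z \<omega>)) <= exp \<kappa>" "\<And>\<omega>. \<omega> \<in> space M ==> \<bar>G Q z \<omega>\<bar> <= 1" "G Q z \<in> borel_measurable M"
  if "Q \<in> \<Q>" "z \<in> Z" for Q z
 proof -
  have 1: "u z \<in> borel_measurable (?\<nu> Q)" "s z \<in> borel_measurable (?\<nu> Q)" using um[OF that(2)] by simp_all
  have 2: "\<bar>expectation (y x)\<bar> <= b1" "expectation (%\<omega>. (y x \<omega>)\<^sup>2) <= 1" for x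
   using mean var unfolding y_def by simp_all
  note m = block_exponential_moment[OF \<nu>f[OF that(1)] eq_refl[OF \<nu>v[OF that(1)]] ym y\<tau> 1(1) ub[OF that(2)]
    1(2) s0 sb[OF that(2)] small2 2(1) 2(2) covQ[OF that(1)] pos(5) V0]
  show "expectation (%\<omega>. exp (G Q z \<omega>)) <= exp \<kappa>" "\<And>\<omega>. \<omega> \<in> space M ==> \<bar>G Q z \<omega>\<bar> <= 1" "G Q z \<in> borel_measurable M"
   unfolding G_def \<kappa>_def by (rule m(1), rule m(2), assumption, rule m(3))
 qed
 have "emeasure M {\<omega>\<in>space M. \<exists>z\<in>Z. t < (\<Sum>i\<in>I. f z (X i \<omega>) * y (X i \<omega>) \<omega>)} \<le>
  (\<integral>\<^sup>+\<omega>. min 1 (\<Sum>z\<in>Z. ennreal (exp (- lam * t +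
    (\<Sum>i\<in>I. \<integral>x. lam * (f z x * y x \<omega>) + (lam * (f z x * y x \<omega>))\<^sup>2 \<partial>?\<mu>)))) \<partial>M)"
 proof (rule conditional_chernoff[OF N(1,2) X law _ Z _ pos(1)])
  show "indep_set (gen_sigma M X I) (sets N)" using ind N by simp
  fix z i assume z: "z \<in> Z"
  show "(%(x, \<omega>). f z x * y x \<omega>) \<in> borel_measurable (borel \<Otimes>\<^sub>M N)"
   using f(1)[OF z] yN unfolding case_prod_beta' by measurable
  fix x \<omega>
  have "\<bar>lam * (f z x * y x \<omega>)\<bar> = lam * (\<bar>f z x\<bar> * \<bar>y x \<omega>\<bar>)" using pos by (simp add: abs_mult)
  also have "... <= lam * (C0 * \<tau>)" using f(2)[OF z] y\<tau> pos by (intro mult_left_mono mult_mono) auto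
  finally show "\<bar>lam * (f z x * y x \<omega>)\<bar> <= 1" using small(1) by (simp add: mult.assoc)
 qed
 also have "... = (\<integral>\<^sup>+\<omega>. ennreal (min 1 (\<Sum>z\<in>Z. exp (- lam * t) * exp (\<Sum>Q\<in>\<Q>. G Q z \<omega>))) \<partial>M)"
 proof (rule nn_integral_cong)
  fix \<omega> assume sw: "\<omega> \<in> space M"
  have ys: "(%x. y x \<omega>) \<in> borel_measurable borel"
   using measurable_Pair_compose_split[OF yM _ measurable_const[OF sw], of "%x. x" borel] by simp
  have "(\<Sum>i\<in>I. \<integral>x. lam * (f z x * y x \<omega>) + (lam * (f z x * y x \<omega>))\<^sup>2 \<partial>?\<mu>) = (\<Sum>Q\<in>\<Q>. G Q z \<omega>)" if z: "z \<in> Z" for z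
  proof -
   let ?h = "%x. u z x * y x \<omega> + s z x * (y x \<omega>)\<^sup>2"
   have hm: "?h \<in> borel_measurable borel" using um[OF z] ys by measurable
   have hb: "\<bar>?h x\<bar> <= L1 * \<tau> + L2 * \<tau>\<^sup>2" for x
   proof -
    have "\<bar>u z x * y x \<omega>\<bar> <= L1 * \<tau>" unfolding abs_mult using ub[OF z] y\<tau> L0 by (intro mult_mono) auto
    moreover have "\<bar>s z x * (y x \<omega>)\<^sup>2\<bar> <= L2 * \<tau>\<^sup>2"
     using sb[OF z] s0 power_mono[OF y\<tau>[of x \<omega>], of 2] L0 by (simp add: abs_mult mult_mono)
    ultimately show ?thesis by linarith
   qed
   have dec: "?h x = (\<Sum>Q\<in>\<Q>. indicator Q x * ?h x)" for x
   proof (cases "x \<in> \<Union>\<Q>")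
    case True
    then obtain Q where Q': "Q \<in> \<Q>" "x \<in> Q" by auto
    have "(\<Sum>Q\<in>\<Q>. indicator Q x :: real) = (\<Sum>P\<in>\<Q>. if P = Q then 1 else 0)"
     using Q' disjointD[OF Q(2) Q'(1)] by (intro sum.cong refl) (auto simp: indicator_def)
    then show ?thesis using Q' Q(1) by (simp add: sum_distrib_right[symmetric])
   next
    case False
    then have "f z x = 0" using f(3)[OF z] by blast
    then show ?thesis by (simp add: u_def s_def)
   qed
   have iQ: "integrable lborel (%x. indicator Q x * ?h x)" if "Q \<in> \<Q>" for Q
   proof (rule Bochner_Integration.integrable_bound)
    show "integrable lborel (%x. (L1 * \<tau> + L2 * \<tau>\<^sup>2) * indicator Q x :: real)"
     using Q(3,4)[OF that] by (intro integrable_mult_right integrable_real_indicator) auto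
    show "(%x. indicator Q x * ?h x) \<in> borel_measurable lborel" using hm Q(3)[OF that] by measurable
    show "AE x in lborel. norm (indicator Q x * ?h x) <= norm ((L1 * \<tau> + L2 * \<tau>\<^sup>2) * indicator Q x :: real)"
    proof (rule AE_I2)
     fix x show "norm (indicator Q x * ?h x) <= norm ((L1 * \<tau> + L2 * \<tau>\<^sup>2) * indicator Q x :: real)"
      using hb[of x] by (simp add: indicator_def)
    qed
   qed
   have "(\<integral>x. lam * (f z x * y x \<omega>) + (lam * (f z x * y x \<omega>))\<^sup>2 \<partial>?\<mu>)
    = (\<integral>x. w x * (lam * (f z x * y x \<omega>) + (lam * (f z x * y x \<omega>))\<^sup>2) \<partial>lborel)"
    using w ys f(1)[OF z] by (subst integral_density) auto
   then have "(\<Sum>i\<in>I. \<integral>x. lam * (f z x * y x \<omega>) + (lam * (f z x * y x \<omega>))\<^sup>2 \<partial>?\<mu>)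
    = ?n * (\<integral>x. w x * (lam * (f z x * y x \<omega>) + (lam * (f z x * y x \<omega>))\<^sup>2) \<partial>lborel)" by simp
   also have "... = (\<integral>x. ?n * (w x * (lam * (f z x * y x \<omega>) + (lam * (f z x * y x \<omega>))\<^sup>2)) \<partial>lborel)" by simp
   also have "... = (\<integral>x. ?h x \<partial>lborel)"
    by (intro Bochner_Integration.integral_cong refl) (simp add: u_def s_def power_mult_distrib algebra_simps)
   also have "... = (\<integral>x. (\<Sum>Q\<in>\<Q>. indicator Q x * ?h x) \<partial>lborel)" using dec by simp
   also have "... = (\<Sum>Q\<in>\<Q>. \<integral>x. indicator Q x * ?h x \<partial>lborel)"
    by (rule Bochner_Integration.integral_sum[OF iQ])
   also have "... = (\<Sum>Q\<in>\<Q>. G Q z \<omega>)" unfolding G_def using \<nu>i[OF _ hm] by simp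
   finally show ?thesis .
  qed
  then have "(\<Sum>z\<in>Z. ennreal (exp (- lam * t + (\<Sum>i\<in>I. \<integral>x. lam * (f z x * y x \<omega>) + (lam * (f z x * y x \<omega>))\<^sup>2 \<partial>?\<mu>))))
   = (\<Sum>z\<in>Z. ennreal (exp (- lam * t) * exp (\<Sum>Q\<in>\<Q>. G Q z \<omega>)))"
   by (intro sum.cong refl) (simp add: exp_add[symmetric])
  then show "min 1 (\<Sum>z\<in>Z. ennreal (exp (- lam * t + (\<Sum>i\<in>I. \<integral>x. lam * (f z x * y x \<omega>) + (lam * (f z x * y x \<omega>))\<^sup>2 \<partial>?\<mu>))))
   = ennreal (min 1 (\<Sum>z\<in>Z. exp (- lam * t) * exp (\<Sum>Q\<in>\<Q>. G Q z \<omega>)))"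
   by (simp add: sum_nonneg sum_ennreal min_one_ennreal)
 qed
 also have "... = ennreal (expectation (%\<omega>. min 1 (\<Sum>z\<in>Z. exp (- lam * t) * exp (\<Sum>Q\<in>\<Q>. G Q z \<omega>))))"
 proof (rule nn_integral_eq_integral)
  have m: "(%\<omega>. min 1 (\<Sum>z\<in>Z. exp (- lam * t) * exp (\<Sum>Q\<in>\<Q>. G Q z \<omega>))) \<in> borel_measurable M"
   using G(3) by (intro borel_measurable_min borel_measurable_const borel_measurable_sum borel_measurable_times borel_measurable_exp[THEN measurable_compose[rotated]])
  have p: "0 <= (\<Sum>z\<in>Z. exp (- lam * t) * exp (\<Sum>Q\<in>\<Q>. G Q z \<omega>))" for \<omega> by (intro sum_nonneg) simp
  show "integrable M (%\<omega>. min 1 (\<Sum>z\<in>Z. exp (- lam * t) * exp (\<Sum>Q\<in>\<Q>. G Q z \<omega>)))"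
   using p by (intro integrable_const_bound[OF _ m, where B=1] AE_I2) simp
  show "AE \<omega> in M. 0 <= min 1 (\<Sum>z\<in>Z. exp (- lam * t) * exp (\<Sum>Q\<in>\<Q>. G Q z \<omega>))"
   using p by (intro AE_I2) simp
 qed
 also have "... <= ennreal (exp 1 * (\<Sum>z\<in>Z. exp (- lam * t) * (\<Prod>Q\<in>\<Q>. expectation (%\<omega>. exp (G Q z \<omega>)))) + 2 * card \<Q> * \<beta>)"
 proof (intro ennreal_leI blocks_mgf[where T="%Q. Q" and e=e, OF em Q(1) G(3) G(2) _ _ Z])
  fix Q z assume Q': "Q \<in> \<Q>" and z: "z \<in> Z"
  define \<Phi> where "\<Phi> = (%x \<omega>. indicator Q x * (u z x * y x \<omega> + s z x * (y x \<omega>)\<^sup>2))"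
  have "\<exists>g\<in>borel_measurable (field_algebra M e Q). AE \<omega> in M. (\<integral>x. \<Phi> x \<omega> \<partial>?\<nu> Q) = g \<omega>"
  proof (rule field_integral_measurable[OF em \<nu>f[OF Q']])
   have "(%p. \<Phi> (fst p) (snd p)) \<in> borel_measurable (borel \<Otimes>\<^sub>M M)"
    unfolding \<Phi>_def using yM um[OF z] Q(3)[OF Q'] unfolding case_prod_beta' by measurable
   then show "(%(x, \<omega>). \<Phi> x \<omega>) \<in> borel_measurable (?\<nu> Q \<Otimes>\<^sub>M M)"
    by (simp add: case_prod_beta' cong: measurable_cong_sets sets_pair_measure_cong)
   show "\<bar>\<Phi> x \<omega>\<bar> <= L1 * \<tau> + L2 * \<tau>\<^sup>2" for x \<omega>
   proof -
    have "\<bar>u z x * y x \<omega>\<bar> <= L1 * \<tau>" unfolding abs_mult using ub[OF z] y\<tau> L0 by (intro mult_mono) auto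
    moreover have "\<bar>s z x * (y x \<omega>)\<^sup>2\<bar> <= L2 * \<tau>\<^sup>2"
     using sb[OF z] s0 power_mono[OF y\<tau>[of x \<omega>], of 2] L0 by (simp add: abs_mult mult_mono)
    ultimately show ?thesis unfolding \<Phi>_def by (auto simp: indicator_def)
   qed
   show "\<Phi> x \<in> borel_measurable (field_algebra M e Q)" for x
   proof (cases "x \<in> Q")
    case True
    have "y x \<in> borel_measurable (field_algebra M e Q)"
     unfolding y_def by (rule measurable_compose[OF measurable_field_algebra[OF True] truncation_measurable])
    then show ?thesis unfolding \<Phi>_def by measurable
   qed (simp add: \<Phi>_def)
  qed
  moreover have "(\<integral>x. \<Phi> x \<omega> \<partial>?\<nu> Q) = G Q z \<omega>" if "\<omega> \<in> space M" for \<omega>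
  proof -
   have ys: "(%x. y x \<omega>) \<in> borel_measurable borel"
    using measurable_Pair_compose_split[OF yM _ measurable_const[OF that], of "%x. x" borel] by simp
   have 1: "(%x. u z x * y x \<omega> + s z x * (y x \<omega>)\<^sup>2) \<in> borel_measurable borel" using um[OF z] ys by measurable
   have 2: "(%x. \<Phi> x \<omega>) \<in> borel_measurable borel" unfolding \<Phi>_def using 1 Q(3)[OF Q'] by measurable
   show ?thesis unfolding G_def \<nu>i[OF Q' 1] \<nu>i[OF Q' 2]
    by (intro Bochner_Integration.integral_cong refl) (simp add: \<Phi>_def indicator_def)
  qed
  ultimately show "\<exists>g\<in>borel_measurable (field_algebra M e Q). AE \<omega> in M. G Q z \<omega> = g \<omega>"
   using AE_space by (auto elim!: bexI[rotated] eventually_elim2)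
 next
  fix \<Q>' Q assume "\<Q>' \<subseteq> \<Q>" "Q \<in> \<Q>" "Q \<notin> \<Q>'"
  then show "beta_bar M e (\<Union>((%Q. Q) ` \<Q>')) Q <= \<beta>" using \<beta> by simp
 qed auto
 also have "... <= ennreal (exp 1 * card Z * exp (- lam * t + card \<Q> * \<kappa>) + 2 * card \<Q> * \<beta>)"
 proof (intro ennreal_leI add_right_mono)
  have "(\<Sum>z\<in>Z. exp (- lam * t) * (\<Prod>Q\<in>\<Q>. expectation (%\<omega>. exp (G Q z \<omega>)))) <= (\<Sum>z\<in>Z. exp (- lam * t) * (\<Prod>Q\<in>\<Q>. exp \<kappa>))"
   using G(1) by (intro sum_mono mult_left_mono prod_mono) auto
  also have "... = card Z * exp (- lam * t + card \<Q> * \<kappa>)"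
   by (simp add: exp_of_nat_mult[symmetric] exp_add[symmetric])
  finally show "exp 1 * (\<Sum>z\<in>Z. exp (- lam * t) * (\<Prod>Q\<in>\<Q>. expectation (%\<omega>. exp (G Q z \<omega>)))) <= exp 1 * card Z * exp (- lam * t + card \<Q> * \<kappa>)"
   by (simp add: mult.assoc)
 qed
 finally have fin: "emeasure M {\<omega>\<in>space M. \<exists>z\<in>Z. t < (\<Sum>i\<in>I. f z (X i \<omega>) * y (X i \<omega>) \<omega>)}
  <= ennreal (exp 1 * card Z * exp (- lam * t + card \<Q> * \<kappa>) + 2 * card \<Q> * \<beta>)" .
 have "0 <= 2 * card \<Q> * \<beta>"
 proof (cases "\<Q> = {}")
  case False
  then obtain Q where "Q \<in> \<Q>" by auto
  then have "0 <= \<beta>" using \<beta>[of "{}" Q] beta_bar_nonneg[where e=e, OF em, of "{}" Q] by simp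
  then show ?thesis by simp
 qed simp
 then have "measure M {\<omega>\<in>space M. \<exists>z\<in>Z. t < (\<Sum>i\<in>I. f z (X i \<omega>) * y (X i \<omega>) \<omega>)}
  <= exp 1 * card Z * exp (- lam * t + card \<Q> * \<kappa>) + 2 * card \<Q> * \<beta>"
  using fin unfolding emeasure_eq_measure by (subst (asm) ennreal_le_iff) auto
 then show ?thesis unfolding \<kappa>_def y_def L1_def L2_def by (simp add: mult.assoc)
qed

section \<open>Truncated moments and stationarity\<close>

context prob_space begin

text \<open>On the event \<open>\<tau> < |Y|\<close> one has \<open>|Y|^k \<le> |Y|^q / \<tau>^(q - k)\<close>.\<close>

lemma tail_moment_le:
 fixes Y :: "'a => real" and \<tau> :: real
 assumes Y: "integrable M (%\<omega>. \<bar>Y \<omega>\<bar> ^ q)" "Y \<in> borel_measurable M" and k: "k <= q" and \<tau>: "0 < \<tau>"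
 shows "expectation (%\<omega>. if \<tau> < \<bar>Y \<omega>\<bar> then \<bar>Y \<omega>\<bar> ^ k else 0) <= expectation (%\<omega>. \<bar>Y \<omega>\<bar> ^ q) / \<tau> ^ (q - k)"
  and "integrable M (%\<omega>. if \<tau> < \<bar>Y \<omega>\<bar> then \<bar>Y \<omega>\<bar> ^ k else 0)"
proof -
 have pt: "(if \<tau> < \<bar>Y \<omega>\<bar> then \<bar>Y \<omega>\<bar> ^ k else 0) <= \<bar>Y \<omega>\<bar> ^ q / \<tau> ^ (q - k)" for \<omega>
 proof (cases "\<tau> < \<bar>Y \<omega>\<bar>")
  case True
  have "\<bar>Y \<omega>\<bar> ^ k * \<tau> ^ (q - k) <= \<bar>Y \<omega>\<bar> ^ k * \<bar>Y \<omega>\<bar> ^ (q - k)"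
   using True \<tau> by (intro mult_left_mono power_mono) auto
  also have "... = \<bar>Y \<omega>\<bar> ^ q" using k by (simp add: power_add[symmetric])
  finally show ?thesis using True \<tau> by (simp add: field_simps)
 qed (use \<tau> in simp)
 show i: "integrable M (%\<omega>. if \<tau> < \<bar>Y \<omega>\<bar> then \<bar>Y \<omega>\<bar> ^ k else 0)"
 proof (rule Bochner_Integration.integrable_bound)
  show "integrable M (%\<omega>. \<bar>Y \<omega>\<bar> ^ q / \<tau> ^ (q - k))" using Y by simp
  show "(%\<omega>. if \<tau> < \<bar>Y \<omega>\<bar> then \<bar>Y \<omega>\<bar> ^ k else 0) \<in> borel_measurable M" using Y(2) by measurable
  show "AE \<omega> in M. norm (if \<tau> < \<bar>Y \<omega>\<bar> then \<bar>Y \<omega>\<bar> ^ k else 0) <= norm (\<bar>Y \<omega>\<bar> ^ q / \<tau> ^ (q - k))"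
  proof (rule AE_I2)
   fix \<omega>
   have "0 <= (if \<tau> < \<bar>Y \<omega>\<bar> then \<bar>Y \<omega>\<bar> ^ k else 0)" by simp
   then show "norm (if \<tau> < \<bar>Y \<omega>\<bar> then \<bar>Y \<omega>\<bar> ^ k else 0) <= norm (\<bar>Y \<omega>\<bar> ^ q / \<tau> ^ (q - k))"
    using pt[of \<omega>] by (simp only: real_norm_def) linarith
  qed
 qed
 have "expectation (%\<omega>. if \<tau> < \<bar>Y \<omega>\<bar> then \<bar>Y \<omega>\<bar> ^ k else 0) <= expectation (%\<omega>. \<bar>Y \<omega>\<bar> ^ q / \<tau> ^ (q - k))"
  using i Y pt by (intro integral_mono) auto
 then show "expectation (%\<omega>. if \<tau> < \<bar>Y \<omega>\<bar> then \<bar>Y \<omega>\<bar> ^ k else 0) <= expectation (%\<omega>. \<bar>Y \<omega>\<bar> ^ q) / \<tau> ^ (q - k)" by simp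
qed

lemma tail_prob_le:
 fixes Y :: "'a => real" and \<tau> :: real
 assumes Y: "integrable M (%\<omega>. \<bar>Y \<omega>\<bar> ^ q)" "Y \<in> borel_measurable M" and \<tau>: "0 < \<tau>"
 shows "prob {\<omega>\<in>space M. \<tau> < \<bar>Y \<omega>\<bar>} <= expectation (%\<omega>. \<bar>Y \<omega>\<bar> ^ q) / \<tau> ^ q"
proof -
 have s: "{\<omega>\<in>space M. \<tau> < \<bar>Y \<omega>\<bar>} \<in> sets M" using Y(2) by measurable
 have "prob {\<omega>\<in>space M. \<tau> < \<bar>Y \<omega>\<bar>} = expectation (indicator {\<omega>\<in>space M. \<tau> < \<bar>Y \<omega>\<bar>})"
  using s sets.sets_into_space[OF s] by (simp add: Int_absorb2)
 also have "... = expectation (%\<omega>. if \<tau> < \<bar>Y \<omega>\<bar> then \<bar>Y \<omega>\<bar> ^ 0 else 0)"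
  by (intro Bochner_Integration.integral_cong) (auto simp: indicator_def)
 also have "... <= expectation (%\<omega>. \<bar>Y \<omega>\<bar> ^ q) / \<tau> ^ q"
  using tail_moment_le(1)[OF Y, of 0 \<tau>] \<tau> by simp
 finally show ?thesis .
qed

text \<open>The mean is zero, so the truncated mean is minus the mean of the part that was cut off.\<close>

lemma truncated_mean_le:
 assumes Y: "integrable M (%\<omega>. \<bar>Y \<omega>\<bar> ^ q)" "integrable M Y" and q: "1 <= q" and \<tau>: "0 < \<tau>"
  and 0: "expectation Y = 0"
 shows "\<bar>expectation (%\<omega>. truncation \<tau> (Y \<omega>))\<bar> <= expectation (%\<omega>. \<bar>Y \<omega>\<bar> ^ q) / \<tau> ^ (q - 1)"
proof -
 have Ym: "Y \<in> borel_measurable M" using Y(2) by simp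
 note t = tail_moment_le[OF Y(1) Ym q \<tau>]
 have it: "integrable M (%\<omega>. truncation \<tau> (Y \<omega>))"
  using \<tau> abs_truncation_le[of \<tau>] measurable_compose[OF Ym truncation_measurable]
  by (intro integrable_const_bound[of _ \<tau>] AE_I2) auto
 have "\<bar>expectation (%\<omega>. truncation \<tau> (Y \<omega>))\<bar> = \<bar>expectation (%\<omega>. truncation \<tau> (Y \<omega>) - Y \<omega>)\<bar>"
  using it Y(2) 0 by simp
 also have "... <= expectation (%\<omega>. \<bar>truncation \<tau> (Y \<omega>) - Y \<omega>\<bar>)"
  using integral_norm_bound[of M "%\<omega>. truncation \<tau> (Y \<omega>) - Y \<omega>"] by simp
 also have "... = expectation (%\<omega>. if \<tau> < \<bar>Y \<omega>\<bar> then \<bar>Y \<omega>\<bar> ^ 1 else 0)"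
  by (intro Bochner_Integration.integral_cong refl) (simp add: truncation_def)
 finally show ?thesis using t(1) by linarith
qed

lemma truncated_second_moment_le:
 assumes "integrable M (%\<omega>. (Y \<omega>)\<^sup>2)"
 shows "expectation (%\<omega>. (truncation \<tau> (Y \<omega>))\<^sup>2) <= expectation (%\<omega>. (Y \<omega>)\<^sup>2)"
 using assms by (intro integral_mono') (auto simp: truncation_def)

text \<open>The product of the truncated variables differs from the product only where one of them is large. There
\<open>|Y W|\<close> is bounded by squares, which the moment of order \<open>q\<close> controls.\<close>

lemma truncated_covariance_le:
 assumes Y: "integrable M (%\<omega>. \<bar>Y \<omega>\<bar> ^ q)" "Y \<in> borel_measurable M"
  and W: "integrable M (%\<omega>. \<bar>W \<omega>\<bar> ^ q)" "W \<in> borel_measurable M"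
  and YW: "integrable M (%\<omega>. Y \<omega> * W \<omega>)"
  and m: "expectation (%\<omega>. \<bar>Y \<omega>\<bar> ^ q) = m" "expectation (%\<omega>. \<bar>W \<omega>\<bar> ^ q) = m"
  and q: "2 <= q" and \<tau>: "0 < \<tau>"
 shows "\<bar>expectation (%\<omega>. truncation \<tau> (Y \<omega>) * truncation \<tau> (W \<omega>))\<bar>
  <= \<bar>expectation (%\<omega>. Y \<omega> * W \<omega>)\<bar> + 3 * m / \<tau> ^ (q - 2)"
proof -
 let ?r = "%k V \<omega>. if \<tau> < \<bar>V \<omega>\<bar> then \<bar>V \<omega>\<bar> ^ k else 0"
 have q1: "1 <= q" using q by simp
 note ty = tail_moment_le[OF Y q1 \<tau>] tail_moment_le[OF Y q \<tau>]
 note tw = tail_moment_le[OF W q1 \<tau>] tail_moment_le[OF W q \<tau>]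
 have \<tau>1: "\<tau> * (m / \<tau> ^ (q - 1)) = m / \<tau> ^ (q - 2)"
 proof -
  have "q - 1 = Suc (q - 2)" using q by simp
  then show ?thesis using \<tau> by simp
 qed
 have i0: "integrable M (%\<omega>. truncation \<tau> (Y \<omega>) * truncation \<tau> (W \<omega>))"
 proof (rule integrable_const_bound[of _ "\<tau> * \<tau>"])
  show "AE \<omega> in M. norm (truncation \<tau> (Y \<omega>) * truncation \<tau> (W \<omega>)) <= \<tau> * \<tau>"
   using abs_truncation_le[of \<tau>] \<tau> by (intro AE_I2) (auto simp: abs_mult intro!: mult_mono)
  show "(%\<omega>. truncation \<tau> (Y \<omega>) * truncation \<tau> (W \<omega>)) \<in> borel_measurable M"
   using Y(2) W(2) by measurable
 qed
 have pt: "\<bar>truncation \<tau> y * truncation \<tau> w - y * w\<bar> \<le>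
   \<tau> * (if \<tau> < \<bar>y\<bar> then \<bar>y\<bar> ^ 1 else 0) + \<tau> * (if \<tau> < \<bar>w\<bar> then \<bar>w\<bar> ^ 1 else 0)
   + (1/2) * (if \<tau> < \<bar>y\<bar> then \<bar>y\<bar> ^ 2 else 0) + (1/2) * (if \<tau> < \<bar>w\<bar> then \<bar>w\<bar> ^ 2 else 0)" for y w :: real
 proof -
  have amgm: "\<bar>y\<bar> * \<bar>w\<bar> <= (1/2) * \<bar>y\<bar> ^ 2 + (1/2) * \<bar>w\<bar> ^ 2"
   using sum_squares_bound[of "\<bar>y\<bar>" "\<bar>w\<bar>"] by simp
  have 1: "\<bar>y\<bar> * \<bar>w\<bar> <= \<tau> * \<bar>y\<bar>" if "\<bar>w\<bar> <= \<tau>" using mult_left_mono[OF that, of "\<bar>y\<bar>"] by (simp add: mult.commute)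
  have 2: "\<bar>y\<bar> * \<bar>w\<bar> <= \<tau> * \<bar>w\<bar>" if "\<bar>y\<bar> <= \<tau>" using mult_right_mono[OF that, of "\<bar>w\<bar>"] by simp
  have 3: "0 <= \<tau> * \<bar>y\<bar>" "0 <= \<tau> * \<bar>w\<bar>" using \<tau> by auto
  show ?thesis
  proof (cases "\<bar>y\<bar> <= \<tau>"; cases "\<bar>w\<bar> <= \<tau>")
   assume "\<bar>y\<bar> <= \<tau>" "\<bar>w\<bar> <= \<tau>" then show ?thesis by (simp add: truncation_def)
  next
   assume a: "\<bar>y\<bar> <= \<tau>" "\<not> \<bar>w\<bar> <= \<tau>"
   then have "\<bar>y * w\<bar> <= \<tau> * \<bar>w\<bar> + (1/2) * w\<^sup>2" using 2 by (simp add: abs_mult add_increasing2)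
   then show ?thesis using a by (simp add: truncation_def)
  next
   assume a: "\<not> \<bar>y\<bar> <= \<tau>" "\<bar>w\<bar> <= \<tau>"
   then have "\<bar>y * w\<bar> <= \<tau> * \<bar>y\<bar> + (1/2) * y\<^sup>2" using 1 by (simp add: abs_mult add_increasing2)
   then show ?thesis using a by (simp add: truncation_def)
  next
   assume a: "\<not> \<bar>y\<bar> <= \<tau>" "\<not> \<bar>w\<bar> <= \<tau>"
   have "\<bar>y * w\<bar> <= \<tau> * \<bar>y\<bar> + \<tau> * \<bar>w\<bar> + (1/2) * y\<^sup>2 + (1/2) * w\<^sup>2"
    using 3 amgm by (simp add: abs_mult)
   then show ?thesis using a by (simp add: truncation_def)
  qed
 qed
 have "\<bar>expectation (%\<omega>. truncation \<tau> (Y \<omega>) * truncation \<tau> (W \<omega>)) - expectation (%\<omega>. Y \<omega> * W \<omega>)\<bar>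
  = \<bar>expectation (%\<omega>. truncation \<tau> (Y \<omega>) * truncation \<tau> (W \<omega>) - Y \<omega> * W \<omega>)\<bar>"
  using i0 YW by simp
 also have "... <= expectation (%\<omega>. \<bar>truncation \<tau> (Y \<omega>) * truncation \<tau> (W \<omega>) - Y \<omega> * W \<omega>\<bar>)"
  using integral_norm_bound[of M "%\<omega>. truncation \<tau> (Y \<omega>) * truncation \<tau> (W \<omega>) - Y \<omega> * W \<omega>"] by simp
 also have "... <= expectation (%\<omega>. \<tau> * ?r 1 Y \<omega> + \<tau> * ?r 1 W \<omega> + (1/2) * ?r 2 Y \<omega> + (1/2) * ?r 2 W \<omega>)"
  using i0 YW ty tw pt
  by (intro integral_mono Bochner_Integration.integrable_add integrable_mult_right integrable_abs Bochner_Integration.integrable_diff) auto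
 also have "... = \<tau> * expectation (?r 1 Y) + \<tau> * expectation (?r 1 W) + (1/2) * expectation (?r 2 Y) + (1/2) * expectation (?r 2 W)"
  using ty tw by (simp only: Bochner_Integration.integral_add integrable_mult_right Bochner_Integration.integrable_add integral_mult_right_zero)
 also have "... <= \<tau> * (m / \<tau> ^ (q - 1)) + \<tau> * (m / \<tau> ^ (q - 1)) + (1/2) * (m / \<tau> ^ (q - 2)) + (1/2) * (m / \<tau> ^ (q - 2))"
  using ty tw \<tau> unfolding m by (intro add_mono mult_left_mono) auto
 also have "... = 3 * m / \<tau> ^ (q - 2)" unfolding \<tau>1 by simp
 finally show ?thesis by linarith
qed

text \<open>Stationarity is an equality of finite-dimensional laws; integrals of measurable functions of finitely many values follow.\<close>

lemma stationary_expectation: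
 fixes e :: "real ^ 'd::finite => 'a => real" and h :: "(real ^ 'd => real) => real"
 assumes e: "\<And>x. e x \<in> borel_measurable M" "stationary M e" and T: "finite T"
  and h: "h \<in> borel_measurable (PiM T (%_. borel))"
 shows "expectation (%\<omega>. h (\<lambda>x\<in>T. e (x + v) \<omega>)) = expectation (%\<omega>. h (\<lambda>x\<in>T. e x \<omega>))"
  and "integrable M (%\<omega>. h (\<lambda>x\<in>T. e (x + v) \<omega>)) \<longleftrightarrow> integrable M (%\<omega>. h (\<lambda>x\<in>T. e x \<omega>))"
proof -
 have m: "(%\<omega>. \<lambda>x\<in>T. e (x + v) \<omega>) \<in> measurable M (PiM T (%_. borel))" for v
  using e(1) by (intro measurable_restrict) auto
 have m0: "(%\<omega>. \<lambda>x\<in>T. e x \<omega>) \<in> measurable M (PiM T (%_. borel))"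
  using e(1) by (intro measurable_restrict) auto
 have D: "distr M (PiM T (%_. borel)) (%\<omega>. \<lambda>x\<in>T. e (x + v) \<omega>) = distr M (PiM T (%_. borel)) (%\<omega>. \<lambda>x\<in>T. e x \<omega>)"
  using e(2) T unfolding stationary_def by blast
 show "expectation (%\<omega>. h (\<lambda>x\<in>T. e (x + v) \<omega>)) = expectation (%\<omega>. h (\<lambda>x\<in>T. e x \<omega>))"
  using integral_distr[OF m[of v] h] integral_distr[OF m0 h] D by simp
 show "integrable M (%\<omega>. h (\<lambda>x\<in>T. e (x + v) \<omega>)) \<longleftrightarrow> integrable M (%\<omega>. h (\<lambda>x\<in>T. e x \<omega>))"
  using integrable_distr_eq[OF m[of v] h] integrable_distr_eq[OF m0 h] D by simp
qed

lemma stationary_moment: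
 fixes e :: "real ^ 'd::finite => 'a => real"
 assumes e: "\<And>x. e x \<in> borel_measurable M" "stationary M e" and i: "integrable M (%\<omega>. \<bar>e 0 \<omega>\<bar> ^ q)"
 shows "expectation (%\<omega>. \<bar>e x \<omega>\<bar> ^ q) = expectation (%\<omega>. \<bar>e 0 \<omega>\<bar> ^ q)"
  and "integrable M (%\<omega>. \<bar>e x \<omega>\<bar> ^ q)"
proof -
 have h: "(%f. \<bar>f 0\<bar> ^ q) \<in> borel_measurable (PiM {0 :: real ^ 'd} (%_. borel :: real measure))"
  by measurable
 note se = stationary_expectation[OF e _ h, of x]
 show "expectation (%\<omega>. \<bar>e x \<omega>\<bar> ^ q) = expectation (%\<omega>. \<bar>e 0 \<omega>\<bar> ^ q)" using se(1) by simp
 show "integrable M (%\<omega>. \<bar>e x \<omega>\<bar> ^ q)" using se(2) i by simp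
qed

lemma stationary_covariance:
 fixes e :: "real ^ 'd::finite => 'a => real"
 assumes e: "\<And>x. e x \<in> borel_measurable M" "stationary M e"
 shows "expectation (%\<omega>. e x \<omega> * e y \<omega>) = expectation (%\<omega>. e 0 \<omega> * e (y - x) \<omega>)"
proof -
 have h: "(%f. f 0 * f (y - x)) \<in> borel_measurable (PiM {0, y - x} (%_. borel :: real measure))"
  by measurable
 show ?thesis using stationary_expectation(1)[OF e _ h, of x] by simp
qed

text \<open>The random site is independent of the field, so the tail of the field at the site is an average of tails at fixed points.\<close>

lemma field_max_tail:
 fixes e :: "real ^ 'd::finite => 'a => real" and X :: "'i => 'a => real ^ 'd" and \<tau> b :: real
 assumes e: "random_field M e"
  and X: "indep_vars (%_. borel) X I" "I ~= {}" "finite I"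
  and law: "\<And>i. i \<in> I ==> distr M borel (X i) = \<mu>"
  and ind: "indep_set (gen_sigma M X I) (gen_sigma M e UNIV)"
  and tail: "\<And>x. prob {\<omega>\<in>space M. \<tau> < \<bar>e x \<omega>\<bar>} <= b"
 shows "{\<omega>\<in>space M. \<exists>i\<in>I. \<tau> < \<bar>e (X i \<omega>) \<omega>\<bar>} \<in> sets M"
  and "prob {\<omega>\<in>space M. \<exists>i\<in>I. \<tau> < \<bar>e (X i \<omega>) \<omega>\<bar>} <= card I * b"
proof -
 define N where "N = field_algebra M e UNIV"
 have em: "e x \<in> borel_measurable M" for x using e by (simp add: random_field_def)
 have N: "space N = space M" "sets N \<subseteq> sets M" "sets N = gen_sigma M e UNIV"
  unfolding N_def using gen_sigma_sets[of UNIV e M] em by (auto simp: space_field_algebra sets_field_algebra)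
 have eN: "(%(x, \<omega>). e x \<omega>) \<in> borel_measurable (borel \<Otimes>\<^sub>M N)"
  using e unfolding random_field_def N_def by blast
 have Xm: "X i \<in> borel_measurable M" if "i \<in> I" for i
  using X(1) that unfolding indep_vars_def by auto
 obtain i0 where i0: "i0 \<in> I" using X by auto
 interpret \<mu>: prob_space \<mu> using law[OF i0] prob_space_distr[OF Xm[OF i0]] by simp
 have s\<mu>: "sets \<mu> = sets borel" using law[OF i0] sets_distr by metis
 interpret PQ: product_prob_space "%_. \<mu>" I ..
 let ?P = "PiM I (%_. borel :: (real ^ 'd) measure)" and ?Q = "PiM I (%_. \<mu>)"
 let ?V = "%\<omega>. \<lambda>i\<in>I. X i \<omega>"
 define B where "B = {p\<in>space (?P \<Otimes>\<^sub>M N). \<exists>i\<in>I. \<tau> < \<bar>e (fst p i) (snd p)\<bar>}"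
 have Fm: "(%p. e (fst p i) (snd p)) \<in> borel_measurable (?P \<Otimes>\<^sub>M N)" if "i \<in> I" for i
 proof -
  have "(%p. (fst p i, snd p)) \<in> measurable (?P \<Otimes>\<^sub>M N) (borel \<Otimes>\<^sub>M N)"
   using that by (intro measurable_Pair measurable_compose[OF measurable_fst measurable_component_singleton]) auto
  from measurable_compose[OF this eN] show ?thesis by simp
 qed
 have Bm: "B \<in> sets (?P \<Otimes>\<^sub>M N)"
  unfolding B_def using X(3) Fm
  by (auto intro!: sets.sets_Collect_finite_Ex borel_measurable_less borel_measurable_abs)
 have Vm: "?V \<in> measurable M ?P"
  using Xm by (intro measurable_restrict) auto
 have idm: "(%\<omega>. \<omega>) \<in> measurable M N"
  using N(1,2) by (auto simp: measurable_def dest: sets.sets_into_space)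
 have VN: "(%\<omega>. (?V \<omega>, \<omega>)) \<in> measurable M (?P \<Otimes>\<^sub>M N)" using Vm idm by simp
 let ?S = "{\<omega>\<in>space M. \<exists>i\<in>I. \<tau> < \<bar>e (X i \<omega>) \<omega>\<bar>}"
 have S: "?S = (%\<omega>. (?V \<omega>, \<omega>)) -` B \<inter> space M"
  using measurable_space[OF VN] by (auto simp: B_def)
 show Sm: "?S \<in> sets M" unfolding S by (rule measurable_sets[OF VN Bm])
 have b0: "0 <= b" using tail[of 0] measure_nonneg order_trans by blast
 have "emeasure M ?S = (\<integral>\<^sup>+\<omega>. indicator B (?V \<omega>, \<omega>) \<partial>M)"
  unfolding nn_integral_indicator[OF Sm, symmetric]
  by (intro nn_integral_cong) (auto simp: S indicator_def)
 also have "... = (\<integral>\<^sup>+\<omega>. \<integral>\<^sup>+x. indicator B (x, \<omega>) \<partial>?Q \<partial>M)"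
  using indep_product_law[OF N(1,2) X law, of "indicator B"] Bm ind N(3) by simp
 also have "... = (\<integral>\<^sup>+x. \<integral>\<^sup>+\<omega>. indicator B (x, \<omega>) \<partial>M \<partial>?Q)"
 proof -
  interpret P2: pair_sigma_finite ?Q M ..
  have sQ: "sets ?Q = sets ?P" by (rule sets_PiM_cong) (auto simp: s\<mu>)
  have idp: "(%p. (fst p, snd p)) \<in> measurable (?Q \<Otimes>\<^sub>M M) (?P \<Otimes>\<^sub>M N)"
   by (intro measurable_Pair measurable_compose[OF measurable_snd idm])
     (simp add: measurable_cong_sets[OF refl sQ[symmetric]])
  have "(indicator B :: _ => ennreal) \<in> borel_measurable (?P \<Otimes>\<^sub>M N)" using Bm by simp
  from measurable_compose[OF idp this] have "(%(x, \<omega>). indicator B (x, \<omega>) :: ennreal) \<in> borel_measurable (?Q \<Otimes>\<^sub>M M)"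
   by (simp add: case_prod_beta')
  from P2.Fubini'[OF this] show ?thesis by simp
 qed
 also have "... <= (\<integral>\<^sup>+x. ennreal (card I * b) \<partial>?Q)"
 proof (rule nn_integral_mono)
  fix x :: "'i => real ^ 'd"
  have es: "{\<omega>\<in>space M. \<tau> < \<bar>e (x i) \<omega>\<bar>} \<in> sets M" for i using em[of "x i"] by measurable
  have "(\<integral>\<^sup>+\<omega>. indicator B (x, \<omega>) \<partial>M) <= (\<integral>\<^sup>+\<omega>. indicator (\<Union>i\<in>I. {\<omega>\<in>space M. \<tau> < \<bar>e (x i) \<omega>\<bar>}) \<omega> \<partial>M)"
   by (intro nn_integral_mono) (auto simp: B_def indicator_def)
  also have "... = emeasure M (\<Union>i\<in>I. {\<omega>\<in>space M. \<tau> < \<bar>e (x i) \<omega>\<bar>})"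
   using es X(3) by (intro nn_integral_indicator) auto
  also have "... = ennreal (prob (\<Union>i\<in>I. {\<omega>\<in>space M. \<tau> < \<bar>e (x i) \<omega>\<bar>}))" by (simp add: emeasure_eq_measure)
  also have "... <= ennreal (\<Sum>i\<in>I. prob {\<omega>\<in>space M. \<tau> < \<bar>e (x i) \<omega>\<bar>})"
   using es X(3) by (intro ennreal_leI finite_measure_subadditive_finite) auto
  also have "... <= ennreal (card I * b)"
   using tail by (intro ennreal_leI sum_bounded_above[where K=b, simplified]) 
  finally show "(\<integral>\<^sup>+\<omega>. indicator B (x, \<omega>) \<partial>M) <= ennreal (card I * b)" .
 qed
 also have "... = ennreal (card I * b)" by (simp add: PQ.emeasure_space_1)
 finally show "prob ?S <= card I * b" using b0 by (simp add: emeasure_eq_measure)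
qed

section \<open>Sums of independent terms\<close>

text \<open>The conditional exponent of one error given the sites is linear plus quadratic in the error; this is its exponential moment.\<close>

lemma error_exponential_moment:
 fixes y :: "'a => real" and lam \<tau> C0 \<pi> b1 a1 a2 :: real
 assumes y: "y \<in> borel_measurable M" "\<And>\<omega>. \<bar>y \<omega>\<bar> <= \<tau>"
  and pos: "0 < lam" "0 < \<tau>" "0 <= C0" "0 <= \<pi>" "\<pi> <= 1" "0 <= b1"
  and small: "lam * C0 * \<tau> <= 1/2"
  and mean: "\<bar>expectation y\<bar> <= b1" and var: "expectation (%\<omega>. (y \<omega>)\<^sup>2) <= 1"
  and a1: "\<bar>a1\<bar> <= C0 * \<pi>" and a2: "0 <= a2" "a2 <= C0\<^sup>2 * \<pi>"
 shows "(\<integral>\<^sup>+\<omega>. ennreal (exp (lam * y \<omega> * a1 + (lam * y \<omega>)\<^sup>2 * a2)) \<partial>M)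
  <= ennreal (exp (lam * C0 * \<pi> * b1 + 5 * lam\<^sup>2 * C0\<^sup>2 * \<pi>))"
proof -
 define G where "G = (%\<omega>. lam * y \<omega> * a1 + (lam * y \<omega>)\<^sup>2 * a2)"
 have p1: "C0 * \<pi> <= C0 * 1" "C0\<^sup>2 * \<pi> <= C0\<^sup>2 * 1" using pos by (intro mult_left_mono; simp)+
 have ly: "\<bar>lam * y \<omega>\<bar> <= lam * \<tau>" for \<omega> using y(2) pos by (simp add: abs_mult)
 have g1: "\<bar>lam * y \<omega> * a1\<bar> <= 1/2" for \<omega>
 proof -
  have "\<bar>lam * y \<omega> * a1\<bar> <= (lam * \<tau>) * C0"
   unfolding abs_mult[of "lam * y \<omega>"] using ly a1 p1 pos by (intro mult_mono) auto
  then show ?thesis using small by (simp add: mult_ac)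
 qed
 have g2: "(lam * y \<omega>)\<^sup>2 * a2 <= 1/2" "0 <= (lam * y \<omega>)\<^sup>2 * a2" for \<omega>
 proof -
  have "(lam * y \<omega>)\<^sup>2 <= (lam * \<tau>)\<^sup>2" using power_mono[OF ly[of \<omega>], of 2] by simp
  then have "(lam * y \<omega>)\<^sup>2 * a2 <= (lam * \<tau>)\<^sup>2 * C0\<^sup>2"
   using a2 p1 by (intro mult_mono) auto
  also have "... = (lam * C0 * \<tau>)\<^sup>2" by (simp add: power_mult_distrib)
  also have "... <= (1/2)\<^sup>2" using small pos by (intro power_mono) auto
  finally show "(lam * y \<omega>)\<^sup>2 * a2 <= 1/2" by (simp add: power2_eq_square)
  show "0 <= (lam * y \<omega>)\<^sup>2 * a2" using a2 by simp
 qed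
 have Gb: "\<bar>G \<omega>\<bar> <= 1" for \<omega>
  using g1[of \<omega>] g2[of \<omega>] unfolding G_def by linarith
 have Gm: "G \<in> borel_measurable M" unfolding G_def using y(1) by measurable
 have iy: "integrable M y" "integrable M (%\<omega>. (y \<omega>)\<^sup>2)"
 proof -
  show "integrable M y" using y by (intro integrable_const_bound[of _ \<tau>] AE_I2) auto
  have "(y \<omega>)\<^sup>2 <= \<tau>\<^sup>2" for \<omega> using power_mono[OF y(2)[of \<omega>], of 2] by simp
  then show "integrable M (%\<omega>. (y \<omega>)\<^sup>2)" using y by (intro integrable_const_bound[of _ "\<tau>\<^sup>2"] AE_I2) auto
 qed
 have "expectation (%\<omega>. G \<omega> + (G \<omega>)\<^sup>2) <= expectation (%\<omega>. (lam * a1) * y \<omega> + (lam\<^sup>2 * (3 * a2 + 2 * a1\<^sup>2)) * (y \<omega>)\<^sup>2)"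
 proof (rule integral_mono)
  show "integrable M (%\<omega>. G \<omega> + (G \<omega>)\<^sup>2)"
  proof (rule integrable_const_bound[of _ 2])
   show "AE \<omega> in M. norm (G \<omega> + (G \<omega>)\<^sup>2) <= 2"
   proof (rule AE_I2)
    fix \<omega> show "norm (G \<omega> + (G \<omega>)\<^sup>2) <= 2"
     using Gb[of \<omega>] power_mono[OF Gb[of \<omega>], of 2] abs_triangle_ineq[of "G \<omega>" "(G \<omega>)\<^sup>2"] by simp
   qed
  qed (use Gm in measurable)
  show "integrable M (%\<omega>. (lam * a1) * y \<omega> + (lam\<^sup>2 * (3 * a2 + 2 * a1\<^sup>2)) * (y \<omega>)\<^sup>2)"
   using iy by simp
  fix \<omega>
  let ?p = "lam * y \<omega> * a1" and ?r = "(lam * y \<omega>)\<^sup>2 * a2"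
  have "(?p + ?r)\<^sup>2 <= 2 * ?p\<^sup>2 + 2 * ?r\<^sup>2" using sum_squares_bound[of ?p ?r] by (simp add: power2_sum)
  moreover have "?r\<^sup>2 <= ?r * 1" unfolding power2_eq_square[of ?r] using g2[of \<omega>] by (intro mult_left_mono) auto
  ultimately have "G \<omega> + (G \<omega>)\<^sup>2 <= ?p + 3 * ?r + 2 * ?p\<^sup>2" unfolding G_def by linarith
  also have "... = (lam * a1) * y \<omega> + (lam\<^sup>2 * (3 * a2 + 2 * a1\<^sup>2)) * (y \<omega>)\<^sup>2"
   by (simp add: power_mult_distrib algebra_simps)
  finally show "G \<omega> + (G \<omega>)\<^sup>2 <= (lam * a1) * y \<omega> + (lam\<^sup>2 * (3 * a2 + 2 * a1\<^sup>2)) * (y \<omega>)\<^sup>2" .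
 qed
 also have "... = (lam * a1) * expectation y + (lam\<^sup>2 * (3 * a2 + 2 * a1\<^sup>2)) * expectation (%\<omega>. (y \<omega>)\<^sup>2)"
  using iy by simp
 also have "... <= (lam * (C0 * \<pi>)) * b1 + (lam\<^sup>2 * (3 * (C0\<^sup>2 * \<pi>) + 2 * (C0\<^sup>2 * \<pi>))) * 1"
 proof (rule add_mono)
  have "(lam * a1) * expectation y <= \<bar>lam * a1\<bar> * \<bar>expectation y\<bar>"
   unfolding abs_mult[symmetric] by (rule abs_ge_self)
  also have "... <= (lam * (C0 * \<pi>)) * b1" using a1 mean pos by (intro mult_mono) (auto simp: abs_mult)
  finally show "(lam * a1) * expectation y <= (lam * (C0 * \<pi>)) * b1" .
  have "a1\<^sup>2 <= (C0 * \<pi>)\<^sup>2" using power_mono[OF a1, of 2] by simp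
  also have "... = (C0\<^sup>2 * \<pi>) * \<pi>" by (simp add: power2_eq_square)
  also have "... <= (C0\<^sup>2 * \<pi>) * 1" using pos by (intro mult_left_mono) auto
  finally have "a1\<^sup>2 <= C0\<^sup>2 * \<pi>" by simp
  then have "3 * a2 + 2 * a1\<^sup>2 <= 3 * (C0\<^sup>2 * \<pi>) + 2 * (C0\<^sup>2 * \<pi>)" using a2 by linarith
  then show "(lam\<^sup>2 * (3 * a2 + 2 * a1\<^sup>2)) * expectation (%\<omega>. (y \<omega>)\<^sup>2) <= (lam\<^sup>2 * (3 * (C0\<^sup>2 * \<pi>) + 2 * (C0\<^sup>2 * \<pi>))) * 1"
   using a2 var pos by (intro mult_mono mult_left_mono) auto
 qed
 also have "... = lam * C0 * \<pi> * b1 + 5 * lam\<^sup>2 * C0\<^sup>2 * \<pi>" by (simp add: algebra_simps)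
 finally have "ennreal (exp (expectation (%\<omega>. G \<omega> + (G \<omega>)\<^sup>2))) <= ennreal (exp (lam * C0 * \<pi> * b1 + 5 * lam\<^sup>2 * C0\<^sup>2 * \<pi>))"
  by (intro ennreal_leI) simp
 with nn_integral_exp_le[OF Gm Gb] show ?thesis unfolding G_def by (rule order_trans)
qed

text \<open>Conditionally on the errors, the sites are integrated out first; the factor \<open>\<pi>\<close> bounds the probability of hitting the kernel support.\<close>

lemma independent_error_tail:
 fixes X :: "'i => 'a => 'b::topological_space" and eps :: "'i => 'a => real"
  and lam \<tau> C0 \<pi> b1 t :: real and f :: "'z => 'b => real"
 assumes X: "indep_vars (%_. borel) X I" "I ~= {}" "finite I"
  and law: "\<And>i. i \<in> I ==> distr M borel (X i) = \<mu>"
  and eps: "indep_vars (%_. borel) eps I"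
  and ind: "indep_set (gen_sigma M X I) (gen_sigma M eps I)"
  and Z: "finite Z"
  and f: "\<And>z. z \<in> Z ==> f z \<in> borel_measurable borel" "\<And>z x. z \<in> Z ==> \<bar>f z x\<bar> <= C0"
   "\<And>z. z \<in> Z ==> \<bar>\<integral>x. f z x \<partial>\<mu>\<bar> <= C0 * \<pi>" "\<And>z. z \<in> Z ==> (\<integral>x. (f z x)\<^sup>2 \<partial>\<mu>) <= C0\<^sup>2 * \<pi>"
  and pos: "0 < lam" "0 < \<tau>" "0 <= C0" "0 <= \<pi>" "\<pi> <= 1" "0 <= b1"
  and small: "lam * C0 * \<tau> <= 1/2"
  and mean: "\<And>i. i \<in> I ==> \<bar>expectation (%\<omega>. truncation \<tau> (eps i \<omega>))\<bar> <= b1"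
  and var: "\<And>i. i \<in> I ==> expectation (%\<omega>. (truncation \<tau> (eps i \<omega>))\<^sup>2) <= 1"
 shows "prob {\<omega>\<in>space M. \<exists>z\<in>Z. t < (\<Sum>i\<in>I. f z (X i \<omega>) * truncation \<tau> (eps i \<omega>))}
  <= card Z * exp (- lam * t + card I * (lam * C0 * \<pi> * b1 + 5 * lam\<^sup>2 * C0\<^sup>2 * \<pi>))"
proof -
 define y where "y = (%i \<omega>. truncation \<tau> (eps i \<omega>))"
 have epm: "eps i \<in> borel_measurable M" if "i \<in> I" for i using eps that unfolding indep_vars_def by auto
 have Xm: "X i \<in> borel_measurable M" if "i \<in> I" for i
  using X(1) that unfolding indep_vars_def by auto
 obtain i0 where i0: "i0 \<in> I" using X by auto
 interpret \<mu>: prob_space \<mu> using law[OF i0] prob_space_distr[OF Xm[OF i0]] by simp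
 have s\<mu>: "sets \<mu> = sets borel" using law[OF i0] sets_distr by metis
 define N where "N = field_algebra M eps I"
 have N: "space N = space M" "sets N \<subseteq> sets M" "sets N = gen_sigma M eps I"
  unfolding N_def using gen_sigma_sets[of I eps M] epm by (auto simp: space_field_algebra sets_field_algebra)
 have yN: "y i \<in> borel_measurable N" if "i \<in> I" for i
  unfolding y_def N_def by (rule measurable_compose[OF measurable_field_algebra[OF that] truncation_measurable])
 have ym: "y i \<in> borel_measurable M" if "i \<in> I" for i
  unfolding y_def by (rule measurable_compose[OF epm[OF that] truncation_measurable])
 have y\<tau>: "\<bar>y i \<omega>\<bar> <= \<tau>" for i \<omega> unfolding y_def using pos by (intro abs_truncation_le) simp
 define a1 where "a1 = (%z. \<integral>x. f z x \<partial>\<mu>)"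
 define a2 where "a2 = (%z. \<integral>x. (f z x)\<^sup>2 \<partial>\<mu>)"
 define G where "G = (%z i \<omega>. lam * y i \<omega> * a1 z + (lam * y i \<omega>)\<^sup>2 * a2 z)"
 have fm: "f z \<in> borel_measurable \<mu>" if "z \<in> Z" for z
  using f(1)[OF that] by (simp add: measurable_cong_sets[OF s\<mu> refl])
 have i1: "integrable \<mu> (f z)" "integrable \<mu> (%x. (f z x)\<^sup>2)" if "z \<in> Z" for z
 proof -
  show "integrable \<mu> (f z)" using f(2)[OF that] by (intro \<mu>.integrable_const_bound[OF _ fm[OF that], of C0] AE_I2) auto
  have "(f z x)\<^sup>2 <= C0\<^sup>2" for x using power_mono[OF f(2)[OF that, of x], of 2] by simp
  then show "integrable \<mu> (%x. (f z x)\<^sup>2)" using fm[OF that] by (intro \<mu>.integrable_const_bound[of _ "C0\<^sup>2"] AE_I2) auto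
 qed
 have a2: "0 <= a2 z" "a2 z <= C0\<^sup>2 * \<pi>" if "z \<in> Z" for z using f(4)[OF that] by (auto simp: a2_def)
 have a1: "\<bar>a1 z\<bar> <= C0 * \<pi>" if "z \<in> Z" for z using f(3)[OF that] by (simp add: a1_def)
 define \<kappa> where "\<kappa> = lam * C0 * \<pi> * b1 + 5 * lam\<^sup>2 * C0\<^sup>2 * \<pi>"
 have Gm: "G z i \<in> borel_measurable M" if "i \<in> I" for z i unfolding G_def using ym[OF that] by measurable
 have EG: "(\<integral>\<^sup>+\<omega>. ennreal (exp (G z i \<omega>)) \<partial>M) <= ennreal (exp \<kappa>)" if z: "z \<in> Z" and i: "i \<in> I" for z i
  unfolding G_def \<kappa>_def
  using mean[OF i] var[OF i] by (intro error_exponential_moment[OF ym[OF i] y\<tau> pos small _ _ a1[OF z] a2[OF z]]) (simp_all add: y_def)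
 have indG: "indep_vars (%_. borel) (%i \<omega>. ennreal (exp (G z i \<omega>))) I" for z
 proof -
  define k where "k = (%v. ennreal (exp (lam * truncation \<tau> v * a1 z + (lam * truncation \<tau> v)\<^sup>2 * a2 z)))"
  have "k \<in> borel_measurable borel" unfolding k_def by measurable
  then have "indep_vars (%_. borel) (%i \<omega>. k (eps i \<omega>)) I"
   by (intro indep_vars_compose2[OF eps])
  then show ?thesis unfolding k_def G_def y_def .
 qed
 have "emeasure M {\<omega>\<in>space M. \<exists>z\<in>Z. t < (\<Sum>i\<in>I. f z (X i \<omega>) * y i \<omega>)} \<le>
  (\<integral>\<^sup>+\<omega>. min 1 (\<Sum>z\<in>Z. ennreal (exp (- lam * t +
    (\<Sum>i\<in>I. \<integral>x. lam * (f z x * y i \<omega>) + (lam * (f z x * y i \<omega>))\<^sup>2 \<partial>\<mu>)))) \<partial>M)"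
 proof (rule conditional_chernoff[OF N(1,2) X law _ Z _ pos(1)])
  show "indep_set (gen_sigma M X I) (sets N)" using ind N by simp
  fix z i assume z: "z \<in> Z" and i: "i \<in> I"
  show "(%(x, \<omega>). f z x * y i \<omega>) \<in> borel_measurable (borel \<Otimes>\<^sub>M N)"
   using f(1)[OF z] yN[OF i] unfolding case_prod_beta' by measurable
  fix x \<omega>
  have "\<bar>lam * (f z x * y i \<omega>)\<bar> = lam * (\<bar>f z x\<bar> * \<bar>y i \<omega>\<bar>)" using pos by (simp add: abs_mult)
  also have "... <= lam * (C0 * \<tau>)" using f(2)[OF z] y\<tau> pos by (intro mult_left_mono mult_mono) auto
  finally show "\<bar>lam * (f z x * y i \<omega>)\<bar> <= 1" using small by (simp add: mult.assoc)
 qed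
 also have "... <= (\<integral>\<^sup>+\<omega>. (\<Sum>z\<in>Z. ennreal (exp (- lam * t)) * (\<Prod>i\<in>I. ennreal (exp (G z i \<omega>)))) \<partial>M)"
 proof (rule nn_integral_mono)
  fix \<omega>
  have "(\<integral>x. lam * (f z x * y i \<omega>) + (lam * (f z x * y i \<omega>))\<^sup>2 \<partial>\<mu>) = G z i \<omega>" if "z \<in> Z" for z i
  proof -
   have "(\<integral>x. lam * (f z x * y i \<omega>) + (lam * (f z x * y i \<omega>))\<^sup>2 \<partial>\<mu>) = (\<integral>x. (lam * y i \<omega>) * f z x + (lam * y i \<omega>)\<^sup>2 * (f z x)\<^sup>2 \<partial>\<mu>)"
    by (intro Bochner_Integration.integral_cong refl) (simp add: power_mult_distrib mult_ac)
   also have "... = G z i \<omega>" using i1[OF that] by (simp add: G_def a1_def a2_def)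
   finally show ?thesis .
  qed
  then have "(\<Sum>z\<in>Z. ennreal (exp (- lam * t + (\<Sum>i\<in>I. \<integral>x. lam * (f z x * y i \<omega>) + (lam * (f z x * y i \<omega>))\<^sup>2 \<partial>\<mu>))))
   = (\<Sum>z\<in>Z. ennreal (exp (- lam * t)) * (\<Prod>i\<in>I. ennreal (exp (G z i \<omega>))))"
   using X(3) by (intro sum.cong refl) (simp add: prod_ennreal ennreal_mult[symmetric] exp_sum[symmetric] exp_add[symmetric])
  then show "min 1 (\<Sum>z\<in>Z. ennreal (exp (- lam * t + (\<Sum>i\<in>I. \<integral>x. lam * (f z x * y i \<omega>) + (lam * (f z x * y i \<omega>))\<^sup>2 \<partial>\<mu>))))
   <= (\<Sum>z\<in>Z. ennreal (exp (- lam * t)) * (\<Prod>i\<in>I. ennreal (exp (G z i \<omega>))))" by simp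
 qed
 also have "... = (\<Sum>z\<in>Z. ennreal (exp (- lam * t)) * (\<Prod>i\<in>I. \<integral>\<^sup>+\<omega>. ennreal (exp (G z i \<omega>)) \<partial>M))"
 proof -
  have m: "(%\<omega>. ennreal (exp (G z i \<omega>))) \<in> borel_measurable M" if "i \<in> I" for z i
   using Gm[OF that, of z] by measurable
  have "(\<integral>\<^sup>+\<omega>. (\<Sum>z\<in>Z. ennreal (exp (- lam * t)) * (\<Prod>i\<in>I. ennreal (exp (G z i \<omega>)))) \<partial>M)
   = (\<Sum>z\<in>Z. \<integral>\<^sup>+\<omega>. ennreal (exp (- lam * t)) * (\<Prod>i\<in>I. ennreal (exp (G z i \<omega>))) \<partial>M)"
   using m by (intro nn_integral_sum borel_measurable_times_ennreal borel_measurable_const borel_measurable_prod_ennreal)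
  also have "... = (\<Sum>z\<in>Z. ennreal (exp (- lam * t)) * (\<integral>\<^sup>+\<omega>. (\<Prod>i\<in>I. ennreal (exp (G z i \<omega>))) \<partial>M))"
   using m by (intro sum.cong refl nn_integral_cmult borel_measurable_prod_ennreal)
  finally show ?thesis using indep_vars_nn_integral[OF X(3) indG] by simp
 qed
 also have "... <= (\<Sum>z\<in>Z. ennreal (exp (- lam * t)) * (\<Prod>i\<in>I. ennreal (exp \<kappa>)))"
  using EG by (intro sum_mono mult_left_mono prod_mono_ennreal) auto
 also have "... = (\<Sum>z\<in>Z. ennreal (exp (- lam * t + card I * \<kappa>)))"
  by (simp add: ennreal_power ennreal_mult[symmetric] exp_of_nat_mult[symmetric] exp_add[symmetric])
 also have "... = ennreal (card Z * exp (- lam * t + card I * \<kappa>))"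
  by (simp add: ennreal_mult' ennreal_of_nat_eq_real_of_nat)
 finally show ?thesis unfolding \<kappa>_def y_def by (simp add: emeasure_eq_measure)
qed

text \<open>The Chernoff bound with a trivial frozen sigma-algebra and centred summands.\<close>

lemma iid_sum_tail:
 fixes X :: "'i => 'a => 'b::topological_space" and lam C0 V t :: real and f :: "'z => 'b => real"
 assumes X: "indep_vars (%_. borel) X I" "I ~= {}" "finite I"
  and law: "\<And>i. i \<in> I ==> distr M borel (X i) = \<mu>"
  and Z: "finite Z"
  and f: "\<And>z. z \<in> Z ==> f z \<in> borel_measurable borel" "\<And>z x. z \<in> Z ==> \<bar>f z x\<bar> <= C0"
   "\<And>z. z \<in> Z ==> (\<integral>x. (f z x)\<^sup>2 \<partial>\<mu>) <= V"
  and pos: "0 < lam" and small: "lam * C0 <= 1/2"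
 shows "prob {\<omega>\<in>space M. \<exists>z\<in>Z. t < (\<Sum>i\<in>I. f z (X i \<omega>)) - card I * (\<integral>x. f z x \<partial>\<mu>)}
  <= card Z * exp (- lam * t + card I * lam\<^sup>2 * V)"
proof -
 have Xm: "X i \<in> borel_measurable M" if "i \<in> I" for i
  using X(1) that unfolding indep_vars_def by auto
 obtain i0 where i0: "i0 \<in> I" using X by auto
 interpret \<mu>: prob_space \<mu> using law[OF i0] prob_space_distr[OF Xm[OF i0]] by simp
 have s\<mu>: "sets \<mu> = sets borel" using law[OF i0] sets_distr by metis
 define N where "N = sigma (space M) {}"
 have N: "space N = space M" "sets N = {{}, space M}" unfolding N_def by (auto simp: space_measure_of_conv sigma_sets_empty_eq)
 have N2: "sets N \<subseteq> sets M" unfolding N by auto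
 have ind: "indep_set (gen_sigma M X I) (sets N)"
 proof (rule indep_setI)
  show gs: "gen_sigma M X I \<subseteq> events" using Xm by (rule gen_sigma_sets)
  fix a b assume "a \<in> gen_sigma M X I" "b \<in> sets N"
  then show "prob (a \<inter> b) = prob a * prob b"
   using gs sets.sets_into_space unfolding N by (auto simp: prob_space Int_absorb2 subset_eq)
 qed (rule N2)
 define m where "m = (%z. \<integral>x. f z x \<partial>\<mu>)"
 have fm: "f z \<in> borel_measurable \<mu>" if "z \<in> Z" for z
  using f(1)[OF that] by (simp add: measurable_cong_sets[OF s\<mu> refl])
 have i1: "integrable \<mu> (f z)" "integrable \<mu> (%x. (f z x)\<^sup>2)" if "z \<in> Z" for z
 proof -
  show "integrable \<mu> (f z)" using f(2)[OF that] by (intro \<mu>.integrable_const_bound[OF _ fm[OF that], of C0] AE_I2) auto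
  have "(f z x)\<^sup>2 <= C0\<^sup>2" for x using power_mono[OF f(2)[OF that, of x], of 2] by simp
  then show "integrable \<mu> (%x. (f z x)\<^sup>2)" using fm[OF that] by (intro \<mu>.integrable_const_bound[of _ "C0\<^sup>2"] AE_I2) auto
 qed
 have mb: "\<bar>m z\<bar> <= C0" if "z \<in> Z" for z
  unfolding m_def using \<mu>.abs_integral_le[of "f z", OF f(2)[OF that]] by (simp add: \<mu>.prob_space)
 have "emeasure M {\<omega>\<in>space M. \<exists>z\<in>Z. t < (\<Sum>i\<in>I. f z (X i \<omega>) - m z)} \<le>
  (\<integral>\<^sup>+\<omega>. min 1 (\<Sum>z\<in>Z. ennreal (exp (- lam * t +
    (\<Sum>i\<in>I. \<integral>x. lam * (f z x - m z) + (lam * (f z x - m z))\<^sup>2 \<partial>\<mu>)))) \<partial>M)"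
 proof (rule conditional_chernoff[OF N(1) N2 X law ind Z _ pos])
  fix z i assume z: "z \<in> Z" and i: "i \<in> I"
  show "(%(x, \<omega>). f z x - m z) \<in> borel_measurable (borel \<Otimes>\<^sub>M N)"
   using f(1)[OF z] unfolding case_prod_beta' by measurable
  fix x and \<omega> :: 'a
  have "\<bar>lam * (f z x - m z)\<bar> = lam * \<bar>f z x - m z\<bar>" using pos by (simp add: abs_mult)
  also have "... <= lam * (2 * C0)" using f(2)[OF z, of x] mb[OF z] pos by (intro mult_left_mono) auto
  finally show "\<bar>lam * (f z x - m z)\<bar> <= 1" using small by simp
 qed
 also have "... <= (\<integral>\<^sup>+\<omega>. (\<Sum>z\<in>Z. ennreal (exp (- lam * t + card I * lam\<^sup>2 * V))) \<partial>M)"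
 proof (intro nn_integral_mono order_trans[OF min.cobounded2] sum_mono ennreal_leI)
  fix z assume z: "z \<in> Z"
  have "(\<integral>x. lam * (f z x - m z) + (lam * (f z x - m z))\<^sup>2 \<partial>\<mu>)
   = (\<integral>x. lam * f z x - lam * m z + lam\<^sup>2 * (f z x)\<^sup>2 - (2 * lam\<^sup>2 * m z) * f z x + lam\<^sup>2 * (m z)\<^sup>2 \<partial>\<mu>)"
   by (intro Bochner_Integration.integral_cong refl) (simp add: power2_eq_square algebra_simps)
  also have "... = lam * m z - lam * m z + lam\<^sup>2 * (\<integral>x. (f z x)\<^sup>2 \<partial>\<mu>) - (2 * lam\<^sup>2 * m z) * m z + lam\<^sup>2 * (m z)\<^sup>2"
   using i1[OF z] by (simp add: m_def \<mu>.prob_space)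
  also have "... = lam\<^sup>2 * (\<integral>x. (f z x)\<^sup>2 \<partial>\<mu>) - (lam * m z)\<^sup>2" by (simp add: power2_eq_square algebra_simps)
  also have "... <= lam\<^sup>2 * (\<integral>x. (f z x)\<^sup>2 \<partial>\<mu>)" by simp
  also have "... <= lam\<^sup>2 * V" using f(3)[OF z] by (intro mult_left_mono) auto
  finally have "(\<Sum>i\<in>I. \<integral>x. lam * (f z x - m z) + (lam * (f z x - m z))\<^sup>2 \<partial>\<mu>) <= (\<Sum>i\<in>I. lam\<^sup>2 * V)"
   by (intro sum_mono)
  then show "exp (- lam * t + (\<Sum>i\<in>I. \<integral>x. lam * (f z x - m z) + (lam * (f z x - m z))\<^sup>2 \<partial>\<mu>)) <= exp (- lam * t + card I * lam\<^sup>2 * V)"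
   by simp
 qed
 also have "... = ennreal (card Z * exp (- lam * t + card I * lam\<^sup>2 * V))"
  by (simp add: ennreal_mult' ennreal_of_nat_eq_real_of_nat emeasure_space_1)
 finally show ?thesis unfolding m_def by (simp add: emeasure_eq_measure sum_subtractf)
qed

end

section \<open>Cube covers and nets\<close>

text \<open>Half-open cubes, so that distinct grid cubes are disjoint.\<close>

definition grid_cube :: "real => ('d => int) => (real ^ 'd) set" where
 "grid_cube s k = {x. \<forall>j. x $ j \<in> {s * k j..<s * k j + s}}"

lemma mem_grid_cube_iff:
 assumes "0 < s"
 shows "x \<in> grid_cube s k \<longleftrightarrow> k = (%j. \<lfloor>x $ j / s\<rfloor>)"
proof -
 have "x $ j \<in> {s * k j..<s * k j + s} \<longleftrightarrow> k j = \<lfloor>x $ j / s\<rfloor>" for j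
  using assms by (auto simp: eq_commute[of "k j"] floor_eq_iff field_simps)
 then show ?thesis unfolding grid_cube_def by (auto simp: fun_eq_iff)
qed

lemma is_cube_grid_cube: "0 < s ==> is_cube (grid_cube s (k :: 'd::finite => int))"
 unfolding is_cube_def grid_cube_def
 by (intro exI[of _ "%j. {s * k j..<s * k j + s}"] exI[of _ "%j. s * k j"] exI[of _ s]) auto

lemma sets_grid_cube: "grid_cube s (k :: 'd::finite => int) \<in> sets borel"
proof -
 have "grid_cube s k = (\<Inter>j\<in>UNIV. (%x. x $ j) -` {s * k j..<s * k j + s})"
  unfolding grid_cube_def by auto
 also have "... \<in> sets borel"
 proof (rule sets.finite_INT)
  fix j :: 'd
  have "(%x :: real ^ 'd. x $ j) \<in> borel_measurable borel"
   by (intro borel_measurable_continuous_onI continuous_intros)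
  from measurable_sets[OF this, of "{s * k j..<s * k j + s}"]
  show "(%x :: real ^ 'd. x $ j) -` {s * k j..<s * k j + s} \<in> sets borel" by simp
 qed auto
 finally show ?thesis .
qed

lemma emeasure_grid_cube:
 assumes "0 < s"
 shows "emeasure lborel (grid_cube s (k :: 'd::finite => int)) = ennreal (s ^ CARD('d))"
proof -
 let ?l = "\<chi> j. s * k j" and ?u = "\<chi> j. s * k j + s"
 have b: "(?u - ?l) \<bullet> b = s \<and> ?l \<bullet> b <= ?u \<bullet> b" if "b \<in> Basis" for b :: "real ^ 'd"
  using that assms by (auto simp: Basis_vec_def inner_axis)
 have "emeasure lborel (box ?l ?u) = ennreal (\<Prod>b\<in>Basis. (?u - ?l) \<bullet> b)"
  "emeasure lborel (cbox ?l ?u) = ennreal (\<Prod>b\<in>Basis. (?u - ?l) \<bullet> b)"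
  using b by (auto intro!: emeasure_lborel_box emeasure_lborel_cbox)
 moreover have "(\<Prod>b\<in>Basis. (?u - ?l) \<bullet> b) = s ^ CARD('d)" using b by simp
 moreover have "box ?l ?u \<subseteq> grid_cube s k" "grid_cube s k \<subseteq> cbox ?l ?u"
  unfolding grid_cube_def by (auto simp: mem_box_cart less_imp_le)
 ultimately show ?thesis
  using emeasure_mono[of "box ?l ?u" "grid_cube s k" lborel] emeasure_mono[of "grid_cube s k" "cbox ?l ?u" lborel] sets_grid_cube[of s k]
  by (simp add: antisym)
qed

lemma card_parity_le:
 fixes a b :: int
 shows "real (card {i\<in>{a..b}. odd i = P}) <= max 0 (real_of_int (b - a) / 2 + 3/2)"
proof (cases "a <= b")
 case True
 have "card {i\<in>{a..b}. odd i = P} <= card {a div 2..b div 2}"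
 proof (rule card_inj_on_le)
  show "inj_on (%i. i div 2) {i\<in>{a..b}. odd i = P}"
  proof (rule inj_onI)
   fix x y assume "x \<in> {i\<in>{a..b}. odd i = P}" "y \<in> {i\<in>{a..b}. odd i = P}" "x div 2 = y div 2"
   then show "x = y" by (cases P) (auto elim!: oddE evenE)
  qed
  show "(%i. i div 2) ` {i\<in>{a..b}. odd i = P} \<subseteq> {a div 2..b div 2}" by (auto intro: zdiv_mono1)
 qed simp
 then have "real (card {i\<in>{a..b}. odd i = P}) <= real (card {a div 2..b div 2})" by simp
 also have "... = real_of_int (b div 2 - a div 2 + 1)"
  using zdiv_mono1[OF True, of 2] by simp
 also have "... <= real_of_int (b - a) / 2 + 3/2"
 proof -
  have "2 * (b div 2 - a div 2 + 1) <= b - a + 3" by presburger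
  then have "real_of_int (2 * (b div 2 - a div 2 + 1)) <= real_of_int (b - a + 3)" by (simp only: of_int_le_iff)
  then show ?thesis by (simp add: field_simps)
 qed
 finally show ?thesis by simp
next
 case False
 then have e: "{i\<in>{a..b}. odd i = P} = {}" by auto
 show ?thesis unfolding e by simp
qed

text \<open>Distinct cubes of one parity class have indices that differ by at least two in some coordinate, hence a full cube lies
between them. The slack \<open>3/2 * w\<close> against \<open>w\<close> in the counting bound is absorbed because a parity class has only about half
of the indices in each coordinate; \<open>8 * s \<le> w\<close> leaves room for the cubes at the boundary.\<close>

lemma parity_cube_cover:
 fixes l u :: "real ^ 'd::finite" and w :: "'d => real" and s :: real
 assumes s: "0 < s" and w: "\<And>j. u $ j - l $ j <= 3/2 * w j" "\<And>j. 8 * s <= w j"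
 shows "\<exists>\<Q> :: 'd set => (real ^ 'd) set set.
  (\<forall>T. finite (\<Q> T) \<and> disjoint (\<Q> T) \<and>
    (\<forall>Q\<in>\<Q> T. is_cube Q \<and> Q \<in> sets borel \<and> emeasure lborel Q = ennreal (s ^ CARD('d))) \<and>
    card (\<Q> T) * s ^ CARD('d) <= (\<Prod>j\<in>UNIV. w j) \<and>
    (\<forall>Q\<in>\<Q> T. \<forall>Q'\<in>\<Q> T. Q ~= Q' --> (\<forall>x\<in>Q. \<forall>y\<in>Q'. s <= norm1 (x - y)))) \<and>
  (\<forall>T T'. T ~= T' --> \<Union>(\<Q> T) \<inter> \<Union>(\<Q> T') = {}) \<and>
  cbox l u \<subseteq> (\<Union>T. \<Union>(\<Q> T))"
proof -
 let ?a = "%j. \<lfloor>l $ j / s\<rfloor>" and ?b = "%j. \<lfloor>u $ j / s\<rfloor>"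
 define I where "I = (%T j. {i\<in>{?a j..?b j}. odd i = (j \<in> T)})"
 define N where "N = (%T. PiE UNIV (I T))"
 define \<Q> where "\<Q> = (%T. grid_cube s ` N T)"
 have fI: "finite (I T j)" for T j unfolding I_def by (rule finite_subset[of _ "{?a j..?b j}"]) auto
 have fN: "finite (N T)" for T unfolding N_def using fI by (intro finite_PiE) auto
 have par: "{j. odd (k j)} = T" if "k \<in> N T" for k T
  using that unfolding N_def I_def by (auto simp: PiE_iff)
 have wpos: "0 < w j" for j using w(2)[of j] s by linarith
 have cI: "real (card (I T j)) * s <= w j" for T j
 proof -
  define v where "v = w j / s"
  have v0: "0 <= v" unfolding v_def using wpos[of j] s by simp
  define D where "D = (u $ j - l $ j) / s"
  have D_eq: "D = u $ j / s - l $ j / s" by (simp add: D_def diff_divide_distrib)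
  define r where "r = real_of_int (?b j - ?a j)"
  have fl: "r <= D + 1"
   unfolding r_def D_eq using floor_correct[of "u $ j / s"] floor_correct[of "l $ j / s"] by linarith
  have "D <= (3/2 * w j) / s" unfolding D_def using w(1)[of j] s by (intro divide_right_mono) auto
  then have "D <= 3/2 * v" by (simp add: v_def)
  then have r2: "r / 2 + 3/2 <= 3/4 * v + 2" using fl by linarith
  have "real (card (I T j)) <= max 0 (r / 2 + 3/2)"
   unfolding r_def I_def by (rule card_parity_le)
  also have "... <= 3/4 * v + 2" using r2 v0 by (intro max.boundedI) linarith+
  finally have "real (card (I T j)) <= 3/4 * v + 2" .
  then have "real (card (I T j)) * s <= (3/4 * v + 2) * s" using s by (intro mult_right_mono) auto
  also have "... = 3/4 * w j + 2 * s" using s by (simp add: v_def field_simps)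
  also have "... <= w j" using w(2)[of j] by linarith
  finally show ?thesis .
 qed
 have cN: "real (card (\<Q> T)) * s ^ CARD('d) <= (\<Prod>j\<in>UNIV. w j)" for T
 proof -
  have "real (card (\<Q> T)) <= real (card (N T))" unfolding \<Q>_def using fN by (simp add: card_image_le)
  also have "... = (\<Prod>j\<in>UNIV. real (card (I T j)))" unfolding N_def by (simp add: card_PiE)
  finally have "real (card (\<Q> T)) * s ^ CARD('d) <= (\<Prod>j\<in>UNIV. real (card (I T j))) * s ^ CARD('d)"
   using s by (intro mult_right_mono) auto
  also have "... = (\<Prod>j\<in>UNIV. real (card (I T j)) * s)" by (simp add: prod.distrib)
  also have "... <= (\<Prod>j\<in>UNIV. w j)" using cI s by (intro prod_mono) auto
  finally show ?thesis .
 qed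
 have dist: "s <= norm1 (x - y)" if k: "k \<in> N T" "k' \<in> N T" "k ~= k'" and xy: "x \<in> grid_cube s k" "y \<in> grid_cube s k'" for T k k' x y
 proof -
  obtain j where j: "k j ~= k' j" using k(3) by auto
  have "odd (k j) = odd (k' j)" using par[OF k(1)] par[OF k(2)] by blast
  then have "2 <= \<bar>k j - k' j\<bar>" using j by presburger
  then have d: "k j + 2 <= k' j \<or> k' j + 2 <= k j" by linarith
  have x: "s * k j <= x $ j" "x $ j < s * k j + s" and y: "s * k' j <= y $ j" "y $ j < s * k' j + s"
   using xy unfolding grid_cube_def by auto
  have "s <= \<bar>x $ j - y $ j\<bar>"
  proof (cases "k j + 2 <= k' j")
   case True
   then have "s * (real_of_int (k j) + 2) <= s * k' j" using s by (intro mult_left_mono) auto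
   then show ?thesis using x y by (simp add: algebra_simps)
  next
   case False
   then have "s * (real_of_int (k' j) + 2) <= s * k j" using d s by (intro mult_left_mono) auto
   then show ?thesis using x y by (simp add: algebra_simps)
  qed
  also have "... <= norm1 (x - y)"
   unfolding norm1_def using member_le_sum[of j UNIV "%j. \<bar>(x - y) $ j\<bar>"] by simp
  finally show ?thesis .
 qed
 have uniq: "k = k'" if "x \<in> grid_cube s k" "x \<in> grid_cube s k'" for x :: "real ^ 'd" and k k'
  using that unfolding mem_grid_cube_iff[OF s] by simp
 have disj: "disjoint (\<Q> T)" for T
 proof (rule disjointI)
  fix Q Q' assume "Q \<in> \<Q> T" "Q' \<in> \<Q> T" "Q ~= Q'"
  then obtain k k' where "Q = grid_cube s k" "Q' = grid_cube s k'" "k ~= k'" unfolding \<Q>_def by auto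
  then show "Q \<inter> Q' = {}" using uniq by blast
 qed
 have disj2: "\<Union>(\<Q> T) \<inter> \<Union>(\<Q> T') = {}" if "T ~= T'" for T T'
 proof (rule equals0I)
  fix x assume "x \<in> \<Union>(\<Q> T) \<inter> \<Union>(\<Q> T')"
  then obtain k k' where k: "x \<in> grid_cube s k" "k \<in> N T" "x \<in> grid_cube s k'" "k' \<in> N T'"
   unfolding \<Q>_def by auto
  then have "k = k'" using uniq by blast
  then show False using par[OF k(2)] par[OF k(4)] that by simp
 qed
 have cov: "cbox l u \<subseteq> (\<Union>T. \<Union>(\<Q> T))"
 proof
  fix x assume x: "x \<in> cbox l u"
  let ?k = "%j. \<lfloor>x $ j / s\<rfloor>"
  have "?k j \<in> {?a j..?b j}" for j
   using x s by (auto simp: mem_box_cart intro!: floor_mono divide_right_mono)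
  then have "?k \<in> N {j. odd (?k j)}" unfolding N_def I_def by auto
  moreover have "x \<in> grid_cube s ?k" using mem_grid_cube_iff[OF s] by blast
  ultimately show "x \<in> (\<Union>T. \<Union>(\<Q> T))" unfolding \<Q>_def by blast
 qed
 show ?thesis
 proof (intro exI[of _ \<Q>] conjI allI impI ballI)
  fix T Q Q' x y assume "Q \<in> \<Q> T" "Q' \<in> \<Q> T" "Q ~= Q'" "x \<in> Q" "y \<in> Q'"
  then show "s <= norm1 (x - y)" unfolding \<Q>_def using dist by blast
 next
  fix T show "finite (\<Q> T)" unfolding \<Q>_def using fN by (rule finite_imageI)
 next
  fix T Q assume "Q \<in> \<Q> T"
  then obtain k where "Q = grid_cube s k" unfolding \<Q>_def by auto
  then show "is_cube Q" "Q \<in> sets borel" "emeasure lborel Q = ennreal (s ^ CARD('d))"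
   using is_cube_grid_cube[OF s] sets_grid_cube emeasure_grid_cube[OF s] by simp_all
 qed (fact disj disj2 cN cov)+
qed

text \<open>Rounding down towards \<open>l\<close> keeps the net point inside the box.\<close>

definition net_point :: "real ^ 'd::finite => ('d => real) => real ^ 'd => real ^ 'd" where
 "net_point l \<delta> z = (\<chi> j. l $ j + \<delta> j * \<lfloor>(z $ j - l $ j) / \<delta> j\<rfloor>)"

lemma net_point_close:
 assumes "\<And>j. 0 < \<delta> j"
 shows "net_point l \<delta> z $ j <= z $ j" "z $ j <= net_point l \<delta> z $ j + \<delta> j"
proof -
 let ?q = "(z $ j - l $ j) / \<delta> j"
 have "\<delta> j * \<lfloor>?q\<rfloor> <= \<delta> j * ?q" "\<delta> j * ?q <= \<delta> j * (\<lfloor>?q\<rfloor> + 1)"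
  using assms[of j] by (intro mult_left_mono; linarith)+
 moreover have "\<delta> j * ?q = z $ j - l $ j" using assms[of j] by simp
 ultimately show "net_point l \<delta> z $ j <= z $ j" "z $ j <= net_point l \<delta> z $ j + \<delta> j"
  by (simp_all add: net_point_def distrib_left)
qed

lemma net_point_mem:
 fixes l u :: "real ^ 'd::finite"
 assumes \<delta>: "\<And>j. 0 < \<delta> j" and z: "z \<in> cbox l u"
 shows "net_point l \<delta> z \<in> cbox l u"
proof -
 have "l $ j <= net_point l \<delta> z $ j" for j
  using z \<delta>[of j] by (simp add: net_point_def mem_box_cart)
 moreover have "net_point l \<delta> z $ j <= u $ j" for j
  using net_point_close(1)[where \<delta>=\<delta> and l=l and z=z and j=j, OF \<delta>] z by (auto simp: mem_box_cart intro: order_trans)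
 ultimately show ?thesis by (simp add: mem_box_cart)
qed

lemma net_finite_card:
 fixes l u :: "real ^ 'd::finite"
 assumes \<delta>: "\<And>j. 0 < \<delta> j"
 shows "finite (net_point l \<delta> ` cbox l u)"
  and "real (card (net_point l \<delta> ` cbox l u)) <= (\<Prod>j\<in>UNIV. max 0 ((u $ j - l $ j) / \<delta> j) + 1)"
proof -
 define I where "I = (%j. {0..\<lfloor>(u $ j - l $ j) / \<delta> j\<rfloor>})"
 have sub: "net_point l \<delta> ` cbox l u \<subseteq> (%k. \<chi> j. l $ j + \<delta> j * real_of_int (k j)) ` PiE UNIV I"
 proof
  fix y assume "y \<in> net_point l \<delta> ` cbox l u"
  then obtain z where z: "z \<in> cbox l u" "y = net_point l \<delta> z" by auto
  have "\<lfloor>(z $ j - l $ j) / \<delta> j\<rfloor> \<in> I j" for j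
   unfolding I_def using z(1) \<delta>[of j] by (auto simp: mem_box_cart intro!: floor_mono divide_right_mono)
  then have "(%j. \<lfloor>(z $ j - l $ j) / \<delta> j\<rfloor>) \<in> PiE UNIV I" by auto
  then show "y \<in> (%k. \<chi> j. l $ j + \<delta> j * real_of_int (k j)) ` PiE UNIV I"
   unfolding z(2) net_point_def by (rule rev_image_eqI) simp
 qed
 have fin: "finite (PiE UNIV I)" by (intro finite_PiE) (auto simp: I_def)
 show "finite (net_point l \<delta> ` cbox l u)" using finite_subset[OF sub] fin by blast
 have "card (net_point l \<delta> ` cbox l u) <= card (PiE UNIV I)"
  by (rule order_trans[OF card_mono[OF _ sub] card_image_le]) (use fin in auto)
 then have "real (card (net_point l \<delta> ` cbox l u)) <= (\<Prod>j\<in>UNIV. real (card (I j)))"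
  using card_PiE[of UNIV I] by simp (metis of_nat_le_iff of_nat_prod)
 also have "... <= (\<Prod>j\<in>UNIV. max 0 ((u $ j - l $ j) / \<delta> j) + 1)"
 proof (intro prod_mono conjI)
  fix j
  have "real (card (I j)) = max 0 (real_of_int (\<lfloor>(u $ j - l $ j) / \<delta> j\<rfloor> + 1))" unfolding I_def by simp
  also have "... <= max 0 ((u $ j - l $ j) / \<delta> j) + 1"
   using of_int_floor_le[of "(u $ j - l $ j) / \<delta> j"] by (simp add: max_def)
  finally show "real (card (I j)) <= max 0 ((u $ j - l $ j) / \<delta> j) + 1" .
 qed auto
 finally show "real (card (net_point l \<delta> ` cbox l u)) <= (\<Prod>j\<in>UNIV. max 0 ((u $ j - l $ j) / \<delta> j) + 1)" .
qed

section \<open>Taylor expansion on the box\<close>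

lemma sorted_split_max:
 fixes b :: "'d::linorder"
 assumes "sorted js" "\<And>j. j \<in> set js ==> j <= b"
 shows "js = filter (%j. j ~= b) js @ replicate (count_list js b) b"
 using assms
proof (induction js)
 case (Cons a js)
 show ?case
 proof (cases "a = b")
  case True
  then have "\<forall>j\<in>set js. j = b" using Cons.prems by (auto intro: antisym)
  then have "js = replicate (length js) b" by (simp add: replicate_length_same)
  moreover have "count_list js b = length js" using \<open>\<forall>j\<in>set js. j = b\<close> by (induction js) auto
  moreover have "filter (%j. j ~= b) js = []" using \<open>\<forall>j\<in>set js. j = b\<close> by simp
  ultimately show ?thesis using True by simp
 qed (use Cons in auto)
qed simp

text \<open>A sorted tuple over \<open>insert b A\<close> with \<open>b\<close> maximal is a sorted tuple over \<open>A\<close> followed by copies of \<open>b\<close>.\<close>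

lemma bij_betw_append_max:
 fixes b :: "'d::linorder"
 assumes A: "\<And>a. a \<in> A ==> a < b"
 shows "bij_betw (%(a, js). js @ replicate a b)
  {(a, js). sorted js \<and> set js \<subseteq> A \<and> a + length js \<in> N} {js. sorted js \<and> set js \<subseteq> insert b A \<and> length js \<in> N}"
proof (rule bij_betw_byWitness[where f'="%js. (count_list js b, filter (%j. j ~= b) js)"])
 have bA: "b \<notin> A" using A by auto
 have split: "filter (%j. j ~= b) js @ replicate (count_list js b) b = js"
  if "sorted js" "set js \<subseteq> insert b A" for js
 proof -
  have "j <= b" if "j \<in> set js" for j
   using that \<open>set js \<subseteq> insert b A\<close> A by (auto intro: less_imp_le)
  from sorted_split_max[OF \<open>sorted js\<close> this] show ?thesis by (rule sym)
 qed
 show "\<forall>p\<in>{(a, js). sorted js \<and> set js \<subseteq> A \<and> a + length js \<in> N}.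
  (count_list (case p of (a, js) => js @ replicate a b) b, filter (%j. j ~= b) (case p of (a, js) => js @ replicate a b)) = p"
 proof safe
  fix a and js :: "'d list" assume js: "set js \<subseteq> A"
  then have n: "b \<notin> set js" using bA by auto
  have r: "count_list (replicate a b) b = a" by (induction a) auto
  show "count_list (js @ replicate a b) b = a" using n r by simp
  show "filter (%j. j ~= b) (js @ replicate a b) = js" using n by (auto simp: filter_id_conv)
 qed
 show "\<forall>js\<in>{js. sorted js \<and> set js \<subseteq> insert b A \<and> length js \<in> N}.
  (case (count_list js b, filter (%j. j ~= b) js) of (a, js) => js @ replicate a b) = js"
  using split by simp
 show "(%(a, js). js @ replicate a b) ` {(a, js). sorted js \<and> set js \<subseteq> A \<and> a + length js \<in> N}
   \<subseteq> {js. sorted js \<and> set js \<subseteq> insert b A \<and> length js \<in> N}"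
 proof safe
  fix a and js :: "'d list" assume js: "sorted js" "set js \<subseteq> A" "a + length js \<in> N"
  have "x <= b" if "x \<in> set js" for x using A[of x] js(2) that by auto
  then show "sorted (js @ replicate a b)" using js(1) by (auto simp: sorted_append)
  show "length (js @ replicate a b) \<in> N" using js(3) by (simp add: add.commute)
 qed auto
 show "(%js. (count_list js b, filter (%j. j ~= b) js)) ` {js. sorted js \<and> set js \<subseteq> insert b A \<and> length js \<in> N}
   \<subseteq> {(a, js). sorted js \<and> set js \<subseteq> A \<and> a + length js \<in> N}"
 proof safe
  fix js :: "'d list" assume js: "sorted js" "set js \<subseteq> insert b A" "length js \<in> N"
  then have "js = filter (%j. j ~= b) js @ replicate (count_list js b) b"
   using split by simp
  then have "length js = length (filter (%j. j ~= b) js) + count_list js b"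
   by (metis length_append length_replicate)
  then show "count_list js b + length (filter (%j. j ~= b) js) \<in> N" using js(3) by (simp add: add.commute)
  show "sorted (filter (%j. j ~= b) js)" using js(1) by (rule sorted_wrt_filter)
 qed auto
qed

lemma finite_sorted_tuples:
 "finite {js :: 'd::{finite,linorder} list. sorted js \<and> set js \<subseteq> A \<and> length js <= q}"
 by (rule finite_subset[OF _ finite_lists_length_le[of UNIV q]]) auto

text \<open>The combinatorial step of the Taylor formula: the largest coordinate is expanded first.\<close>

lemma sum_tuples_insert_max:
 fixes b :: "'d::{finite,linorder}" and F :: "'d list => real"
 assumes A: "\<And>a. a \<in> A ==> a < b"
 shows "(\<Sum>js | sorted js \<and> set js \<subseteq> insert b A \<and> length js <= q. F js)
   = (\<Sum>a\<le>q. \<Sum>js | sorted js \<and> set js \<subseteq> A \<and> length js <= q - a. F (js @ replicate a b))"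
  and "(\<Sum>js | sorted js \<and> set js \<subseteq> insert b A \<and> length js = q. F js)
   = (\<Sum>a\<le>q. \<Sum>js | sorted js \<and> set js \<subseteq> A \<and> length js = q - a. F (js @ replicate a b))"
proof -
 have f: "finite {js :: 'd list. sorted js \<and> set js \<subseteq> A \<and> length js = n}" for n
  by (rule finite_subset[OF _ finite_sorted_tuples[of A n]]) auto
 have "(\<Sum>js | sorted js \<and> set js \<subseteq> insert b A \<and> length js \<in> {..q}. F js)
  = (\<Sum>(a, js) | sorted js \<and> set js \<subseteq> A \<and> a + length js \<in> {..q}. F (js @ replicate a b))"
  using sum.reindex_bij_betw[OF bij_betw_append_max[OF A, where N="{..q}"], where g=F] by (simp add: case_prod_beta')
 also have "{(a, js). sorted js \<and> set js \<subseteq> A \<and> a + length js \<in> {..q}} = (SIGMA a:{..q}. {js. sorted js \<and> set js \<subseteq> A \<and> length js <= q - a})"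
  by auto
 also have "(\<Sum>(a, js)\<in>.... F (js @ replicate a b)) = (\<Sum>a\<le>q. \<Sum>js | sorted js \<and> set js \<subseteq> A \<and> length js <= q - a. F (js @ replicate a b))"
  using finite_sorted_tuples by (intro sum.Sigma[symmetric]) auto
 finally show "(\<Sum>js | sorted js \<and> set js \<subseteq> insert b A \<and> length js <= q. F js)
   = (\<Sum>a\<le>q. \<Sum>js | sorted js \<and> set js \<subseteq> A \<and> length js <= q - a. F (js @ replicate a b))" by simp
 have "(\<Sum>js | sorted js \<and> set js \<subseteq> insert b A \<and> length js \<in> {q}. F js)
  = (\<Sum>(a, js) | sorted js \<and> set js \<subseteq> A \<and> a + length js \<in> {q}. F (js @ replicate a b))"
  using sum.reindex_bij_betw[OF bij_betw_append_max[OF A, where N="{q}"], where g=F] by (simp add: case_prod_beta')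
 also have "{(a, js). sorted js \<and> set js \<subseteq> A \<and> a + length js \<in> {q}} = (SIGMA a:{..q}. {js. sorted js \<and> set js \<subseteq> A \<and> length js = q - a})"
  by auto
 also have "(\<Sum>(a, js)\<in>.... F (js @ replicate a b)) = (\<Sum>a\<le>q. \<Sum>js | sorted js \<and> set js \<subseteq> A \<and> length js = q - a. F (js @ replicate a b))"
  using f by (intro sum.Sigma[symmetric]) auto
 finally show "(\<Sum>js | sorted js \<and> set js \<subseteq> insert b A \<and> length js = q. F js)
   = (\<Sum>a\<le>q. \<Sum>js | sorted js \<and> set js \<subseteq> A \<and> length js = q - a. F (js @ replicate a b))" by simp
qed

lemma prod_tuple_append: "prod_tuple u (js @ ks) = prod_tuple u js * prod_tuple u ks"
 by (simp add: prod_tuple_def)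

lemma prod_tuple_replicate: "prod_tuple u (replicate a b) = u b ^ a"
 by (induction a) (auto simp: prod_tuple_def)

lemma tuple_fact_append_max:
 fixes b :: "'d::finite"
 assumes "b \<notin> set js"
 shows "tuple_fact (js @ replicate a b) = tuple_fact js * fact a"
proof -
 have r: "count_list (replicate a b) k = (if k = b then a else 0)" for k by (induction a) auto
 have "tuple_fact (js @ replicate a b) = (\<Prod>k\<in>UNIV. fact (count_list js k) * (if k = b then fact a else 1))"
  unfolding tuple_fact_def using assms by (intro prod.cong refl) (auto simp: r count_list_0_iff)
 also have "... = tuple_fact js * fact a" by (simp add: prod.distrib tuple_fact_def)
 finally show ?thesis .
qed

lemma tuple_fact_ge_1: "1 <= tuple_fact js"
 unfolding tuple_fact_def by (intro prod_ge_1) (metis fact_ge_1)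

text \<open>The one-dimensional Taylor formula along a coordinate line, where derivatives at the ends of the interval are one-sided.\<close>

lemma coordinate_Taylor:
 fixes f :: "real ^ 'd::finite => real"
 assumes f: "cont_partially_diff_on k R f" and R: "convex (line_through R b x)"
  and len: "length ks + Suc q <= k"
  and B: "\<And>js z. length js <= k ==> z \<in> R ==> \<bar>iter_partial R js f z\<bar> <= B"
  and x: "x \<in> R" "x + t *\<^sub>R axis b 1 \<in> R"
 shows "\<bar>iter_partial R ks f (x + t *\<^sub>R axis b 1) - (\<Sum>a\<le>q. iter_partial R (replicate a b @ ks) f x * t ^ a / fact a)\<bar>
  <= B * \<bar>t\<bar> ^ Suc q"
proof -
 let ?S = "line_through R b x"
 define H where "H = (%a r. iter_partial R (replicate a b @ ks) f (x + r *\<^sub>R axis b 1))"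
 have der: "(H a has_field_derivative H (Suc a) r) (at r within ?S)" if r: "r \<in> ?S" and a: "a <= q" for r a
 proof -
  let ?y = "x + r *\<^sub>R axis b 1" and ?G = "iter_partial R (replicate a b @ ks) f"
  have y: "?y \<in> R" using r by (simp add: line_through_def)
  have "(%t. ?G (?y + t *\<^sub>R axis b 1)) differentiable (at 0 within line_through R b ?y)"
   using f y len a unfolding cont_partially_diff_on_def by auto
  then have 1: "((%t. ?G (?y + t *\<^sub>R axis b 1)) has_vector_derivative partial_deriv R b ?G ?y) (at 0 within line_through R b ?y)"
   unfolding partial_deriv_def by (simp add: vector_derivative_works)
  have 2: "partial_deriv R b ?G ?y = H (Suc a) r" unfolding H_def iter_partial_def by simp
  have 3: "line_through R b ?y = (%s. s - r) ` ?S"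
  proof safe
   fix s assume "s \<in> line_through R b ?y"
   then have "s + r \<in> ?S" by (simp add: line_through_def algebra_simps)
   then show "s \<in> (%s. s - r) ` ?S" by (rule rev_image_eqI) simp
  next
   fix s assume "s \<in> ?S" then show "s - r \<in> line_through R b ?y" by (simp add: line_through_def algebra_simps)
  qed
  have "((%t. ?G (?y + t *\<^sub>R axis b 1)) has_field_derivative H (Suc a) r) (at (r - r) within (%s. s - r) ` ?S)"
   using 1 unfolding 2 3 has_real_derivative_iff_has_vector_derivative by simp
  moreover have "((%s. s - r) has_field_derivative 1) (at r within ?S)"
   by (auto intro!: derivative_eq_intros)
  ultimately have "(((%t. ?G (?y + t *\<^sub>R axis b 1)) \<circ> (%s. s - r)) has_field_derivative H (Suc a) r * 1) (at r within ?S)"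
   by (rule DERIV_image_chain)
  moreover have "((%t. ?G (?y + t *\<^sub>R axis b 1)) \<circ> (%s. s - r)) = H a"
   by (auto simp: H_def fun_eq_iff algebra_simps)
  ultimately show ?thesis by simp
 qed
 have "norm (H 0 t - (\<Sum>i\<le>q. H i 0 * (t - 0) ^ i / fact i)) <= B * norm (t - 0) ^ Suc q / fact q"
 proof (rule field_Taylor[OF R])
  show "norm (H (Suc q) r) <= B" if "r \<in> ?S" for r
   using B[of "replicate (Suc q) b @ ks"] that len unfolding H_def by (simp add: line_through_def)
 qed (use der x in \<open>auto simp: line_through_def\<close>)
 moreover have "B * \<bar>t\<bar> ^ Suc q / fact q <= B * \<bar>t\<bar> ^ Suc q"
 proof -
  have "0 <= B" using B[of "[]" x] x by (smt (verit) abs_ge_zero le0 list.size(3))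
  then have "0 <= B * \<bar>t\<bar> ^ Suc q" by simp
  then show ?thesis using fact_ge_1[of q, where 'a=real] by (simp add: divide_le_eq mult_le_cancel_left1 mult_left_le)
 qed
 ultimately show ?thesis by (simp add: H_def)
qed

text \<open>The coordinates are moved one at a time, in decreasing order. Iterated partial derivatives are applied from the right end
of the tuple, so the derivatives that occur are exactly those of the sorted tuples.
The induction is over the set \<open>C\<close> of coordinates in which \<open>x\<close> and \<open>z\<close> may differ, for all derivatives \<open>ks\<close> already taken.\<close>

lemma multivariate_Taylor:
 fixes f :: "real ^ 'd::{finite,linorder} => real"
 assumes f: "cont_partially_diff_on k R0 f"
  and B: "\<And>js z. length js <= k ==> z \<in> R0 ==> \<bar>iter_partial R0 js f z\<bar> <= B"
 shows "\<lbrakk>length ks + Suc q <= k; x \<in> R0; z \<in> R0; \<forall>j. j \<notin> C --> x $ j = z $ j\<rbrakk> \<Longrightarrow>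
  \<bar>iter_partial R0 ks f x - (\<Sum>js | sorted js \<and> set js \<subseteq> C \<and> length js <= q.
    iter_partial R0 (js @ ks) f z / tuple_fact js * prod_tuple (vec_nth (x - z)) js)\<bar>
  <= B * (\<Sum>js | sorted js \<and> set js \<subseteq> C \<and> length js = Suc q. \<bar>prod_tuple (vec_nth (x - z)) js\<bar>)"
 using finite[of C]
proof (induction C arbitrary: ks q x rule: finite_linorder_max_induct)
 case empty
 then have xz: "x = z" by (simp add: Finite_Cartesian_Product.vec_eq_iff)
 have e: "{js :: 'd list. sorted js \<and> set js \<subseteq> {} \<and> length js <= q} = {[]}"
  "{js :: 'd list. sorted js \<and> set js \<subseteq> {} \<and> length js = Suc q} = {}" by auto
 show ?case unfolding e xz by (simp add: tuple_fact_def prod_tuple_def)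
next
 case (insert b A)
 have A: "\<And>a. a \<in> A ==> a < b" using insert.hyps by auto
 have bA: "b \<notin> A" using A by auto
 define t where "t = x $ b - z $ b"
 define x' where "x' = x - t *\<^sub>R axis b 1"
 have x'j: "x' $ j = (if j = b then z $ b else x $ j)" for j by (simp add: x'_def t_def axis_def)
 have xx: "x = x' + t *\<^sub>R axis b 1" by (simp add: x'_def)
 have x'R: "x' \<in> R0" using insert.prems(2,3) x'j by (auto simp: R0_def mem_box_cart)
 have conv: "convex (line_through R0 b x')"
 proof -
  have "line_through R0 b x' = {t. \<forall>j. - 1/2 <= x' $ j + t * axis b 1 $ j \<and> x' $ j + t * axis b 1 $ j <= 1/2}"
   by (auto simp: line_through_def R0_def mem_box_cart)
  also have "... = {- 1/2 - x' $ b..1/2 - x' $ b}"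
   using x'R by (auto simp: axis_def R0_def mem_box_cart algebra_simps)
  finally show ?thesis by simp
 qed
 have B0: "0 <= B" using B[of "[]" x] insert.prems(2) by (smt (verit) abs_ge_zero le0 list.size(3))
 note T1 = coordinate_Taylor[OF f conv insert.prems(1) B x'R, of t, folded xx, OF _ _ insert.prems(2)]
 have pj: "prod_tuple (vec_nth (x - z)) (js @ replicate a b) = prod_tuple (vec_nth (x' - z)) js * t ^ a"
  if "set js \<subseteq> A" for js a
 proof -
  have "map (vec_nth (x - z)) js = map (vec_nth (x' - z)) js"
   using that bA x'j by (intro map_cong refl) auto
  then have "prod_tuple (vec_nth (x - z)) js = prod_tuple (vec_nth (x' - z)) js"
   unfolding prod_tuple_def by (rule arg_cong)
  then show ?thesis by (simp add: prod_tuple_append prod_tuple_replicate t_def)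
 qed
 have fj: "tuple_fact (js @ replicate a b) = tuple_fact js * fact a" if "set js \<subseteq> A" for js a
  using that bA by (intro tuple_fact_append_max) auto
 define P where "P = (%a. \<Sum>js | sorted js \<and> set js \<subseteq> A \<and> length js <= q - a.
   iter_partial R0 (js @ (replicate a b @ ks)) f z / tuple_fact js * prod_tuple (vec_nth (x' - z)) js)"
 define E where "E = (%n. \<Sum>js | sorted js \<and> set js \<subseteq> A \<and> length js = n. \<bar>prod_tuple (vec_nth (x' - z)) js\<bar>)"
 have IH: "\<bar>iter_partial R0 (replicate a b @ ks) f x' - P a\<bar> <= B * E (Suc q - a)" if "a <= q" for a
 proof -
  have "Suc (q - a) = Suc q - a" using that by simp
  moreover have "\<bar>iter_partial R0 (replicate a b @ ks) f x' - P a\<bar> <= B * E (Suc (q - a))"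
   unfolding P_def E_def
   by (rule insert.IH) (use insert.prems that x'R x'j in auto)
  ultimately show ?thesis by simp
 qed
 have main: "(\<Sum>js | sorted js \<and> set js \<subseteq> insert b A \<and> length js <= q.
    iter_partial R0 (js @ ks) f z / tuple_fact js * prod_tuple (vec_nth (x - z)) js) = (\<Sum>a\<le>q. P a * t ^ a / fact a)"
  unfolding P_def
 proof (subst sum_tuples_insert_max(1)[where A=A and b=b and q=q, OF A], assumption, intro sum.cong refl)
  fix a
  have "(\<Sum>js | sorted js \<and> set js \<subseteq> A \<and> length js <= q - a. iter_partial R0 ((js @ replicate a b) @ ks) f z / tuple_fact (js @ replicate a b) *
    prod_tuple (vec_nth (x - z)) (js @ replicate a b)) = (\<Sum>js | sorted js \<and> set js \<subseteq> A \<and> length js <= q - a.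
    (iter_partial R0 (js @ (replicate a b @ ks)) f z / tuple_fact js * prod_tuple (vec_nth (x' - z)) js) * (t ^ a / fact a))"
  proof (intro sum.cong refl)
   fix js assume "js \<in> {js. sorted js \<and> set js \<subseteq> A \<and> length js <= q - a}"
   then have "set js \<subseteq> A" by simp
   then show "iter_partial R0 ((js @ replicate a b) @ ks) f z / tuple_fact (js @ replicate a b) * prod_tuple (vec_nth (x - z)) (js @ replicate a b)
    = (iter_partial R0 (js @ (replicate a b @ ks)) f z / tuple_fact js * prod_tuple (vec_nth (x' - z)) js) * (t ^ a / fact a)"
    by (simp add: pj fj)
  qed
  then show "(\<Sum>js | sorted js \<and> set js \<subseteq> A \<and> length js <= q - a. iter_partial R0 ((js @ replicate a b) @ ks) f z / tuple_fact (js @ replicate a b) *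
    prod_tuple (vec_nth (x - z)) (js @ replicate a b)) = (\<Sum>js | sorted js \<and> set js \<subseteq> A \<and> length js <= q - a.
    iter_partial R0 (js @ (replicate a b @ ks)) f z / tuple_fact js * prod_tuple (vec_nth (x' - z)) js) * t ^ a / fact a"
   unfolding sum_distrib_right[symmetric] by simp
 qed
 have rest: "(\<Sum>js | sorted js \<and> set js \<subseteq> insert b A \<and> length js = Suc q. \<bar>prod_tuple (vec_nth (x - z)) js\<bar>) = (\<Sum>a\<le>Suc q. E (Suc q - a) * \<bar>t\<bar> ^ a)"
  unfolding E_def sum_distrib_right
 proof (subst sum_tuples_insert_max(2)[where A=A and b=b and q="Suc q", OF A], assumption, intro sum.cong refl)
  fix a js assume "js \<in> {js. sorted js \<and> set js \<subseteq> A \<and> length js = Suc q - a}"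
  then have "set js \<subseteq> A" by simp
  from pj[OF this] show "\<bar>prod_tuple (vec_nth (x - z)) (js @ replicate a b)\<bar> = \<bar>prod_tuple (vec_nth (x' - z)) js\<bar> * \<bar>t\<bar> ^ a"
   by (simp add: abs_mult power_abs)
 qed
 have E0: "E 0 = 1"
 proof -
  have "{js :: 'd list. sorted js \<and> set js \<subseteq> A \<and> length js = 0} = {[]}" by auto
  then show ?thesis by (simp add: E_def prod_tuple_def)
 qed
 have En: "0 <= E n" for n unfolding E_def by (intro sum_nonneg) simp
 have T1': "\<bar>iter_partial R0 ks f x - (\<Sum>a\<le>q. iter_partial R0 (replicate a b @ ks) f x' * t ^ a / fact a)\<bar> <= B * \<bar>t\<bar> ^ Suc q"
  using T1 by simp
 have "\<bar>(\<Sum>a\<le>q. iter_partial R0 (replicate a b @ ks) f x' * t ^ a / fact a) - (\<Sum>a\<le>q. P a * t ^ a / fact a)\<bar>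
  = \<bar>\<Sum>a\<le>q. (iter_partial R0 (replicate a b @ ks) f x' - P a) * (t ^ a / fact a)\<bar>"
  unfolding sum_subtractf[symmetric]
  by (intro arg_cong[where f=abs] sum.cong refl) (simp add: left_diff_distrib diff_divide_distrib)
 also have "... <= (\<Sum>a\<le>q. \<bar>(iter_partial R0 (replicate a b @ ks) f x' - P a) * (t ^ a / fact a)\<bar>)" by (rule sum_abs)
 also have "... <= (\<Sum>a\<le>q. B * E (Suc q - a) * \<bar>t\<bar> ^ a)"
 proof (intro sum_mono)
  fix a assume a: "a \<in> {..q}"
  have "\<bar>t ^ a / fact a\<bar> <= \<bar>t\<bar> ^ a"
   using fact_ge_1[of a, where 'a=real] by (simp add: power_abs divide_le_eq mult_left_le mult_le_cancel_left1)
  then show "\<bar>(iter_partial R0 (replicate a b @ ks) f x' - P a) * (t ^ a / fact a)\<bar> <= B * E (Suc q - a) * \<bar>t\<bar> ^ a"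
   unfolding abs_mult[of "_ - _"] using IH[of a] a B0 En by (intro mult_mono) auto
 qed
 finally have "\<bar>iter_partial R0 ks f x - (\<Sum>a\<le>q. P a * t ^ a / fact a)\<bar> <= (\<Sum>a\<le>q. B * E (Suc q - a) * \<bar>t\<bar> ^ a) + B * \<bar>t\<bar> ^ Suc q"
  using T1' by linarith
 also have "... = B * (\<Sum>a\<le>Suc q. E (Suc q - a) * \<bar>t\<bar> ^ a)"
  by (simp add: E0 distrib_left sum_distrib_left mult.assoc)
 finally show ?case unfolding main rest .
qed

lemma iter_partial_bounded:
 fixes f :: "real ^ 'd::finite => real"
 assumes f: "cont_partially_diff_on k R0 f"
 shows "\<exists>B. \<forall>js z. length js <= k --> z \<in> R0 --> \<bar>iter_partial R0 js f z\<bar> <= B"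
proof -
 have ex: "\<exists>B. \<forall>z\<in>R0. \<bar>iter_partial R0 js f z\<bar> <= B" if "length js <= k" for js
 proof -
  have "continuous_on R0 (iter_partial R0 js f)" using f that unfolding cont_partially_diff_on_def by blast
  moreover have "compact (R0 :: (real ^ 'd) set)" unfolding R0_def by (rule compact_cbox)
  ultimately have "bounded (iter_partial R0 js f ` R0)"
   by (intro compact_imp_bounded compact_continuous_image)
  then obtain C where C: "\<And>y. y \<in> iter_partial R0 js f ` R0 ==> norm y <= C"
   unfolding bounded_iff by metis
  show ?thesis by (intro exI[of _ C] ballI) (use C in \<open>simp\<close>)
 qed
 define B where "B = (%js. SOME B. \<forall>z\<in>R0. \<bar>iter_partial R0 js f z\<bar> <= B)"
 have B': "\<forall>z\<in>R0. \<bar>iter_partial R0 js f z\<bar> <= B js" if "length js <= k" for js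
  unfolding B_def by (rule someI_ex[OF ex[OF that]])
 have B: "\<bar>iter_partial R0 js f z\<bar> <= B js" if "length js <= k" "z \<in> R0" for js z
  by (rule bspec[OF B'[OF that(1)] that(2)])
 have fin: "finite {js :: 'd list. length js <= k}"
  using finite_lists_length_le[of "UNIV :: 'd set" k] by simp
 show ?thesis
 proof (intro exI[of _ "\<Sum>js | length js <= k. \<bar>B js\<bar>"] allI impI)
  fix js :: "'d list" and z :: "real ^ 'd" assume a: "length js <= k" "z \<in> R0"
  have le: "\<bar>B js\<bar> <= (\<Sum>js | length js <= k. \<bar>B js\<bar>)"
   by (rule member_le_sum) (use fin a in simp_all)
  show "\<bar>iter_partial R0 js f z\<bar> <= (\<Sum>js | length js <= k. \<bar>B js\<bar>)"
   by (rule order_trans[OF B[OF a] order_trans[OF abs_ge_self le]])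
 qed
qed

section \<open>Perturbed linear systems\<close>

text \<open>Multiply the system by the inverse \<open>T\<close> of \<open>S\<close>: the largest entry of \<open>b\<close> is at most \<open>t0 D (r + D \<epsilon> max |b|) / \<gamma>\<close>, and the
smallness condition absorbs the last term into the left side.\<close>

lemma perturbed_system_bound:
 fixes T S P :: "nat => nat => real" and b \<rho> :: "nat => real" and \<gamma> \<epsilon> t0 r :: real
 assumes T: "\<And>k m. k < D ==> m < D ==> (\<Sum>l<D. T k l * S l m) = (if k = m then 1 else 0)"
  and t0: "\<And>k l. k < D ==> l < D ==> \<bar>T k l\<bar> <= t0" "0 <= t0"
  and P: "\<And>k l. k < D ==> l < D ==> \<bar>P k l - \<gamma> * S k l\<bar> <= \<epsilon>" "0 <= \<epsilon>"
  and sys: "\<And>k. k < D ==> (\<Sum>l<D. P k l * b l) = \<rho> k"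
  and r: "\<And>k. k < D ==> \<bar>\<rho> k\<bar> <= r"
  and \<gamma>: "0 < \<gamma>" and small: "2 * t0 * D * D * \<epsilon> <= \<gamma>"
  and k: "k < D"
 shows "\<bar>b k\<bar> <= 2 * t0 * D * r / \<gamma>"
proof -
 define B where "B = Max ((%l. \<bar>b l\<bar>) ` {..<D})"
 have B: "\<bar>b l\<bar> <= B" if "l < D" for l unfolding B_def using that by (intro Max_ge) auto
 have B0: "0 <= B" using B[OF k] by (rule order_trans[OF abs_ge_zero])
 have "B \<in> (%l. \<bar>b l\<bar>) ` {..<D}" unfolding B_def using k by (intro Max_in) auto
 then obtain k0 where k0: "k0 < D" "B = \<bar>b k0\<bar>" by auto
 have eq: "\<gamma> * b k0 = (\<Sum>l<D. T k0 l * (\<rho> l + (\<Sum>m<D. (\<gamma> * S l m - P l m) * b m)))"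
 proof -
  have "(\<Sum>l<D. T k0 l * (\<rho> l + (\<Sum>m<D. (\<gamma> * S l m - P l m) * b m)))
   = (\<Sum>l<D. T k0 l * (\<Sum>m<D. \<gamma> * S l m * b m))"
   using sys by (intro sum.cong refl) (simp add: left_diff_distrib sum_subtractf)
  also have "... = (\<Sum>m<D. \<Sum>l<D. \<gamma> * b m * (T k0 l * S l m))"
   unfolding sum_distrib_left by (subst sum.swap) (intro sum.cong refl, simp add: mult_ac)
  also have "... = (\<Sum>m<D. \<gamma> * b m * (if k0 = m then 1 else 0))"
   using T[OF k0(1)] by (intro sum.cong refl) (simp add: sum_distrib_left[symmetric])
  also have "... = \<gamma> * b k0" using k0(1) by (simp add: if_distrib cong: if_cong)
  finally show ?thesis by simp
 qed
 have inner: "\<bar>\<rho> l + (\<Sum>m<D. (\<gamma> * S l m - P l m) * b m)\<bar> <= r + D * (\<epsilon> * B)" if l: "l < D" for l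
 proof -
  have "\<bar>\<Sum>m<D. (\<gamma> * S l m - P l m) * b m\<bar> <= (\<Sum>m<D. \<bar>(\<gamma> * S l m - P l m) * b m\<bar>)" by (rule sum_abs)
  also have "... <= (\<Sum>m<D. \<epsilon> * B)"
  proof (intro sum_mono)
   fix m assume "m \<in> {..<D}"
   then have m: "m < D" by simp
   have "\<bar>\<gamma> * S l m - P l m\<bar> <= \<epsilon>" using P(1)[OF l m] by (simp add: abs_minus_commute)
   then show "\<bar>(\<gamma> * S l m - P l m) * b m\<bar> <= \<epsilon> * B"
    unfolding abs_mult using B[OF m] P(2) by (intro mult_mono) auto
  qed
  finally have "\<bar>\<Sum>m<D. (\<gamma> * S l m - P l m) * b m\<bar> <= D * (\<epsilon> * B)" by simp
  with r[OF l] show ?thesis by linarith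
 qed
 have "\<gamma> * B = \<bar>\<gamma> * b k0\<bar>" using \<gamma> k0(2) by (simp add: abs_mult)
 also have "... <= (\<Sum>l<D. \<bar>T k0 l * (\<rho> l + (\<Sum>m<D. (\<gamma> * S l m - P l m) * b m))\<bar>)"
  unfolding eq by (rule sum_abs)
 also have "... <= (\<Sum>l<D. t0 * (r + D * (\<epsilon> * B)))"
 proof (intro sum_mono)
  fix l assume "l \<in> {..<D}"
  then have l: "l < D" by simp
  show "\<bar>T k0 l * (\<rho> l + (\<Sum>m<D. (\<gamma> * S l m - P l m) * b m))\<bar> <= t0 * (r + D * (\<epsilon> * B))"
   unfolding abs_mult using t0(1)[OF k0(1) l] inner[OF l] t0(2) by (intro mult_mono) auto
 qed
 also have "... = t0 * D * r + (t0 * D * D * \<epsilon>) * B" by (simp add: algebra_simps)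
 finally have 1: "\<gamma> * B <= t0 * D * r + (t0 * D * D * \<epsilon>) * B" .
 have "(2 * t0 * D * D * \<epsilon>) * B <= \<gamma> * B" using small B0 by (rule mult_right_mono)
 then have "\<gamma> * B <= 2 * t0 * D * r" using 1 by (simp add: algebra_simps)
 then have "B <= 2 * t0 * D * r / \<gamma>" using \<gamma> by (simp add: field_simps)
 with B[OF k] show ?thesis by (rule order_trans)
qed

text \<open>A trivial kernel forces a nonzero determinant, and then elimination returns an inverse; so the estimate will be defined.\<close>

lemma mat_inverse_exists:
 fixes L :: "real Matrix.mat"
 assumes L: "L \<in> carrier_mat D D"
  and inj: "\<And>v. v \<in> carrier_vec D ==> L *\<^sub>v v = 0\<^sub>v D ==> v = 0\<^sub>v D"
 shows "\<exists>B. mat_inverse L = Some B \<and> B \<in> carrier_mat D D \<and> L * B = 1\<^sub>m D"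
proof -
 have "Determinant.det L ~= 0"
 proof
  assume "Determinant.det L = 0"
  from iffD1[OF det_0_iff_vec_prod_zero_field[OF L] this]
  obtain v where "v \<in> carrier_vec D" "v ~= 0\<^sub>v D" "L *\<^sub>v v = 0\<^sub>v D" by (elim exE conjE)
  then show False using inj by metis
 qed
 then have u: "L \<in> Units (ring_mat TYPE(real) D ())" by (rule det_non_zero_imp_unit[OF L])
 show ?thesis
 proof (cases "mat_inverse L")
  case None
  from mat_inverse(1)[OF L None, of "()"] u show ?thesis by (rule notE)
 next
  case (Some B)
  with mat_inverse(2)[OF L Some] show ?thesis by (intro exI[of _ B]) simp
 qed
qed

lemma invertible_entries:
 fixes S :: "real Matrix.mat"
 assumes S: "invertible_mat S" "S \<in> carrier_mat D D"
 shows "\<exists>T. \<forall>k<D. \<forall>m<D. (\<Sum>l<D. T k l * index_mat S (l, m)) = (if k = m then 1 else 0)"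
proof -
 obtain B where B: "inverts_mat S B" "inverts_mat B S" using S(1) unfolding invertible_mat_def by blast
 have "dim_row B = D"
 proof -
  have "B * S = 1\<^sub>m (dim_row B)" "S * B = 1\<^sub>m D" using B S(2) unfolding inverts_mat_def by auto
  then show ?thesis using S(2) by (metis carrier_matD(2) index_mult_mat(3) index_one_mat(3))
 qed
 moreover have "dim_col B = D"
  using B(1) S(2) unfolding inverts_mat_def by (metis carrier_matD(1) index_mult_mat(3) index_one_mat(3))
 ultimately have Bc: "B \<in> carrier_mat D D" by auto
 have BS: "B * S = 1\<^sub>m D" using B(2) Bc unfolding inverts_mat_def by auto
 show ?thesis
 proof (intro exI[of _ "%k l. index_mat B (k, l)"] allI impI)
  fix k m assume km: "k < D" "m < D"
  have "index_mat (B * S) (k, m) = (\<Sum>l<D. index_mat B (k, l) * index_mat S (l, m))"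
   using km Bc S(2) by (auto simp: scalar_prod_def lessThan_atLeast0 intro!: sum.cong)
  then show "(\<Sum>l<D. index_mat B (k, l) * index_mat S (l, m)) = (if k = m then 1 else 0)"
   unfolding BS using km by simp
 qed
qed

section \<open>Error of the local polynomial estimator\<close>

lemma prod_tuple_mult: "prod_tuple (%j. u j * v j) js = prod_tuple u js * prod_tuple v js"
 unfolding prod_tuple_def by (induction js) (auto simp: mult_ac)

lemma prod_tuple_pos: "(\<And>j. 0 < u j) ==> 0 < prod_tuple u js"
 unfolding prod_tuple_def by (induction js) auto

text \<open>The argument of the kernel: the site relative to \<open>z\<close>, in units of the bandwidths.\<close>

definition scaled_site :: "('d => real) => ('d => real) => real ^ 'd::finite => real ^ 'd => real ^ 'd" where
 "scaled_site A h z x = (\<chi> j. (x $ j / A j - z $ j) / h j)"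

lemma tuple_pos_correct:
 fixes js :: "'d::{finite,linorder} list"
 assumes "sorted js" "length js <= p"
 shows "tuple_pos p js < length (tuples p :: 'd list list)" "tuples p ! tuple_pos p js = js"
proof -
 have "js \<in> set (tuples p)" using assms by (simp add: set_tuples)
 then obtain k where k: "k < length (tuples p :: 'd list list)" "tuples p ! k = js" by (auto simp: in_set_conv_nth)
 have "tuples p ! tuple_pos p js = js" unfolding tuple_pos_def by (rule LeastI[of "%k. tuples p ! k = js", OF k(2)])
 then show "tuples p ! tuple_pos p js = js" .
 have "tuple_pos p js <= k" unfolding tuple_pos_def by (rule Least_le[of "%k. tuples p ! k = js", OF k(2)])
 then show "tuple_pos p js < length (tuples p :: 'd list list)" using k(1) by simp
qed

text \<open>The equations for the error of the coefficients, rescaled by the bandwidth products, have a matrix close to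
\<open>\<gamma> S\<close> and the weighted residuals as right side. Applied with zero residuals, the same bound shows that the kernel
of the matrix is trivial, so the estimate exists.\<close>

lemma lp_deriv_error:
 fixes K :: "real ^ 'd::{finite,linorder} => real" and A h :: "'d => real" and x :: "nat => real ^ 'd::{finite,linorder}"
  and T S :: "nat => nat => real" and \<theta> :: "nat => real" and N \<gamma> \<epsilon> t0 r :: real
  and p n :: nat and z :: "real ^ 'd::{finite,linorder}"
 defines "D \<equiv> length (tuples p :: 'd list list)"
 defines "W \<equiv> %i k. prod_tuple (vec_nth (scaled_site A h z (x i))) (tuples p ! k)"
 defines "\<kappa> \<equiv> %i. K (scaled_site A h z (x i))"
 assumes A: "\<And>j. 0 < A j" and h: "\<And>j. 0 < h j" and N: "0 < N"
  and T: "\<And>k m. k < D ==> m < D ==> (\<Sum>l<D. T k l * S l m) = (if k = m then 1 else 0)"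
  and t0: "\<And>k l. k < D ==> l < D ==> \<bar>T k l\<bar> <= t0" "0 <= t0"
  and P: "\<And>k l. k < D ==> l < D ==> \<bar>(\<Sum>i=1..n. \<kappa> i * (W i k * W i l)) / N - \<gamma> * S k l\<bar> <= \<epsilon>" "0 <= \<epsilon>"
  and r: "\<And>k. k < D ==> \<bar>(\<Sum>i=1..n. \<kappa> i * W i k * (y i - (\<Sum>l<D. \<theta> l * prod_tuple (vec_nth (cdiv (x i) A - z)) (tuples p ! l)))) / N\<bar> <= r"
  and \<gamma>: "0 < \<gamma>" and small: "2 * t0 * D * D * \<epsilon> <= \<gamma>"
  and js: "sorted js" "length js <= p"
 shows "\<exists>u. lp_deriv p K A h n x y js z = Some u \<and>
  \<bar>u - tuple_fact js * \<theta> (tuple_pos p js)\<bar> <= tuple_fact js * (2 * t0 * D * r / \<gamma>) / prod_tuple h js"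
proof -
 define H where "H = (%k. prod_tuple h (tuples p ! k :: 'd list))"
 have H: "0 < H k" for k unfolding H_def by (rule prod_tuple_pos[OF h])
 define w where "w = (%i k. prod_tuple (vec_nth (cdiv (x i) A - z)) (tuples p ! k))"
 have w: "w i k = H k * W i k" for i k
 proof -
  have "vec_nth (cdiv (x i) A - z) = (%j. h j * scaled_site A h z (x i) $ j)"
  proof
   fix j show "(cdiv (x i) A - z) $ j = h j * scaled_site A h z (x i) $ j"
    using h[of j] by (simp add: cdiv_def scaled_site_def)
  qed
  then show ?thesis unfolding w_def W_def H_def by (simp add: prod_tuple_mult)
 qed
 have \<kappa>: "K_Ah K A h (x i - cmult A z) = \<kappa> i" for i
 proof -
  have "(x i $ j - A j * z $ j) / (A j * h j) = (x i $ j / A j - z $ j) / h j" for j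
   using A[of j] h[of j] by (simp add: field_simps)
  then show ?thesis unfolding K_Ah_def \<kappa>_def scaled_site_def cmult_def by simp
 qed
 define L where "L = lp_matrix p K A h n x z"
 define V where "V = lp_vector p K A h n x y z"
 have Lc: "L \<in> carrier_mat D D" unfolding L_def lp_matrix_def D_def Let_def by simp
 have Vc: "V \<in> carrier_vec D" unfolding V_def lp_vector_def D_def Let_def by simp
 have L: "index_mat L (k, l) = H k * H l * (\<Sum>i=1..n. \<kappa> i * (W i k * W i l))" if "k < D" "l < D" for k l
 proof -
  have "index_mat L (k, l) = (\<Sum>i=1..n. \<kappa> i * (w i k * w i l))"
   using that unfolding L_def lp_matrix_def D_def Let_def by (simp add: \<kappa> poly_vec_def w_def)
  also have "... = H k * H l * (\<Sum>i=1..n. \<kappa> i * (W i k * W i l))"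
   unfolding w sum_distrib_left by (intro sum.cong refl) (simp add: mult_ac)
  finally show ?thesis .
 qed
 have V: "vec_index V k = H k * (\<Sum>i=1..n. \<kappa> i * W i k * y i)" if "k < D" for k
 proof -
  have "vec_index V k = (\<Sum>i=1..n. \<kappa> i * w i k * y i)"
   using that unfolding V_def lp_vector_def D_def Let_def by (simp add: \<kappa> poly_vec_def w_def)
  also have "... = H k * (\<Sum>i=1..n. \<kappa> i * W i k * y i)"
   unfolding w sum_distrib_left by (intro sum.cong refl) (simp add: mult_ac)
  finally show ?thesis .
 qed
 define Ph where "Ph = (%k l. (\<Sum>i=1..n. \<kappa> i * (W i k * W i l)) / N)"
 have Lv: "vec_index (L *\<^sub>v v) k = N * H k * (\<Sum>l<D. Ph k l * (H l * vec_index v l))"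
  if "v \<in> carrier_vec D" "k < D" for v k
 proof -
  have "vec_index (L *\<^sub>v v) k = (\<Sum>l<D. index_mat L (k, l) * vec_index v l)"
   using that Lc by (auto simp: scalar_prod_def lessThan_atLeast0 intro!: sum.cong)
  also have "... = (\<Sum>l<D. N * H k * (Ph k l * (H l * vec_index v l)))"
   using that N by (intro sum.cong refl) (simp add: L Ph_def)
  finally show ?thesis by (simp add: sum_distrib_left)
 qed
 have P': "\<bar>Ph k l - \<gamma> * S k l\<bar> <= \<epsilon>" if "k < D" "l < D" for k l using P(1)[OF that] by (simp add: Ph_def)
 have "\<exists>B. mat_inverse L = Some B \<and> B \<in> carrier_mat D D \<and> L * B = 1\<^sub>m D"
 proof (rule mat_inverse_exists[OF Lc])
  fix v assume v: "v \<in> carrier_vec D" "L *\<^sub>v v = 0\<^sub>v D"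
  have sys: "(\<Sum>l<D. Ph k l * (H l * vec_index v l)) = 0" if "k < D" for k
   using Lv[OF v(1) that] v(2) that N H[of k] by simp
  have "vec_index v k = 0" if k: "k < D" for k
  proof -
   have "\<bar>H k * vec_index v k\<bar> <= 2 * t0 * D * 0 / \<gamma>"
    by (rule perturbed_system_bound[where b="%l. H l * vec_index v l" and \<rho>="%_. 0", OF T t0 P' P(2) sys _ \<gamma> small k]) auto
   then show ?thesis using H[of k] by simp
  qed
  then show "v = 0\<^sub>v D" using v(1) by (intro eq_vecI) auto
 qed
 then obtain B where B: "mat_inverse L = Some B" "B \<in> carrier_mat D D" "L * B = 1\<^sub>m D" by blast
 define c where "c = B *\<^sub>v V"
 have cc: "c \<in> carrier_vec D" unfolding c_def using B(2) Vc by simp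
 have Lc': "L *\<^sub>v c = V" unfolding c_def
  using assoc_mult_mat_vec[OF Lc B(2) Vc] B(3) Vc by simp
 define b where "b = (%l. H l * (vec_index c l - \<theta> l))"
 define \<rho> where "\<rho> = (%k. (\<Sum>i=1..n. \<kappa> i * W i k * (y i - (\<Sum>l<D. \<theta> l * prod_tuple (vec_nth (cdiv (x i) A - z)) (tuples p ! l)))) / N)"
 have sys: "(\<Sum>l<D. Ph k l * b l) = \<rho> k" if k: "k < D" for k
 proof -
  have "N * H k * (\<Sum>l<D. Ph k l * (H l * vec_index c l)) = H k * (\<Sum>i=1..n. \<kappa> i * W i k * y i)"
   by (rule trans[OF Lv[OF cc k, symmetric, unfolded Lc'] V[OF k]])
  then have 1: "(\<Sum>l<D. Ph k l * (H l * vec_index c l)) = (\<Sum>i=1..n. \<kappa> i * W i k * y i) / N"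
   using H[of k] N by (simp add: field_simps)
  have "(\<Sum>l<D. Ph k l * (H l * \<theta> l)) = (\<Sum>l<D. \<Sum>i=1..n. \<kappa> i * W i k * (\<theta> l * w i l) / N)"
   unfolding Ph_def w times_divide_eq_left sum_distrib_right sum_divide_distrib
   by (intro sum.cong refl) (simp add: mult_ac)
  also have "... = (\<Sum>i=1..n. \<kappa> i * W i k * (\<Sum>l<D. \<theta> l * w i l)) / N"
   by (subst sum.swap) (simp add: sum_distrib_left sum_divide_distrib)
  finally have 2: "(\<Sum>l<D. Ph k l * (H l * \<theta> l)) = (\<Sum>i=1..n. \<kappa> i * W i k * (\<Sum>l<D. \<theta> l * w i l)) / N" .
  have "(\<Sum>l<D. Ph k l * b l) = (\<Sum>l<D. Ph k l * (H l * vec_index c l)) - (\<Sum>l<D. Ph k l * (H l * \<theta> l))"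
   unfolding b_def sum_subtractf[symmetric] by (intro sum.cong refl) (simp add: algebra_simps)
  also have "... = \<rho> k" unfolding 1 2 \<rho>_def w_def
   by (simp add: right_diff_distrib sum_subtractf diff_divide_distrib)
  finally show ?thesis .
 qed
 let ?k = "tuple_pos p js"
 have k: "?k < D" "tuples p ! ?k = js" using tuple_pos_correct[OF js] unfolding D_def by simp_all
 have "\<bar>b ?k\<bar> <= 2 * t0 * D * r / \<gamma>"
  by (rule perturbed_system_bound[where b=b and \<rho>=\<rho>, OF T t0 P' P(2) sys _ \<gamma> small k(1)]) (use r in \<open>simp_all add: \<rho>_def\<close>)
 then have "prod_tuple h js * \<bar>vec_index c ?k - \<theta> ?k\<bar> <= 2 * t0 * D * r / \<gamma>"
  unfolding b_def H_def k(2) using prod_tuple_pos[where u=h and js=js, OF h] by (simp add: abs_mult)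
 then have "\<bar>vec_index c ?k - \<theta> ?k\<bar> * prod_tuple h js <= 2 * t0 * D * r / \<gamma>"
  by (subst mult.commute)
 then have e: "\<bar>vec_index c ?k - \<theta> ?k\<bar> <= (2 * t0 * D * r / \<gamma>) / prod_tuple h js"
  by (rule iffD2[OF pos_le_divide_eq[OF prod_tuple_pos[where u=h and js=js, OF h]]])
 have f: "0 <= tuple_fact js" unfolding tuple_fact_def by (intro prod_nonneg) auto
 have "lp_deriv p K A h n x y js z = Some (tuple_fact js * vec_index c ?k)"
  unfolding lp_deriv_def lp_beta_def L_def[symmetric] V_def[symmetric] B(1) by (simp add: c_def)
 moreover have "\<bar>tuple_fact js * vec_index c ?k - tuple_fact js * \<theta> ?k\<bar> <= tuple_fact js * (2 * t0 * D * r / \<gamma>) / prod_tuple h js"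
 proof -
  have "\<bar>tuple_fact js * vec_index c ?k - tuple_fact js * \<theta> ?k\<bar> = tuple_fact js * \<bar>vec_index c ?k - \<theta> ?k\<bar>"
   using f by (simp add: abs_mult right_diff_distrib[symmetric])
  also have "... <= tuple_fact js * ((2 * t0 * D * r / \<gamma>) / prod_tuple h js)" using e f by (rule mult_left_mono)
  finally show ?thesis by simp
 qed
 ultimately show ?thesis by blast
qed

section \<open>Kernel weights\<close>

text \<open>The properties of the kernel that the uniform estimates use. They are stable under multiplication by
monomials, so all entries of the normal equations are averages of such weights.\<close>

definition kernel_like :: "real => (real ^ 'd::finite => real) => bool" where
 "kernel_like c \<phi> \<longleftrightarrow> (\<exists>C. \<forall>v. \<bar>\<phi> v\<bar> <= C) \<and>
   (\<exists>L\<ge>0. \<forall>v v'. \<bar>\<phi> v - \<phi> v'\<bar> <= L * norm1 (v - v')) \<and>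
   (\<forall>v. \<phi> v ~= 0 --> (\<forall>j. \<bar>v $ j\<bar> <= c))"

lemma norm1_le_norm: "norm1 (x :: real ^ 'd::finite) <= CARD('d) * norm x"
 unfolding norm1_def using sum_bounded_above[of UNIV "%j. \<bar>x $ j\<bar>" "norm x"] component_le_norm_cart by auto

lemma abs_component_le_norm1: "\<bar>(x :: real ^ 'd::finite) $ j\<bar> <= norm1 x"
 unfolding norm1_def by (rule member_le_sum) auto

lemma norm1_nonneg: "0 <= norm1 x"
 unfolding norm1_def by (intro sum_nonneg) auto

lemma kernel_like_continuous:
 assumes "kernel_like c \<phi>"
 shows "continuous_on UNIV \<phi>"
proof -
 obtain L where L: "0 <= L" "\<And>v v'. \<bar>\<phi> v - \<phi> v'\<bar> <= L * norm1 (v - v')"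
  using assms unfolding kernel_like_def by auto
 have "(L * CARD('a))-lipschitz_on UNIV \<phi>"
 proof (rule lipschitz_onI)
  fix x y :: "real ^ 'a"
  have "\<bar>\<phi> x - \<phi> y\<bar> <= L * (CARD('a) * norm (x - y))"
   using L(2)[of x y] mult_left_mono[OF norm1_le_norm[of "x - y"] L(1)] by linarith
  then show "dist (\<phi> x) (\<phi> y) <= L * CARD('a) * dist x y" by (simp add: dist_norm mult.assoc)
 qed (use L in simp)
 then show ?thesis by (rule lipschitz_on_continuous_on)
qed

lemma kernel_like_measurable: "kernel_like c \<phi> ==> \<phi> \<in> borel_measurable borel"
 by (rule borel_measurable_continuous_onI) (rule kernel_like_continuous)

lemma kernel_like_times_coordinate:
 assumes \<phi>: "kernel_like c \<phi>" and c: "c <= 1"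
 shows "kernel_like c (%v. \<phi> v * v $ j)"
proof -
 obtain C where C: "\<And>v. \<bar>\<phi> v\<bar> <= C" using \<phi> unfolding kernel_like_def by auto
 obtain L where L: "0 <= L" "\<And>v v'. \<bar>\<phi> v - \<phi> v'\<bar> <= L * norm1 (v - v')"
  using \<phi> unfolding kernel_like_def by auto
 have C0: "0 <= C" using C[of undefined] by linarith
 have supp: "\<bar>v $ j\<bar> <= 1" if "\<phi> v ~= 0" for v j
  using \<phi> c that unfolding kernel_like_def by (meson order_trans)
 have one: "\<bar>\<phi> v * v $ j - \<phi> v' * v' $ j\<bar> <= (L + C) * norm1 (v - v')" if "\<phi> v ~= 0" for v v'
 proof -
  have "\<phi> v * v $ j - \<phi> v' * v' $ j = (\<phi> v - \<phi> v') * v $ j + \<phi> v' * ((v - v') $ j)" by (simp add: algebra_simps)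
  also have "\<bar>...\<bar> <= \<bar>\<phi> v - \<phi> v'\<bar> * \<bar>v $ j\<bar> + \<bar>\<phi> v'\<bar> * \<bar>(v - v') $ j\<bar>"
   unfolding abs_mult[symmetric] by (rule abs_triangle_ineq)
  also have "... <= (L * norm1 (v - v')) * 1 + C * norm1 (v - v')"
   using L C0 C supp[OF that] abs_component_le_norm1[of "v - v'" j] norm1_nonneg
   by (intro add_mono mult_mono) auto
  finally show ?thesis by (simp add: algebra_simps)
 qed
 have "\<bar>\<phi> v * v $ j\<bar> <= C" for v
 proof (cases "\<phi> v = 0")
  case False
  have "\<bar>\<phi> v\<bar> * \<bar>v $ j\<bar> <= C * 1" using C[of v] supp[OF False] C0 by (intro mult_mono) auto
  then show ?thesis by (simp add: abs_mult)
 qed (use C0 in simp)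
 moreover have "\<bar>\<phi> v * v $ j - \<phi> v' * v' $ j\<bar> <= (L + C) * norm1 (v - v')" for v v'
 proof (cases "\<phi> v = 0")
  case True
  show ?thesis
  proof (cases "\<phi> v' = 0")
   case True
   then show ?thesis using \<open>\<phi> v = 0\<close> L C0 norm1_nonneg[of "v - v'"] by simp
  next
   case False
   have "norm1 (v' - v) = norm1 (v - v')" by (simp add: norm1_def abs_minus_commute)
   then show ?thesis using one[OF False, of v] by (simp add: abs_minus_commute)
  qed
 qed (rule one)
 moreover have "\<forall>v. \<phi> v * v $ j ~= 0 --> (\<forall>j. \<bar>v $ j\<bar> <= c)" using \<phi> unfolding kernel_like_def by simp
 ultimately show ?thesis unfolding kernel_like_def using L C0 add_nonneg_nonneg by blast
qed

lemma kernel_like_times_tuple: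
 assumes "kernel_like c \<phi>" "c <= 1"
 shows "kernel_like c (%v. \<phi> v * prod_tuple (vec_nth v) js)"
proof (induction js)
 case Nil
 then show ?case using assms by (simp add: prod_tuple_def)
next
 case (Cons j js)
 from kernel_like_times_coordinate[OF this assms(2), of j] show ?case
  by (simp add: prod_tuple_def mult_ac)
qed

lemma kernel_like_abs:
 assumes "kernel_like c \<phi>"
 shows "kernel_like c (%v. \<bar>\<phi> v\<bar>)"
proof -
 have "\<bar>\<bar>\<phi> v\<bar> - \<bar>\<phi> v'\<bar>\<bar> <= \<bar>\<phi> v - \<phi> v'\<bar>" for v v' by (rule abs_triangle_ineq3)
 then show ?thesis using assms unfolding kernel_like_def by simp (meson order_trans)
qed

lemma lborel_integral_diagonal:
 fixes G :: "real ^ 'd::finite => real" and c :: "'d => real"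
 assumes c: "\<And>j. 0 < c j" and G: "G \<in> borel_measurable borel"
 shows "(\<integral>x. G x \<partial>lborel) = cprod c * (\<integral>v. G (\<chi> j. b $ j + c j * v $ j) \<partial>lborel)"
proof -
 define c' where "c' = (%i :: real ^ 'd. c (THE j. i = axis j 1))"
 have c'ax: "c' (axis j 1) = c j" for j
  unfolding c'_def by (rule arg_cong[where f=c]) (auto simp: axis_eq_axis intro!: the_equality)
 define T where "T = (%v :: real ^ 'd. \<chi> j. b $ j + c j * v $ j)"
 have sumB: "(\<Sum>i\<in>Basis. F i) = (\<Sum>j\<in>UNIV. F (axis j 1))" for F :: "real ^ 'd => real ^ 'd"
 proof -
  have B: "(Basis :: (real ^ 'd) set) = (%j. axis j 1) ` UNIV" by (auto simp: Basis_vec_def)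
  show ?thesis unfolding B by (subst sum.reindex) (auto simp: inj_on_def axis_eq_axis)
 qed
 have prodB: "(\<Prod>i\<in>Basis. F i) = (\<Prod>j\<in>UNIV. F (axis j 1))" for F :: "real ^ 'd => real"
 proof -
  have B: "(Basis :: (real ^ 'd) set) = (%j. axis j 1) ` UNIV" by (auto simp: Basis_vec_def)
  show ?thesis unfolding B by (subst prod.reindex) (auto simp: inj_on_def axis_eq_axis)
 qed
 have T: "T = (%x. b + (\<Sum>i\<in>Basis. (c' i * (x \<bullet> i)) *\<^sub>R i))"
  unfolding sumB c'ax inner_axis T_def
  by (auto simp: fun_eq_iff Finite_Cartesian_Product.vec_eq_iff axis_def if_distrib cong: if_cong)
 have "lborel = density (distr lborel borel T) (%_. ennreal (\<Prod>i\<in>Basis. \<bar>c' i\<bar>))"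
  unfolding T
 proof (rule lborel_affine_euclidean)
  fix i :: "real ^ 'd" assume "i \<in> Basis"
  then obtain j where "i = axis j 1" by (auto simp: Basis_vec_def)
  then show "c' i ~= 0" using c'ax[of j] c[of j] by simp
 qed
 also have "(\<Prod>i\<in>Basis. \<bar>c' i\<bar>) = cprod c"
  unfolding prodB c'ax cprod_def using c by (intro prod.cong) (auto simp: abs_of_pos)
 finally have L: "lborel = density (distr lborel borel T) (%_. ennreal (cprod c))" .
 have Tm: "T \<in> measurable lborel borel"
  unfolding T by measurable
 have cp: "0 <= cprod c" unfolding cprod_def using c by (intro prod_nonneg) (auto intro: less_imp_le)
 have "(\<integral>x. G x \<partial>lborel) = (\<integral>x. G x \<partial>density (distr lborel borel T) (%_. ennreal (cprod c)))"
  by (subst (1) L) simp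
 also have "... = (\<integral>x. cprod c *\<^sub>R G x \<partial>distr lborel borel T)"
  using G cp by (intro integral_density) auto
 also have "... = cprod c * (\<integral>x. G x \<partial>distr lborel borel T)" by simp
 also have "(\<integral>x. G x \<partial>distr lborel borel T) = (\<integral>v. G (T v) \<partial>lborel)"
  using G Tm by (intro integral_distr) auto
 finally show ?thesis unfolding T_def .
qed

section \<open>Events of high probability\<close>

text \<open>The probability of failure tends to zero. The covering event avoids the measurability of suprema over uncountable sets,
as in \<open>bigOp\<close>.\<close>

definition whp :: "'a measure => (nat => 'a => bool) => bool" where
 "whp M Q \<longleftrightarrow> (\<forall>\<delta>>0. \<forall>\<^sub>F n in sequentially. \<exists>E\<in>sets M. measure M E <= \<delta> \<and> {\<omega>\<in>space M. \<not> Q n \<omega>} \<subseteq> E)"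

lemma whpI:
 assumes "\<forall>\<^sub>F n in sequentially. \<exists>E\<in>sets M. measure M E <= b n \<and> {\<omega>\<in>space M. \<not> Q n \<omega>} \<subseteq> E" and "b \<longlonglongrightarrow> 0"
 shows "whp M Q"
 unfolding whp_def
proof (intro allI impI)
 fix \<delta> :: real assume "\<delta> > 0"
 then have "\<forall>\<^sub>F n in sequentially. b n < \<delta>" using assms(2) by (rule order_tendstoD(2)[rotated])
 with assms(1) show "\<forall>\<^sub>F n in sequentially. \<exists>E\<in>sets M. measure M E <= \<delta> \<and> {\<omega>\<in>space M. \<not> Q n \<omega>} \<subseteq> E"
  by eventually_elim (meson less_imp_le order_trans)
qed

lemma whp_mono:
 assumes "whp M Q" "\<forall>\<^sub>F n in sequentially. \<forall>\<omega>\<in>space M. Q n \<omega> --> R n \<omega>"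
 shows "whp M R"
 unfolding whp_def
proof (intro allI impI)
 fix \<delta> :: real assume "\<delta> > 0"
 then have "\<forall>\<^sub>F n in sequentially. \<exists>E\<in>sets M. measure M E <= \<delta> \<and> {\<omega>\<in>space M. \<not> Q n \<omega>} \<subseteq> E"
  using assms(1) unfolding whp_def by auto
 with assms(2) show "\<forall>\<^sub>F n in sequentially. \<exists>E\<in>sets M. measure M E <= \<delta> \<and> {\<omega>\<in>space M. \<not> R n \<omega>} \<subseteq> E"
 proof eventually_elim
  case (elim n)
  from elim(2) obtain E where "E \<in> sets M" "measure M E <= \<delta>" "{\<omega>\<in>space M. \<not> Q n \<omega>} \<subseteq> E" by blast
  then show ?case using elim(1) by (intro bexI[of _ E]) auto
 qed
qed

lemma (in prob_space) whp_conj: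
 assumes "whp M Q" "whp M R"
 shows "whp M (%n \<omega>. Q n \<omega> \<and> R n \<omega>)"
 unfolding whp_def
proof (intro allI impI)
 fix \<delta> :: real assume "\<delta> > 0"
 then have "\<delta> / 2 > 0" by simp
 then have "\<forall>\<^sub>F n in sequentially. \<exists>E\<in>sets M. measure M E <= \<delta> / 2 \<and> {\<omega>\<in>space M. \<not> Q n \<omega>} \<subseteq> E"
  "\<forall>\<^sub>F n in sequentially. \<exists>E\<in>sets M. measure M E <= \<delta> / 2 \<and> {\<omega>\<in>space M. \<not> R n \<omega>} \<subseteq> E"
  using assms unfolding whp_def by blast+
 then show "\<forall>\<^sub>F n in sequentially. \<exists>E\<in>sets M. measure M E <= \<delta> \<and> {\<omega>\<in>space M. \<not> (Q n \<omega> \<and> R n \<omega>)} \<subseteq> E"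
 proof eventually_elim
  case (elim n)
  from elim(1) obtain E where E: "E \<in> sets M" "measure M E <= \<delta> / 2" "{\<omega>\<in>space M. \<not> Q n \<omega>} \<subseteq> E" by blast
  from elim(2) obtain F where F: "F \<in> sets M" "measure M F <= \<delta> / 2" "{\<omega>\<in>space M. \<not> R n \<omega>} \<subseteq> F" by blast
  have "measure M (E \<union> F) <= \<delta>" using measure_Un_le[OF E(1) F(1)] E(2) F(2) by linarith
  then show ?case using E F by (intro bexI[of _ "E \<union> F"]) auto
 qed
qed

lemma (in prob_space) whp_ball:
 assumes "finite S" "\<And>k. k \<in> S ==> whp M (Q k)"
 shows "whp M (%n \<omega>. \<forall>k\<in>S. Q k n \<omega>)"
 using assms
proof (induction S rule: finite_induct)
 case empty
 have "whp M (%n \<omega>. True)" unfolding whp_def by (auto intro!: bexI[of _ "{}"])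
 then show ?case by simp
next
 case (insert x S)
 have "whp M (%n \<omega>. Q x n \<omega> \<and> (\<forall>k\<in>S. Q k n \<omega>))" using insert by (intro whp_conj) auto
 then show ?case by simp
qed

section \<open>The model and its rates\<close>

text \<open>The assumptions of the theorem, collected so that all sequences are available without repetition.\<close>

locale spatial_regression = prob_space M for M :: "'a measure" +
 fixes p q1 q2 :: nat
  and A A1 A2 h :: "nat => 'd::{finite,linorder} => real"
  and X :: "nat => nat => 'a => real ^ 'd::{finite,linorder}"
  and e :: "real ^ 'd::{finite,linorder} => 'a => real"
  and eps :: "nat => 'a => real"
  and Y :: "nat => nat => 'a => real"
  and m \<eta> \<sigma>\<^sub>\<epsilon> g K :: "real ^ 'd::{finite,linorder} => real"
  and \<kappa> C\<^sub>K :: real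
  and \<beta>\<^sub>1 \<omega>\<^sub>2 :: "real => real"
 assumes p: "p \<ge> 1"
  \<comment> \<open>model\<close>
  and A_pos: "\<And>n j. n \<ge> 1 ==> A n j > 0"
  and A_lim: "\<And>j. filterlim (%n. A n j) at_top sequentially"
  and h_pos: "\<And>n j. n \<ge> 1 ==> h n j > 0"
  and Y: "\<And>n i \<omega>. 1 <= i ==> i <= n ==> \<omega> \<in> space M \<Longrightarrow>
    Y n i \<omega> = m (cdiv (X n i \<omega>) (A n))
     + \<eta> (cdiv (X n i \<omega>) (A n)) * e (X n i \<omega>) \<omega>
     + \<sigma>\<^sub>\<epsilon> (cdiv (X n i \<omega>) (A n)) * eps i \<omega>"
  and e_field: "random_field M e"
  and e_mean: "\<And>x. integrable M (e x)" "\<And>x. (LINT \<omega>|M. e x \<omega>) = 0"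
  and e_var: "\<And>x. integrable M (%\<omega>. (e x \<omega>)\<^sup>2)" "\<And>x. (LINT \<omega>|M. (e x \<omega>)\<^sup>2) = 1"
  \<comment> \<open>mean, variance functions and measurement errors\<close>
  and m: "cont_partially_diff_on (p + 1) R0 m"
  and \<eta>: "\<And>z. z \<in> R0 ==> \<eta> z > 0" "continuous_on R0 \<eta>" "(INF z\<in>R0. \<eta> z) > 0"
  and eps_iid: "prob_space.indep_vars M (%_. borel) eps {1..}"
   "\<And>i. i \<ge> 1 ==> distr M borel (eps i) = distr M borel (eps 1)"
  and eps_mean: "integrable M (eps 1)" "(LINT \<omega>|M. eps 1 \<omega>) = 0"
  and eps_var: "integrable M (%\<omega>. (eps 1 \<omega>)\<^sup>2)" "(LINT \<omega>|M. (eps 1 \<omega>)\<^sup>2) = 1"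
  and eps_moment: "q1 > 4" "integrable M (%\<omega>. \<bar>eps 1 \<omega>\<bar> ^ q1)"
  and \<sigma>\<^sub>\<epsilon>: "\<And>z. z \<in> R0 ==> \<sigma>\<^sub>\<epsilon> z > 0" "continuous_on R0 \<sigma>\<^sub>\<epsilon>" "(INF z\<in>R0. \<sigma>\<^sub>\<epsilon> z) > 0"
  \<comment> \<open>sampling\<close>
  and \<kappa>: "\<kappa> \<ge> 0" "(%n. cprod (A n) / real n) \<longlonglongrightarrow> \<kappa>"
  and g: "\<And>z. g z \<ge> 0" "integrable lborel g" "(LINT z|lborel. g z) = 1"
   "closure {z. g z ~= 0} = R0" "continuous_on R0 g" "\<And>z. z \<in> R0 ==> g z > 0"
  and X_indep: "\<And>n. n \<ge> 1 ==> prob_space.indep_vars M (%_. borel) (X n) {1..n}"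
  and X_density: "\<And>n i. 1 <= i ==> i <= n \<Longrightarrow>
    distributed M lborel (X n i) (%x. ennreal (g (cdiv x (A n)) / cprod (A n)))"
  and indep: "\<And>n. n \<ge> 1 ==> prob_space.indep_sets M
    (%k. [gen_sigma M (X n) {1..n}, gen_sigma M e UNIV, gen_sigma M eps {1..n}] ! k) {..<3}"
  \<comment> \<open>random field and bandwidths\<close>
  and A12_pos: "\<And>n j. n \<ge> 1 ==> A1 n j > 0" "\<And>n j. n \<ge> 1 ==> A2 n j > 0"
  and e_stationary: "stationary M e"
  and e_moment: "q2 > 4" "integrable M (%\<omega>. \<bar>e 0 \<omega>\<bar> ^ q2)"
  and e_cov: "integrable lborel (%v. LINT \<omega>|M. e 0 \<omega> * e v \<omega>)"
  and blocks: "\<And>j. filterlim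
    (%n. min (A2 n j) (min (A1 n j / A2 n j) (A n j * h n j / A1 n j))) at_top sequentially"
  and \<beta>\<^sub>1: "antimono_on {0<..} \<beta>\<^sub>1" "(\<beta>\<^sub>1 \<longlongrightarrow> 0) at_top"
  and \<omega>\<^sub>2: "mono_on {0<..} \<omega>\<^sub>2"
  and mixing: "\<And>a b. a > 0 ==> b > 0 ==> beta_mix M e a b <= \<beta>\<^sub>1 a * \<omega>\<^sub>2 b"
  and h_lim: "\<And>j. (%n. h n j) \<longlonglongrightarrow> 0"
  and block_shape: "(%n. cprod (A1 n) / Max (range (A1 n)) ^ CARD('d::{finite,linorder})) \<in> \<Theta>(%_. 1)"
  and bandwidth: "\<exists>\<iota>>0. (%_. 1) \<in> O(%n. cprod (A n) powr (1 / 2) * cprod (h n) powr (1 / 2) /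
    (real n powr (1 / real q2) * Max (range (A1 n)) ^ CARD('d::{finite,linorder}) * ln (real n) powr (1 / 2 + \<iota>)))"
  and mixing_rate: "(%n. real n ^ CARD('d::{finite,linorder}) * cprod (A n) powr (1 - real CARD('d::{finite,linorder}) / 2) * cprod (h n) powr (real CARD('d::{finite,linorder}) / 2) /
    (ln (real n) powr (real CARD('d::{finite,linorder}) / 2) * cprod (A1 n)) * \<beta>\<^sub>1 (Min (range (A2 n))) * \<omega>\<^sub>2 (cprod (A n) * cprod (h n))) \<longlonglongrightarrow> 0"
  \<comment> \<open>kernel\<close>
  and K_int: "integrable lborel K" "(LINT z|lborel. K z) = 1"
  and K_bounded: "bounded (range K)"
  and K_supp: "C\<^sub>K > 0" "{z. K z ~= 0} \<subseteq> cbox (\<chi> j. - C\<^sub>K) (\<chi> j. C\<^sub>K)"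
   "cbox (\<chi> j. - C\<^sub>K) (\<chi> j. C\<^sub>K) \<subseteq> (R0 :: (real ^ 'd::{finite,linorder}) set)"
  and K_Lipschitz: "\<exists>L>0. \<forall>v1 v2. \<bar>K v1 - K v2\<bar> <= L * norm1 (v1 - v2)"
  and S: "invertible_mat (moment_matrix p K)"
  and q: "q1 \<ge> q2"
begin

abbreviation "Avol n \<equiv> cprod (A n)"
abbreviation "hvol n \<equiv> cprod (h n)"
abbreviation "side n \<equiv> Max (range (A1 n))"
definition esize :: "nat => real" where
 "esize n = Avol n * hvol n"

definition rate :: "nat => real" where
 "rate n = sqrt (ln (real n) / esize n)"

text \<open>A fixed choice of the exponent in the bandwidth condition.\<close>

definition slack :: real where
 "slack = (SOME \<iota>. 0 < \<iota> \<and> (%_. 1) \<in> O(%n. cprod (A n) powr (1 / 2) * cprod (h n) powr (1 / 2) /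
    (real n powr (1 / real q2) * Max (range (A1 n)) ^ CARD('d) * ln (real n) powr (1 / 2 + \<iota>))))"

text \<open>The truncation level. The logarithmic factor makes \<open>n / level^q2\<close> tend to zero, while half of the available power leaves
the other half for \<open>rate * side^d * level\<close>.\<close>

definition level :: "nat => real" where
 "level n = real n powr (1 / real q2) * ln (real n) powr (slack / 2)"

lemma Avol_pos: "1 <= n ==> 0 < Avol n"
 unfolding cprod_def using A_pos by (intro prod_pos) auto

lemma hvol_pos: "1 <= n ==> 0 < hvol n"
 unfolding cprod_def using h_pos by (intro prod_pos) auto

lemma esize_pos: "1 <= n ==> 0 < esize n"
 using Avol_pos hvol_pos by (simp add: esize_def)

lemma slack: "0 < slack"
 "(%_. 1) \<in> O(%n. cprod (A n) powr (1 / 2) * cprod (h n) powr (1 / 2) /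
    (real n powr (1 / real q2) * Max (range (A1 n)) ^ CARD('d) * ln (real n) powr (1 / 2 + slack)))"
 using someI_ex[OF bandwidth[unfolded Bex_def], folded slack_def] by auto

lemma eventually_all_coordinates:
 fixes P :: "nat => 'd => bool"
 assumes "\<And>j. \<forall>\<^sub>F n in sequentially. P n j"
 shows "\<forall>\<^sub>F n in sequentially. \<forall>j. P n j"
 using assms by (intro eventually_all_finite) auto

lemma eventually_ln_ge: "\<forall>\<^sub>F n in sequentially. c <= ln (real n)"
proof -
 have "filterlim (%n. ln (real n)) at_top sequentially"
  by (rule filterlim_compose[OF ln_at_top filterlim_real_sequentially])
 then show ?thesis unfolding filterlim_at_top by blast
qed

lemma eventually_A_ge_1: "\<forall>\<^sub>F n in sequentially. \<forall>j. 1 <= A n j"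
 using A_lim unfolding filterlim_at_top by (intro eventually_all_coordinates) blast

lemma eventually_h_le:
 assumes "0 < c"
 shows "\<forall>\<^sub>F n in sequentially. \<forall>j. h n j <= c"
proof (rule eventually_all_coordinates)
 fix j
 have "\<forall>\<^sub>F n in sequentially. h n j < c" using order_tendstoD(2)[OF h_lim[of j] assms] .
 then show "\<forall>\<^sub>F n in sequentially. h n j <= c" by eventually_elim simp
qed

lemma eventually_Avol_le: "\<forall>\<^sub>F n in sequentially. Avol n <= (\<kappa> + 1) * real n"
proof -
 have "\<forall>\<^sub>F n in sequentially. Avol n / real n < \<kappa> + 1"
  by (rule order_tendstoD(2)[OF \<kappa>(2)]) simp
 then show ?thesis using eventually_gt_at_top[of 0]
 proof eventually_elim
  case (elim n)
  then show ?case by (simp add: divide_less_eq)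
 qed
qed

lemma A_le_Avol:
 assumes "\<forall>j. 1 <= A n j"
 shows "A n j <= Avol n"
proof -
 have "A n j * 1 <= A n j * (\<Prod>i\<in>UNIV - {j}. A n i)"
  using assms by (intro mult_left_mono prod_ge_1) (auto intro: order_trans[OF zero_le_one])
 also have "... = Avol n" unfolding cprod_def by (rule prod.remove[symmetric]) auto
 finally show ?thesis by simp
qed

lemma hvol_le_1:
 assumes "\<forall>j. h n j <= 1" "1 <= n"
 shows "hvol n <= 1"
 unfolding cprod_def using assms h_pos by (intro prod_le_1) (auto intro: less_imp_le)

lemma A1_le_side: "A1 n j <= side n"
 by (intro Max_ge) auto

lemma cprod_A1_le: "1 <= n ==> cprod (A1 n) <= side n ^ CARD('d)"
 unfolding cprod_def using prod_mono[of UNIV "A1 n" "%_. side n"] A12_pos(1) A1_le_side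
 by (auto intro: less_imp_le)

lemma prod_remove_side_le:
 assumes "1 <= n"
 shows "cprod (A1 n) <= A1 n j * side n ^ (CARD('d) - 1)"
proof -
 have "cprod (A1 n) = A1 n j * (\<Prod>i\<in>UNIV - {j}. A1 n i)" unfolding cprod_def by (rule prod.remove) auto
 also have "... <= A1 n j * (\<Prod>i\<in>UNIV - {j}. side n)"
 proof (rule mult_left_mono)
  show "(\<Prod>i\<in>UNIV - {j}. A1 n i) <= (\<Prod>i\<in>UNIV - {j}. side n)"
   by (rule prod_mono) (use A12_pos(1)[OF assms] A1_le_side in \<open>simp add: less_imp_le\<close>)
  show "0 <= A1 n j" using A12_pos(1)[OF assms] by (rule less_imp_le)
 qed
 also have "(\<Prod>i\<in>UNIV - {j}. side n) = side n ^ (CARD('d) - 1)" by simp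
 finally show ?thesis .
qed

lemma shape_imp_A1_ge:
 assumes n: "1 <= n" and c: "0 < c0" and shape: "1 <= c0 * (cprod (A1 n) / side n ^ CARD('d))"
 shows "side n <= c0 * A1 n j"
proof -
 have s: "0 < side n" using A12_pos(1)[OF n, of j] A1_le_side[of n j] by (rule less_le_trans)
 then have sp: "0 < side n ^ CARD('d)" by (rule zero_less_power)
 have "1 <= (c0 * cprod (A1 n)) / side n ^ CARD('d)" using shape by simp
 then have "side n ^ CARD('d) <= c0 * cprod (A1 n)" using sp by (subst (asm) le_divide_eq_1_pos)
 also have "... <= c0 * (A1 n j * side n ^ (CARD('d) - 1))"
  using prod_remove_side_le[OF n] c by (intro mult_left_mono) auto
 also have "side n ^ CARD('d) = side n * side n ^ (CARD('d) - 1)"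
  by (rule power_eq_if[THEN trans]) simp
 finally have "side n * side n ^ (CARD('d) - 1) <= (c0 * A1 n j) * side n ^ (CARD('d) - 1)" by (simp only: mult.assoc)
 then show ?thesis by (rule mult_right_le_imp_le) (rule zero_less_power[OF s])
qed

text \<open>The shape condition makes all sides of the blocks comparable to the largest one, so cubes of side \<open>side n\<close> are still
small compared with the window \<open>A_j h_j\<close> of the kernel in every direction.\<close>

lemma eventually_blocks:
 "\<forall>\<^sub>F n in sequentially. 1 <= side n \<and> Min (range (A2 n)) <= side n \<and> (\<forall>j. 8 * side n <= A n j * h n j)"
proof -
 have "(%_. 1 :: real) \<in> O(%n. cprod (A1 n) / side n ^ CARD('d))"
  using block_shape by (rule bigthetaD2[THEN bigomega_iff_bigo[THEN iffD1]])
 then obtain c0 where c0: "0 < c0" "\<forall>\<^sub>F n in sequentially. norm (1 :: real) <= c0 * norm (cprod (A1 n) / side n ^ CARD('d))"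
  by (rule landau_o.bigE)
 have lim: "\<forall>\<^sub>F n in sequentially. \<forall>j. max 1 (8 * c0) <= min (A2 n j) (min (A1 n j / A2 n j) (A n j * h n j / A1 n j))"
  by (rule eventually_all_coordinates) (rule blocks[unfolded filterlim_at_top, THEN spec])
 from c0(2) lim eventually_ge_at_top[of 1] show ?thesis
 proof eventually_elim
  case (elim n)
  note pos = A12_pos[OF elim(3)]
  have a: "max 1 (8 * c0) <= A2 n j" "max 1 (8 * c0) <= A1 n j / A2 n j" "max 1 (8 * c0) <= A n j * h n j / A1 n j" for j
   using spec[OF elim(2), of j] by (simp_all only: min.bounded_iff)
  have j1: "1 <= A2 n j" for j using a(1)[of j] by (simp only: max.bounded_iff)
  have j2: "A2 n j <= A1 n j" for j
  proof -
   have "1 <= A1 n j / A2 n j" using a(2)[of j] by (simp only: max.bounded_iff)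
   then show ?thesis using pos(2)[of j] by (subst (asm) le_divide_eq_1_pos)
  qed
  have j3: "8 * c0 * A1 n j <= A n j * h n j" for j
  proof -
   have "8 * c0 <= A n j * h n j / A1 n j" using a(3)[of j] by (simp only: max.bounded_iff)
   then show ?thesis using pos(1)[of j] by (subst (asm) pos_le_divide_eq)
  qed
  let ?j0 = "undefined :: 'd"
  have s1: "1 <= side n" using j1[of ?j0] j2[of ?j0] A1_le_side[of n ?j0] by (rule order_trans[OF order_trans])
  have "Min (range (A2 n)) <= A2 n ?j0" by (intro Min_le) auto
  then have m: "Min (range (A2 n)) <= side n" using j2[of ?j0] A1_le_side[of n ?j0] by (rule order_trans[OF order_trans])
  have "0 <= cprod (A1 n) / side n ^ CARD('d)"
   unfolding cprod_def using s1 pos(1) by (intro divide_nonneg_nonneg prod_nonneg) (simp_all add: less_imp_le)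
  then have shape: "1 <= c0 * (cprod (A1 n) / side n ^ CARD('d))" using elim(1) by (simp only: real_norm_def abs_of_nonneg abs_one)
  have "8 * side n <= A n j * h n j" for j
  proof -
   have "8 * side n <= 8 * (c0 * A1 n j)" using shape_imp_A1_ge[OF elim(3) c0(1) shape] by (rule mult_left_mono) simp
   also have "... = 8 * c0 * A1 n j" by (simp only: mult.assoc)
   finally show ?thesis using j3 by (rule order_trans)
  qed
  then show ?case using s1 m by blast
 qed
qed

lemma eventually_bandwidth:
 "\<exists>c>0. \<forall>\<^sub>F n in sequentially. real n powr (1 / real q2) * side n ^ CARD('d) * ln (real n) powr (1 / 2 + slack) <= c * sqrt (esize n)"
proof -
 from slack(2) obtain c where c: "0 < c" "\<forall>\<^sub>F n in sequentially. norm (1 :: real) <= c * norm (cprod (A n) powr (1 / 2) * cprod (h n) powr (1 / 2) /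
    (real n powr (1 / real q2) * side n ^ CARD('d) * ln (real n) powr (1 / 2 + slack)))"
  by (rule landau_o.bigE)
 from c(2) eventually_blocks eventually_ge_at_top[of 3]
 have "\<forall>\<^sub>F n in sequentially. real n powr (1 / real q2) * side n ^ CARD('d) * ln (real n) powr (1 / 2 + slack) <= c * sqrt (esize n)"
 proof eventually_elim
  case (elim n)
  let ?D = "real n powr (1 / real q2) * side n ^ CARD('d) * ln (real n) powr (1 / 2 + slack)"
  have D: "0 < ?D" using elim by simp
  have "cprod (A n) powr (1 / 2) * cprod (h n) powr (1 / 2) = sqrt (esize n)"
   using Avol_pos[of n] hvol_pos[of n] elim by (simp add: powr_half_sqrt real_sqrt_mult esize_def)
  then have "1 <= c * (sqrt (esize n) / ?D)"
   using elim(1) D esize_pos[of n] elim(3) by simp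
  then show ?case using D by (simp add: le_divide_eq)
 qed
 with c(1) show ?thesis by blast
qed

lemma q2_pos: "0 < real q2" using e_moment(1) by simp

lemma level_bounds:
 assumes "1 <= ln (real n)" "1 <= n"
 shows "1 <= level n" "real n powr (1 / real q2) <= level n"
  and "real n / level n ^ q2 = ln (real n) powr - (slack * real q2 / 2)"
proof -
 have l: "1 <= ln (real n) powr (slack / 2)" using assms slack(1) by (intro ge_one_powr_ge_zero) auto
 have n1: "1 <= real n powr (1 / real q2)" using assms q2_pos by (intro ge_one_powr_ge_zero) auto
 show 1: "real n powr (1 / real q2) <= level n"
  unfolding level_def using l n1 by (intro mult_right_mono[of 1, simplified mult_1] order_trans[OF _ mult_left_mono[OF l]]) auto
 then show "1 <= level n" using n1 by linarith
 have "level n ^ q2 = (real n powr (1 / real q2)) powr real q2 * (ln (real n) powr (slack / 2)) powr real q2"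
 proof -
  have "0 < real n powr (1 / real q2)" "0 < ln (real n) powr (slack / 2)" using n1 l by linarith+
  then show ?thesis unfolding level_def power_mult_distrib by (simp only: powr_realpow)
 qed
 also have "... = real n * ln (real n) powr (slack * real q2 / 2)"
  using assms q2_pos by (simp add: powr_powr)
 finally show "real n / level n ^ q2 = ln (real n) powr - (slack * real q2 / 2)"
  using assms by (simp add: powr_minus field_simps)
qed

lemma ln_powr_neg_lim:
 assumes "0 < c"
 shows "(%n. ln (real n) powr - c) \<longlonglongrightarrow> 0"
proof -
 have "filterlim (%n. ln (real n)) at_top sequentially"
  by (rule filterlim_compose[OF ln_at_top filterlim_real_sequentially])
 then show ?thesis using assms by (intro tendsto_neg_powr) auto
qed

text \<open>This is what the bandwidth condition is for: the exponent contributed by one cube stays bounded.\<close>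

lemma rate_side_level_lim: "(%n. rate n * side n ^ CARD('d) * level n) \<longlonglongrightarrow> 0"
proof -
 obtain c where c: "0 < c" "\<forall>\<^sub>F n in sequentially. real n powr (1 / real q2) * side n ^ CARD('d) * ln (real n) powr (1 / 2 + slack) <= c * sqrt (esize n)"
  using eventually_bandwidth by blast
 have "\<forall>\<^sub>F n in sequentially. norm (rate n * side n ^ CARD('d) * level n) <= c * ln (real n) powr - (slack / 2)"
  using c(2) eventually_blocks eventually_ge_at_top[of 3]
 proof eventually_elim
  case (elim n)
  have L: "0 < ln (real n)" using elim by simp
  have q: "0 < sqrt (esize n)" using esize_pos[of n] elim by simp
  have r0: "0 <= rate n" unfolding rate_def using L esize_pos[of n] elim by simp
  have "rate n * side n ^ CARD('d) * level n = (real n powr (1 / real q2) * side n ^ CARD('d) * ln (real n) powr (1 / 2 + slack / 2)) / sqrt (esize n)"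
   unfolding rate_def level_def real_sqrt_divide using L by (simp add: powr_add powr_half_sqrt)
  also have "ln (real n) powr (1 / 2 + slack / 2) = ln (real n) powr (1 / 2 + slack) * ln (real n) powr - (slack / 2)"
  proof -
   have "1 / 2 + slack + - (slack / 2) = 1 / 2 + slack / 2" by simp
   then show ?thesis unfolding powr_add[symmetric] by (simp only:)
  qed
  also have "(real n powr (1 / real q2) * side n ^ CARD('d) * (ln (real n) powr (1 / 2 + slack) * ln (real n) powr - (slack / 2))) / sqrt (esize n)
   = (real n powr (1 / real q2) * side n ^ CARD('d) * ln (real n) powr (1 / 2 + slack)) * ln (real n) powr - (slack / 2) / sqrt (esize n)"
   by simp
  also have "... <= (c * sqrt (esize n)) * ln (real n) powr - (slack / 2) / sqrt (esize n)"
   using elim(1) q by (intro divide_right_mono mult_right_mono) auto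
  also have "... = c * ln (real n) powr - (slack / 2)" using q by simp
  finally have "rate n * side n ^ CARD('d) * level n <= c * ln (real n) powr - (slack / 2)" .
  moreover have "0 <= rate n * side n ^ CARD('d) * level n"
   using r0 elim unfolding level_def by simp
  ultimately show ?case by simp
 qed
 moreover have "(%n. c * ln (real n) powr - (slack / 2)) \<longlonglongrightarrow> 0"
  using tendsto_mult_right_zero[OF ln_powr_neg_lim[of "slack / 2"], of c] slack(1) by simp
 ultimately show ?thesis by (rule Lim_null_comparison)
qed

lemma eventually_level: "\<forall>\<^sub>F n in sequentially. 1 <= level n \<and> real n powr (1 / real q2) <= level n"
 using eventually_ln_ge[of 1] eventually_ge_at_top[of 1]
 by eventually_elim (use level_bounds in blast)

lemma rate_lims: "rate \<longlonglongrightarrow> 0" "(%n. rate n * level n) \<longlonglongrightarrow> 0"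
proof -
 have e: "\<forall>\<^sub>F n in sequentially. 0 <= rate n \<and> rate n <= rate n * level n \<and> rate n * level n <= rate n * side n ^ CARD('d) * level n"
  using eventually_level eventually_blocks eventually_ge_at_top[of 3]
 proof eventually_elim
  case (elim n)
  have r0: "0 <= rate n" unfolding rate_def using esize_pos[of n] elim by simp
  have s1: "1 <= side n ^ CARD('d)" using elim by simp
  have "rate n * 1 <= rate n * level n" using r0 elim by (intro mult_left_mono) auto
  moreover have "(rate n * level n) * 1 <= (rate n * level n) * side n ^ CARD('d)"
   using r0 elim s1 by (intro mult_left_mono) auto
  ultimately show ?case using r0 by (simp add: mult_ac)
 qed
 show lim: "(%n. rate n * level n) \<longlonglongrightarrow> 0"
  by (rule tendsto_sandwich[OF _ _ tendsto_const rate_side_level_lim]) (use e in \<open>auto elim!: eventually_mono\<close>)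
 show "rate \<longlonglongrightarrow> 0"
  by (rule tendsto_sandwich[OF _ _ tendsto_const lim]) (use e in \<open>auto elim!: eventually_mono\<close>)
qed

lemma rate_sq: "3 <= n ==> (rate n)\<^sup>2 * esize n = ln (real n)"
 unfolding rate_def using esize_pos[of n] by (simp add: less_imp_le)

lemma rate_pos: "3 <= n ==> 0 < rate n"
 unfolding rate_def using esize_pos[of n] by simp

lemma eventually_esize_ge: "\<forall>\<^sub>F n in sequentially. c * ln (real n) <= esize n"
proof -
 have "\<forall>\<^sub>F n in sequentially. rate n < sqrt (1 / (\<bar>c\<bar> + 1))" by (rule order_tendstoD(2)[OF rate_lims(1)]) simp
 then show ?thesis using eventually_ge_at_top[of 3]
 proof eventually_elim
  case (elim n)
  have "(rate n)\<^sup>2 <= (sqrt (1 / (\<bar>c\<bar> + 1)))\<^sup>2" using elim rate_pos[of n] by (intro power_mono) auto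
  then have "(rate n)\<^sup>2 * (\<bar>c\<bar> + 1) <= 1" by (simp add: field_simps)
  then have "((rate n)\<^sup>2 * (\<bar>c\<bar> + 1)) * esize n <= 1 * esize n" using esize_pos[of n] elim by (intro mult_right_mono) auto
  then have "(\<bar>c\<bar> + 1) * ((rate n)\<^sup>2 * esize n) <= esize n" by (simp only: mult_1_left mult_ac)
  then have "(\<bar>c\<bar> + 1) * ln (real n) <= esize n" using rate_sq[of n] elim by simp
  moreover have "c * ln (real n) <= (\<bar>c\<bar> + 1) * ln (real n)" using elim by (intro mult_right_mono) auto
  ultimately show ?case by linarith
 qed
qed

lemma eventually_esize_le: "\<forall>\<^sub>F n in sequentially. esize n <= (\<kappa> + 1) * real n"
 using eventually_Avol_le eventually_h_le[of 1, simplified] eventually_ge_at_top[of 1]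
proof eventually_elim
 case (elim n)
 have "Avol n * hvol n <= Avol n * 1" using hvol_le_1[of n] Avol_pos[of n] elim by (intro mult_left_mono) auto
 then show ?case using elim unfolding esize_def by linarith
qed

text \<open>The bias of truncation contributes this amount to the exponents of both noise sums.\<close>

lemma eventually_bias_level: "\<forall>\<^sub>F n in sequentially. rate n * esize n / level n ^ (q2 - 1) <= sqrt (\<kappa> + 1) * ln (real n)"
 using eventually_level eventually_esize_le eventually_ge_at_top[of 3] eventually_ln_ge[of 1]
proof eventually_elim
 case (elim n)
 have k: "0 <= \<kappa> + 1" using \<kappa>(1) by simp
 have "rate n * esize n = sqrt (ln (real n)) * sqrt (esize n)"
  unfolding rate_def real_sqrt_divide using esize_pos[of n] elim by (simp add: real_div_sqrt field_simps)
 also have "... <= ln (real n) * sqrt ((\<kappa> + 1) * real n)"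
 proof (intro mult_mono real_sqrt_le_mono)
  show "sqrt (ln (real n)) <= ln (real n)" using elim by (intro real_le_lsqrt) (auto simp: power2_eq_square mult_left_le intro: mult_le_cancel_left1[THEN iffD2])
 qed (use elim esize_pos[of n] in auto)
 finally have 1: "rate n * esize n <= ln (real n) * (sqrt (\<kappa> + 1) * sqrt (real n))" by (simp add: real_sqrt_mult)
 have "sqrt (real n) = real n powr (1 / 2)" by (simp add: powr_half_sqrt)
 also have "... <= real n powr (real (q2 - 1) / real q2)"
  using elim e_moment(1) by (intro powr_mono) (auto simp: field_simps of_nat_diff)
 also have "... = (real n powr (1 / real q2)) ^ (q2 - 1)"
  using elim by (simp add: powr_realpow[symmetric] powr_powr)
 also have "... <= level n ^ (q2 - 1)" using elim by (intro power_mono) auto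
 finally have 2: "sqrt (real n) <= level n ^ (q2 - 1)" .
 have lp: "0 < level n ^ (q2 - 1)" using elim by simp
 have "rate n * esize n <= (sqrt (\<kappa> + 1) * ln (real n)) * sqrt (real n)" using 1 by (simp add: mult_ac)
 also have "... <= (sqrt (\<kappa> + 1) * ln (real n)) * level n ^ (q2 - 1)" using 2 k elim by (intro mult_left_mono) auto
 finally show ?case using lp by (simp add: pos_divide_le_eq)
qed

lemma eventually_side_level: "\<exists>c. \<forall>\<^sub>F n in sequentially. side n ^ CARD('d) / level n ^ (q2 - 2) <= c"
proof -
 obtain c where c: "0 < c" "\<forall>\<^sub>F n in sequentially. real n powr (1 / real q2) * side n ^ CARD('d) * ln (real n) powr (1 / 2 + slack) <= c * sqrt (esize n)"
  using eventually_bandwidth by blast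
 have "\<forall>\<^sub>F n in sequentially. side n ^ CARD('d) / level n ^ (q2 - 2) <= c * sqrt (\<kappa> + 1)"
  using c(2) eventually_level eventually_esize_le eventually_ge_at_top[of 3] eventually_ln_ge[of 1] eventually_blocks
 proof eventually_elim
  case (elim n)
  have k: "0 <= \<kappa> + 1" using \<kappa>(1) by simp
  let ?N = "real n powr (1 / real q2)"
  have N: "0 < ?N" using elim by simp
  have l1: "1 <= ln (real n) powr (1 / 2 + slack)" using elim slack(1) by (intro ge_one_powr_ge_zero) auto
  have "?N * side n ^ CARD('d) * 1 <= ?N * side n ^ CARD('d) * ln (real n) powr (1 / 2 + slack)"
   using l1 elim by (intro mult_left_mono) auto
  also have "... <= c * sqrt (esize n)" by (rule elim(1))
  also have "... <= c * sqrt ((\<kappa> + 1) * real n)" using elim c(1) by (intro mult_left_mono real_sqrt_le_mono) auto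
  finally have 1: "?N * side n ^ CARD('d) <= c * sqrt (\<kappa> + 1) * sqrt (real n)" by (simp add: real_sqrt_mult mult.assoc)
  have "sqrt (real n) = real n powr (1 / 2)" by (simp add: powr_half_sqrt)
  also have "... <= real n powr (real (q2 - 1) / real q2)"
   using elim e_moment(1) by (intro powr_mono) (auto simp: field_simps of_nat_diff)
  also have "... = ?N ^ Suc (q2 - 2)"
   using elim e_moment(1) by (simp add: powr_realpow[symmetric] powr_powr Suc_diff_Suc numeral_2_eq_2)
  also have "... <= ?N * level n ^ (q2 - 2)" using elim N by (simp add: mult_left_mono power_mono)
  finally have 2: "sqrt (real n) <= ?N * level n ^ (q2 - 2)" .
  have "?N * side n ^ CARD('d) <= (c * sqrt (\<kappa> + 1)) * (?N * level n ^ (q2 - 2))"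
   using c(1) k by (intro order_trans[OF 1] mult_left_mono[OF 2]) auto
  then have "?N * side n ^ CARD('d) <= ?N * (c * sqrt (\<kappa> + 1) * level n ^ (q2 - 2))" by (simp add: mult_ac)
  then have "side n ^ CARD('d) <= c * sqrt (\<kappa> + 1) * level n ^ (q2 - 2)" using N by (simp only: mult_le_cancel_left_pos)
  then show ?case using elim by (simp add: pos_divide_le_eq)
 qed
 then show ?thesis by blast
qed

text \<open>The mixing coefficient at the distance and volume that occur for the cubes in one cell.\<close>

definition dep :: "nat => real" where
 "dep n = beta_mix M e (Min (range (A2 n))) (esize n)"

lemma e_measurable: "e x \<in> borel_measurable M"
 using e_field by (simp add: random_field_def)

lemma dep_nonneg: "1 <= n ==> 0 <= dep n"
proof -
 assume n: "1 <= n"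
 have u: "{} \<in> cube_unions (esize n)" unfolding cube_unions_def
  using esize_pos[OF n] by (intro CollectI exI[of _ "{}"]) (auto simp: disjoint_def)
 have "ereal (Min (range (A2 n))) <= set_dist1 {} {}" by (simp add: set_dist1_def top_ereal_def)
 from beta_bar_le_beta_mix[where e=e, OF e_measurable this u u] beta_bar_nonneg[where e=e, OF e_measurable, of "{}" "{}"]
 show "0 <= dep n" unfolding dep_def by linarith
qed

text \<open>The mixing rate condition involves \<open>n^d\<close> and half-integer powers; it dominates \<open>A_n / side^d\<close> because \<open>A_n\<close> is at most of
order \<open>n\<close> and \<open>A_n h_1 \<dots> h_d\<close> exceeds any multiple of \<open>ln n\<close>.\<close>

lemma dep_lim: "(%n. Avol n / side n ^ CARD('d) * dep n) \<longlonglongrightarrow> 0"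
proof -
 let ?d = "real CARD('d)"
 have "\<forall>\<^sub>F n in sequentially. norm (Avol n / side n ^ CARD('d) * dep n) \<le>
   real n ^ CARD('d) * cprod (A n) powr (1 - ?d / 2) * cprod (h n) powr (?d / 2) /
    (ln (real n) powr (?d / 2) * cprod (A1 n)) * \<beta>\<^sub>1 (Min (range (A2 n))) * \<omega>\<^sub>2 (cprod (A n) * cprod (h n))"
  using eventually_ge_at_top[of 3] eventually_blocks eventually_Avol_le eventually_esize_ge[of "(\<kappa> + 1)\<^sup>2"]
 proof eventually_elim
  case (elim n)
  have n1: "1 <= n" using elim by simp
  have Ap: "0 < Avol n" and hp: "0 < hvol n" using Avol_pos[OF n1] hvol_pos[OF n1] .
  have L: "0 < ln (real n)" using elim by simp
  have m: "0 < Min (range (A2 n))" using A12_pos(2)[OF n1] by (subst Min_gr_iff) auto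
  have c1: "0 < cprod (A1 n)" unfolding cprod_def using A12_pos(1)[OF n1] by (intro prod_pos) auto
  have mx: "dep n <= \<beta>\<^sub>1 (Min (range (A2 n))) * \<omega>\<^sub>2 (esize n)"
   unfolding dep_def using mixing[OF m esize_pos[OF n1]] .
  have "Avol n * (Avol n * ln (real n)) = (Avol n)\<^sup>2 * ln (real n)" by (simp only: power2_eq_square mult.assoc)
  also have "... <= ((\<kappa> + 1) * real n)\<^sup>2 * ln (real n)"
   using elim(3) Ap L by (intro mult_right_mono power_mono) auto
  also have "... = (real n)\<^sup>2 * ((\<kappa> + 1)\<^sup>2 * ln (real n))" by (simp only: power_mult_distrib mult_ac)
  also have "... <= (real n)\<^sup>2 * esize n" by (rule mult_left_mono[OF elim(4)]) simp
  also have "... = Avol n * ((real n)\<^sup>2 * hvol n)" by (simp only: esize_def mult_ac)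
  finally have "Avol n * ln (real n) <= (real n)\<^sup>2 * hvol n" using Ap by (simp only: mult_le_cancel_left_pos)
  then have ge1: "1 <= (real n)\<^sup>2 * hvol n / (Avol n * ln (real n))"
   using Ap L by (subst le_divide_eq_1_pos) simp_all
  let ?F = "((real n)\<^sup>2 * hvol n / (Avol n * ln (real n))) powr (?d / 2)"
  have F1: "1 <= ?F" using ge1 by (intro ge_one_powr_ge_zero) auto
  have Fn: "((real n)\<^sup>2) powr (?d / 2) = real n ^ CARD('d)"
  proof -
   have "(real n)\<^sup>2 = real n powr 2" using elim(1) by simp
   then have "((real n)\<^sup>2) powr (?d / 2) = real n powr (2 * (?d / 2))" by (simp only: powr_powr)
   also have "2 * (?d / 2) = ?d" by simp
   finally show ?thesis using elim(1) by (simp only: powr_realpow)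
  qed
  have Feq: "Avol n / cprod (A1 n) * ?F = real n ^ CARD('d) * Avol n powr (1 - ?d / 2) * hvol n powr (?d / 2) / (ln (real n) powr (?d / 2) * cprod (A1 n))"
  proof -
   have "?F = real n ^ CARD('d) * hvol n powr (?d / 2) / (Avol n powr (?d / 2) * ln (real n) powr (?d / 2))"
    using Ap hp L by (simp add: powr_divide powr_mult Fn)
   moreover have "Avol n powr (1 - ?d / 2) = Avol n / Avol n powr (?d / 2)"
    using Ap by (simp add: powr_diff)
   ultimately show ?thesis by (simp add: mult_ac)
  qed
  have "Avol n / side n ^ CARD('d) <= Avol n / cprod (A1 n)"
   using Ap c1 cprod_A1_le[OF n1] by (intro divide_left_mono) auto
  also have "... = Avol n / cprod (A1 n) * 1" by simp
  also have "... <= Avol n / cprod (A1 n) * ?F" using F1 Ap c1 by (intro mult_left_mono) auto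
  finally have 1: "Avol n / side n ^ CARD('d) <= Avol n / cprod (A1 n) * ?F" .
  have a0: "0 <= Avol n / side n ^ CARD('d)" using Ap elim by simp
  have fin: "Avol n / side n ^ CARD('d) * dep n <= (Avol n / cprod (A1 n) * ?F) * (\<beta>\<^sub>1 (Min (range (A2 n))) * \<omega>\<^sub>2 (esize n))"
   by (rule mult_mono[OF 1 mx _ dep_nonneg[OF n1]]) (rule order_trans[OF a0 1])
  have x0: "0 <= Avol n / side n ^ CARD('d) * dep n" using a0 dep_nonneg[OF n1] by (rule mult_nonneg_nonneg)
  show ?case
   unfolding real_norm_def abs_of_nonneg[OF x0] using fin unfolding Feq esize_def by (simp only: mult.assoc)
 qed
 then show ?thesis using mixing_rate by (rule Lim_null_comparison)
qed

end

type_synonym 'd point = "(real, 'd) Finite_Cartesian_Product.vec"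

section \<open>The design density\<close>

text \<open>The union bound over a net of size \<open>c n^k\<close> against a tail \<open>n powr (- k - 1)\<close>.\<close>

lemma prob_bound_power_lim:
 fixes c :: real
 shows "(%n. c * real n ^ k * exp (- (real k + 1) * ln (real n))) \<longlonglongrightarrow> 0"
proof -
 have "(%n. c * (1 / real n)) \<longlonglongrightarrow> c * 0" by (intro tendsto_mult_left lim_1_over_n)
 moreover have "\<forall>\<^sub>F n in sequentially. c * (1 / real n) = c * real n ^ k * exp (- (real k + 1) * ln (real n))"
  using eventually_gt_at_top[of 0]
 proof eventually_elim
  case (elim n)
  have "exp (- (real k + 1) * ln (real n)) = exp (- ln (real n)) * exp (- (real k * ln (real n)))"
   by (simp add: exp_add[symmetric] algebra_simps)
  also have "exp (real k * ln (real n)) = real n ^ k" using elim by (simp add: exp_of_nat_mult)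
  then have "exp (- (real k * ln (real n))) = 1 / real n ^ k" by (simp only: exp_minus inverse_eq_divide)
  finally show ?case using elim by (simp add: exp_minus field_simps)
 qed
 ultimately show ?thesis by (simp add: filterlim_cong tendsto_cong)
qed

context spatial_regression begin

abbreviation "site n z x \<equiv> scaled_site (A n) (h n) z x"
abbreviation "region n \<equiv> trimmed_box C\<^sub>K (h n)"
abbreviation "dens n \<equiv> %x. g (cdiv x (A n)) / Avol n"

abbreviation "site_law n \<equiv> density lborel (%x. ennreal (dens n x))"

text \<open>The variance functions are continuous on the box only; the extension by zero is measurable, and it makes no difference
where the kernel does not vanish.\<close>

definition on_R0 :: "('d point => real) => nat => 'd point => real" where
 "on_R0 \<psi> n x = (if cdiv x (A n) \<in> R0 then \<psi> (cdiv x (A n)) else 0)"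

lemma CK_le: "C\<^sub>K <= 1 / 2"
proof -
 have "((\<chi> j. C\<^sub>K) :: 'd point) \<in> cbox (\<chi> j. - C\<^sub>K) (\<chi> j. C\<^sub>K)" using K_supp(1) by (simp add: mem_box_cart)
 then have "((\<chi> j. C\<^sub>K) :: 'd point) \<in> R0" using K_supp(3) by blast
 then show ?thesis by (auto simp: R0_def mem_box_cart)
qed

lemma cdiv_measurable: "(%x. cdiv x a) \<in> measurable borel (borel :: 'd point measure)"
proof -
 have "continuous_on UNIV (%x :: 'd point. \<chi> j. x $ j * inverse (a j))"
  by (intro continuous_on_vec_lambda continuous_intros)
 then show ?thesis unfolding cdiv_def divide_inverse by (rule borel_measurable_continuous_onI)
qed

lemma site_measurable: "(%x. site n z x) \<in> measurable borel borel"
proof -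
 have "continuous_on UNIV (%x :: 'd point. \<chi> j. (x $ j * inverse (A n j) - z $ j) * inverse (h n j))"
  by (intro continuous_on_vec_lambda continuous_intros)
 then show ?thesis unfolding scaled_site_def divide_inverse by (rule borel_measurable_continuous_onI)
qed

lemma on_R0_measurable:
 fixes \<psi> :: "'d point => real"
 assumes "continuous_on R0 \<psi>"
 shows "on_R0 \<psi> n \<in> borel_measurable borel"
proof -
 have "(%u. indicator R0 u *\<^sub>R \<psi> u) \<in> borel_measurable borel"
  by (rule borel_measurable_continuous_on_indicator[OF _ assms]) (simp add: R0_def)
 from measurable_compose[OF cdiv_measurable[of "A n"] this] show ?thesis
  by (rule measurable_cong[THEN iffD1, rotated]) (simp add: on_R0_def)
qed

lemma on_R0_bounded:
 fixes \<psi> :: "'d point => real"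
 assumes "continuous_on R0 \<psi>"
 shows "\<exists>C\<ge>0. \<forall>n x. \<bar>on_R0 \<psi> n x\<bar> <= C"
proof -
 have "compact (R0 :: 'd point set)" unfolding R0_def by (rule compact_cbox)
 then have "bounded (\<psi> ` R0)" using assms by (intro compact_imp_bounded compact_continuous_image)
 then obtain C where C: "\<And>y. y \<in> \<psi> ` R0 ==> norm y <= C" unfolding bounded_iff by metis
 have "\<bar>on_R0 \<psi> n x\<bar> <= max 0 C" for n x
  using C[of "\<psi> (cdiv x (A n))"] by (auto simp: on_R0_def)
 then show ?thesis by (intro exI[of _ "max 0 C"]) simp
qed

lemma g_outside: "z \<notin> R0 ==> g z = 0"
 using closure_subset[of "{z. g z ~= 0}"] g(4) by auto

lemma g_bounded: "\<exists>C>0. \<forall>z. g z <= C"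
proof -
 have "compact (R0 :: 'd point set)" unfolding R0_def by (rule compact_cbox)
 then have "bounded (g ` R0)" using g(5) by (intro compact_imp_bounded compact_continuous_image)
 then obtain C where C: "\<And>y. y \<in> g ` R0 ==> norm y <= C" unfolding bounded_iff by metis
 have "g z <= max 1 C" for z
  using C[of "g z"] g_outside[of z] by (cases "z \<in> R0") auto
 then show ?thesis by (intro exI[of _ "max 1 C"]) auto
qed

definition gmax :: real where "gmax = (SOME C. 0 < C \<and> (\<forall>z. g z <= C))"

lemma gmax: "0 < gmax" "g z <= gmax"
 using someI_ex[OF g_bounded[unfolded Bex_def], folded gmax_def] by auto

lemma g_measurable: "g \<in> borel_measurable borel"
 using borel_measurable_integrable[OF g(2)] by simp

lemma dens: "1 <= n ==> 0 <= dens n x" "1 <= n ==> dens n x <= gmax / Avol n" "dens n \<in> borel_measurable borel"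
proof -
 show "0 <= dens n x" if "1 <= n" using g(1) Avol_pos[OF that] by (intro divide_nonneg_pos)
 show "dens n x <= gmax / Avol n" if "1 <= n" using gmax(2) Avol_pos[OF that] by (intro divide_right_mono) auto
 show "dens n \<in> borel_measurable borel"
  using measurable_compose[OF cdiv_measurable[of "A n"] g_measurable] by measurable
qed

lemma X_law: "1 <= i ==> i <= n ==> distr M borel (X n i) = site_law n"
proof -
 assume i: "1 <= i" "i <= n"
 have "distr M borel (X n i) = distr M lborel (X n i)" by (rule distr_cong) auto
 also have "... = site_law n"
  using X_density[OF i] unfolding distributed_def by blast
 finally show ?thesis .
qed

lemma X_measurable: "1 <= i ==> i <= n ==> X n i \<in> borel_measurable M"
 using X_density[of i n] unfolding distributed_def by simp

text \<open>The trimming of the region keeps the whole kernel window inside the sampling box.\<close>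

lemma site_in_R0:
 assumes n: "1 <= n" and z: "z \<in> region n" and v: "\<And>j. \<bar>site n z x $ j\<bar> <= C\<^sub>K"
 shows "cdiv x (A n) \<in> R0"
proof -
 have "- 1/2 <= x $ j / A n j \<and> x $ j / A n j <= 1/2" for j
 proof -
  have hp: "0 < h n j" using h_pos[OF n] .
  have "\<bar>x $ j / A n j - z $ j\<bar> = \<bar>site n z x $ j\<bar> * h n j" using hp by (simp add: scaled_site_def abs_divide)
  also have "... <= C\<^sub>K * h n j" using v[of j] hp by (intro mult_right_mono) auto
  finally have "\<bar>x $ j / A n j - z $ j\<bar> <= C\<^sub>K * h n j" .
  moreover have "- 1 / 2 + C\<^sub>K * h n j <= z $ j" "z $ j <= 1 / 2 - C\<^sub>K * h n j"
   using z by (auto simp: trimmed_box_def mem_box_cart)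
  ultimately show ?thesis unfolding abs_le_iff by linarith
 qed
 then show ?thesis by (simp add: R0_def mem_box_cart cdiv_def)
qed

lemma region_subset_R0: "1 <= n ==> region n \<subseteq> R0"
proof
 fix z assume n: "1 <= n" and z: "z \<in> region n"
 have "- 1/2 <= z $ j \<and> z $ j <= 1/2" for j
 proof -
  have "0 <= C\<^sub>K * h n j" using K_supp(1) h_pos[OF n, of j] by simp
  moreover have "- 1 / 2 + C\<^sub>K * h n j <= z $ j" "z $ j <= 1 / 2 - C\<^sub>K * h n j"
   using z by (auto simp: trimmed_box_def mem_box_cart)
  ultimately show ?thesis by linarith
 qed
 then show "z \<in> R0" by (simp add: R0_def mem_box_cart)
qed

lemma site_integral:
 fixes F :: "'d point => real"
 assumes n: "1 <= n" and F: "F \<in> borel_measurable borel"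
 shows "(\<integral>x. F (site n z x) * dens n x \<partial>lborel) = hvol n * (\<integral>v. F v * g (\<chi> j. z $ j + h n j * v $ j) \<partial>lborel)"
proof -
 let ?c = "%j. A n j * h n j" and ?b = "\<chi> j. A n j * z $ j"
 have c: "0 < ?c j" for j using A_pos[OF n] h_pos[OF n] by simp
 have m: "(%x. F (site n z x) * dens n x) \<in> borel_measurable borel"
  using measurable_compose[OF site_measurable[of n z] F] dens(3)[of n] by measurable
 have s: "site n z (\<chi> j. ?b $ j + ?c j * v $ j) = v" for v
  using A_pos[OF n] h_pos[OF n] unfolding scaled_site_def
  by (auto simp: Finite_Cartesian_Product.vec_eq_iff field_simps less_imp_neq[symmetric])
 have d: "cdiv (\<chi> j. ?b $ j + ?c j * v $ j) (A n) = (\<chi> j. z $ j + h n j * v $ j)" for v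
  using A_pos[OF n] unfolding cdiv_def
  by (auto simp: Finite_Cartesian_Product.vec_eq_iff field_simps less_imp_neq[symmetric])
 have cp: "cprod ?c = Avol n * hvol n" unfolding cprod_def by (rule prod.distrib)
 have "(\<integral>x. F (site n z x) * dens n x \<partial>lborel) = cprod ?c * (\<integral>v. F v * (g (\<chi> j. z $ j + h n j * v $ j) / Avol n) \<partial>lborel)"
  unfolding lborel_integral_diagonal[where G="%x. F (site n z x) * dens n x" and b="?b" and c="?c", OF c m] s d by (rule refl)
 also have "... = hvol n * (\<integral>v. F v * g (\<chi> j. z $ j + h n j * v $ j) \<partial>lborel)"
  using Avol_pos[OF n] unfolding cp by simp
 finally show ?thesis .
qed

lemma support_integral:
 fixes F :: "'d point => real"
 assumes F: "F \<in> borel_measurable borel" "\<And>v. \<bar>F v\<bar> <= c" "\<And>v. F v ~= 0 ==> (\<forall>j. \<bar>v $ j\<bar> <= C\<^sub>K)"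
 shows "integrable lborel (F :: 'd point => real)" "\<bar>\<integral>v. F v \<partial>lborel\<bar> <= c"
proof -
 have c0: "0 <= c" using F(2)[of undefined] by linarith
 have b: "(((\<chi> j. 1 / 2) :: 'd point) - (\<chi> j. - 1 / 2)) \<bullet> b = 1 \<and> ((\<chi> j. - 1 / 2) :: 'd point) \<bullet> b <= (\<chi> j. 1 / 2) \<bullet> b" if "b \<in> Basis" for b :: "'d point"
  using that by (auto simp: Basis_vec_def inner_axis)
 have e: "emeasure lborel (R0 :: 'd point set) = 1"
 proof -
  have "emeasure lborel (R0 :: 'd point set) = (\<Prod>b\<in>Basis. (((\<chi> j. 1 / 2) :: 'd point) - (\<chi> j. - 1 / 2)) \<bullet> b)"
   unfolding R0_def using b by (intro emeasure_lborel_cbox) blast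
  also have "(\<Prod>b\<in>Basis. (((\<chi> j. 1 / 2) :: 'd point) - (\<chi> j. - 1 / 2)) \<bullet> b) = 1" using b by (intro prod.neutral) blast
  finally show ?thesis by simp
 qed
 have sR: "(R0 :: 'd point set) \<in> sets lborel" by (simp add: R0_def)
 have mR: "measure lborel (R0 :: 'd point set) = 1" using e by (simp add: measure_def)
 have iR: "integrable lborel (%v :: 'd point. c * indicator R0 v :: real)"
  using e sR by (intro integrable_mult_right integrable_real_indicator) auto
 have le: "\<bar>F v\<bar> <= c * indicator R0 v" for v :: "'d point"
 proof (cases "F v = 0")
  case False
  then have "\<bar>v $ j\<bar> <= 1/2" for j using F(3)[OF False] CK_le order_trans by blast
  note v = this
  have "- 1/2 <= v $ j \<and> v $ j <= 1/2" for j using v[of j] unfolding abs_le_iff by linarith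
  then have "v \<in> R0" by (simp add: R0_def mem_box_cart)
  then show ?thesis using F(2)[of v] by simp
 qed (use c0 in simp)
 show i: "integrable lborel F"
  by (rule Bochner_Integration.integrable_bound[OF iR]) (use F(1) le c0 in \<open>auto simp: abs_mult\<close>)
 have "\<bar>\<integral>v. F v \<partial>lborel\<bar> <= (\<integral>v. \<bar>F v\<bar> \<partial>lborel)" using integral_norm_bound[of lborel F] by simp
 also have "... <= (\<integral>v. c * indicator (R0 :: 'd point set) v \<partial>lborel)" using i iR le by (intro integral_mono) auto
 also have "... = c" using mR sR by simp
 finally show "\<bar>\<integral>v. F v \<partial>lborel\<bar> <= c" .
qed

lemma shift_measurable: "(%v. \<chi> j. z $ j + h n j * v $ j) \<in> measurable borel (borel :: 'd point measure)"
 by (intro borel_measurable_continuous_onI continuous_on_vec_lambda continuous_intros)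

text \<open>A site hits the kernel window with probability of order \<open>h_1 \<dots> h_d\<close>.\<close>

lemma site_law_integral_le:
 fixes F :: "'d point => real"
 assumes n: "1 <= n" and F: "F \<in> borel_measurable borel" and c: "0 <= c"
  and le: "\<And>x. \<bar>F x\<bar> <= (if \<forall>j. \<bar>site n z x $ j\<bar> <= C\<^sub>K then c else 0)"
 shows "\<bar>\<integral>x. F x \<partial>site_law n\<bar> <= c * (gmax * hvol n)"
proof -
 define H where "H = (%v :: 'd point. if \<forall>j. \<bar>v $ j\<bar> <= C\<^sub>K then c else 0)"
 have Hb: "H = (%v. c * indicator (cbox (\<chi> j. - C\<^sub>K) (\<chi> j. C\<^sub>K)) v)"
 proof
  fix v :: "'d point"
  have "(\<forall>j. \<bar>v $ j\<bar> <= C\<^sub>K) \<longleftrightarrow> v \<in> cbox (\<chi> j. - C\<^sub>K) (\<chi> j. C\<^sub>K)"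
   unfolding mem_box_cart vec_lambda_beta by (rule iff_allI) (auto simp: abs_le_iff)
  then show "H v = c * indicator (cbox (\<chi> j. - C\<^sub>K) (\<chi> j. C\<^sub>K)) v"
   unfolding H_def by (auto simp: indicator_def)
 qed
 have Hm: "H \<in> borel_measurable borel" unfolding Hb by measurable
 have Hx: "\<bar>F x\<bar> <= H (site n z x)" for x using le[of x] unfolding H_def .
 let ?G = "%v. H v * g (\<chi> j. z $ j + h n j * v $ j)"
 have G: "integrable lborel ?G" "\<bar>\<integral>v. ?G v \<partial>lborel\<bar> <= c * gmax"
 proof -
  have a1: "?G \<in> borel_measurable borel" using Hm measurable_compose[OF shift_measurable[of z n] g_measurable] by measurable
  have a2: "\<bar>?G v\<bar> <= c * gmax" for v
   unfolding abs_mult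
  proof (rule mult_mono)
   show "\<bar>H v\<bar> <= c" using c unfolding H_def by simp
   show "\<bar>g (\<chi> j. z $ j + h n j * v $ j)\<bar> <= gmax" using g(1) gmax(2) by (simp only: abs_of_nonneg)
  qed (use c in auto)
  have a3: "\<forall>j. \<bar>v $ j\<bar> <= C\<^sub>K" if "?G v ~= 0" for v using that unfolding H_def by (auto split: if_splits)
  show "integrable lborel ?G" by (rule support_integral(1)[OF a1 a2 a3])
  show "\<bar>\<integral>v. ?G v \<partial>lborel\<bar> <= c * gmax" by (rule support_integral(2)[OF a1 a2 a3])
 qed
 have intH: "integrable lborel (%x. H (site n z x) * dens n x)"
 proof -
  let ?S = "cbox (\<chi> j. A n j * (z $ j - h n j * C\<^sub>K)) (\<chi> j. A n j * (z $ j + h n j * C\<^sub>K))"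
  have S: "x \<in> ?S" if "\<forall>j. \<bar>site n z x $ j\<bar> <= C\<^sub>K" for x
  proof -
   have "A n j * (z $ j - h n j * C\<^sub>K) <= x $ j \<and> x $ j <= A n j * (z $ j + h n j * C\<^sub>K)" for j
   proof -
    have p: "0 < A n j" "0 < h n j" using A_pos[OF n] h_pos[OF n] by auto
    have a: "\<bar>site n z x $ j\<bar> <= C\<^sub>K" using that by blast
    have "- C\<^sub>K <= site n z x $ j" "site n z x $ j <= C\<^sub>K"
     using abs_le_D1[OF a] abs_le_D2[OF a] by linarith+
    then have "- C\<^sub>K <= (x $ j / A n j - z $ j) / h n j" "(x $ j / A n j - z $ j) / h n j <= C\<^sub>K"
     by (simp_all only: scaled_site_def vec_lambda_beta)
    then have "- C\<^sub>K * h n j <= x $ j / A n j - z $ j" "x $ j / A n j - z $ j <= C\<^sub>K * h n j"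
     using p(2) by (simp_all add: pos_le_divide_eq pos_divide_le_eq)
    then have "z $ j - h n j * C\<^sub>K <= x $ j / A n j" "x $ j / A n j <= z $ j + h n j * C\<^sub>K" by (simp_all add: algebra_simps)
    then show ?thesis using p(1) by (simp add: pos_le_divide_eq pos_divide_le_eq mult.commute)
   qed
   then show ?thesis by (simp add: mem_box_cart)
  qed
  have "integrable lborel (%x. (c * (gmax / Avol n)) * indicator ?S x :: real)"
   by (intro integrable_mult_right integrable_real_indicator emeasure_lborel_cbox_finite) simp
  then show ?thesis
  proof (rule Bochner_Integration.integrable_bound)
   show "(%x. H (site n z x) * dens n x) \<in> borel_measurable lborel"
    using measurable_compose[OF site_measurable[of n z] Hm] dens(3)[of n] by measurable
   show "AE x in lborel. norm (H (site n z x) * dens n x) <= norm ((c * (gmax / Avol n)) * indicator ?S x :: real)"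
   proof (rule AE_I2)
    fix x
    show "norm (H (site n z x) * dens n x) <= norm ((c * (gmax / Avol n)) * indicator ?S x :: real)"
    proof (cases "\<forall>j. \<bar>site n z x $ j\<bar> <= C\<^sub>K")
     case True
     have "norm (H (site n z x) * dens n x) <= c * (gmax / Avol n)"
      unfolding real_norm_def abs_mult
     proof (rule mult_mono)
      show "\<bar>H (site n z x)\<bar> <= c" using c unfolding H_def by simp
      show "\<bar>dens n x\<bar> <= gmax / Avol n" using dens(1,2)[OF n, of x] by (simp only: abs_of_nonneg)
     qed (use c in auto)
     then show ?thesis using S[OF True] c gmax(1) Avol_pos[OF n] by simp
    next
     case False
     then have "H (site n z x) = 0" unfolding H_def by auto
     then show ?thesis by simp
    qed
   qed
  qed
 qed
 have "(\<integral>x. F x \<partial>site_law n) = (\<integral>x. dens n x * F x \<partial>lborel)"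
  using F dens(1)[OF n] dens(3)[of n] by (subst integral_density) auto
 also have "\<bar>...\<bar> <= (\<integral>x. \<bar>dens n x * F x\<bar> \<partial>lborel)" using integral_norm_bound[of lborel "%x. dens n x * F x"] by simp
 also have "... <= (\<integral>x. H (site n z x) * dens n x \<partial>lborel)"
 proof (rule integral_mono'[OF intH])
  fix x
  show "\<bar>dens n x * F x\<bar> <= H (site n z x) * dens n x"
   unfolding abs_mult abs_of_nonneg[OF dens(1)[OF n]] using mult_right_mono[OF Hx[of x] dens(1)[OF n, of x]]
   by (simp only: mult.commute)
  show "0 <= H (site n z x) * dens n x" using order_trans[OF abs_ge_zero Hx[of x]] dens(1)[OF n, of x] by (rule mult_nonneg_nonneg)
 qed
 also have "... = hvol n * (\<integral>v. ?G v \<partial>lborel)" by (rule site_integral[OF n Hm])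
 also have "... <= hvol n * (c * gmax)" using G(2) hvol_pos[OF n] by (intro mult_left_mono) auto
 finally show ?thesis by (simp add: mult_ac)
qed

section \<open>Nets for the design region\<close>

abbreviation "low n \<equiv> (\<chi> j. - 1 / 2 + C\<^sub>K * h n j)"
abbreviation "fine_mesh n j \<equiv> h n j / (real n)\<^sup>2"

text \<open>The mesh \<open>h / n^2\<close> is fine enough that moving to the nearest net point changes the averages of truncated noise by less than
the rate, and coarse enough for a polynomial number of points.\<close>

definition net :: "nat => 'd point set" where
 "net n = net_point (low n) (fine_mesh n) ` region n"

lemma fine_mesh_pos: "1 <= n ==> 0 < fine_mesh n j"
 by (rule divide_pos_pos) (auto intro: h_pos)

lemma net_subset:
 assumes n: "1 <= n"
 shows "net n \<subseteq> region n"
proof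
 fix y assume "y \<in> net n"
 then obtain z where z: "z \<in> region n" and y: "y = net_point (low n) (fine_mesh n) z" unfolding net_def by (rule imageE)
 show "y \<in> region n"
  using net_point_mem[where \<delta>="fine_mesh n", OF _ z[unfolded trimmed_box_def]] fine_mesh_pos[OF n]
  unfolding y trimmed_box_def by simp
qed

lemma finite_net: "1 <= n ==> finite (net n)"
 unfolding net_def trimmed_box_def by (rule net_finite_card(1)) (rule fine_mesh_pos)

lemma eventually_h_inverse: "\<forall>\<^sub>F n in sequentially. (\<forall>j. 1 / h n j <= (\<kappa> + 1) * real n) \<and> 1 / hvol n <= (\<kappa> + 1) * real n"
 using eventually_blocks eventually_Avol_le eventually_A_ge_1 eventually_esize_ge[of 1] eventually_ln_ge[of 1] eventually_ge_at_top[of 1]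
proof eventually_elim
 case (elim n)
 have "1 / h n j <= (\<kappa> + 1) * real n" for j
 proof -
  have hp: "0 < h n j" using h_pos elim by simp
  have "1 <= A n j * h n j" using elim(1) by (smt (verit))
  then have "1 / h n j <= A n j" using hp by (simp add: pos_divide_le_eq)
  also have "... <= Avol n" by (rule A_le_Avol[OF elim(3)])
  finally show ?thesis using elim(2) by linarith
 qed
 moreover have "1 / hvol n <= (\<kappa> + 1) * real n"
 proof -
  have hp: "0 < hvol n" using hvol_pos elim by simp
  have "1 <= Avol n * hvol n" using elim(4,5) unfolding esize_def by linarith
  then have "1 / hvol n <= Avol n" using hp by (simp add: pos_divide_le_eq)
  then show ?thesis using elim(2) by linarith
 qed
 ultimately show ?case by blast
qed

lemma region_length: "1 <= n ==> (1 / 2 - C\<^sub>K * h n j) - (- 1 / 2 + C\<^sub>K * h n j) <= 1"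
proof -
 assume "1 <= n"
 then have "0 <= C\<^sub>K * h n j" using K_supp(1) h_pos[of n j] by simp
 then show ?thesis by simp
qed

lemma eventually_card_net:
 "\<forall>\<^sub>F n in sequentially. real (card (net n)) <= (\<kappa> + 2) ^ CARD('d) * real n ^ (3 * CARD('d))"
 using eventually_h_inverse eventually_ge_at_top[of 1]
proof eventually_elim
 case (elim n)
 have n: "1 <= real n" using elim by simp
 have "real (card (net n)) <= (\<Prod>j\<in>UNIV. max 0 (((\<chi> j. 1 / 2 - C\<^sub>K * h n j) $ j - low n $ j) / fine_mesh n j) + 1)"
  unfolding net_def trimmed_box_def by (rule net_finite_card(2)) (rule fine_mesh_pos[OF elim(2)])
 also have "... <= (\<Prod>j\<in>(UNIV :: 'd set). (\<kappa> + 2) * real n ^ 3)"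
 proof (intro prod_mono conjI)
  fix j
  have mp: "0 < fine_mesh n j" by (rule fine_mesh_pos[OF elim(2)])
  have "((1 / 2 - C\<^sub>K * h n j) - (- 1 / 2 + C\<^sub>K * h n j)) / fine_mesh n j <= 1 / fine_mesh n j"
   using mp by (intro divide_right_mono region_length[OF elim(2)]) auto
  also have "1 / fine_mesh n j = (1 / h n j) * (real n)\<^sup>2" by simp
  also have "... <= ((\<kappa> + 1) * real n) * (real n)\<^sup>2" using elim(1) by (intro mult_right_mono) auto
  also have "... = (\<kappa> + 1) * real n ^ 3" by (simp add: power2_eq_square power3_eq_cube)
  finally have "max 0 (((1 / 2 - C\<^sub>K * h n j) - (- 1 / 2 + C\<^sub>K * h n j)) / fine_mesh n j) <= (\<kappa> + 1) * real n ^ 3"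
   using \<kappa>(1) by (intro max.boundedI) auto
  moreover have "1 <= real n ^ 3" using n by (rule one_le_power)
  ultimately show "max 0 (((\<chi> j. 1 / 2 - C\<^sub>K * h n j) $ j - low n $ j) / fine_mesh n j) + 1 <= (\<kappa> + 2) * real n ^ 3"
   unfolding vec_lambda_beta distrib_right by linarith
 qed auto
 also have "... = (\<kappa> + 2) ^ CARD('d) * real n ^ (3 * CARD('d))" by (simp add: power_mult_distrib power_mult)
 finally show ?case .
qed

lemma net_approx:
 assumes n: "1 <= n" and z: "z \<in> region n"
 shows "\<exists>z'\<in>net n. (\<forall>j. \<bar>z $ j - z' $ j\<bar> <= h n j) \<and> (\<forall>x. norm1 (site n z x - site n z' x) <= CARD('d) / (real n)\<^sup>2)"
proof (intro bexI[of _ "net_point (low n) (fine_mesh n) z"] conjI allI)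
 let ?z = "net_point (low n) (fine_mesh n) z"
 have mp: "\<And>j. 0 < fine_mesh n j" by (rule fine_mesh_pos[OF n])
 have d: "\<bar>z $ j - ?z $ j\<bar> <= fine_mesh n j" for j
  using net_point_close[where \<delta>="fine_mesh n" and l="low n" and z=z and j=j, OF mp] unfolding abs_le_iff by linarith
 show "?z \<in> net n" unfolding net_def using z by (rule imageI)
 fix j
 have "1 <= (real n)\<^sup>2" using n by simp
 then have "fine_mesh n j <= h n j" using h_pos[OF n, of j] n by (simp add: divide_le_eq mult_le_cancel_left1)
 then show "\<bar>z $ j - ?z $ j\<bar> <= h n j" using d[of j] by linarith
next
 let ?z = "net_point (low n) (fine_mesh n) z"
 have mp: "\<And>j. 0 < fine_mesh n j" by (rule fine_mesh_pos[OF n])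
 have d: "\<bar>z $ j - ?z $ j\<bar> <= fine_mesh n j" for j
  using net_point_close[where \<delta>="fine_mesh n" and l="low n" and z=z and j=j, OF mp] unfolding abs_le_iff by linarith
 fix x
 have "norm1 (site n z x - site n ?z x) <= (\<Sum>j\<in>(UNIV :: 'd set). 1 / (real n)\<^sup>2)"
  unfolding norm1_def
 proof (rule sum_mono)
  fix j
  have hp: "0 < h n j" by (rule h_pos[OF n])
  have "(site n z x - site n ?z x) $ j = (?z $ j - z $ j) / h n j"
   by (simp add: scaled_site_def diff_divide_distrib[symmetric])
  then have "\<bar>(site n z x - site n ?z x) $ j\<bar> = \<bar>z $ j - ?z $ j\<bar> / h n j" using hp by (simp add: abs_divide abs_minus_commute)
  also have "... <= fine_mesh n j / h n j" using d[of j] hp by (intro divide_right_mono) auto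
  also have "... = 1 / (real n)\<^sup>2" using hp by simp
  finally show "\<bar>(site n z x - site n ?z x) $ j\<bar> <= 1 / (real n)\<^sup>2" .
 qed
 then show "norm1 (site n z x - site n ?z x) <= CARD('d) / (real n)\<^sup>2" by simp
qed

text \<open>The weights move by \<open>n powr (- 2)\<close>, which outweighs the factor \<open>1 / (h_1 \<dots> h_d) = O(n)\<close> of the normalization.\<close>

lemma oscillation:
 fixes \<phi> :: "'d point => real" and L b :: real and x :: "nat => 'd point" and y :: "nat => real"
 assumes n: "1 <= n" and hv: "1 / hvol n <= (\<kappa> + 1) * real n"
  and L: "0 <= L" "\<And>v v'. \<bar>\<phi> v - \<phi> v'\<bar> <= L * norm1 (v - v')"
  and y: "\<And>i. i \<in> {1..n} ==> \<bar>y i\<bar> <= b" "0 <= b"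
  and close: "\<And>x. norm1 (site n z x - site n z' x) <= CARD('d) / (real n)\<^sup>2"
 shows "\<bar>(\<Sum>i=1..n. \<phi> (site n z (x i)) * y i) / (real n * hvol n) - (\<Sum>i=1..n. \<phi> (site n z' (x i)) * y i) / (real n * hvol n)\<bar>
  <= L * CARD('d) * (\<kappa> + 1) * b / real n"
proof -
 have N: "0 < real n * hvol n" using n hvol_pos[OF n] by simp
 have b0: "0 <= L * (CARD('d) / (real n)\<^sup>2) * b" using L y by (intro mult_nonneg_nonneg) auto
 have "\<bar>(\<Sum>i=1..n. \<phi> (site n z (x i)) * y i) - (\<Sum>i=1..n. \<phi> (site n z' (x i)) * y i)\<bar>
  = \<bar>\<Sum>i=1..n. (\<phi> (site n z (x i)) - \<phi> (site n z' (x i))) * y i\<bar>"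
  unfolding sum_subtractf[symmetric] left_diff_distrib ..
 also have "... <= (\<Sum>i=1..n. \<bar>(\<phi> (site n z (x i)) - \<phi> (site n z' (x i))) * y i\<bar>)" by (rule sum_abs)
 also have "... <= (\<Sum>i=1..n. L * (CARD('d) / (real n)\<^sup>2) * b)"
 proof (rule sum_mono)
  fix i assume i: "i \<in> {1..n}"
  have "\<bar>\<phi> (site n z (x i)) - \<phi> (site n z' (x i))\<bar> <= L * (CARD('d) / (real n)\<^sup>2)"
   using L(2) mult_left_mono[OF close L(1)] by (rule order_trans)
  then show "\<bar>(\<phi> (site n z (x i)) - \<phi> (site n z' (x i))) * y i\<bar> <= L * (CARD('d) / (real n)\<^sup>2) * b"
   unfolding abs_mult using y(1)[OF i] L(1) by (intro mult_mono) auto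
 qed
 also have "... = real n * (L * (CARD('d) / (real n)\<^sup>2) * b)" by simp
 finally have 1: "\<bar>(\<Sum>i=1..n. \<phi> (site n z (x i)) * y i) - (\<Sum>i=1..n. \<phi> (site n z' (x i)) * y i)\<bar> <= real n * (L * (CARD('d) / (real n)\<^sup>2) * b)" .
 have "\<bar>(\<Sum>i=1..n. \<phi> (site n z (x i)) * y i) / (real n * hvol n) - (\<Sum>i=1..n. \<phi> (site n z' (x i)) * y i) / (real n * hvol n)\<bar>
  = \<bar>(\<Sum>i=1..n. \<phi> (site n z (x i)) * y i) - (\<Sum>i=1..n. \<phi> (site n z' (x i)) * y i)\<bar> / (real n * hvol n)"
  unfolding diff_divide_distrib[symmetric] abs_divide using N by (simp only: abs_of_pos)
 also have "... <= (real n * (L * (CARD('d) / (real n)\<^sup>2) * b)) / (real n * hvol n)"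
  using 1 N by (intro divide_right_mono) auto
 also have "... = (L * (CARD('d) / (real n)\<^sup>2) * b) * (1 / hvol n)" using n by simp
 also have "... <= (L * (CARD('d) / (real n)\<^sup>2) * b) * ((\<kappa> + 1) * real n)" using hv b0 by (rule mult_left_mono)
 also have "... = L * CARD('d) * (\<kappa> + 1) * b / real n" using n by (simp add: power2_eq_square field_simps)
 finally show ?thesis .
qed


section \<open>Uniform convergence of design averages\<close>

text \<open>The number of sites in the kernel window exceeds any multiple of \<open>ln n\<close>, so Chernoff bounds beat the size of the net.\<close>

lemma eventually_nhvol_ge: "\<forall>\<^sub>F n in sequentially. c * ln (real n) <= real n * hvol n"
 using eventually_esize_ge[of "c * (\<kappa> + 1)"] eventually_Avol_le eventually_ge_at_top[of 1]
proof eventually_elim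
 case (elim n)
 have "c * (\<kappa> + 1) * ln (real n) <= esize n" by (rule elim(1))
 also have "... <= ((\<kappa> + 1) * real n) * hvol n"
  unfolding esize_def using elim(2) hvol_pos[OF elim(3)] by (intro mult_right_mono) auto
 finally have "(\<kappa> + 1) * (c * ln (real n)) <= (\<kappa> + 1) * (real n * hvol n)" by (simp only: mult_ac)
 then show ?case using \<kappa>(1) by (simp add: mult_le_cancel_left_pos)
qed

lemma kernel_like_minus:
 fixes \<phi> :: "'d point => real"
 assumes "kernel_like c \<phi>" shows "kernel_like c (%v. - \<phi> v)"
proof -
 have "\<bar>- \<phi> v - - \<phi> v'\<bar> = \<bar>\<phi> v - \<phi> v'\<bar>" for v v' by linarith
 then show ?thesis using assms unfolding kernel_like_def by simp
qed

lemma g_modulus: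
 assumes \<epsilon>: "0 < \<epsilon>"
 shows "\<forall>\<^sub>F n in sequentially. \<forall>x\<in>R0. \<forall>y\<in>R0. (\<forall>j. \<bar>x $ j - y $ j\<bar> <= h n j) --> \<bar>g x - g y\<bar> <= \<epsilon>"
proof -
 have "compact (R0 :: 'd point set)" unfolding R0_def by (rule compact_cbox)
 then have "uniformly_continuous_on R0 g" using g(5) by (intro compact_uniformly_continuous)
 then obtain \<delta> where \<delta>: "0 < \<delta>" "\<And>x y. x \<in> R0 ==> y \<in> R0 ==> dist y x < \<delta> ==> dist (g y) (g x) < \<epsilon>"
  unfolding uniformly_continuous_on_def using \<epsilon> by metis
 have "0 < \<delta> / (2 * CARD('d))" using \<delta>(1) by simp
 from eventually_h_le[OF this] show ?thesis
 proof eventually_elim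
  case (elim n)
  show ?case
  proof (intro ballI impI)
   fix x y :: "'d point" assume xy: "x \<in> R0" "y \<in> R0" and c: "\<forall>j. \<bar>x $ j - y $ j\<bar> <= h n j"
   have "norm (x - y) <= (\<Sum>j\<in>UNIV. \<bar>(x - y) $ j\<bar>)" by (rule norm_le_l1_cart)
   also have "... <= (\<Sum>j\<in>(UNIV :: 'd set). \<delta> / (2 * CARD('d)))"
   proof (rule sum_mono)
    fix j show "\<bar>(x - y) $ j\<bar> <= \<delta> / (2 * CARD('d))"
     using order_trans[OF c[rule_format, of j] elim[rule_format, of j]] by simp
   qed
   also have "... = \<delta> / 2" by simp
   also have "... < \<delta>" using \<delta>(1) by simp
   finally have "dist x y < \<delta>" by (simp only: dist_norm)
   from \<delta>(2)[OF xy(2,1) this] show "\<bar>g x - g y\<bar> <= \<epsilon>" by (simp add: dist_real_def)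
  qed
 qed
qed

lemma law_integral:
 fixes F :: "'d point => real"
 assumes n: "1 <= n" and F: "F \<in> borel_measurable borel"
 shows "(\<integral>x. F x \<partial>site_law n) = (\<integral>x. F x * dens n x \<partial>lborel)"
proof -
 have "(\<integral>x. F x \<partial>site_law n) = (\<integral>x. dens n x *\<^sub>R F x \<partial>lborel)"
  using F dens(3)[of n] dens(1)[OF n] by (intro integral_density AE_I2) simp_all
 then show ?thesis by (simp only: real_scaleR_def mult.commute)
qed

lemma site_weight_measurable: "kernel_like C\<^sub>K \<phi> ==> (%x. \<phi> (site n z x)) \<in> borel_measurable borel"
 by (rule measurable_compose[OF site_measurable kernel_like_measurable])

text \<open>By substitution the mean is \<open>\<integral> \<phi>(v) g(z + h v) dv\<close>, and \<open>g\<close> is uniformly continuous.\<close>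

lemma average_mean:
 fixes \<phi> :: "'d point => real"
 assumes \<phi>: "kernel_like C\<^sub>K \<phi>" and \<epsilon>: "0 < \<epsilon>"
 shows "\<forall>\<^sub>F n in sequentially. \<forall>z\<in>region n.
  \<bar>(\<integral>x. \<phi> (site n z x) \<partial>site_law n) / hvol n - g z * (\<integral>v. \<phi> v \<partial>lborel)\<bar> <= \<epsilon>"
proof -
 obtain C0 where C0: "\<And>v. \<bar>\<phi> v\<bar> <= C0" using \<phi> unfolding kernel_like_def by auto
 define C where "C = max 1 C0"
 have C: "1 <= C" "\<And>v. \<bar>\<phi> v\<bar> <= C" unfolding C_def using C0 by (auto intro: max.coboundedI2)
 have supp: "\<bar>v $ j\<bar> <= C\<^sub>K" if "\<phi> v ~= 0" for v j using \<phi> that unfolding kernel_like_def by blast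
 have \<phi>m: "\<phi> \<in> borel_measurable borel" by (rule kernel_like_measurable[OF \<phi>])
 have "0 < \<epsilon> / C" using \<epsilon> C(1) by simp
 from g_modulus[OF this] show ?thesis using eventually_ge_at_top[of 1]
 proof eventually_elim
  case (elim n)
  note n = elim(2)
  show ?case
  proof
   fix z assume z: "z \<in> region n"
   let ?s = "%v :: 'd point. \<chi> j. z $ j + h n j * v $ j"
   let ?F = "%v. \<phi> v * g (?s v)" and ?D = "%v. \<phi> v * (g (?s v) - g z)"
   have gm: "(%v. g (?s v)) \<in> borel_measurable borel" by (rule measurable_compose[OF shift_measurable[of z n] g_measurable])
   have sR: "?s v \<in> R0" if "\<phi> v ~= 0" for v
   proof -
    have "- 1/2 <= z $ j + h n j * v $ j \<and> z $ j + h n j * v $ j <= 1/2" for j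
    proof -
     have "\<bar>h n j * v $ j\<bar> <= h n j * C\<^sub>K" using supp[OF that, of j] h_pos[OF n, of j] by (simp add: abs_mult)
     then have "- (C\<^sub>K * h n j) <= h n j * v $ j" "h n j * v $ j <= C\<^sub>K * h n j" unfolding abs_le_iff by (simp_all only: mult.commute) linarith+
     moreover have "- 1 / 2 + C\<^sub>K * h n j <= z $ j" "z $ j <= 1 / 2 - C\<^sub>K * h n j"
      using z by (auto simp: trimmed_box_def mem_box_cart)
     ultimately show ?thesis by linarith
    qed
    then show ?thesis by (simp add: R0_def mem_box_cart)
   qed
   have Db: "\<bar>?D v\<bar> <= \<epsilon>" for v
   proof (cases "\<phi> v = 0")
    case False
    have "\<bar>?s v $ j - z $ j\<bar> <= h n j" for j
    proof -
     have "\<bar>v $ j\<bar> <= 1" using supp[OF False, of j] CK_le by linarith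
     then have "h n j * \<bar>v $ j\<bar> <= h n j * 1" using h_pos[OF n, of j] by (intro mult_left_mono) auto
     then show ?thesis using h_pos[OF n, of j] by (simp add: abs_mult)
    qed
    then have "\<bar>g (?s v) - g z\<bar> <= \<epsilon> / C" using elim(1) sR[OF False] region_subset_R0[OF n] z by blast
    then have "\<bar>?D v\<bar> <= C * (\<epsilon> / C)" unfolding abs_mult using C by (intro mult_mono) auto
    then show ?thesis using C(1) by simp
   qed (use \<epsilon> in simp)
   have Dm: "?D \<in> borel_measurable borel" using gm \<phi>m by measurable
   have Ds: "\<forall>j. \<bar>v $ j\<bar> <= C\<^sub>K" if "?D v ~= 0" for v using that supp[of v] by auto
   have zs: "\<forall>j. \<bar>v $ j\<bar> <= C\<^sub>K" if "\<phi> v ~= 0" for v using that supp[of v] by auto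
   have i\<phi>: "integrable lborel \<phi>" by (rule support_integral(1)[OF \<phi>m C(2) zs])
   have iD: "integrable lborel ?D" by (rule support_integral(1)[OF Dm Db Ds])
   have "?F = (%v. ?D v + g z * \<phi> v)" by (simp add: algebra_simps)
   then have "(\<integral>v. ?F v \<partial>lborel) = (\<integral>v. ?D v + g z * \<phi> v \<partial>lborel)" by (simp only:)
   also have "... = (\<integral>v. ?D v \<partial>lborel) + g z * (\<integral>v. \<phi> v \<partial>lborel)"
    using iD i\<phi> by (subst Bochner_Integration.integral_add) auto
   finally have eq: "(\<integral>v. ?F v \<partial>lborel) - g z * (\<integral>v. \<phi> v \<partial>lborel) = (\<integral>v. ?D v \<partial>lborel)" by simp
   have "(\<integral>x. \<phi> (site n z x) \<partial>site_law n) / hvol n = (\<integral>v. ?F v \<partial>lborel)"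
    unfolding law_integral[OF n site_weight_measurable[OF \<phi>]] site_integral[OF n \<phi>m] using hvol_pos[OF n] by simp
   then have "(\<integral>x. \<phi> (site n z x) \<partial>site_law n) / hvol n - g z * (\<integral>v. \<phi> v \<partial>lborel) = (\<integral>v. ?D v \<partial>lborel)"
    by (simp only: eq)
   moreover have "\<bar>\<integral>v. ?D v \<partial>lborel\<bar> <= \<epsilon>" by (rule support_integral(2)[OF Dm Db Ds])
   ultimately show "\<bar>(\<integral>x. \<phi> (site n z x) \<partial>site_law n) / hvol n - g z * (\<integral>v. \<phi> v \<partial>lborel)\<bar> <= \<epsilon>"
    by (simp only:)
  qed
 qed
qed

lemma whp_of_power_bound:
 fixes c :: real
 assumes "\<forall>\<^sub>F n in sequentially. \<exists>E\<in>sets M. measure M E <= c * real n ^ k * exp (- (real k + 1) * ln (real n)) \<and> {\<omega>\<in>space M. \<not> Q n \<omega>} \<subseteq> E"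
 shows "whp M Q"
 by (rule whpI[OF assms prob_bound_power_lim])

text \<open>A fixed tilting parameter suffices, since a fixed deviation of a sum with variance of order \<open>n h_1 \<dots> h_d\<close> is exponentially
unlikely in \<open>n h_1 \<dots> h_d\<close>.\<close>

lemma local_average_upper:
 fixes \<phi> :: "'d point => real"
 assumes \<phi>: "kernel_like C\<^sub>K \<phi>" and \<epsilon>: "0 < \<epsilon>"
 shows "whp M (%n \<omega>. \<forall>z\<in>net n. (\<Sum>i=1..n. \<phi> (site n z (X n i \<omega>))) / (real n * hvol n) <= g z * (\<integral>v. \<phi> v \<partial>lborel) + \<epsilon>)"
proof -
 obtain C0 where C0: "\<And>v. \<bar>\<phi> v\<bar> <= C0" using \<phi> unfolding kernel_like_def by auto
 define C where "C = max 1 C0"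
 have C: "1 <= C" "\<And>v. \<bar>\<phi> v\<bar> <= C" unfolding C_def using C0 by (auto intro: max.coboundedI2)
 have supp: "\<And>v. \<phi> v ~= 0 ==> \<forall>j. \<bar>v $ j\<bar> <= C\<^sub>K" using \<phi> unfolding kernel_like_def by blast
 \<comment> \<open>The first bound makes the exponential inequality applicable, the second lets the linear term win over the quadratic one.\<close>
 define lam where "lam = min (1 / (2 * C)) (\<epsilon> / (4 * (C\<^sup>2 * gmax)))"
 have lam: "0 < lam" "lam * C <= 1/2" "lam * (C\<^sup>2 * gmax) <= \<epsilon> / 4"
 proof -
  have p: "0 < C\<^sup>2 * gmax" "0 < 2 * C" using C(1) gmax(1) by auto
  show "0 < lam" unfolding lam_def using p \<epsilon> by simp
  have "lam <= 1 / (2 * C)" "lam <= \<epsilon> / (4 * (C\<^sup>2 * gmax))" unfolding lam_def by auto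
  then have "lam * (2 * C) <= 1" "lam * (4 * (C\<^sup>2 * gmax)) <= \<epsilon>" using p by (simp_all only: pos_le_divide_eq zero_less_mult_iff) (simp_all add: field_simps)
  then show "lam * C <= 1/2" "lam * (C\<^sup>2 * gmax) <= \<epsilon> / 4" by linarith+
 qed
 define k where "k = 3 * CARD('d)"
 have e2: "0 < \<epsilon> / 2" using \<epsilon> by simp
 show ?thesis
 proof (rule whp_of_power_bound[where c="(\<kappa> + 2) ^ CARD('d)" and k=k])
  show "\<forall>\<^sub>F n in sequentially. \<exists>E\<in>sets M. measure M E <= (\<kappa> + 2) ^ CARD('d) * real n ^ k * exp (- (real k + 1) * ln (real n)) \<and>
   {\<omega>\<in>space M. \<not> (\<forall>z\<in>net n. (\<Sum>i=1..n. \<phi> (site n z (X n i \<omega>))) / (real n * hvol n) <= g z * (\<integral>v. \<phi> v \<partial>lborel) + \<epsilon>)} \<subseteq> E"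
   using average_mean[OF \<phi> e2] eventually_card_net eventually_nhvol_ge[of "(real k + 1) / (lam * (\<epsilon> / 4))"] eventually_ge_at_top[of 1]
  proof eventually_elim
   case (elim n)
   note n = elim(4)
   define \<mu> where "\<mu> = site_law n"
   define f where "f = (%z x. \<phi> (site n z x))"
   define t where "t = real n * hvol n * (\<epsilon> / 2)"
   define E where "E = {\<omega>\<in>space M. \<exists>z\<in>net n. t < (\<Sum>i\<in>{1..n}. f z (X n i \<omega>)) - card {1..n} * (\<integral>x. f z x \<partial>\<mu>)}"
   have N: "0 < real n * hvol n" using n hvol_pos[OF n] by simp
   have fm: "f z \<in> borel_measurable borel" for z unfolding f_def by (rule site_weight_measurable[OF \<phi>])
   have Es: "E \<in> sets M"
   proof -
    have "E = (\<Union>z\<in>net n. {\<omega>\<in>space M. t < (\<Sum>i\<in>{1..n}. f z (X n i \<omega>)) - card {1..n} * (\<integral>x. f z x \<partial>\<mu>)})" unfolding E_def by blast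
    moreover have "{\<omega>\<in>space M. t < (\<Sum>i\<in>{1..n}. f z (X n i \<omega>)) - card {1..n} * (\<integral>x. f z x \<partial>\<mu>)} \<in> sets M" for z
    proof -
     have "(%\<omega>. \<Sum>i\<in>{1..n}. f z (X n i \<omega>)) \<in> borel_measurable M"
      by (intro borel_measurable_sum measurable_compose[OF X_measurable fm]) auto
     then show ?thesis by measurable
    qed
    ultimately show ?thesis using finite_net[OF n] by auto
   qed
   have V: "(\<integral>x. (f z x)\<^sup>2 \<partial>\<mu>) <= C\<^sup>2 * (gmax * hvol n)" for z
   proof -
    have m2: "(%x. (f z x)\<^sup>2) \<in> borel_measurable borel" using fm[of z] by measurable
    have "\<bar>(f z x)\<^sup>2\<bar> <= (if \<forall>j. \<bar>site n z x $ j\<bar> <= C\<^sub>K then C\<^sup>2 else 0)" for x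
    proof (cases "\<forall>j. \<bar>site n z x $ j\<bar> <= C\<^sub>K")
     case True
     have "\<bar>(f z x)\<^sup>2\<bar> = \<bar>f z x\<bar>\<^sup>2" by simp
     also have "... <= C\<^sup>2" unfolding f_def by (rule power_mono[OF C(2)]) simp
     finally show ?thesis using True by simp
    next
     case False
     then have "f z x = 0" unfolding f_def using supp by blast
     then show ?thesis by simp
    qed
    from site_law_integral_le[OF n m2 _ this] show ?thesis unfolding \<mu>_def by simp
   qed
   have "prob E <= card (net n) * exp (- lam * t + card {1..n} * lam\<^sup>2 * (C\<^sup>2 * (gmax * hvol n)))"
    unfolding E_def
   proof (rule iid_sum_tail[where \<mu>=\<mu> and ?C0.0=C])
    show "indep_vars (%_. borel) (X n) {1..n}" by (rule X_indep[OF n])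
    show "distr M borel (X n i) = \<mu>" if "i \<in> {1..n}" for i unfolding \<mu>_def using X_law that by simp
    show "\<bar>f z x\<bar> <= C" for z x unfolding f_def by (rule C(2))
   qed (use n finite_net[OF n] fm V lam in auto)
   also have "... <= card (net n) * exp (- (real k + 1) * ln (real n))"
   proof (intro mult_left_mono)
    have "- lam * t + card {1..n} * lam\<^sup>2 * (C\<^sup>2 * (gmax * hvol n)) = (real n * hvol n) * (lam * (lam * (C\<^sup>2 * gmax) - \<epsilon> / 2))"
     unfolding t_def by (simp add: algebra_simps power2_eq_square)
    also have "... <= (real n * hvol n) * (lam * (- (\<epsilon> / 4)))"
     using lam(1,3) N by (intro mult_left_mono) auto
    also have "... <= - ((real k + 1) * ln (real n))"
    proof -
     have p: "0 < lam * (\<epsilon> / 4)" using lam(1) \<epsilon> by simp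
     have "(real k + 1) * ln (real n) = ((real k + 1) / (lam * (\<epsilon> / 4)) * ln (real n)) * (lam * (\<epsilon> / 4))" using p \<epsilon> lam(1) by simp
     also have "... <= (real n * hvol n) * (lam * (\<epsilon> / 4))" using elim(3) p by (intro mult_right_mono) auto
     finally show ?thesis unfolding mult_minus_left mult_minus_right by (rule le_imp_neg_le)
    qed
    finally show "exp (- lam * t + card {1..n} * lam\<^sup>2 * (C\<^sup>2 * (gmax * hvol n))) <= exp (- (real k + 1) * ln (real n))"
     unfolding exp_le_cancel_iff mult_minus_left .
   qed simp
   also have "... <= ((\<kappa> + 2) ^ CARD('d) * real n ^ k) * exp (- (real k + 1) * ln (real n))"
    using elim(2) unfolding k_def by (intro mult_right_mono) auto
   finally have PE: "prob E <= (\<kappa> + 2) ^ CARD('d) * real n ^ k * exp (- (real k + 1) * ln (real n))" .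
   moreover have "{\<omega>\<in>space M. \<not> (\<forall>z\<in>net n. (\<Sum>i=1..n. \<phi> (site n z (X n i \<omega>))) / (real n * hvol n) <= g z * (\<integral>v. \<phi> v \<partial>lborel) + \<epsilon>)} \<subseteq> E"
   proof
    fix \<omega> assume "\<omega> \<in> {\<omega>\<in>space M. \<not> (\<forall>z\<in>net n. (\<Sum>i=1..n. \<phi> (site n z (X n i \<omega>))) / (real n * hvol n) <= g z * (\<integral>v. \<phi> v \<partial>lborel) + \<epsilon>)}"
    then obtain z where w: "\<omega> \<in> space M" and z: "z \<in> net n"
     and b: "\<not> (\<Sum>i=1..n. \<phi> (site n z (X n i \<omega>))) / (real n * hvol n) <= g z * (\<integral>v. \<phi> v \<partial>lborel) + \<epsilon>" by blast
    define I where "I = (\<integral>x. f z x \<partial>\<mu>)"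
    define S where "S = (\<Sum>i=1..n. f z (X n i \<omega>))"
    have zr: "z \<in> region n" using net_subset[OF n] z by blast
    have "\<bar>I / hvol n - g z * (\<integral>v. \<phi> v \<partial>lborel)\<bar> <= \<epsilon> / 2"
     using elim(1)[rule_format, OF zr] unfolding I_def f_def \<mu>_def .
    then have a: "I / hvol n - g z * (\<integral>v. \<phi> v \<partial>lborel) <= \<epsilon> / 2" by linarith
    have b': "g z * (\<integral>v. \<phi> v \<partial>lborel) + \<epsilon> < S / (real n * hvol n)" using b unfolding S_def f_def by (simp only: not_le)
    have "I / hvol n + \<epsilon> / 2 < S / (real n * hvol n)" using a b' by linarith
    then have "(I / hvol n + \<epsilon> / 2) * (real n * hvol n) < S" using N by (simp only: pos_less_divide_eq)
    moreover have "(I / hvol n + \<epsilon> / 2) * (real n * hvol n) = real n * I + t"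
     unfolding t_def using hvol_pos[OF n] by (simp add: distrib_right)
    ultimately have "t < S - real (card {1..n}) * I" by simp
    then show "\<omega> \<in> E" unfolding E_def S_def I_def using w z by blast
   qed
   ultimately show ?case using Es by (intro bexI[of _ E]) auto
  qed
 qed
qed

text \<open>The lower bound is the upper bound for \<open>- \<phi>\<close>.\<close>

lemma local_average:
 fixes \<phi> :: "'d point => real"
 assumes \<phi>: "kernel_like C\<^sub>K \<phi>" and \<epsilon>: "0 < \<epsilon>"
 shows "whp M (%n \<omega>. \<forall>z\<in>region n. \<bar>(\<Sum>i=1..n. \<phi> (site n z (X n i \<omega>))) / (real n * hvol n) - g z * (\<integral>v. \<phi> v \<partial>lborel)\<bar> <= \<epsilon>)"
proof -
 have \<epsilon>3: "0 < \<epsilon> / 3" using \<epsilon> by simp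
 let ?I = "\<integral>v. \<phi> v \<partial>lborel"
 obtain L where L: "0 <= L" "\<And>v v'. \<bar>\<phi> v - \<phi> v'\<bar> <= L * norm1 (v - v')"
  using \<phi> unfolding kernel_like_def by auto
 have \<epsilon>I: "0 < \<epsilon> / 3 / (1 + \<bar>?I\<bar>)" using \<epsilon> by (intro divide_pos_pos) auto
 have "(%n. (L * CARD('d) * (\<kappa> + 1)) * (1 / real n)) \<longlonglongrightarrow> (L * CARD('d) * (\<kappa> + 1)) * 0" by (intro tendsto_mult_left lim_1_over_n)
 then have o: "\<forall>\<^sub>F n in sequentially. (L * CARD('d) * (\<kappa> + 1)) * (1 / real n) < \<epsilon> / 3" using \<epsilon>3 by (intro order_tendstoD(2)) auto
 have m: "kernel_like C\<^sub>K (%v. - \<phi> v)" by (rule kernel_like_minus[OF \<phi>])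
 show ?thesis
 proof (rule whp_mono[OF whp_conj[OF local_average_upper[OF \<phi> \<epsilon>3] local_average_upper[OF m \<epsilon>3]]])
  show "\<forall>\<^sub>F n in sequentially. \<forall>\<omega>\<in>space M.
   (\<forall>z\<in>net n. (\<Sum>i=1..n. \<phi> (site n z (X n i \<omega>))) / (real n * hvol n) <= g z * ?I + \<epsilon> / 3) \<and>
   (\<forall>z\<in>net n. (\<Sum>i=1..n. - \<phi> (site n z (X n i \<omega>))) / (real n * hvol n) <= g z * (\<integral>v. - \<phi> v \<partial>lborel) + \<epsilon> / 3) \<longrightarrow>
   (\<forall>z\<in>region n. \<bar>(\<Sum>i=1..n. \<phi> (site n z (X n i \<omega>))) / (real n * hvol n) - g z * ?I\<bar> <= \<epsilon>)"
   using o g_modulus[OF \<epsilon>I] eventually_h_inverse eventually_ge_at_top[of 1]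
  proof eventually_elim
   case (elim n)
   note n = elim(4)
   show ?case
   proof (intro ballI impI)
    fix \<omega> z assume w: "\<omega> \<in> space M"
     and U: "(\<forall>z\<in>net n. (\<Sum>i=1..n. \<phi> (site n z (X n i \<omega>))) / (real n * hvol n) <= g z * ?I + \<epsilon> / 3) \<and>
      (\<forall>z\<in>net n. (\<Sum>i=1..n. - \<phi> (site n z (X n i \<omega>))) / (real n * hvol n) <= g z * (\<integral>v. - \<phi> v \<partial>lborel) + \<epsilon> / 3)"
     and z: "z \<in> region n"
    obtain z' where z': "z' \<in> net n" "\<And>j. \<bar>z $ j - z' $ j\<bar> <= h n j" "\<And>x. norm1 (site n z x - site n z' x) <= CARD('d) / (real n)\<^sup>2"
     using net_approx[OF n z] by blast
    define a where "a = (%z. (\<Sum>i=1..n. \<phi> (site n z (X n i \<omega>))) / (real n * hvol n))"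
    have "\<bar>(\<Sum>i=1..n. \<phi> (site n z (X n i \<omega>)) * 1) / (real n * hvol n) - (\<Sum>i=1..n. \<phi> (site n z' (X n i \<omega>)) * 1) / (real n * hvol n)\<bar>
     <= L * CARD('d) * (\<kappa> + 1) * 1 / real n"
     by (rule oscillation[OF n _ L _ _ z'(3)]) (use elim(3) in auto)
    also have "... <= \<epsilon> / 3" using elim(1) by simp
    finally have 1: "\<bar>a z - a z'\<bar> <= \<epsilon> / 3" unfolding a_def by (simp only: mult_1_right)
    have 2: "a z' <= g z' * ?I + \<epsilon> / 3" using U z'(1) unfolding a_def by blast
    have "(\<Sum>i=1..n. - \<phi> (site n z' (X n i \<omega>))) / (real n * hvol n) <= g z' * (\<integral>v. - \<phi> v \<partial>lborel) + \<epsilon> / 3" using U z'(1) by blast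
    then have 3: "- a z' <= - (g z' * ?I) + \<epsilon> / 3" unfolding a_def by (simp add: sum_negf)
    have zR: "z \<in> R0" "z' \<in> R0" using region_subset_R0[OF n] net_subset[OF n] z z'(1) by auto
    have "\<bar>g z' - g z\<bar> <= \<epsilon> / 3 / (1 + \<bar>?I\<bar>)"
     using elim(2)[rule_format, OF zR(2,1)] z'(2) by (simp only: abs_minus_commute)
    then have "\<bar>g z' - g z\<bar> * \<bar>?I\<bar> <= \<epsilon> / 3 / (1 + \<bar>?I\<bar>) * (1 + \<bar>?I\<bar>)" using \<epsilon>I by (intro mult_mono) auto
    also have "... = \<epsilon> / 3" by (rule nonzero_eq_divide_eq[THEN iffD1, OF _ refl]) linarith
    finally have 4: "\<bar>g z' * ?I - g z * ?I\<bar> <= \<epsilon> / 3" by (simp only: left_diff_distrib[symmetric] abs_mult)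
    have "\<bar>a z - g z * ?I\<bar> <= \<epsilon>" using 1 2 3 4 unfolding abs_le_iff by linarith
    then show "\<bar>(\<Sum>i=1..n. \<phi> (site n z (X n i \<omega>))) / (real n * hvol n) - g z * ?I\<bar> <= \<epsilon>" unfolding a_def .
   qed
  qed
 qed
qed

end

section \<open>Independent errors at the net points\<close>

lemma (in prob_space) pairwise_indep_set:
 assumes F: "indep_sets F I" and ij: "i \<in> I" "j \<in> I" "i ~= j"
 shows "indep_set (F i) (F j)"
proof (rule indep_setI)
 show "F i \<subseteq> events" "F j \<subseteq> events" using F ij unfolding indep_sets_def by auto
 fix a b assume ab: "a \<in> F i" "b \<in> F j"
 have "prob (\<Inter>k\<in>{i, j}. (if k = i then a else b)) = (\<Prod>k\<in>{i, j}. prob (if k = i then a else b))"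
  using F ij ab by (intro indep_setsD) auto
 then show "prob (a \<inter> b) = prob a * prob b" using ij(3) by (simp add: Int_commute mult.commute)
qed

context spatial_regression begin

lemma independent_of_sites:
 assumes "1 <= n"
 shows "indep_set (gen_sigma M (X n) {1..n}) (gen_sigma M e UNIV)"
  and "indep_set (gen_sigma M (X n) {1..n}) (gen_sigma M eps {1..n})"
 using pairwise_indep_set[OF indep[OF assms], of 0 1] pairwise_indep_set[OF indep[OF assms], of 0 2]
 by (simp_all add: numeral_2_eq_2)

text \<open>The exponential tilting parameter, optimal up to constants: threshold and variance then both contribute multiples of \<open>ln n\<close>.\<close>

definition tilt :: "nat => real" where
 "tilt n = rate n * Avol n / real n"

lemma tilt_pos: "3 <= n ==> 0 < tilt n"
 unfolding tilt_def using rate_pos[of n] Avol_pos[of n] by simp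

lemma tilt_threshold: "3 <= n ==> tilt n * (B * (real n * hvol n * rate n)) = B * ln (real n)"
 unfolding tilt_def using rate_sq[of n] by (simp add: esize_def power2_eq_square mult_ac)

lemma tilt_hvol: "3 <= n ==> real n * tilt n * hvol n = rate n * esize n"
 unfolding tilt_def by (simp add: esize_def mult_ac)

lemma eventually_tilt_level:
 fixes c :: real
 assumes c: "0 <= c"
 shows "\<forall>\<^sub>F n in sequentially. tilt n * c * level n <= 1 / 2"
proof -
 have "(%n. ((\<kappa> + 1) * c) * (rate n * level n)) \<longlonglongrightarrow> ((\<kappa> + 1) * c) * 0" by (intro tendsto_mult_left rate_lims(2))
 then have "\<forall>\<^sub>F n in sequentially. ((\<kappa> + 1) * c) * (rate n * level n) < 1 / 2" by (intro order_tendstoD(2)) auto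
 then show ?thesis using eventually_Avol_le eventually_level eventually_ge_at_top[of 3]
 proof eventually_elim
  case (elim n)
  have "Avol n / real n <= \<kappa> + 1" using elim(2,4) by (simp add: pos_divide_le_eq)
  then have "(Avol n / real n) * (c * (rate n * level n)) <= (\<kappa> + 1) * (c * (rate n * level n))"
   using c rate_pos[OF elim(4)] elim(3) by (intro mult_right_mono mult_nonneg_nonneg) auto
  also have "... <= 1 / 2" using elim(1) by (simp only: mult.assoc)
  also have "(Avol n / real n) * (c * (rate n * level n)) = tilt n * c * level n" unfolding tilt_def by simp
  finally show ?case .
 qed
qed

lemma eventually_tilt_sq: "\<forall>\<^sub>F n in sequentially. real n * (tilt n)\<^sup>2 * hvol n <= (\<kappa> + 1) * ln (real n)"
 using eventually_Avol_le eventually_ln_ge[of 0] eventually_ge_at_top[of 3]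
proof eventually_elim
 case (elim n)
 have "real n * (tilt n)\<^sup>2 * hvol n = (Avol n / real n) * ((rate n)\<^sup>2 * esize n)"
  using elim(3) unfolding tilt_def esize_def by (simp add: power2_eq_square field_simps)
 also have "... = (Avol n / real n) * ln (real n)" using rate_sq[OF elim(3)] by simp
 also have "... <= (\<kappa> + 1) * ln (real n)" using elim by (intro mult_right_mono) (auto simp: pos_divide_le_eq)
 finally show ?case .
qed

lemma eventually_level_rate: "\<forall>\<^sub>F n in sequentially. level n / real n <= (\<kappa> + 1) * rate n"
proof -
 have "\<forall>\<^sub>F n in sequentially. rate n * level n < 1" by (rule order_tendstoD(2)[OF rate_lims(2)]) simp
 then show ?thesis using eventually_esize_le eventually_ln_ge[of 1] eventually_ge_at_top[of 3]
 proof eventually_elim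
  case (elim n)
  have r: "0 < rate n" by (rule rate_pos[OF elim(4)])
  have n: "0 < real n" using elim(4) by simp
  have "1 <= (rate n)\<^sup>2 * esize n" using rate_sq[OF elim(4)] elim(3) by simp
  also have "... <= (rate n)\<^sup>2 * ((\<kappa> + 1) * real n)" using elim(2) by (intro mult_left_mono) auto
  finally have "rate n * level n <= rate n * (rate n * ((\<kappa> + 1) * real n))"
   using elim(1) by (simp add: power2_eq_square mult.assoc)
  then have "level n <= rate n * ((\<kappa> + 1) * real n)" using r by (simp only: mult_le_cancel_left_pos)
  then show ?case using n by (simp add: pos_divide_le_eq mult_ac)
 qed
qed

text \<open>One-sided bounds for truncated noise at the net points give two-sided bounds on the region: use \<open>\<phi>\<close> and \<open>- \<phi>\<close>, observe that
with high probability truncation changes nothing, and move from the net by the Lipschitz property.\<close>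

lemma noise_from_net:
 fixes u :: "nat => nat => 'a => real" and \<psi> \<phi> :: "'d point => real"
 assumes \<psi>: "continuous_on R0 \<psi>"
  and u: "whp M (%n \<omega>. \<forall>i\<in>{1..n}. \<bar>u n i \<omega>\<bar> <= level n)"
  and H: "\<And>\<phi>. kernel_like C\<^sub>K \<phi> ==> \<exists>B. whp M (%n \<omega>. \<forall>z\<in>net n.
   (\<Sum>i\<in>{1..n}. (\<phi> (site n z (X n i \<omega>)) * on_R0 \<psi> n (X n i \<omega>)) * truncation (level n) (u n i \<omega>)) <= B * (real n * hvol n * rate n))"
  and \<phi>: "kernel_like C\<^sub>K \<phi>"
 shows "\<exists>B\<ge>0. whp M (%n \<omega>. \<forall>z\<in>region n.
  \<bar>(\<Sum>i=1..n. \<phi> (site n z (X n i \<omega>)) * (on_R0 \<psi> n (X n i \<omega>) * u n i \<omega>)) / (real n * hvol n)\<bar> <= B * rate n)"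
proof -
 obtain B1 where B1: "whp M (%n \<omega>. \<forall>z\<in>net n.
   (\<Sum>i\<in>{1..n}. (\<phi> (site n z (X n i \<omega>)) * on_R0 \<psi> n (X n i \<omega>)) * truncation (level n) (u n i \<omega>)) <= B1 * (real n * hvol n * rate n))"
  using H[OF \<phi>] by blast
 obtain B2 where B2: "whp M (%n \<omega>. \<forall>z\<in>net n.
   (\<Sum>i\<in>{1..n}. (- \<phi> (site n z (X n i \<omega>)) * on_R0 \<psi> n (X n i \<omega>)) * truncation (level n) (u n i \<omega>)) <= B2 * (real n * hvol n * rate n))"
  using H[OF kernel_like_minus[OF \<phi>]] by blast
 obtain C where C: "0 <= C" "\<And>n x. \<bar>on_R0 \<psi> n x\<bar> <= C" using on_R0_bounded[OF \<psi>] by blast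
 obtain L where L: "0 <= L" "\<And>v v'. \<bar>\<phi> v - \<phi> v'\<bar> <= L * norm1 (v - v')"
  using \<phi> unfolding kernel_like_def by auto
 define B0 where "B0 = max 0 (max B1 B2)"
 define B where "B = B0 + L * CARD('d) * (\<kappa> + 1) * C * (\<kappa> + 1)"
 have B0: "0 <= B0" "B1 <= B0" "B2 <= B0" unfolding B0_def by auto
 have c0: "0 <= L * CARD('d) * (\<kappa> + 1) * C" using L(1) \<kappa>(1) C(1) by simp
 show ?thesis
 proof (intro exI[of _ B] conjI whp_mono[OF whp_conj[OF u whp_conj[OF B1 B2]]])
  show "0 <= B" unfolding B_def using B0(1) c0 \<kappa>(1) by simp
  show "\<forall>\<^sub>F n in sequentially. \<forall>\<omega>\<in>space M. (\<forall>i\<in>{1..n}. \<bar>u n i \<omega>\<bar> <= level n) \<and>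
   (\<forall>z\<in>net n. (\<Sum>i\<in>{1..n}. (\<phi> (site n z (X n i \<omega>)) * on_R0 \<psi> n (X n i \<omega>)) * truncation (level n) (u n i \<omega>)) <= B1 * (real n * hvol n * rate n)) \<and>
   (\<forall>z\<in>net n. (\<Sum>i\<in>{1..n}. (- \<phi> (site n z (X n i \<omega>)) * on_R0 \<psi> n (X n i \<omega>)) * truncation (level n) (u n i \<omega>)) <= B2 * (real n * hvol n * rate n)) \<longrightarrow>
   (\<forall>z\<in>region n. \<bar>(\<Sum>i=1..n. \<phi> (site n z (X n i \<omega>)) * (on_R0 \<psi> n (X n i \<omega>) * u n i \<omega>)) / (real n * hvol n)\<bar> <= B * rate n)"
   using eventually_level_rate eventually_level eventually_h_inverse eventually_ge_at_top[of 3]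
  proof eventually_elim
   case (elim n)
   have n: "1 <= n" using elim(4) by simp
   show ?case
   proof (intro ballI impI)
    fix \<omega> z assume w: "\<omega> \<in> space M" and z: "z \<in> region n"
     and U: "(\<forall>i\<in>{1..n}. \<bar>u n i \<omega>\<bar> <= level n) \<and>
      (\<forall>z\<in>net n. (\<Sum>i\<in>{1..n}. (\<phi> (site n z (X n i \<omega>)) * on_R0 \<psi> n (X n i \<omega>)) * truncation (level n) (u n i \<omega>)) <= B1 * (real n * hvol n * rate n)) \<and>
      (\<forall>z\<in>net n. (\<Sum>i\<in>{1..n}. (- \<phi> (site n z (X n i \<omega>)) * on_R0 \<psi> n (X n i \<omega>)) * truncation (level n) (u n i \<omega>)) <= B2 * (real n * hvol n * rate n))"
    obtain z' where z': "z' \<in> net n" "\<And>x. norm1 (site n z x - site n z' x) <= CARD('d) / (real n)\<^sup>2"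
     using net_approx[OF n z] by blast
    define y where "y = (%i. on_R0 \<psi> n (X n i \<omega>) * u n i \<omega>)"
    define N where "N = real n * hvol n"
    have N: "0 < N" unfolding N_def using n hvol_pos[OF n] by simp
    define a where "a = (%z. \<Sum>i=1..n. \<phi> (site n z (X n i \<omega>)) * y i)"
    have tr: "truncation (level n) (u n i \<omega>) = u n i \<omega>" if "i \<in> {1..n}" for i
     using bspec[OF U[THEN conjunct1] that] unfolding truncation_def by simp
    have yb: "\<bar>y i\<bar> <= C * level n" if "i \<in> {1..n}" for i
     unfolding y_def abs_mult using C bspec[OF U[THEN conjunct1] that] by (intro mult_mono) auto
    have "\<bar>a z / N - a z' / N\<bar> <= L * CARD('d) * (\<kappa> + 1) * (C * level n) / real n"
     unfolding a_def N_def using elim(3) C(1) elim(2) yb by (intro oscillation[OF n _ L _ _ z'(2)]) auto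
    also have "... = (L * CARD('d) * (\<kappa> + 1) * C) * (level n / real n)" by simp
    also have "... <= (L * CARD('d) * (\<kappa> + 1) * C) * ((\<kappa> + 1) * rate n)" using elim(1) c0 by (rule mult_left_mono)
    finally have 1: "\<bar>a z / N - a z' / N\<bar> <= (B - B0) * rate n" unfolding B_def by (simp add: mult_ac)
    have r: "0 < rate n" by (rule rate_pos[OF elim(4)])
    have Nr: "0 <= N * rate n" using N r by simp
    have s1: "(\<Sum>i\<in>{1..n}. (\<phi> (site n z' (X n i \<omega>)) * on_R0 \<psi> n (X n i \<omega>)) * truncation (level n) (u n i \<omega>)) = a z'"
     unfolding a_def y_def by (rule sum.cong) (simp_all add: tr mult.assoc)
    have s2: "(\<Sum>i\<in>{1..n}. (- \<phi> (site n z' (X n i \<omega>)) * on_R0 \<psi> n (X n i \<omega>)) * truncation (level n) (u n i \<omega>)) = - a z'"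
     unfolding s1[symmetric] sum_negf[symmetric] by (rule sum.cong) simp_all
    have "a z' <= B1 * (N * rate n)" using bspec[OF U[THEN conjunct2, THEN conjunct1] z'(1)] unfolding s1 N_def .
    then have "a z' <= B0 * (N * rate n)" using mult_right_mono[OF B0(2) Nr] by linarith
    moreover have "- a z' <= B2 * (N * rate n)" using bspec[OF U[THEN conjunct2, THEN conjunct2] z'(1)] unfolding s2 N_def .
    then have "- a z' <= B0 * (N * rate n)" using mult_right_mono[OF B0(3) Nr] by linarith
    ultimately have "\<bar>a z'\<bar> <= B0 * (N * rate n)" unfolding abs_le_iff by simp
    then have "\<bar>a z'\<bar> / N <= B0 * rate n" using N by (simp add: pos_divide_le_eq mult_ac)
    then have 2: "\<bar>a z' / N\<bar> <= B0 * rate n" using N by (simp add: abs_divide)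
    have "\<bar>a z / N\<bar> <= \<bar>a z / N - a z' / N\<bar> + \<bar>a z' / N\<bar>" by linarith
    also have "... <= (B - B0) * rate n + B0 * rate n" using 1 2 by (rule add_mono)
    also have "... = B * rate n" by (simp add: algebra_simps)
    finally show "\<bar>(\<Sum>i=1..n. \<phi> (site n z (X n i \<omega>)) * (on_R0 \<psi> n (X n i \<omega>) * u n i \<omega>)) / (real n * hvol n)\<bar> <= B * rate n"
     unfolding a_def y_def N_def .
   qed
  qed
 qed
qed

lemma level_tail_lim: "(%n. c * (real n / level n ^ q2)) \<longlonglongrightarrow> 0"
proof -
 have "0 < slack * real q2 / 2" using slack(1) q2_pos by simp
 from tendsto_mult_left[OF ln_powr_neg_lim[OF this], of c]
 have l: "(%n. c * ln (real n) powr - (slack * real q2 / 2)) \<longlonglongrightarrow> 0" by simp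
 have "\<forall>\<^sub>F n in sequentially. c * ln (real n) powr - (slack * real q2 / 2) = c * (real n / level n ^ q2)"
  using eventually_ln_ge[of 1] eventually_ge_at_top[of 1]
  by eventually_elim (simp add: level_bounds(3))
 from Lim_transform_eventually[OF l this] show ?thesis .
qed

lemma eps_measurable: "1 <= i ==> eps i \<in> borel_measurable M"
 using eps_iid(1) unfolding indep_vars_def by auto

lemma eps_transfer:
 fixes f :: "real => real"
 assumes i: "1 <= i" and f: "f \<in> borel_measurable borel"
 shows "expectation (%\<omega>. f (eps i \<omega>)) = expectation (%\<omega>. f (eps 1 \<omega>))"
  and "integrable M (%\<omega>. f (eps i \<omega>)) \<longleftrightarrow> integrable M (%\<omega>. f (eps 1 \<omega>))"
proof -
 have m: "eps i \<in> measurable M borel" "eps 1 \<in> measurable M borel" using eps_measurable i by auto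
 show "expectation (%\<omega>. f (eps i \<omega>)) = expectation (%\<omega>. f (eps 1 \<omega>))"
  using integral_distr[OF m(1) f] integral_distr[OF m(2) f] eps_iid(2)[OF i] by simp
 show "integrable M (%\<omega>. f (eps i \<omega>)) \<longleftrightarrow> integrable M (%\<omega>. f (eps 1 \<omega>))"
  using integrable_distr_eq[OF m(1) f] integrable_distr_eq[OF m(2) f] eps_iid(2)[OF i] by simp
qed

abbreviation "eps_moment1 \<equiv> expectation (%\<omega>. \<bar>eps 1 \<omega>\<bar> ^ q1)"

lemma eps_moment1_nonneg: "0 <= eps_moment1"
 by (rule integral_nonneg_AE) simp

lemma eps_facts:
 assumes i: "1 <= i"
 shows "integrable M (%\<omega>. \<bar>eps i \<omega>\<bar> ^ q1)" "expectation (%\<omega>. \<bar>eps i \<omega>\<bar> ^ q1) = eps_moment1"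
  "integrable M (eps i)" "expectation (eps i) = 0"
  "integrable M (%\<omega>. (eps i \<omega>)\<^sup>2)" "expectation (%\<omega>. (eps i \<omega>)\<^sup>2) = 1"
 using eps_transfer[OF i, of "%x. \<bar>x\<bar> ^ q1"] eps_transfer[OF i, of "%x. x"] eps_transfer[OF i, of "%x. x\<^sup>2"]
  eps_moment eps_mean eps_var by simp_all

text \<open>Moments of order \<open>q1 \<ge> q2\<close> keep all \<open>n\<close> errors below the level that is chosen for the field.\<close>

lemma eps_max: "whp M (%n \<omega>. \<forall>i\<in>{1..n}. \<bar>eps i \<omega>\<bar> <= level n)"
proof (rule whpI[OF _ level_tail_lim])
 show "\<forall>\<^sub>F n in sequentially. \<exists>E\<in>sets M. prob E <= eps_moment1 * (real n / level n ^ q2) \<and>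
  {\<omega>\<in>space M. \<not> (\<forall>i\<in>{1..n}. \<bar>eps i \<omega>\<bar> <= level n)} \<subseteq> E"
  using eventually_level
 proof eventually_elim
  case (elim n)
  define E where "E = (\<Union>i\<in>{1..n}. {\<omega>\<in>space M. level n < \<bar>eps i \<omega>\<bar>})"
  have S: "{\<omega>\<in>space M. level n < \<bar>eps i \<omega>\<bar>} \<in> sets M" if "i \<in> {1..n}" for i
  proof -
   have "eps i \<in> borel_measurable M" using eps_measurable that by auto
   then show ?thesis by measurable
  qed
  note m0 = eps_moment1_nonneg
  have "prob E <= (\<Sum>i\<in>{1..n}. prob {\<omega>\<in>space M. level n < \<bar>eps i \<omega>\<bar>})"
   unfolding E_def using S by (intro finite_measure_subadditive_finite) auto
  also have "... <= (\<Sum>i\<in>{1..n}. eps_moment1 / level n ^ q2)"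
  proof (rule sum_mono)
   fix i assume "i \<in> {1..n}"
   then have i: "1 <= i" by simp
   have "prob {\<omega>\<in>space M. level n < \<bar>eps i \<omega>\<bar>} <= expectation (%\<omega>. \<bar>eps i \<omega>\<bar> ^ q1) / level n ^ q1"
    using elim by (intro tail_prob_le eps_facts[OF i] eps_measurable[OF i]) auto
   also have "... = eps_moment1 / level n ^ q1" by (simp only: eps_facts[OF i])
   also have "... <= eps_moment1 / level n ^ q2"
    using elim q m0 by (intro divide_left_mono power_increasing) auto
   finally show "prob {\<omega>\<in>space M. level n < \<bar>eps i \<omega>\<bar>} <= eps_moment1 / level n ^ q2" .
  qed
  also have "... = eps_moment1 * (real n / level n ^ q2)" by simp
  finally have "prob E <= eps_moment1 * (real n / level n ^ q2)" .
  moreover have "E \<in> sets M" unfolding E_def using S by auto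
  moreover have "{\<omega>\<in>space M. \<not> (\<forall>i\<in>{1..n}. \<bar>eps i \<omega>\<bar> <= level n)} \<subseteq> E" unfolding E_def by auto
  ultimately show ?case by blast
 qed
qed

lemma eventually_hvol_le:
 assumes c: "0 < c"
 shows "\<forall>\<^sub>F n in sequentially. hvol n <= c"
proof -
 have "0 < min 1 c" using c by simp
 from eventually_h_le[OF this] show ?thesis using eventually_ge_at_top[of 1]
 proof eventually_elim
  case (elim n)
  have "hvol n <= (\<Prod>j\<in>(UNIV :: 'd set). min 1 c)" unfolding cprod_def using elim h_pos[OF elim(2)] by (intro prod_mono) (auto intro: less_imp_le)
  also have "... = min 1 c ^ CARD('d)" by simp
  also have "... <= min 1 c ^ 1" using c by (intro power_decreasing) (auto simp: Suc_leI)
  finally show ?case by simp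
 qed
qed

lemma noise_weight:
 fixes \<psi> \<phi> :: "'d point => real"
 assumes \<psi>: "continuous_on R0 \<psi>" and \<phi>: "kernel_like C\<^sub>K \<phi>"
 obtains C where "1 <= C" "\<And>n z x. \<bar>\<phi> (site n z x) * on_R0 \<psi> n x\<bar> <= C"
  "\<And>n z. (%x. \<phi> (site n z x) * on_R0 \<psi> n x) \<in> borel_measurable borel"
  "\<And>n z x. \<phi> (site n z x) * on_R0 \<psi> n x ~= 0 ==> \<forall>j. \<bar>site n z x $ j\<bar> <= C\<^sub>K"
proof -
 obtain C1 where C1: "\<And>v. \<bar>\<phi> v\<bar> <= C1" using \<phi> unfolding kernel_like_def by auto
 have s: "\<And>v. \<phi> v ~= 0 ==> \<forall>j. \<bar>v $ j\<bar> <= C\<^sub>K" using \<phi> unfolding kernel_like_def by blast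
 obtain C2 where C2: "0 <= C2" "\<And>n x. \<bar>on_R0 \<psi> n x\<bar> <= C2" using on_R0_bounded[OF \<psi>] by blast
 have C10: "0 <= C1" using C1[of undefined] by linarith
 show thesis
 proof (rule that[of "max 1 (C1 * C2)"])
  show "\<bar>\<phi> (site n z x) * on_R0 \<psi> n x\<bar> <= max 1 (C1 * C2)" for n z x
  proof -
   have "\<bar>\<phi> (site n z x) * on_R0 \<psi> n x\<bar> <= C1 * C2" unfolding abs_mult by (intro mult_mono C1 C2 C10) simp
   then show ?thesis by simp
  qed
  show "(%x. \<phi> (site n z x) * on_R0 \<psi> n x) \<in> borel_measurable borel" for n z
   using site_weight_measurable[OF \<phi>] on_R0_measurable[OF \<psi>] by (rule borel_measurable_times)
  show "\<forall>j. \<bar>site n z x $ j\<bar> <= C\<^sub>K" if "\<phi> (site n z x) * on_R0 \<psi> n x ~= 0" for n z x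
   using that s by simp
 qed simp
qed

text \<open>The three terms of the exponent are all multiples of \<open>ln n\<close>; the threshold constant outweighs the other two and the net.\<close>

lemma error_net:
 fixes \<psi> \<phi> :: "'d point => real"
 assumes \<psi>: "continuous_on R0 \<psi>" and \<phi>: "kernel_like C\<^sub>K \<phi>"
 shows "\<exists>B. whp M (%n \<omega>. \<forall>z\<in>net n.
   (\<Sum>i\<in>{1..n}. (\<phi> (site n z (X n i \<omega>)) * on_R0 \<psi> n (X n i \<omega>)) * truncation (level n) (eps i \<omega>)) <= B * (real n * hvol n * rate n))"
proof -
 obtain C where C: "1 <= C" "\<And>n z x. \<bar>\<phi> (site n z x) * on_R0 \<psi> n x\<bar> <= C"
  "\<And>n z. (%x. \<phi> (site n z x) * on_R0 \<psi> n x) \<in> borel_measurable borel"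
  "\<And>n z x. \<phi> (site n z x) * on_R0 \<psi> n x ~= 0 ==> \<forall>j. \<bar>site n z x $ j\<bar> <= C\<^sub>K"
  using noise_weight[OF \<psi> \<phi>] by metis
 have C0: "0 <= C" using C(1) by linarith
 note m0 = eps_moment1_nonneg
 have gm: "0 < 1 / gmax" using gmax(1) by simp
 define k where "k = 3 * CARD('d)"
 define c1 where "c1 = C * gmax * eps_moment1 * sqrt (\<kappa> + 1) + 5 * C\<^sup>2 * gmax * (\<kappa> + 1)"
 \<comment> \<open>\<open>c1\<close> pays for bias and variance, \<open>k\<close> for the size of the net, and the extra one makes the bound tend to zero.\<close>
 define B where "B = c1 + (real k + 1)"
 show ?thesis
 proof (intro exI[of _ B] whp_of_power_bound[where c="(\<kappa> + 2) ^ CARD('d)" and k=k])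
  show "\<forall>\<^sub>F n in sequentially. \<exists>E\<in>sets M. prob E <= (\<kappa> + 2) ^ CARD('d) * real n ^ k * exp (- (real k + 1) * ln (real n)) \<and>
   {\<omega>\<in>space M. \<not> (\<forall>z\<in>net n. (\<Sum>i\<in>{1..n}. (\<phi> (site n z (X n i \<omega>)) * on_R0 \<psi> n (X n i \<omega>)) * truncation (level n) (eps i \<omega>)) <= B * (real n * hvol n * rate n))} \<subseteq> E"
   using eventually_tilt_level[OF C0] eventually_tilt_sq eventually_card_net eventually_hvol_le[OF gm]
    eventually_bias_level eventually_level eventually_ge_at_top[of 3]
  proof eventually_elim
   case (elim n)
   have n: "1 <= n" using elim(7) by simp
   define f where "f = (%z x. \<phi> (site n z x) * on_R0 \<psi> n x)"
   define t where "t = B * (real n * hvol n * rate n)"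
   define \<pi> where "\<pi> = gmax * hvol n"
   define b1 where "b1 = eps_moment1 / level n ^ (q2 - 1)"
   define E where "E = {\<omega>\<in>space M. \<exists>z\<in>net n. t < (\<Sum>i\<in>{1..n}. f z (X n i \<omega>) * truncation (level n) (eps i \<omega>))}"
   have fm: "f z \<in> borel_measurable borel" for z unfolding f_def by (rule C(3))
   have fC: "\<bar>f z x\<bar> <= C" for z x unfolding f_def by (rule C(2))
   have fs: "\<bar>F x\<bar> <= (if \<forall>j. \<bar>site n z x $ j\<bar> <= C\<^sub>K then c else 0)"
    if "f z x = 0 ==> F x = 0" "\<bar>F x\<bar> <= c" for F :: "'d point => real" and c z x
   proof (cases "f z x = 0")
    case True
    then show ?thesis using that by auto
   next
    case False
    then have "\<forall>j. \<bar>site n z x $ j\<bar> <= C\<^sub>K" unfolding f_def by (rule C(4))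
    then show ?thesis using that(2) by simp
   qed
   have sq: "\<bar>(f z x)\<^sup>2\<bar> <= C\<^sup>2" for z x
   proof -
    have "\<bar>f z x\<bar>\<^sup>2 <= C\<^sup>2" by (rule power_mono[OF fC]) simp
    then show ?thesis by simp
   qed
   have l0: "0 < level n" using elim(6) by linarith
   have Es: "E \<in> sets M"
   proof -
    have "E = (\<Union>z\<in>net n. {\<omega>\<in>space M. t < (\<Sum>i\<in>{1..n}. f z (X n i \<omega>) * truncation (level n) (eps i \<omega>))})" unfolding E_def by blast
    moreover have "{\<omega>\<in>space M. t < (\<Sum>i\<in>{1..n}. f z (X n i \<omega>) * truncation (level n) (eps i \<omega>))} \<in> sets M" for z
    proof -
     have "(%\<omega>. \<Sum>i\<in>{1..n}. f z (X n i \<omega>) * truncation (level n) (eps i \<omega>)) \<in> borel_measurable M"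
      by (intro borel_measurable_sum borel_measurable_times measurable_compose[OF X_measurable fm]
        measurable_compose[OF eps_measurable truncation_measurable]) auto
     then show ?thesis by measurable
    qed
    ultimately show ?thesis using finite_net[OF n] by auto
   qed
   have "prob E <= card (net n) * exp (- tilt n * t + card {1..n} * (tilt n * C * \<pi> * b1 + 5 * (tilt n)\<^sup>2 * C\<^sup>2 * \<pi>))"
    unfolding E_def
   proof (rule independent_error_tail[where \<mu>="site_law n"])
    show "indep_vars (%_. borel) (X n) {1..n}" by (rule X_indep[OF n])
    show "distr M borel (X n i) = site_law n" if "i \<in> {1..n}" for i using X_law that by simp
    show "indep_vars (%_. borel) eps {1..n}" by (rule indep_vars_subset[OF eps_iid(1)]) auto
    show "indep_set (gen_sigma M (X n) {1..n}) (gen_sigma M eps {1..n})" by (rule independent_of_sites(2)[OF n])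
    show "\<bar>f z x\<bar> <= C" for z x by (rule fC)
    show "\<bar>\<integral>x. f z x \<partial>site_law n\<bar> <= C * \<pi>" for z
     unfolding \<pi>_def
    proof (rule site_law_integral_le[OF n fm C0])
     show "\<bar>f z x\<bar> <= (if \<forall>j. \<bar>site n z x $ j\<bar> <= C\<^sub>K then C else 0)" for x by (rule fs[of z x "f z"]) (use fC in auto)
    qed
    have "\<bar>\<integral>x. (f z x)\<^sup>2 \<partial>site_law n\<bar> <= C\<^sup>2 * \<pi>" for z
     unfolding \<pi>_def
    proof (rule site_law_integral_le[OF n])
     show "\<bar>(f z x)\<^sup>2\<bar> <= (if \<forall>j. \<bar>site n z x $ j\<bar> <= C\<^sub>K then C\<^sup>2 else 0)" for x
      by (rule fs[of z x "%x. (f z x)\<^sup>2"]) (use sq in auto)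
     show "(%x. (f z x)\<^sup>2) \<in> borel_measurable borel" using fm[of z] by measurable
    qed simp_all
    then show "(\<integral>x. (f z x)\<^sup>2 \<partial>site_law n) <= C\<^sup>2 * \<pi>" for z
     using abs_le_D1 by blast
    show "\<pi> <= 1" unfolding \<pi>_def using elim(4) gmax(1) by (simp add: pos_le_divide_eq mult.commute)
    show "tilt n * C * level n <= 1 / 2" by (rule elim(1))
    show "\<bar>expectation (%\<omega>. truncation (level n) (eps i \<omega>))\<bar> <= b1" if "i \<in> {1..n}" for i
    proof -
     have i: "1 <= i" using that by simp
     have "\<bar>expectation (%\<omega>. truncation (level n) (eps i \<omega>))\<bar> <= expectation (%\<omega>. \<bar>eps i \<omega>\<bar> ^ q1) / level n ^ (q1 - 1)"
      using eps_moment(1) l0 by (intro truncated_mean_le eps_facts[OF i]) auto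
     also have "... = eps_moment1 / level n ^ (q1 - 1)" by (simp only: eps_facts[OF i])
     also have "... <= b1" unfolding b1_def
      using elim(6) q m0 by (intro divide_left_mono power_increasing) auto
     finally show ?thesis .
    qed
    show "expectation (%\<omega>. (truncation (level n) (eps i \<omega>))\<^sup>2) <= 1" if "i \<in> {1..n}" for i
    proof -
     have i: "1 <= i" using that by simp
     show ?thesis using truncated_second_moment_le[OF eps_facts(5)[OF i], of "level n"] by (simp only: eps_facts(6)[OF i])
    qed
    show "0 <= \<pi>" unfolding \<pi>_def using gmax(1) hvol_pos[OF n] by simp
    show "0 <= b1" unfolding b1_def using m0 l0 by simp
   qed (use n finite_net[OF n] fm tilt_pos[OF elim(7)] l0 C0 in auto)
   also have "... <= card (net n) * exp (- (real k + 1) * ln (real n))"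
   proof (intro mult_left_mono)
    have e1: "real n * (tilt n * C * \<pi> * b1) <= (C * gmax * eps_moment1) * (sqrt (\<kappa> + 1) * ln (real n))"
    proof -
     have "real n * (tilt n * C * \<pi> * b1) = (C * gmax * eps_moment1) * ((real n * tilt n * hvol n) / level n ^ (q2 - 1))"
      unfolding \<pi>_def b1_def by simp
     also have "... = (C * gmax * eps_moment1) * (rate n * esize n / level n ^ (q2 - 1))"
      by (simp only: tilt_hvol[OF elim(7)])
     also have "... <= (C * gmax * eps_moment1) * (sqrt (\<kappa> + 1) * ln (real n))"
      using elim(5) C0 gmax(1) m0 by (intro mult_left_mono mult_nonneg_nonneg) auto
     finally show ?thesis .
    qed
    have e2: "real n * (5 * (tilt n)\<^sup>2 * C\<^sup>2 * \<pi>) <= (5 * C\<^sup>2 * gmax) * ((\<kappa> + 1) * ln (real n))"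
    proof -
     have "real n * (5 * (tilt n)\<^sup>2 * C\<^sup>2 * \<pi>) = (5 * C\<^sup>2 * gmax) * (real n * (tilt n)\<^sup>2 * hvol n)" unfolding \<pi>_def by simp
     also have "... <= (5 * C\<^sup>2 * gmax) * ((\<kappa> + 1) * ln (real n))" using elim(2) gmax(1) by (intro mult_left_mono) auto
     finally show ?thesis .
    qed
    have "- tilt n * t + card {1..n} * (tilt n * C * \<pi> * b1 + 5 * (tilt n)\<^sup>2 * C\<^sup>2 * \<pi>)
     = - (B * ln (real n)) + (real n * (tilt n * C * \<pi> * b1) + real n * (5 * (tilt n)\<^sup>2 * C\<^sup>2 * \<pi>))"
     unfolding t_def mult_minus_left tilt_threshold[OF elim(7)] by (simp add: distrib_left)
    also have "... <= - (B * ln (real n)) + ((C * gmax * eps_moment1) * (sqrt (\<kappa> + 1) * ln (real n)) + (5 * C\<^sup>2 * gmax) * ((\<kappa> + 1) * ln (real n)))"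
     using e1 e2 by (intro add_left_mono add_mono)
    also have "... = - (real k + 1) * ln (real n)" unfolding B_def c1_def by (simp add: algebra_simps)
    finally show "exp (- tilt n * t + card {1..n} * (tilt n * C * \<pi> * b1 + 5 * (tilt n)\<^sup>2 * C\<^sup>2 * \<pi>)) <= exp (- (real k + 1) * ln (real n))"
     unfolding exp_le_cancel_iff .
   qed simp
   also have "... <= ((\<kappa> + 2) ^ CARD('d) * real n ^ k) * exp (- (real k + 1) * ln (real n))"
    using elim(3) unfolding k_def by (intro mult_right_mono) auto
   finally have "prob E <= (\<kappa> + 2) ^ CARD('d) * real n ^ k * exp (- (real k + 1) * ln (real n))" .
   moreover have "{\<omega>\<in>space M. \<not> (\<forall>z\<in>net n. (\<Sum>i\<in>{1..n}. (\<phi> (site n z (X n i \<omega>)) * on_R0 \<psi> n (X n i \<omega>)) * truncation (level n) (eps i \<omega>)) <= B * (real n * hvol n * rate n))} \<subseteq> E"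
    unfolding E_def f_def t_def by (auto simp only: not_le Ball_def Bex_def not_all not_imp)
   ultimately show ?case using Es by (intro bexI[of _ E]) auto
  qed
 qed
qed


section \<open>The field at the net points\<close>

abbreviation "field_moment \<equiv> expectation (%\<omega>. \<bar>e 0 \<omega>\<bar> ^ q2)"
abbreviation "field_cov \<equiv> %v. expectation (%\<omega>. e 0 \<omega> * e v \<omega>)"

lemma field_moment_nonneg: "0 <= field_moment"
 by (rule integral_nonneg_AE) simp

lemma field_moments:
 "integrable M (%\<omega>. \<bar>e x \<omega>\<bar> ^ q2)" "expectation (%\<omega>. \<bar>e x \<omega>\<bar> ^ q2) = field_moment"
 using stationary_moment[where e=e, OF e_measurable e_stationary e_moment(2)] by auto

text \<open>By stationarity the bounds do not depend on the position.\<close>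

lemma field_truncation_bounds:
 assumes \<tau>: "0 < \<tau>"
 shows "\<bar>expectation (%\<omega>. truncation \<tau> (e x \<omega>))\<bar> <= field_moment / \<tau> ^ (q2 - 1)"
  and "expectation (%\<omega>. (truncation \<tau> (e x \<omega>))\<^sup>2) <= 1"
  and "\<bar>expectation (%\<omega>. truncation \<tau> (e x \<omega>) * truncation \<tau> (e y \<omega>))\<bar> <= \<bar>field_cov (y - x)\<bar> + 3 * field_moment / \<tau> ^ (q2 - 2)"
proof -
 have "1 <= q2" using e_moment(1) by simp
 from truncated_mean_le[where Y="e x", OF field_moments(1) e_mean(1) this \<tau> e_mean(2)]
 show "\<bar>expectation (%\<omega>. truncation \<tau> (e x \<omega>))\<bar> <= field_moment / \<tau> ^ (q2 - 1)" unfolding field_moments(2)[of x] .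
 show "expectation (%\<omega>. (truncation \<tau> (e x \<omega>))\<^sup>2) <= 1"
  using truncated_second_moment_le[where Y="e x", OF e_var(1), of \<tau>] unfolding e_var(2) .
 have i: "integrable M (%\<omega>. e x \<omega> * e y \<omega>)"
 proof (rule Bochner_Integration.integrable_bound)
  show "integrable M (%\<omega>. (e x \<omega>)\<^sup>2 + (e y \<omega>)\<^sup>2)" by (intro Bochner_Integration.integrable_add e_var)
  show "(%\<omega>. e x \<omega> * e y \<omega>) \<in> borel_measurable M" by (intro borel_measurable_times e_measurable)
  have "\<bar>a * b\<bar> <= \<bar>a\<^sup>2 + b\<^sup>2\<bar>" for a b :: real
  proof -
   have "0 <= (\<bar>a\<bar> - \<bar>b\<bar>)\<^sup>2" by simp
   then have "2 * (\<bar>a\<bar> * \<bar>b\<bar>) <= a\<^sup>2 + b\<^sup>2" by (simp add: power2_diff)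
   moreover have "0 <= \<bar>a\<bar> * \<bar>b\<bar>" by simp
   ultimately have "\<bar>a\<bar> * \<bar>b\<bar> <= a\<^sup>2 + b\<^sup>2" by linarith
   then show ?thesis unfolding abs_mult by linarith
  qed
  then show "AE \<omega> in M. norm (e x \<omega> * e y \<omega>) <= norm ((e x \<omega>)\<^sup>2 + (e y \<omega>)\<^sup>2)" by (intro AE_I2) (simp only: real_norm_def)
 qed
 have "2 <= q2" using e_moment(1) by simp
 from truncated_covariance_le[where Y="e x" and W="e y", OF field_moments(1) e_measurable field_moments(1) e_measurable i field_moments(2) field_moments(2) this \<tau>]
 show "\<bar>expectation (%\<omega>. truncation \<tau> (e x \<omega>) * truncation \<tau> (e y \<omega>))\<bar> <= \<bar>field_cov (y - x)\<bar> + 3 * field_moment / \<tau> ^ (q2 - 2)"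
  unfolding stationary_covariance[where e=e and x=x and y=y, OF e_measurable e_stationary] .
qed

lemma field_max: "whp M (%n \<omega>. \<forall>i\<in>{1..n}. \<bar>e (X n i \<omega>) \<omega>\<bar> <= level n)"
proof (rule whpI[OF _ level_tail_lim])
 show "\<forall>\<^sub>F n in sequentially. \<exists>E\<in>sets M. prob E <= field_moment * (real n / level n ^ q2) \<and>
  {\<omega>\<in>space M. \<not> (\<forall>i\<in>{1..n}. \<bar>e (X n i \<omega>) \<omega>\<bar> <= level n)} \<subseteq> E"
  using eventually_level eventually_ge_at_top[of 1]
 proof eventually_elim
  case (elim n)
  note n = elim(2)
  define E where "E = {\<omega>\<in>space M. \<exists>i\<in>{1..n}. level n < \<bar>e (X n i \<omega>) \<omega>\<bar>}"
  have l0: "0 < level n" using elim(1) by linarith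
  have tail: "prob {\<omega>\<in>space M. level n < \<bar>e x \<omega>\<bar>} <= field_moment / level n ^ q2" for x
   using tail_prob_le[OF field_moments(1) e_measurable l0, of x] unfolding field_moments(2)[of x] .
  have law: "distr M borel (X n i) = site_law n" if "i \<in> {1..n}" for i using X_law that by simp
  have ne: "{1..n} ~= {}" using n by simp
  note F = field_max_tail[where e=e and X="X n", OF e_field X_indep[OF n] ne finite_atLeastAtMost law independent_of_sites(1)[OF n] tail]
  have "E \<in> sets M" unfolding E_def by (rule F(1))
  moreover have "prob E <= card {1..n} * (field_moment / level n ^ q2)" unfolding E_def by (rule F(2))
  then have "prob E <= field_moment * (real n / level n ^ q2)" by (simp add: mult.commute)
  moreover have "{\<omega>\<in>space M. \<not> (\<forall>i\<in>{1..n}. \<bar>e (X n i \<omega>) \<omega>\<bar> <= level n)} \<subseteq> E"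
   unfolding E_def by (auto simp only: not_le Ball_def Bex_def not_all not_imp)
  ultimately show ?case by blast
 qed
qed

text \<open>Joint measurability of the field makes its value at a random site a random variable.\<close>

lemma field_at_site_measurable:
 assumes "1 <= i" "i <= n"
 shows "(%\<omega>. e (X n i \<omega>) \<omega>) \<in> borel_measurable M"
proof -
 let ?N = "sigma (space M) (gen_sigma M e UNIV)"
 have s: "space ?N = space M" "sets ?N \<subseteq> sets M"
  using gen_sigma_sets[of UNIV e M] e_measurable space_field_algebra[of M e UNIV] sets_field_algebra[of M e UNIV] by auto
 have "(%\<omega>. \<omega>) \<in> measurable M ?N" using s by (auto simp: measurable_def dest: sets.sets_into_space)
 then have "(%\<omega>. (X n i \<omega>, \<omega>)) \<in> measurable M (borel \<Otimes>\<^sub>M ?N)" by (rule measurable_Pair[OF X_measurable[OF assms]])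
 moreover have "(%(x, \<omega>). e x \<omega>) \<in> borel_measurable (borel \<Otimes>\<^sub>M ?N)" using e_field by (simp add: random_field_def)
 ultimately have "(%\<omega>. (%(x, \<omega>). e x \<omega>) (X n i \<omega>, \<omega>)) \<in> borel_measurable M" by (rule measurable_compose)
 then show ?thesis by simp
qed

text \<open>The cubes of one class have total volume at most \<open>A_n h_1 \<dots> h_d\<close> and pairwise distance at least the smallest separation,
so the coefficient at these two parameters bounds their dependence.\<close>

lemma cube_family_dependence:
 fixes \<Q> :: "'d point set set" and s :: real
 assumes n: "1 <= n" and s: "Min (range (A2 n)) <= s" "0 < s"
  and Q: "finite \<Q>" "disjoint \<Q>" "\<And>Q. Q \<in> \<Q> ==> is_cube Q \<and> emeasure lborel Q = ennreal (s ^ CARD('d))"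
   "card \<Q> * s ^ CARD('d) <= esize n"
   "\<And>Q Q' x y. Q \<in> \<Q> ==> Q' \<in> \<Q> ==> Q ~= Q' ==> x \<in> Q ==> y \<in> Q' ==> s <= norm1 (x - y)"
  and Q': "\<Q>' \<subseteq> \<Q>" "Q \<in> \<Q>" "Q \<notin> \<Q>'"
 shows "beta_bar M e (\<Union>\<Q>') Q <= dep n"
 unfolding dep_def
proof (rule beta_bar_le_beta_mix[OF e_measurable])
 show "ereal (Min (range (A2 n))) <= set_dist1 (\<Union>\<Q>') Q"
  unfolding set_dist1_def
 proof (rule INF_greatest)
  fix a assume "a \<in> \<Union>\<Q>' \<times> Q"
  then obtain x y P where a: "a = (x, y)" "x \<in> P" "P \<in> \<Q>'" "y \<in> Q" by blast
  have "P ~= Q" using a(3) Q'(3) by blast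
  moreover have "P \<in> \<Q>" using a(3) Q'(1) by blast
  ultimately have "s <= norm1 (x - y)" using Q(5)[OF _ Q'(2) _ a(2,4)] by blast
  then show "ereal (Min (range (A2 n))) <= (case a of (x, y) => ereal (norm1 (x - y)))" using s(1) a(1) by simp
 qed
 have m: "measure lborel Q = s ^ CARD('d)" if "Q \<in> \<Q>" for Q
  using Q(3)[OF that] s(2) by (simp add: measure_def)
 have U: "\<Union>\<R> \<in> cube_unions (esize n)" if "\<R> \<subseteq> \<Q>" for \<R>
  unfolding cube_unions_def
 proof (intro CollectI exI[of _ \<R>] conjI refl)
  show "finite \<R>" using that Q(1) by (rule finite_subset)
  show "disjoint \<R>" using Q(2) that unfolding disjoint_def by blast
  show "\<forall>Q\<in>\<R>. is_cube Q" using that Q(3) by blast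
  have "(\<Sum>Q\<in>\<R>. measure lborel Q) = (\<Sum>Q\<in>\<R>. s ^ CARD('d))" using m that by (intro sum.cong) auto
  also have "... = card \<R> * s ^ CARD('d)" by simp
  also have "... <= card \<Q> * s ^ CARD('d)" using card_mono[OF Q(1) that] s(2) by (intro mult_right_mono) auto
  finally show "(\<Sum>Q\<in>\<R>. measure lborel Q) <= esize n" using Q(4) by linarith
 qed
 show "\<Union>\<Q>' \<in> cube_unions (esize n)" by (rule U[OF Q'(1)])
 show "Q \<in> cube_unions (esize n)" using U[of "{Q}"] Q'(2) by simp
qed

text \<open>The part of the exponent that comes from the field: truncation bias, variance of the sites given the field, and variance of the blocks.\<close>

definition field_cost :: "real => nat => real" where
 "field_cost C n = esize n * (real n * tilt n * C * (gmax / Avol n) * (field_moment / level n ^ (q2 - 1))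
   + 3 * (real n * (tilt n)\<^sup>2 * C\<^sup>2 * (gmax / Avol n))
   + 2 * (real n * tilt n * C * (gmax / Avol n))\<^sup>2 * ((\<integral>v. \<bar>field_cov v\<bar> \<partial>lborel) + 3 * field_moment / level n ^ (q2 - 2) * side n ^ CARD('d)))"

lemma tilt_density: "1 <= n ==> real n * tilt n * C * (gmax / Avol n) = C * gmax * rate n"
 unfolding tilt_def using Avol_pos[of n] by simp

lemma eventually_field_cost:
 assumes C: "0 <= C"
 shows "\<exists>c. \<forall>\<^sub>F n in sequentially. field_cost C n <= c * ln (real n)"
proof -
 obtain c where c: "\<forall>\<^sub>F n in sequentially. side n ^ CARD('d) / level n ^ (q2 - 2) <= c" using eventually_side_level by blast
 let ?I = "\<integral>v. \<bar>field_cov v\<bar> \<partial>lborel"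
 have "\<forall>\<^sub>F n in sequentially. field_cost C n <= (C * gmax * field_moment * sqrt (\<kappa> + 1) + 3 * C\<^sup>2 * gmax * (\<kappa> + 1) + 2 * (C * gmax)\<^sup>2 * (?I + 3 * field_moment * c)) * ln (real n)"
  using c eventually_bias_level eventually_tilt_sq eventually_ln_ge[of 0] eventually_ge_at_top[of 3]
 proof eventually_elim
  case (elim n)
  have n: "1 <= n" using elim(5) by simp
  note g0 = gmax(1) and m0 = field_moment_nonneg
  have 1: "esize n * (C * gmax * rate n * (field_moment / level n ^ (q2 - 1))) <= (C * gmax * field_moment) * (sqrt (\<kappa> + 1) * ln (real n))"
  proof -
   have "esize n * (C * gmax * rate n * (field_moment / level n ^ (q2 - 1))) = (C * gmax * field_moment) * (rate n * esize n / level n ^ (q2 - 1))" by simp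
   also have "... <= (C * gmax * field_moment) * (sqrt (\<kappa> + 1) * ln (real n))"
    using elim(2) C g0 m0 by (intro mult_left_mono mult_nonneg_nonneg) auto
   finally show ?thesis .
  qed
  have 2: "esize n * (3 * (real n * (tilt n)\<^sup>2 * C\<^sup>2 * (gmax / Avol n))) <= (3 * C\<^sup>2 * gmax) * ((\<kappa> + 1) * ln (real n))"
  proof -
   have "esize n * (3 * (real n * (tilt n)\<^sup>2 * C\<^sup>2 * (gmax / Avol n))) = (3 * C\<^sup>2 * gmax) * (real n * (tilt n)\<^sup>2 * hvol n)"
    unfolding esize_def using Avol_pos[OF n] by simp
   also have "... <= (3 * C\<^sup>2 * gmax) * ((\<kappa> + 1) * ln (real n))" using elim(3) g0 by (intro mult_left_mono) auto
   finally show ?thesis .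
  qed
  define b where "b = ?I + 3 * field_moment / level n ^ (q2 - 2) * side n ^ CARD('d)"
  have 3: "esize n * (2 * (C * gmax * rate n)\<^sup>2 * b) <= (2 * (C * gmax)\<^sup>2 * (?I + 3 * field_moment * c)) * ln (real n)"
  proof -
   have "b = ?I + 3 * field_moment * (side n ^ CARD('d) / level n ^ (q2 - 2))" unfolding b_def by simp
   also have "... <= ?I + 3 * field_moment * c" using elim(1) m0 by (intro add_left_mono mult_left_mono) auto
   finally have bb: "b <= ?I + 3 * field_moment * c" .
   have "esize n * (2 * (C * gmax * rate n)\<^sup>2 * b) = (2 * (C * gmax)\<^sup>2 * b) * ((rate n)\<^sup>2 * esize n)" by (simp add: power_mult_distrib)
   also have "... = (2 * (C * gmax)\<^sup>2 * b) * ln (real n)" by (simp only: rate_sq[OF elim(5)])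
   also have "... <= (2 * (C * gmax)\<^sup>2 * (?I + 3 * field_moment * c)) * ln (real n)"
    using elim(4) bb by (intro mult_right_mono mult_left_mono) auto
   finally show ?thesis .
  qed
  have "field_cost C n = esize n * (C * gmax * rate n * (field_moment / level n ^ (q2 - 1)))
   + esize n * (3 * (real n * (tilt n)\<^sup>2 * C\<^sup>2 * (gmax / Avol n))) + esize n * (2 * (C * gmax * rate n)\<^sup>2 * b)"
   unfolding field_cost_def tilt_density[OF n] b_def by (simp only: distrib_left)
  also have "... <= (C * gmax * field_moment) * (sqrt (\<kappa> + 1) * ln (real n)) + (3 * C\<^sup>2 * gmax) * ((\<kappa> + 1) * ln (real n))
   + (2 * (C * gmax)\<^sup>2 * (?I + 3 * field_moment * c)) * ln (real n)" using 1 2 3 by (intro add_mono)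
  also have "... = (C * gmax * field_moment * sqrt (\<kappa> + 1) + 3 * C\<^sup>2 * gmax * (\<kappa> + 1) + 2 * (C * gmax)\<^sup>2 * (?I + 3 * field_moment * c)) * ln (real n)"
   by (simp only: distrib_right mult.assoc)
  finally show ?case .
 qed
 then show ?thesis by blast
qed

lemma field_family_tail:
 fixes f :: "'z => 'd point => real" and \<Q> :: "'d point set set" and C t :: real
 assumes n: "3 <= n" and lev: "0 < level n" and blk: "Min (range (A2 n)) <= side n" "0 < side n"
  and small: "tilt n * C * level n <= 1 / 2" "(C * gmax) * (rate n * side n ^ CARD('d) * level n) <= 1 / 2"
  and Q: "finite \<Q>" "disjoint \<Q>" "\<And>Q. Q \<in> \<Q> ==> is_cube Q \<and> Q \<in> sets borel \<and> emeasure lborel Q = ennreal (side n ^ CARD('d))"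
   "card \<Q> * side n ^ CARD('d) <= esize n"
   "\<And>Q Q' x y. Q \<in> \<Q> ==> Q' \<in> \<Q> ==> Q ~= Q' ==> x \<in> Q ==> y \<in> Q' ==> side n <= norm1 (x - y)"
  and Z: "finite Z" and f: "\<And>z. z \<in> Z ==> f z \<in> borel_measurable borel" "\<And>z x. z \<in> Z ==> \<bar>f z x\<bar> <= C"
   "\<And>z x. z \<in> Z ==> f z x ~= 0 ==> x \<in> \<Union>\<Q>" and C: "0 <= C"
 defines "E \<equiv> {\<omega>\<in>space M. \<exists>z\<in>Z. t < (\<Sum>i\<in>{1..n}. f z (X n i \<omega>) * truncation (level n) (e (X n i \<omega>) \<omega>))}"
 shows "E \<in> sets M" and "prob E <= exp 1 * card Z * exp (- tilt n * t + field_cost C n) + 2 * (esize n / side n ^ CARD('d)) * dep n"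
proof -
 have n1: "1 <= n" using n by simp
 have fm: "(%\<omega>. \<Sum>i\<in>{1..n}. f z (X n i \<omega>) * truncation (level n) (e (X n i \<omega>) \<omega>)) \<in> borel_measurable M" if "z \<in> Z" for z
  by (intro borel_measurable_sum borel_measurable_times measurable_compose[OF X_measurable f(1)[OF that]]
    measurable_compose[OF field_at_site_measurable truncation_measurable]) auto
 have "E = (\<Union>z\<in>Z. {\<omega>\<in>space M. t < (\<Sum>i\<in>{1..n}. f z (X n i \<omega>) * truncation (level n) (e (X n i \<omega>) \<omega>))})" unfolding E_def by blast
 moreover have "{\<omega>\<in>space M. t < (\<Sum>i\<in>{1..n}. f z (X n i \<omega>) * truncation (level n) (e (X n i \<omega>) \<omega>))} \<in> sets M" if "z \<in> Z" for z
  using fm[OF that] by measurable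
 ultimately show "E \<in> sets M" using Z by auto
 let ?v = "side n ^ CARD('d)" and ?I = "\<integral>v. \<bar>field_cov v\<bar> \<partial>lborel"
 define b1 where "b1 = field_moment / level n ^ (q2 - 1)"
 define b2 where "b2 = 3 * field_moment / level n ^ (q2 - 2)"
 have b: "0 <= b1" "0 <= b2" unfolding b1_def b2_def using field_moment_nonneg lev by auto
 have v0: "0 < ?v" using blk(2) by simp
 have law: "distr M borel (X n i) = site_law n" if "i \<in> {1..n}" for i using X_law that by simp
 have C1: "0 <= gmax / Avol n" using gmax(1) Avol_pos[OF n1] by simp
 have I0: "0 <= ?I" by (rule integral_nonneg_AE) simp
 define br where "br = card {1..n} * tilt n * C * (gmax / Avol n) * b1 + 3 * (card {1..n} * (tilt n)\<^sup>2 * C\<^sup>2 * (gmax / Avol n))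
     + 2 * (card {1..n} * tilt n * C * (gmax / Avol n))\<^sup>2 * (?I + b2 * ?v)"
 have br0: "0 <= br" unfolding br_def using tilt_pos[OF n] C C1 b I0 v0
  by (intro add_nonneg_nonneg mult_nonneg_nonneg) auto
 have "prob E <= exp 1 * card Z * exp (- tilt n * t + card \<Q> * ?v * br) + 2 * card \<Q> * dep n"
  unfolding E_def br_def
 proof (rule field_sum_tail[where \<sigma>=field_cov and \<tau>="level n" and w="dens n" and X="X n" and e=e])
  show "random_field M e" by (rule e_field)
  show "indep_vars (%_. borel) (X n) {1..n}" by (rule X_indep[OF n1])
  show "distr M borel (X n i) = site_law n" if "i \<in> {1..n}" for i by (rule law[OF that])
  show "dens n \<in> borel_measurable borel" by (rule dens(3))
  show "0 <= dens n x" "dens n x <= gmax / Avol n" for x using dens(1,2)[OF n1] by auto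
  show "indep_set (gen_sigma M (X n) {1..n}) (gen_sigma M e UNIV)" by (rule independent_of_sites(1)[OF n1])
  show "beta_bar M e (\<Union>\<Q>') Q <= dep n" if "\<Q>' \<subseteq> \<Q>" "Q \<in> \<Q>" "Q \<notin> \<Q>'" for \<Q>' Q
  proof (rule cube_family_dependence[OF n1 blk Q(1,2) _ Q(4) _ that])
   show "is_cube Q \<and> emeasure lborel Q = ennreal (side n ^ CARD('d))" if "Q \<in> \<Q>" for Q using Q(3)[OF that] by blast
   show "side n <= norm1 (x - y)" if "Q \<in> \<Q>" "Q' \<in> \<Q>" "Q ~= Q'" "x \<in> Q" "y \<in> Q'" for Q Q' x y using Q(5)[OF that] .
  qed
  show "tilt n * C * level n <= 1" using small(1) by linarith
  show "card {1..n} * tilt n * C * (gmax / Avol n) * level n * ?v <= 1/2"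
  proof -
   have "card {1..n} * tilt n * C * (gmax / Avol n) * level n * ?v = (real n * tilt n * C * (gmax / Avol n)) * (level n * ?v)" by simp
   also have "... = (C * gmax) * (rate n * ?v * level n)" unfolding tilt_density[OF n1] by simp
   finally show ?thesis using small(2) by linarith
  qed
  show "\<bar>expectation (%\<omega>. truncation (level n) (e x \<omega>))\<bar> <= b1"
   "expectation (%\<omega>. (truncation (level n) (e x \<omega>))\<^sup>2) <= 1"
   "\<bar>expectation (%\<omega>. truncation (level n) (e x \<omega>) * truncation (level n) (e y \<omega>))\<bar> <= \<bar>field_cov (y - x)\<bar> + b2" for x y
   unfolding b1_def b2_def by (rule field_truncation_bounds[OF lev])+
  show "integrable lborel field_cov" by (rule e_cov)
  show "Q \<in> sets borel" "emeasure lborel Q = ennreal ?v" if "Q \<in> \<Q>" for Q using Q(3)[OF that] by auto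
 qed (use n Q(1,2) Z f C C1 b v0 tilt_pos[OF n] lev in auto)
 also have "... <= exp 1 * card Z * exp (- tilt n * t + field_cost C n) + 2 * (esize n / ?v) * dep n"
 proof (intro add_mono mult_left_mono mult_right_mono)
  have "card \<Q> * ?v * br <= esize n * br" using Q(4) br0 by (rule mult_right_mono)
  also have "... = field_cost C n" unfolding br_def field_cost_def b1_def b2_def by simp
  finally show "exp (- tilt n * t + card \<Q> * ?v * br) <= exp (- tilt n * t + field_cost C n)" by simp
  show "real (2 * card \<Q>) <= 2 * (esize n / ?v)" using Q(4) v0 by (simp add: pos_le_divide_eq)
 qed (use dep_nonneg[OF n1] in auto)
 finally show "prob E <= exp 1 * card Z * exp (- tilt n * t + field_cost C n) + 2 * (esize n / side n ^ CARD('d)) * dep n" .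
qed


text \<open>A coarse grid with mesh half of the bandwidth: all net points of a cell share one family of cubes.\<close>

abbreviation "cell n \<equiv> net_point (low n) (%j. h n j / 2)"

lemma finite_cells: "1 <= n ==> finite (cell n ` region n)"
 unfolding trimmed_box_def by (rule net_finite_card(1)) (simp add: h_pos)

lemma card_cells:
 assumes n: "1 <= n" and h1: "\<forall>j. h n j <= 1"
 shows "real (card (cell n ` region n)) <= 3 ^ CARD('d) * (1 / hvol n)"
proof -
 have p: "0 < h n j / 2" for j using h_pos[OF n, of j] by simp
 have "real (card (cell n ` region n)) <= (\<Prod>j\<in>UNIV. max 0 (((\<chi> j. 1 / 2 - C\<^sub>K * h n j) $ j - low n $ j) / (h n j / 2)) + 1)"
  unfolding trimmed_box_def by (rule net_finite_card(2)) (rule p)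
 also have "... <= (\<Prod>j\<in>(UNIV :: 'd set). 3 * (1 / h n j))"
 proof (intro prod_mono conjI)
  fix j
  have "((1 / 2 - C\<^sub>K * h n j) - (- 1 / 2 + C\<^sub>K * h n j)) / (h n j / 2) <= 1 / (h n j / 2)"
   using p[of j] by (intro divide_right_mono region_length[OF n]) auto
  also have "1 / (h n j / 2) = 2 * (1 / h n j)" by simp
  finally have "max 0 (((1 / 2 - C\<^sub>K * h n j) - (- 1 / 2 + C\<^sub>K * h n j)) / (h n j / 2)) <= 2 * (1 / h n j)"
   using h_pos[OF n, of j] by (intro max.boundedI) auto
  moreover have "1 <= 1 / h n j" using h_pos[OF n, of j] h1 by (simp add: pos_le_divide_eq)
  ultimately show "max 0 (((\<chi> j. 1 / 2 - C\<^sub>K * h n j) $ j - low n $ j) / (h n j / 2)) + 1 <= 3 * (1 / h n j)"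
   unfolding vec_lambda_beta by linarith
 qed auto
 also have "... = 3 ^ CARD('d) * (\<Prod>j\<in>(UNIV :: 'd set). 1 / h n j)" by (simp add: prod.distrib prod_dividef)
 also have "(\<Prod>j\<in>(UNIV :: 'd set). 1 / h n j) = 1 / hvol n" unfolding cprod_def by (simp add: prod_dividef)
 finally show ?thesis .
qed

text \<open>The kernel windows of all points of a cell lie in a box that is only slightly larger than one window.\<close>

lemma cell_support:
 assumes n: "1 <= n" and x: "\<forall>j. \<bar>site n z x $ j\<bar> <= C\<^sub>K"
 shows "x \<in> cbox (\<chi> j. A n j * (cell n z $ j - C\<^sub>K * h n j)) (\<chi> j. A n j * (cell n z $ j + h n j / 2 + C\<^sub>K * h n j))"
proof -
 have "A n j * (cell n z $ j - C\<^sub>K * h n j) <= x $ j \<and> x $ j <= A n j * (cell n z $ j + h n j / 2 + C\<^sub>K * h n j)" for j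
 proof -
  have p: "0 < A n j" "0 < h n j" using A_pos[OF n] h_pos[OF n] by auto
  have hp: "\<And>j. 0 < h n j / 2" using h_pos[OF n] by simp
  have a: "\<bar>site n z x $ j\<bar> <= C\<^sub>K" using x by blast
  have "- C\<^sub>K <= site n z x $ j" "site n z x $ j <= C\<^sub>K"
   using abs_le_D1[OF a] abs_le_D2[OF a] by linarith+
  then have "- C\<^sub>K <= (x $ j / A n j - z $ j) / h n j" "(x $ j / A n j - z $ j) / h n j <= C\<^sub>K"
   by (simp_all only: scaled_site_def vec_lambda_beta)
  then have "- C\<^sub>K * h n j <= x $ j / A n j - z $ j" "x $ j / A n j - z $ j <= C\<^sub>K * h n j"
   using p(2) by (simp_all add: pos_le_divide_eq pos_divide_le_eq)
  moreover have "cell n z $ j <= z $ j" "z $ j <= cell n z $ j + h n j / 2"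
   using net_point_close[where \<delta>="%j. h n j / 2" and l="low n" and z=z and j=j, OF hp] by auto
  ultimately have "cell n z $ j - C\<^sub>K * h n j <= x $ j / A n j" "x $ j / A n j <= cell n z $ j + h n j / 2 + C\<^sub>K * h n j" by linarith+
  then show ?thesis using p(1) by (simp add: pos_le_divide_eq pos_divide_le_eq mult.commute)
 qed
 then show ?thesis by (simp add: mem_box_cart)
qed

lemma cell_cubes:
 assumes n: "1 <= n" and s: "0 < side n" "\<forall>j. 8 * side n <= A n j * h n j"
 shows "\<exists>\<Q> :: 'd set => 'd point set set.
  (\<forall>T. finite (\<Q> T) \<and> disjoint (\<Q> T) \<and>
    (\<forall>Q\<in>\<Q> T. is_cube Q \<and> Q \<in> sets borel \<and> emeasure lborel Q = ennreal (side n ^ CARD('d))) \<and>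
    card (\<Q> T) * side n ^ CARD('d) <= esize n \<and>
    (\<forall>Q\<in>\<Q> T. \<forall>Q'\<in>\<Q> T. Q ~= Q' --> (\<forall>x\<in>Q. \<forall>y\<in>Q'. side n <= norm1 (x - y)))) \<and>
  (\<forall>T T'. T ~= T' --> \<Union>(\<Q> T) \<inter> \<Union>(\<Q> T') = {}) \<and>
  cbox (\<chi> j. A n j * (c $ j - C\<^sub>K * h n j)) (\<chi> j. A n j * (c $ j + h n j / 2 + C\<^sub>K * h n j)) \<subseteq> (\<Union>T. \<Union>(\<Q> T))"
proof -
 have e: "esize n = (\<Prod>j\<in>(UNIV :: 'd set). A n j * h n j)" unfolding esize_def cprod_def by (simp add: prod.distrib)
 show ?thesis
  unfolding e
 proof (rule parity_cube_cover[OF s(1)])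
  fix j
  have p: "0 < A n j * h n j" using A_pos[OF n] h_pos[OF n] by simp
  have "(\<chi> j. A n j * (c $ j + h n j / 2 + C\<^sub>K * h n j)) $ j - (\<chi> j. A n j * (c $ j - C\<^sub>K * h n j)) $ j
   = (1 / 2 + 2 * C\<^sub>K) * (A n j * h n j)" by (simp add: algebra_simps)
  also have "... <= 3 / 2 * (A n j * h n j)" using p CK_le by (intro mult_right_mono) auto
  finally show "(\<chi> j. A n j * (c $ j + h n j / 2 + C\<^sub>K * h n j)) $ j - (\<chi> j. A n j * (c $ j - C\<^sub>K * h n j)) $ j <= 3 / 2 * (A n j * h n j)" .
  show "8 * side n <= A n j * h n j" using s(2) by blast
 qed
qed

text \<open>Within a cell the sum is split over the parity classes; if it exceeds the threshold, then one of the \<open>2^d\<close> partial sums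
exceeds its share. The bound for one class holds for all net points of the cell at once, and the number of cells
is of order \<open>1 / (h_1 \<dots> h_d)\<close>.\<close>

lemma field_net_tail:
 fixes f :: "'d point => 'd point => real" and C t :: real
 assumes n: "3 <= n" and lev: "0 < level n" and blk: "Min (range (A2 n)) <= side n" "0 < side n" "\<forall>j. 8 * side n <= A n j * h n j"
  and h1: "\<forall>j. h n j <= 1"
  and small: "tilt n * C * level n <= 1 / 2" "(C * gmax) * (rate n * side n ^ CARD('d) * level n) <= 1 / 2"
  and f: "\<And>z. f z \<in> borel_measurable borel" "\<And>z x. \<bar>f z x\<bar> <= C" "\<And>z x. f z x ~= 0 ==> \<forall>j. \<bar>site n z x $ j\<bar> <= C\<^sub>K"
  and C: "0 <= C"
 shows "\<exists>E\<in>sets M. prob E <= 6 ^ CARD('d) * (1 / hvol n) *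
   (exp 1 * card (net n) * exp (- tilt n * (t / 2 ^ CARD('d)) + field_cost C n) + 2 * (esize n / side n ^ CARD('d)) * dep n)
  \<and> {\<omega>\<in>space M. \<not> (\<forall>z\<in>net n. (\<Sum>i\<in>{1..n}. f z (X n i \<omega>) * truncation (level n) (e (X n i \<omega>) \<omega>)) <= t)} \<subseteq> E"
proof -
 have n1: "1 <= n" using n by simp
 define lo where "lo = (%c :: 'd point. \<chi> j. A n j * (c $ j - C\<^sub>K * h n j))"
 define up where "up = (%c :: 'd point. \<chi> j. A n j * (c $ j + h n j / 2 + C\<^sub>K * h n j))"
 have "\<forall>c. \<exists>\<Q> :: 'd set => 'd point set set.
  (\<forall>T. finite (\<Q> T) \<and> disjoint (\<Q> T) \<and>
    (\<forall>Q\<in>\<Q> T. is_cube Q \<and> Q \<in> sets borel \<and> emeasure lborel Q = ennreal (side n ^ CARD('d))) \<and>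
    card (\<Q> T) * side n ^ CARD('d) <= esize n \<and>
    (\<forall>Q\<in>\<Q> T. \<forall>Q'\<in>\<Q> T. Q ~= Q' --> (\<forall>x\<in>Q. \<forall>y\<in>Q'. side n <= norm1 (x - y)))) \<and>
  (\<forall>T T'. T ~= T' --> \<Union>(\<Q> T) \<inter> \<Union>(\<Q> T') = {}) \<and>
  cbox (lo c) (up c) \<subseteq> (\<Union>T. \<Union>(\<Q> T))"
  unfolding lo_def up_def using cell_cubes[OF n1 blk(2,3)] by (rule allI)
 from choice[OF this] obtain \<Q> :: "'d point => 'd set => 'd point set set" where \<Q>: "\<forall>c.
  (\<forall>T. finite (\<Q> c T) \<and> disjoint (\<Q> c T) \<and>
    (\<forall>Q\<in>\<Q> c T. is_cube Q \<and> Q \<in> sets borel \<and> emeasure lborel Q = ennreal (side n ^ CARD('d))) \<and>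
    card (\<Q> c T) * side n ^ CARD('d) <= esize n \<and>
    (\<forall>Q\<in>\<Q> c T. \<forall>Q'\<in>\<Q> c T. Q ~= Q' --> (\<forall>x\<in>Q. \<forall>y\<in>Q'. side n <= norm1 (x - y)))) \<and>
  (\<forall>T T'. T ~= T' --> \<Union>(\<Q> c T) \<inter> \<Union>(\<Q> c T') = {}) \<and>
  cbox (lo c) (up c) \<subseteq> (\<Union>T. \<Union>(\<Q> c T))" ..
 have Q1: "finite (\<Q> c T)" "disjoint (\<Q> c T)"
  "\<And>Q. Q \<in> \<Q> c T ==> is_cube Q \<and> Q \<in> sets borel \<and> emeasure lborel Q = ennreal (side n ^ CARD('d))"
  "card (\<Q> c T) * side n ^ CARD('d) <= esize n" for c T
  using \<Q>[THEN spec[of _ c], THEN conjunct1, THEN spec[of _ T]] by auto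
 have Q2: "side n <= norm1 (x - y)" if "Q \<in> \<Q> c T" "Q' \<in> \<Q> c T" "Q ~= Q'" "x \<in> Q" "y \<in> Q'" for c T Q Q' x y
  using \<Q>[THEN spec[of _ c], THEN conjunct1, THEN spec[of _ T]] that by blast
 have Q3: "T = T'" if "x \<in> \<Union>(\<Q> c T)" "x \<in> \<Union>(\<Q> c T')" for c T T' x
 proof (rule ccontr)
  assume "T ~= T'"
  then have "\<Union>(\<Q> c T) \<inter> \<Union>(\<Q> c T') = {}" using \<Q>[THEN spec[of _ c], THEN conjunct2, THEN conjunct1] by blast
  moreover have "x \<in> \<Union>(\<Q> c T) \<inter> \<Union>(\<Q> c T')" using that by (rule IntI)
  ultimately show False by simp
 qed
 have Q4: "cbox (lo c) (up c) \<subseteq> (\<Union>T. \<Union>(\<Q> c T))" for c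
  using \<Q>[THEN spec[of _ c], THEN conjunct2, THEN conjunct2] .
 define U where "U = (%c T. \<Union>(\<Q> c T))"
 have Ub: "U c T \<in> sets borel" for c T
  unfolding U_def
 proof (rule sets.finite_Union)
  show "finite (\<Q> c T)" by (rule Q1(1))
  show "\<Q> c T \<subseteq> sets borel" using Q1(3) by blast
 qed
 have split: "(\<Sum>T\<in>UNIV. f z x * indicator (U (cell n z) T) x) = f z x" for z x
 proof (cases "f z x = 0")
  case False
  have "x \<in> cbox (lo (cell n z)) (up (cell n z))"
   unfolding lo_def up_def by (rule cell_support[OF n1 f(3)[OF False]])
  then obtain T0 where T0: "x \<in> U (cell n z) T0" using Q4[of "cell n z"] unfolding U_def by blast
  have "f z x * indicator (U (cell n z) T) x = (if T = T0 then f z x else 0)" for T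
  proof (cases "T = T0")
   case True
   then show ?thesis using T0 by simp
  next
   case F: False
   have "x \<notin> U (cell n z) T"
   proof
    assume "x \<in> U (cell n z) T"
    from Q3[OF this[unfolded U_def] T0[unfolded U_def]] show False using F by (rule notE[rotated])
   qed
   then show ?thesis using F by simp
  qed
  then show ?thesis by simp
 qed simp
 define t' where "t' = t / 2 ^ CARD('d)"
 define Z where "Z = (%c. {z\<in>net n. cell n z = c})"
 define y where "y = (%i \<omega>. truncation (level n) (e (X n i \<omega>) \<omega>))"
 define F where "F = (%c T. {\<omega>\<in>space M. \<exists>z\<in>Z c. t' < (\<Sum>i\<in>{1..n}. (f z (X n i \<omega>) * indicator (U c T) (X n i \<omega>)) * y i \<omega>)})"
 define bd where "bd = exp 1 * card (net n) * exp (- tilt n * t' + field_cost C n) + 2 * (esize n / side n ^ CARD('d)) * dep n"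
 have fin: "finite (Z c)" for c unfolding Z_def using finite_net[OF n1] by simp
 have FT: "F c T \<in> sets M" "prob (F c T) <= bd" for c T
 proof -
  have m: "(%x. f z x * indicator (U c T) x) \<in> borel_measurable borel" for z
   using f(1)[of z] Ub[of c T] by measurable
  have b: "\<bar>f z x * indicator (U c T) x\<bar> <= C" for z x
   using f(2)[of z x] C by (simp add: indicator_def)
  have s: "x \<in> \<Union>(\<Q> c T)" if "f z x * indicator (U c T) x ~= 0" for z x
   using that unfolding U_def by (auto simp: indicator_def split: if_splits)
  note T = field_family_tail[where f="%z x. f z x * indicator (U c T) x" and t=t' and Z="Z c" and \<Q>="\<Q> c T" and C=C,
   OF n lev blk(1,2) small Q1 Q2 fin m b s C]
  show "F c T \<in> sets M" unfolding F_def y_def by (rule T(1))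
  have "prob (F c T) <= exp 1 * card (Z c) * exp (- tilt n * t' + field_cost C n) + 2 * (esize n / side n ^ CARD('d)) * dep n"
   unfolding F_def y_def by (rule T(2))
  also have "... <= bd" unfolding bd_def
   using card_mono[OF finite_net[OF n1], of "Z c"] by (intro add_right_mono mult_right_mono mult_left_mono) (auto simp: Z_def)
  finally show "prob (F c T) <= bd" .
 qed
 have bd0: "0 <= bd" using FT(2) measure_nonneg order_trans by blast
 define Cs where "Cs = cell n ` region n"
 define E where "E = (\<Union>c\<in>Cs. \<Union>T. F c T)"
 have finC: "finite Cs" unfolding Cs_def by (rule finite_cells[OF n1])
 have ES: "E \<in> sets M" unfolding E_def using finC FT(1) by auto
 have "prob E <= (\<Sum>c\<in>Cs. prob (\<Union>T. F c T))"
  unfolding E_def using finC FT(1) by (intro finite_measure_subadditive_finite) auto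
 also have "... <= (\<Sum>c\<in>Cs. \<Sum>T\<in>(UNIV :: 'd set set). prob (F c T))"
  using FT(1) by (intro sum_mono finite_measure_subadditive_finite) auto
 also have "... <= (\<Sum>c\<in>Cs. \<Sum>T\<in>(UNIV :: 'd set set). bd)" by (intro sum_mono FT(2))
 also have "... = real (card Cs) * (2 ^ CARD('d) * bd)" by (simp add: card_UNIV_set)
 also have "... <= (3 ^ CARD('d) * (1 / hvol n)) * (2 ^ CARD('d) * bd)"
  using card_cells[OF n1 h1] bd0 unfolding Cs_def by (intro mult_right_mono) auto
 also have "... = 6 ^ CARD('d) * (1 / hvol n) * bd" by (simp add: power_mult_distrib[symmetric])
 finally have PE: "prob E <= 6 ^ CARD('d) * (1 / hvol n) * bd" .
 have sub: "{\<omega>\<in>space M. \<not> (\<forall>z\<in>net n. (\<Sum>i\<in>{1..n}. f z (X n i \<omega>) * y i \<omega>) <= t)} \<subseteq> E"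
 proof
  fix \<omega> assume "\<omega> \<in> {\<omega>\<in>space M. \<not> (\<forall>z\<in>net n. (\<Sum>i\<in>{1..n}. f z (X n i \<omega>) * y i \<omega>) <= t)}"
  then obtain z where w: "\<omega> \<in> space M" and z: "z \<in> net n" and gt: "\<not> (\<Sum>i\<in>{1..n}. f z (X n i \<omega>) * y i \<omega>) <= t" by blast
  have "(\<Sum>i\<in>{1..n}. f z (X n i \<omega>) * y i \<omega>) = (\<Sum>i\<in>{1..n}. \<Sum>T\<in>UNIV. (f z (X n i \<omega>) * indicator (U (cell n z) T) (X n i \<omega>)) * y i \<omega>)"
   by (rule sum.cong[OF refl]) (simp only: sum_distrib_right[symmetric] split)
  also have "... = (\<Sum>T\<in>UNIV. \<Sum>i\<in>{1..n}. (f z (X n i \<omega>) * indicator (U (cell n z) T) (X n i \<omega>)) * y i \<omega>)" by (rule sum.swap)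
  finally have eq: "(\<Sum>i\<in>{1..n}. f z (X n i \<omega>) * y i \<omega>) = (\<Sum>T\<in>UNIV. \<Sum>i\<in>{1..n}. (f z (X n i \<omega>) * indicator (U (cell n z) T) (X n i \<omega>)) * y i \<omega>)" .
  have "\<exists>T. t' < (\<Sum>i\<in>{1..n}. (f z (X n i \<omega>) * indicator (U (cell n z) T) (X n i \<omega>)) * y i \<omega>)"
  proof (rule ccontr)
   assume no: "\<not> (\<exists>T. t' < (\<Sum>i\<in>{1..n}. (f z (X n i \<omega>) * indicator (U (cell n z) T) (X n i \<omega>)) * y i \<omega>))"
   have "(\<Sum>i\<in>{1..n}. f z (X n i \<omega>) * y i \<omega>) <= (\<Sum>T\<in>(UNIV :: 'd set set). t')"
    unfolding eq
   proof (rule sum_mono)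
    fix T
    show "(\<Sum>i\<in>{1..n}. (f z (X n i \<omega>) * indicator (U (cell n z) T) (X n i \<omega>)) * y i \<omega>) <= t'" using no not_le by blast
   qed
   also have "... = t" unfolding t'_def by (simp add: card_UNIV_set)
   finally show False using gt by blast
  qed
  then obtain T where "t' < (\<Sum>i\<in>{1..n}. (f z (X n i \<omega>) * indicator (U (cell n z) T) (X n i \<omega>)) * y i \<omega>)" ..
  then have "\<omega> \<in> F (cell n z) T" unfolding F_def Z_def using w z by blast
  moreover have "cell n z \<in> Cs" unfolding Cs_def using net_subset[OF n1] z by blast
  ultimately show "\<omega> \<in> E" unfolding E_def by blast
 qed
 show ?thesis using ES PE[unfolded bd_def t'_def] sub[unfolded y_def] by (intro bexI[of _ E] conjI)
qed

text \<open>The exponential part is polynomially small as for the independent errors, and the mixing part is a multiple of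
\<open>A_n / side^d * dep n\<close>.\<close>

lemma field_net:
 fixes \<psi> \<phi> :: "'d point => real"
 assumes \<psi>: "continuous_on R0 \<psi>" and \<phi>: "kernel_like C\<^sub>K \<phi>"
 shows "\<exists>B. whp M (%n \<omega>. \<forall>z\<in>net n.
   (\<Sum>i\<in>{1..n}. (\<phi> (site n z (X n i \<omega>)) * on_R0 \<psi> n (X n i \<omega>)) * truncation (level n) (e (X n i \<omega>) \<omega>)) <= B * (real n * hvol n * rate n))"
proof -
 obtain C where C: "1 <= C" "\<And>n z x. \<bar>\<phi> (site n z x) * on_R0 \<psi> n x\<bar> <= C"
  "\<And>n z. (%x. \<phi> (site n z x) * on_R0 \<psi> n x) \<in> borel_measurable borel"
  "\<And>n z x. \<phi> (site n z x) * on_R0 \<psi> n x ~= 0 ==> \<forall>j. \<bar>site n z x $ j\<bar> <= C\<^sub>K"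
  using noise_weight[OF \<psi> \<phi>] by metis
 have C0: "0 <= C" using C(1) by linarith
 have one: "0 < (1 :: real)" by simp
 obtain c1 where c1: "\<forall>\<^sub>F n in sequentially. field_cost C n <= c1 * ln (real n)" using eventually_field_cost[OF C0] by blast
 \<comment> \<open>The net has at most \<open>c n^(3 d)\<close> points; the number of cells contributes one more power of \<open>n\<close>.\<close>
 define k where "k = 3 * CARD('d) + 1"
 define c where "c = 6 ^ CARD('d) * (\<kappa> + 1) * exp 1 * (\<kappa> + 2) ^ CARD('d)"
 \<comment> \<open>Each parity class receives the fraction \<open>2^(- d)\<close> of the threshold.\<close>
 define B where "B = 2 ^ CARD('d) * (c1 + (real k + 1))"
 have "(%n. (C * gmax) * (rate n * side n ^ CARD('d) * level n)) \<longlonglongrightarrow> (C * gmax) * 0" by (intro tendsto_mult_left rate_side_level_lim)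
 then have sm: "\<forall>\<^sub>F n in sequentially. (C * gmax) * (rate n * side n ^ CARD('d) * level n) < 1 / 2" by (intro order_tendstoD(2)) auto
 have lim: "(%n. c * real n ^ k * exp (- (real k + 1) * ln (real n)) + (6 ^ CARD('d) * 2) * (Avol n / side n ^ CARD('d) * dep n)) \<longlonglongrightarrow> 0 + (6 ^ CARD('d) * 2) * 0"
  by (intro tendsto_add prob_bound_power_lim tendsto_mult_left dep_lim)
 show ?thesis
 proof (intro exI[of _ B] whpI[OF _ lim[unfolded mult_zero_right add_0_right]])
  show "\<forall>\<^sub>F n in sequentially. \<exists>E\<in>sets M. prob E <= c * real n ^ k * exp (- (real k + 1) * ln (real n)) + (6 ^ CARD('d) * 2) * (Avol n / side n ^ CARD('d) * dep n) \<and>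
   {\<omega>\<in>space M. \<not> (\<forall>z\<in>net n. (\<Sum>i\<in>{1..n}. (\<phi> (site n z (X n i \<omega>)) * on_R0 \<psi> n (X n i \<omega>)) * truncation (level n) (e (X n i \<omega>) \<omega>)) <= B * (real n * hvol n * rate n))} \<subseteq> E"
   using eventually_tilt_level[OF C0] sm c1 eventually_card_net eventually_h_inverse eventually_h_le[OF one]
    eventually_blocks eventually_level eventually_ge_at_top[of 3]
  proof eventually_elim
   case (elim n)
   have n: "1 <= n" using elim(9) by simp
   have lev: "0 < level n" using elim(8) by linarith
   have s0: "0 < side n" using elim(7) by linarith
   define t where "t = B * (real n * hvol n * rate n)"
   have bk: "Min (range (A2 n)) <= side n" "\<forall>j. 8 * side n <= A n j * h n j" using elim(7) by simp_all
   note G = field_net_tail[where f="%z x. \<phi> (site n z x) * on_R0 \<psi> n x" and C=C and t=t,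
    OF elim(9) lev bk(1) s0 bk(2) elim(6,1) less_imp_le[OF elim(2)] C(3) C(2) C(4) C0]
   from G obtain E where E1: "E \<in> sets M" and E2: "prob E <= 6 ^ CARD('d) * (1 / hvol n) *
     (exp 1 * card (net n) * exp (- tilt n * (t / 2 ^ CARD('d)) + field_cost C n) + 2 * (esize n / side n ^ CARD('d)) * dep n)
    \<and> {\<omega>\<in>space M. \<not> (\<forall>z\<in>net n. (\<Sum>i\<in>{1..n}. (\<phi> (site n z (X n i \<omega>)) * on_R0 \<psi> n (X n i \<omega>)) * truncation (level n) (e (X n i \<omega>) \<omega>)) <= t)} \<subseteq> E"
    by (rule bexE)
   note E = E1 E2[THEN conjunct1] E2[THEN conjunct2]
   have hp: "0 < hvol n" by (rule hvol_pos[OF n])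
   have x1: "exp (- tilt n * (t / 2 ^ CARD('d)) + field_cost C n) <= exp (- (real k + 1) * ln (real n))"
   proof -
    have "t / 2 ^ CARD('d) = (c1 + (real k + 1)) * (real n * hvol n * rate n)" unfolding t_def B_def by simp
    then have q: "tilt n * (t / 2 ^ CARD('d)) = (c1 + (real k + 1)) * ln (real n)" by (simp only: tilt_threshold[OF elim(9)])
    show ?thesis using elim(3) unfolding exp_le_cancel_iff mult_minus_left q distrib_right by linarith
   qed
   have x2: "exp 1 * card (net n) * exp (- tilt n * (t / 2 ^ CARD('d)) + field_cost C n)
    <= exp 1 * ((\<kappa> + 2) ^ CARD('d) * real n ^ (3 * CARD('d))) * exp (- (real k + 1) * ln (real n))"
    using elim(4) x1 \<kappa>(1) by (intro mult_mono) auto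
   have "6 ^ CARD('d) * (1 / hvol n) * (exp 1 * card (net n) * exp (- tilt n * (t / 2 ^ CARD('d)) + field_cost C n))
    <= 6 ^ CARD('d) * ((\<kappa> + 1) * real n) * (exp 1 * ((\<kappa> + 2) ^ CARD('d) * real n ^ (3 * CARD('d))) * exp (- (real k + 1) * ln (real n)))"
   proof (rule mult_mono[OF _ x2])
    show "6 ^ CARD('d) * (1 / hvol n) <= 6 ^ CARD('d) * ((\<kappa> + 1) * real n)" using elim(5) by (intro mult_left_mono) auto
   qed (use \<kappa>(1) in auto)
   also have "... = c * real n ^ k * exp (- (real k + 1) * ln (real n))" unfolding c_def k_def by (simp add: mult_ac)
   finally have p1: "6 ^ CARD('d) * (1 / hvol n) * (exp 1 * card (net n) * exp (- tilt n * (t / 2 ^ CARD('d)) + field_cost C n))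
    <= c * real n ^ k * exp (- (real k + 1) * ln (real n))" .
   have p2: "6 ^ CARD('d) * (1 / hvol n) * (2 * (esize n / side n ^ CARD('d)) * dep n) = (6 ^ CARD('d) * 2) * (Avol n / side n ^ CARD('d) * dep n)"
    unfolding esize_def using hp by simp
   have "prob E <= c * real n ^ k * exp (- (real k + 1) * ln (real n)) + (6 ^ CARD('d) * 2) * (Avol n / side n ^ CARD('d) * dep n)"
    using E(2)[unfolded distrib_left p2] p1 by linarith
   then show ?case using E(1,3) unfolding t_def by (intro bexI[of _ E] conjI)
  qed
 qed
qed


section \<open>The uniform rate\<close>

abbreviation "tup k \<equiv> (tuples p :: 'd list list) ! k"
abbreviation "all_tuples \<equiv> (tuples p :: 'd list list)"
abbreviation "mval k v \<equiv> prod_tuple (vec_nth v) (tup k)"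
abbreviation "bias n \<equiv> (\<Sum>ks | sorted ks \<and> length ks = p + 1. prod_tuple (h n) ks)"

abbreviation "field_avg k n \<omega> z \<equiv>
 (\<Sum>i=1..n. K (site n z (X n i \<omega>)) * mval k (site n z (X n i \<omega>)) * (on_R0 \<eta> n (X n i \<omega>) * e (X n i \<omega>) \<omega>)) / (real n * hvol n)"
abbreviation "error_avg k n \<omega> z \<equiv>
 (\<Sum>i=1..n. K (site n z (X n i \<omega>)) * mval k (site n z (X n i \<omega>)) * (on_R0 \<sigma>\<^sub>\<epsilon> n (X n i \<omega>) * eps i \<omega>)) / (real n * hvol n)"
abbreviation "abs_avg k n \<omega> z \<equiv>
 (\<Sum>i=1..n. \<bar>K (site n z (X n i \<omega>)) * mval k (site n z (X n i \<omega>))\<bar>) / (real n * hvol n)"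
abbreviation "moment_avg k l n \<omega> z \<equiv>
 (\<Sum>i=1..n. K (site n z (X n i \<omega>)) * (mval k (site n z (X n i \<omega>)) * mval l (site n z (X n i \<omega>)))) / (real n * hvol n)"
abbreviation "est_err js n \<omega> z \<equiv>
 est_error (lp_deriv p K (A n) (h n) n (%i. X n i \<omega>) (%i. Y n i \<omega>) js z) (iter_partial R0 js m z)"

lemma tuple_sum:
 fixes F :: "'d list => real"
 shows "(\<Sum>l<length all_tuples. F (tup l)) = (\<Sum>js | sorted js \<and> length js <= p. F js)"
proof -
 have "bij_betw (%l. tup l) {..<length all_tuples} (set (tuples p))" by (rule bij_betw_nth[OF distinct_tuples]) auto
 from sum.reindex_bij_betw[OF this, of F] show ?thesis by (simp only: set_tuples)
qed

lemma all_tuples_nonempty: "0 < length all_tuples"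
proof -
 have "[] \<in> set (tuples p :: 'd list list)" by (simp add: set_tuples)
 then show ?thesis by (rule length_pos_if_in_set)
qed

lemma kernel_like_K: "kernel_like C\<^sub>K K"
proof -
 obtain C where C: "\<And>v. \<bar>K v\<bar> <= C" using K_bounded unfolding bounded_iff by auto
 obtain L where L: "L > 0" "\<And>v1 v2. \<bar>K v1 - K v2\<bar> <= L * norm1 (v1 - v2)" using K_Lipschitz by blast
 have "\<bar>v $ j\<bar> <= C\<^sub>K" if "K v ~= 0" for v j
 proof -
  have "v \<in> cbox (\<chi> j. - C\<^sub>K) (\<chi> j. C\<^sub>K)" using that K_supp(2) by blast
  then have "- C\<^sub>K <= v $ j \<and> v $ j <= C\<^sub>K" by (simp add: mem_box_cart)
  then show ?thesis unfolding abs_le_iff by linarith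
 qed
 moreover have "\<exists>L\<ge>0. \<forall>v v'. \<bar>K v - K v'\<bar> <= L * norm1 (v - v')" using L by (intro exI[of _ L]) auto
 ultimately show ?thesis unfolding kernel_like_def using C by blast
qed

lemma kernel_like_K_power: "kernel_like C\<^sub>K (%v. K v * mval k v)"
 using CK_le by (intro kernel_like_times_tuple kernel_like_K) simp

lemma kernel_like_K_power_power: "kernel_like C\<^sub>K (%v. K v * (mval k v * mval l v))"
 using kernel_like_times_tuple[OF kernel_like_K_power[of k], of "tup l"] CK_le by (simp only: mult.assoc)

lemma moment_entry:
 assumes "k < length all_tuples" "l < length all_tuples"
 shows "index_mat (moment_matrix p K) (k, l) = (\<integral>v. K v * (mval k v * mval l v) \<partial>lborel)"
 using assms unfolding moment_matrix_def Let_def by (simp add: poly_vec_def mult_ac)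

lemma g_bounded_below: "\<exists>\<gamma>>0. \<forall>z\<in>R0. \<gamma> <= g z"
proof -
 have c: "compact (R0 :: 'd point set)" unfolding R0_def by (rule compact_cbox)
 have "(0 :: 'd point) \<in> R0" unfolding R0_def by (simp add: mem_box_cart)
 then have ne: "(R0 :: 'd point set) ~= {}" by blast
 from continuous_attains_inf[OF c ne g(5)] obtain x where x: "x \<in> R0" "\<forall>y\<in>R0. g x <= g y" by blast
 then show ?thesis using g(6)[OF x(1)] by blast
qed

lemma abs_prod_tuple_le:
 assumes "\<And>j. \<bar>u j\<bar> <= v j"
 shows "\<bar>prod_tuple u js\<bar> <= prod_tuple v js"
 unfolding prod_tuple_def
proof (induction js)
 case (Cons j js)
 have "0 <= v j" using assms[of j] by linarith
 then show ?case using Cons assms[of j] by (simp add: abs_mult mult_mono)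
qed simp

text \<open>Sites in the kernel window are within the bandwidth of \<open>z\<close>, so each monomial of the remainder is at most a bandwidth product.\<close>

lemma Taylor_at_site:
 assumes n: "1 <= n" and z: "z \<in> region n" and s: "\<forall>j. \<bar>site n z x $ j\<bar> <= C\<^sub>K"
  and B: "\<And>js z. length js <= p + 1 ==> z \<in> R0 ==> \<bar>iter_partial R0 js m z\<bar> <= B" and B0: "0 <= B"
 shows "\<bar>m (cdiv x (A n)) - (\<Sum>l<length all_tuples. iter_partial R0 (tup l) m z / tuple_fact (tup l) * prod_tuple (vec_nth (cdiv x (A n) - z)) (tup l))\<bar>
  <= B * bias n"
proof -
 let ?x = "cdiv x (A n)"
 have xR: "?x \<in> R0" using site_in_R0[OF n z] s by blast
 have zR: "z \<in> R0" using region_subset_R0[OF n] z by blast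
 have d: "\<bar>(?x - z) $ j\<bar> <= h n j" for j
 proof -
  have hp: "0 < h n j" by (rule h_pos[OF n])
  have "(?x - z) $ j = site n z x $ j * h n j" using hp by (simp add: scaled_site_def cdiv_def)
  then have "\<bar>(?x - z) $ j\<bar> = \<bar>site n z x $ j\<bar> * h n j" using hp by (simp add: abs_mult)
  also have "... <= 1 * h n j" using s[rule_format, of j] CK_le hp by (intro mult_right_mono) auto
  finally show ?thesis by simp
 qed
 have len: "length ([] :: 'd list) + Suc p <= p + 1" by simp
 have nn: "\<forall>j. j \<notin> UNIV --> ?x $ j = z $ j" by simp
 have "\<bar>m ?x - (\<Sum>js | sorted js \<and> length js <= p. iter_partial R0 js m z / tuple_fact js * prod_tuple (vec_nth (?x - z)) js)\<bar>
  <= B * (\<Sum>js | sorted js \<and> length js = p + 1. \<bar>prod_tuple (vec_nth (?x - z)) js\<bar>)"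
  using multivariate_Taylor[OF m B len xR zR nn] by (simp add: iter_partial_def)
 also have "... <= B * bias n"
  using B0 d by (intro mult_left_mono sum_mono abs_prod_tuple_le)
 finally show ?thesis by (simp only: tuple_sum[of "%js. iter_partial R0 js m z / tuple_fact js * prod_tuple (vec_nth (?x - z)) js"])
qed

text \<open>Where the weight vanishes, the summand vanishes; elsewhere the site lies in the box and the model equation applies.\<close>

lemma residual_bound:
 assumes n: "1 <= n" and z: "z \<in> region n" and w: "\<omega> \<in> space M"
  and B: "\<And>js z. length js <= p + 1 ==> z \<in> R0 ==> \<bar>iter_partial R0 js m z\<bar> <= B" and B0: "0 <= B"
  and G: "abs_avg k n \<omega> z <= G"
  and r1: "\<bar>field_avg k n \<omega> z\<bar> <= r1"
  and r2: "\<bar>error_avg k n \<omega> z\<bar> <= r2"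
 shows "\<bar>(\<Sum>i=1..n. K (site n z (X n i \<omega>)) * mval k (site n z (X n i \<omega>)) * (Y n i \<omega> -
   (\<Sum>l<length all_tuples. iter_partial R0 (tup l) m z / tuple_fact (tup l) * prod_tuple (vec_nth (cdiv (X n i \<omega>) (A n) - z)) (tup l)))) / (real n * hvol n)\<bar>
  <= G * (B * bias n) + r1 + r2"
proof -
 define N where "N = real n * hvol n"
 have N: "0 < N" unfolding N_def using n hvol_pos[OF n] by simp
 define a where "a = (%i. K (site n z (X n i \<omega>)) * mval k (site n z (X n i \<omega>)))"
 define P where "P = (%i. \<Sum>l<length all_tuples. iter_partial R0 (tup l) m z / tuple_fact (tup l) * prod_tuple (vec_nth (cdiv (X n i \<omega>) (A n) - z)) (tup l))"
 define u where "u = (%i. a i * (m (cdiv (X n i \<omega>) (A n)) - P i))"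
 define u1 where "u1 = (%i. a i * (on_R0 \<eta> n (X n i \<omega>) * e (X n i \<omega>) \<omega>))"
 define u2 where "u2 = (%i. a i * (on_R0 \<sigma>\<^sub>\<epsilon> n (X n i \<omega>) * eps i \<omega>))"
 have supp: "\<forall>j. \<bar>site n z (X n i \<omega>) $ j\<bar> <= C\<^sub>K" if "a i ~= 0" for i
  using that kernel_like_K_power[of k] unfolding a_def kernel_like_def by blast
 have b0: "0 <= B * bias n" using B0 h_pos[OF n] by (intro mult_nonneg_nonneg sum_nonneg less_imp_le[OF prod_tuple_pos])
 have split: "a i * (Y n i \<omega> - P i) = u i + u1 i + u2 i" if i: "i \<in> {1..n}" for i
 proof (cases "a i = 0")
  case False
  have "cdiv (X n i \<omega>) (A n) \<in> R0" using site_in_R0[OF n z] supp[OF False] by blast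
  then have "on_R0 \<eta> n (X n i \<omega>) = \<eta> (cdiv (X n i \<omega>) (A n))" "on_R0 \<sigma>\<^sub>\<epsilon> n (X n i \<omega>) = \<sigma>\<^sub>\<epsilon> (cdiv (X n i \<omega>) (A n))"
   by (simp_all add: on_R0_def)
  moreover have "1 <= i" "i <= n" using i by auto
  ultimately show ?thesis unfolding u_def u1_def u2_def using Y[OF _ _ w, of i n] by (simp add: algebra_simps)
 qed (simp add: u_def u1_def u2_def)
 have ub: "\<bar>u i\<bar> <= \<bar>a i\<bar> * (B * bias n)" for i
 proof (cases "a i = 0")
  case False
  have "\<bar>m (cdiv (X n i \<omega>) (A n)) - P i\<bar> <= B * bias n"
   unfolding P_def by (rule Taylor_at_site[OF n z supp[OF False] B B0])
  then show ?thesis unfolding u_def abs_mult by (intro mult_left_mono) auto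
 qed (simp add: u_def)
 have "(\<Sum>i=1..n. a i * (Y n i \<omega> - P i)) / N = (\<Sum>i=1..n. u i) / N + (\<Sum>i=1..n. u1 i) / N + (\<Sum>i=1..n. u2 i) / N"
  by (simp add: split sum.distrib add_divide_distrib)
 also have "\<bar>...\<bar> <= \<bar>(\<Sum>i=1..n. u i) / N\<bar> + \<bar>(\<Sum>i=1..n. u1 i) / N\<bar> + \<bar>(\<Sum>i=1..n. u2 i) / N\<bar>" by linarith
 also have "... <= G * (B * bias n) + r1 + r2"
 proof (intro add_mono)
  have "\<bar>(\<Sum>i=1..n. u i)\<bar> <= (\<Sum>i=1..n. \<bar>a i\<bar> * (B * bias n))"
   by (rule order_trans[OF sum_abs sum_mono[OF ub]])
  then have "\<bar>(\<Sum>i=1..n. u i) / N\<bar> <= ((\<Sum>i=1..n. \<bar>a i\<bar>) / N) * (B * bias n)"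
   using N by (simp add: abs_divide sum_distrib_right[symmetric] divide_right_mono)
  also have "... <= G * (B * bias n)" using G b0 unfolding a_def N_def by (rule mult_right_mono)
  finally show "\<bar>(\<Sum>i=1..n. u i) / N\<bar> <= G * (B * bias n)" .
  show "\<bar>(\<Sum>i=1..n. u1 i) / N\<bar> <= r1" using r1 unfolding u1_def a_def N_def .
  show "\<bar>(\<Sum>i=1..n. u2 i) / N\<bar> <= r2" using r2 unfolding u2_def a_def N_def .
 qed
 finally show ?thesis unfolding a_def P_def N_def .
qed

lemma noise_bound:
 fixes D :: nat
 assumes \<phi>: "\<And>k. kernel_like C\<^sub>K (\<phi> k)"
 shows "\<exists>B\<ge>0. whp M (%n \<omega>. \<forall>k\<in>{..<D}. \<forall>z\<in>region n.
   \<bar>(\<Sum>i=1..n. \<phi> k (site n z (X n i \<omega>)) * (on_R0 \<eta> n (X n i \<omega>) * e (X n i \<omega>) \<omega>)) / (real n * hvol n)\<bar> <= B * rate n)"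
  and "\<exists>B\<ge>0. whp M (%n \<omega>. \<forall>k\<in>{..<D}. \<forall>z\<in>region n.
   \<bar>(\<Sum>i=1..n. \<phi> k (site n z (X n i \<omega>)) * (on_R0 \<sigma>\<^sub>\<epsilon> n (X n i \<omega>) * eps i \<omega>)) / (real n * hvol n)\<bar> <= B * rate n)"
proof -
 have uniform: "\<exists>B\<ge>0. whp M (%n \<omega>. \<forall>k\<in>{..<D}. \<forall>z\<in>region n. f k n \<omega> z <= B * rate n)"
  if H: "\<And>k. \<exists>B\<ge>0. whp M (%n \<omega>. \<forall>z\<in>region n. f k n \<omega> z <= B * rate n)" for f :: "nat => nat => 'a => 'd point => real"
 proof -
  from choice[OF allI[OF H]] obtain B where
   BB: "\<forall>k. 0 <= B k \<and> whp M (%n \<omega>. \<forall>z\<in>region n. f k n \<omega> z <= B k * rate n)" by (rule exE)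
  have B: "0 <= B k" "whp M (%n \<omega>. \<forall>z\<in>region n. f k n \<omega> z <= B k * rate n)" for k
   using BB[THEN spec, THEN conjunct1, of k] BB[THEN spec, THEN conjunct2, of k] .
  have "whp M (%n \<omega>. \<forall>k\<in>{..<D}. \<forall>z\<in>region n. f k n \<omega> z <= B k * rate n)"
   by (rule whp_ball[OF finite_lessThan]) (rule B(2))
  then have "whp M (%n \<omega>. \<forall>k\<in>{..<D}. \<forall>z\<in>region n. f k n \<omega> z <= (\<Sum>k<D. B k) * rate n)"
  proof (rule whp_mono)
   show "\<forall>\<^sub>F n in sequentially. \<forall>\<omega>\<in>space M. (\<forall>k\<in>{..<D}. \<forall>z\<in>region n. f k n \<omega> z <= B k * rate n) \<longrightarrow>
    (\<forall>k\<in>{..<D}. \<forall>z\<in>region n. f k n \<omega> z <= (\<Sum>k<D. B k) * rate n)"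
    using eventually_ge_at_top[of 3]
   proof eventually_elim
    case (elim n)
    have le: "B k * rate n <= (\<Sum>k<D. B k) * rate n" if "k \<in> {..<D}" for k
     using that B(1) rate_pos[OF elim] by (intro mult_right_mono member_le_sum) auto
    show ?case
    proof (intro ballI impI)
     fix \<omega> k z assume a: "\<forall>k\<in>{..<D}. \<forall>z\<in>region n. f k n \<omega> z <= B k * rate n" and k: "k \<in> {..<D}" and z: "z \<in> region n"
     show "f k n \<omega> z <= (\<Sum>k<D. B k) * rate n" using bspec[OF bspec[OF a k] z] le[OF k] by (rule order_trans)
    qed
   qed
  qed
  moreover have "0 <= (\<Sum>k<D. B k)" using B(1) by (intro sum_nonneg) auto
  ultimately show ?thesis by blast
 qed
 show "\<exists>B\<ge>0. whp M (%n \<omega>. \<forall>k\<in>{..<D}. \<forall>z\<in>region n.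
   \<bar>(\<Sum>i=1..n. \<phi> k (site n z (X n i \<omega>)) * (on_R0 \<eta> n (X n i \<omega>) * e (X n i \<omega>) \<omega>)) / (real n * hvol n)\<bar> <= B * rate n)"
  by (rule uniform, rule noise_from_net[where u="%n i \<omega>. e (X n i \<omega>) \<omega>", OF \<eta>(2) field_max field_net[OF \<eta>(2)] \<phi>])
 show "\<exists>B\<ge>0. whp M (%n \<omega>. \<forall>k\<in>{..<D}. \<forall>z\<in>region n.
   \<bar>(\<Sum>i=1..n. \<phi> k (site n z (X n i \<omega>)) * (on_R0 \<sigma>\<^sub>\<epsilon> n (X n i \<omega>) * eps i \<omega>)) / (real n * hvol n)\<bar> <= B * rate n)"
  by (rule uniform, rule noise_from_net[where u="%n i \<omega>. eps i \<omega>", OF \<sigma>\<^sub>\<epsilon>(2) eps_max error_net[OF \<sigma>\<^sub>\<epsilon>(2)] \<phi>])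
qed

lemma absolute_average:
 "\<exists>G\<ge>0. whp M (%n \<omega>. \<forall>k\<in>{..<D}. \<forall>z\<in>region n.
   abs_avg k n \<omega> z <= G)"
proof -
 define I where "I = (%k. \<integral>v. \<bar>K v * mval k v\<bar> \<partial>lborel)"
 have I0: "0 <= I k" for k unfolding I_def by (rule integral_nonneg_AE) simp
 define G where "G = gmax * (\<Sum>k<D. I k) + 1"
 have S0: "0 <= (\<Sum>k<D. I k)" using I0 by (intro sum_nonneg) auto
 have one: "0 < (1 :: real)" by simp
 have "whp M (%n \<omega>. \<forall>k\<in>{..<D}. \<forall>z\<in>region n.
  \<bar>abs_avg k n \<omega> z - g z * I k\<bar> <= 1)"
  unfolding I_def by (rule whp_ball[OF finite_lessThan]) (rule local_average[OF kernel_like_abs[OF kernel_like_K_power] one])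
 then have "whp M (%n \<omega>. \<forall>k\<in>{..<D}. \<forall>z\<in>region n.
   abs_avg k n \<omega> z <= G)"
 proof (rule whp_mono, intro always_eventually allI ballI impI)
  fix n \<omega> k z
  assume H: "\<forall>k\<in>{..<D}. \<forall>z\<in>region n.
   \<bar>abs_avg k n \<omega> z - g z * I k\<bar> <= 1"
   and k: "k \<in> {..<D}" and z: "z \<in> region n"
  have "abs_avg k n \<omega> z <= g z * I k + 1"
   using bspec[OF bspec[OF H k] z] by linarith
  moreover have "g z * I k <= gmax * (\<Sum>k<D. I k)"
   using gmax I0 k by (intro mult_mono member_le_sum) auto
  ultimately show "abs_avg k n \<omega> z <= G"
   unfolding G_def by linarith
 qed
 moreover have "0 <= G" unfolding G_def using S0 gmax(1) by simp
 ultimately show ?thesis by blast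
qed

lemma rate_over_tuple:
 assumes n: "1 <= n"
 shows "sqrt (ln (real n) / (Avol n * hvol n * (prod_tuple (h n) js)\<^sup>2)) = rate n / prod_tuple (h n) js"
proof -
 have P: "0 < prod_tuple (h n) js" by (rule prod_tuple_pos) (rule h_pos[OF n])
 have "ln (real n) / (Avol n * hvol n * (prod_tuple (h n) js)\<^sup>2) = ln (real n) / esize n / (prod_tuple (h n) js)\<^sup>2"
  unfolding esize_def by simp
 then show ?thesis unfolding rate_def using P by (simp only: real_sqrt_divide real_sqrt_abs abs_of_pos)
qed

text \<open>On an event of high probability, the four uniform averages give the hypotheses of \<open>lp_deriv_error\<close> at every \<open>z\<close> with one set of constants.\<close>

lemma uniform_rate:
 assumes js: "sorted js" "length js <= p"
 shows "bigOp M
   (%n \<omega>. SUP z\<in>region n. est_err js n \<omega> z)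
   (%n. bias n / prod_tuple (h n) js + sqrt (ln (real n) / (Avol n * hvol n * (prod_tuple (h n) js)\<^sup>2)))"
proof -
 define S where "S = (%k l. index_mat (moment_matrix p K) (k, l))"
 have Sc: "moment_matrix p K \<in> carrier_mat (length all_tuples) (length all_tuples)" unfolding moment_matrix_def Let_def by simp
 from invertible_entries[OF S Sc] obtain T where
  T: "\<And>k m. k < length all_tuples ==> m < length all_tuples ==> (\<Sum>l<length all_tuples. T k l * S l m) = (if k = m then 1 else 0)" unfolding S_def by blast
 define t0 where "t0 = (\<Sum>k<length all_tuples. \<Sum>l<length all_tuples. \<bar>T k l\<bar>) + 1"
 have t0s: "\<bar>T k l\<bar> <= t0" if "k < length all_tuples" "l < length all_tuples" for k l
 proof -
  have "\<bar>T k l\<bar> <= (\<Sum>l<length all_tuples. \<bar>T k l\<bar>)" using that by (intro member_le_sum) auto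
  also have "... <= (\<Sum>k<length all_tuples. \<Sum>l<length all_tuples. \<bar>T k l\<bar>)" using that by (intro member_le_sum[where f="%k. \<Sum>l<length all_tuples. \<bar>T k l\<bar>"]) (auto intro: sum_nonneg)
  finally show ?thesis unfolding t0_def by simp
 qed
 have "0 <= (\<Sum>k<length all_tuples. \<Sum>l<length all_tuples. \<bar>T k l\<bar>)" by (intro sum_nonneg) auto
 then have t0: "0 < t0" unfolding t0_def by linarith
 obtain \<gamma>0 where \<gamma>0: "0 < \<gamma>0" "\<And>z. z \<in> R0 ==> \<gamma>0 <= g z" using g_bounded_below by blast
 have D0: "0 < real (length all_tuples)" using all_tuples_nonempty by simp
 \<comment> \<open>The accuracy of the moment averages that the perturbation bound requires.\<close>
 define \<epsilon> where "\<epsilon> = \<gamma>0 / (2 * t0 * real (length all_tuples) * real (length all_tuples))"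
 have \<epsilon>: "0 < \<epsilon>" unfolding \<epsilon>_def using \<gamma>0(1) t0 D0 by simp
 have \<epsilon>D: "2 * t0 * real (length all_tuples) * real (length all_tuples) * \<epsilon> = \<gamma>0" unfolding \<epsilon>_def using t0 D0 by simp
 obtain Bm0 where Bm0: "\<And>js z. length js <= p + 1 ==> z \<in> R0 ==> \<bar>iter_partial R0 js m z\<bar> <= Bm0"
  using iter_partial_bounded[OF m] by blast
 define Bm where "Bm = max 0 Bm0"
 have Bm: "0 <= Bm" "\<And>js z. length js <= p + 1 ==> z \<in> R0 ==> \<bar>iter_partial R0 js m z\<bar> <= Bm"
  unfolding Bm_def using Bm0 by (auto intro: max.coboundedI2)
 obtain G where G: "0 <= G" "whp M (%n \<omega>. \<forall>k\<in>{..<length all_tuples}. \<forall>z\<in>region n.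
   abs_avg k n \<omega> z <= G)"
  using absolute_average[of "length all_tuples"] by blast
 obtain B1 where B1: "0 <= B1" "whp M (%n \<omega>. \<forall>k\<in>{..<length all_tuples}. \<forall>z\<in>region n.
   \<bar>field_avg k n \<omega> z\<bar> <= B1 * rate n)"
  using noise_bound(1)[where \<phi>="%k v. K v * mval k v" and D="length all_tuples", OF kernel_like_K_power] by blast
 obtain B2 where B2: "0 <= B2" "whp M (%n \<omega>. \<forall>k\<in>{..<length all_tuples}. \<forall>z\<in>region n.
   \<bar>error_avg k n \<omega> z\<bar> <= B2 * rate n)"
  using noise_bound(2)[where \<phi>="%k v. K v * mval k v" and D="length all_tuples", OF kernel_like_K_power] by blast
 have P: "whp M (%n \<omega>. \<forall>k\<in>{..<length all_tuples}. \<forall>l\<in>{..<length all_tuples}. \<forall>z\<in>region n.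
  \<bar>moment_avg k l n \<omega> z - g z * S k l\<bar> <= \<epsilon>)"
 proof (intro whp_ball finite_lessThan)
  fix k l assume kl: "k \<in> {..<length all_tuples}" "l \<in> {..<length all_tuples}"
  have "S k l = (\<integral>v. K v * (mval k v * mval l v) \<partial>lborel)" unfolding S_def using kl by (intro moment_entry) auto
  then show "whp M (%n \<omega>. \<forall>z\<in>region n.
   \<bar>moment_avg k l n \<omega> z - g z * S k l\<bar> <= \<epsilon>)"
   using local_average[OF kernel_like_K_power_power[of k l] \<epsilon>] by (simp only:)
 qed
 define c where "c = tuple_fact js * (2 * t0 * real (length all_tuples)) / \<gamma>0"
 have c0: "0 <= c" unfolding c_def using tuple_fact_ge_1[of js] t0 \<gamma>0(1) by (intro divide_nonneg_pos mult_nonneg_nonneg) auto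
 define C where "C = c * (G * Bm + B1 + B2) + 1"
 have C0: "0 < C" unfolding C_def using c0 G(1) Bm(1) B1(1) B2(1) by (intro add_nonneg_pos mult_nonneg_nonneg add_nonneg_nonneg) auto
 have main: "whp M (%n \<omega>. \<forall>z\<in>region n. est_err js n \<omega> z
  <= ennreal (C * (bias n / prod_tuple (h n) js + rate n / prod_tuple (h n) js)))"
 proof (rule whp_mono[OF whp_conj[OF P whp_conj[OF G(2) whp_conj[OF B1(2) B2(2)]]]])
  show "\<forall>\<^sub>F n in sequentially. \<forall>\<omega>\<in>space M.
   (\<forall>k\<in>{..<length all_tuples}. \<forall>l\<in>{..<length all_tuples}. \<forall>z\<in>region n.
    \<bar>moment_avg k l n \<omega> z - g z * S k l\<bar> <= \<epsilon>) \<and>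
   (\<forall>k\<in>{..<length all_tuples}. \<forall>z\<in>region n.
    abs_avg k n \<omega> z <= G) \<and>
   (\<forall>k\<in>{..<length all_tuples}. \<forall>z\<in>region n.
    \<bar>field_avg k n \<omega> z\<bar> <= B1 * rate n) \<and>
   (\<forall>k\<in>{..<length all_tuples}. \<forall>z\<in>region n.
    \<bar>error_avg k n \<omega> z\<bar> <= B2 * rate n) \<longrightarrow>
   (\<forall>z\<in>region n. est_err js n \<omega> z
    <= ennreal (C * (bias n / prod_tuple (h n) js + rate n / prod_tuple (h n) js)))"
   using eventually_ge_at_top[of 3]
  proof eventually_elim
   case (elim n)
   have n: "1 <= n" using elim by simp
   show ?case
   proof (rule ballI, rule impI, elim conjE, rule ballI)
    fix \<omega> z assume w: "\<omega> \<in> space M" and z: "z \<in> region n"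
     and H1: "\<forall>k\<in>{..<length all_tuples}. \<forall>l\<in>{..<length all_tuples}. \<forall>z\<in>region n.
      \<bar>moment_avg k l n \<omega> z - g z * S k l\<bar> <= \<epsilon>"
     and H2: "\<forall>k\<in>{..<length all_tuples}. \<forall>z\<in>region n.
      abs_avg k n \<omega> z <= G"
     and H3: "\<forall>k\<in>{..<length all_tuples}. \<forall>z\<in>region n.
      \<bar>field_avg k n \<omega> z\<bar> <= B1 * rate n"
     and H4: "\<forall>k\<in>{..<length all_tuples}. \<forall>z\<in>region n.
      \<bar>error_avg k n \<omega> z\<bar> <= B2 * rate n"
    have N: "0 < real n * hvol n" using n hvol_pos[OF n] by simp
    have zR: "z \<in> R0" using region_subset_R0[OF n] z by blast
    have gz: "0 < g z" "\<gamma>0 <= g z" using \<gamma>0(1) \<gamma>0(2)[OF zR] by linarith+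
    define r where "r = G * (Bm * bias n) + B1 * rate n + B2 * rate n"
    define v where "v = iter_partial R0 js m z"
    have bias0: "0 <= bias n" using h_pos[OF n] by (intro sum_nonneg less_imp_le[OF prod_tuple_pos])
    have rt0: "0 < rate n" by (rule rate_pos[OF elim])
    have r0: "0 <= r" unfolding r_def using G(1) Bm(1) B1(1) B2(1) bias0 rt0 by (intro add_nonneg_nonneg mult_nonneg_nonneg) auto
    have Pp: "0 < prod_tuple (h n) js" by (rule prod_tuple_pos) (rule h_pos[OF n])
    have "\<exists>u. lp_deriv p K (A n) (h n) n (%i. X n i \<omega>) (%i. Y n i \<omega>) js z = Some u \<and>
     \<bar>u - tuple_fact js * (iter_partial R0 (tup (tuple_pos p js)) m z / tuple_fact (tup (tuple_pos p js)))\<bar>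
      <= tuple_fact js * (2 * t0 * real (length all_tuples) * r / g z) / prod_tuple (h n) js"
    proof (rule lp_deriv_error[where \<theta>="%l. iter_partial R0 (tup l) m z / tuple_fact (tup l)" and T=T and S=S and \<epsilon>=\<epsilon> and N="real n * hvol n"])
     show "0 < A n j" "0 < h n j" for j using A_pos[OF n] h_pos[OF n] by auto
     show "\<bar>moment_avg k l n \<omega> z - g z * S k l\<bar> <= \<epsilon>"
      if "k < length all_tuples" "l < length all_tuples" for k l using H1 that z by blast
     show "\<bar>(\<Sum>i=1..n. K (site n z (X n i \<omega>)) * mval k (site n z (X n i \<omega>)) * (Y n i \<omega> -
      (\<Sum>l<length all_tuples. iter_partial R0 (tup l) m z / tuple_fact (tup l) * prod_tuple (vec_nth (cdiv (X n i \<omega>) (A n) - z)) (tup l)))) / (real n * hvol n)\<bar> <= r"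
      if "k < length all_tuples" for k
     proof -
      have k: "k \<in> {..<length all_tuples}" using that by simp
      show ?thesis unfolding r_def
       by (rule residual_bound[OF n z w Bm(2,1) bspec[OF bspec[OF H2 k] z] bspec[OF bspec[OF H3 k] z] bspec[OF bspec[OF H4 k] z]])
     qed
     show "2 * t0 * real (length all_tuples) * real (length all_tuples) * \<epsilon> <= g z" unfolding \<epsilon>D by (rule gz(2))
    qed (use N T t0s t0 \<epsilon> gz js in auto)
    then obtain u where u: "lp_deriv p K (A n) (h n) n (%i. X n i \<omega>) (%i. Y n i \<omega>) js z = Some u"
     "\<bar>u - v\<bar> <= tuple_fact js * (2 * t0 * real (length all_tuples) * r / g z) / prod_tuple (h n) js"
     using tuple_fact_ge_1[of js] unfolding tuple_pos_correct(2)[OF js] v_def by auto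
    have "tuple_fact js * (2 * t0 * real (length all_tuples) * r / g z) <= tuple_fact js * (2 * t0 * real (length all_tuples) * r / \<gamma>0)"
     using tuple_fact_ge_1[of js] t0 r0 \<gamma>0(1) gz by (intro mult_left_mono divide_left_mono) auto
    also have "... = c * r" unfolding c_def by simp
    also have "... <= C * (bias n + rate n)"
    proof -
     have "r <= (G * Bm + B1 + B2) * (bias n + rate n)"
      unfolding r_def using G(1) Bm(1) B1(1) B2(1) bias0 rt0 by (simp add: algebra_simps add_increasing mult_nonneg_nonneg)
     then have "c * r <= c * ((G * Bm + B1 + B2) * (bias n + rate n))" using c0 by (rule mult_left_mono)
     also have "... <= C * (bias n + rate n)" unfolding C_def using bias0 rt0 by (simp add: algebra_simps)
     finally show ?thesis .
    qed
    finally have "tuple_fact js * (2 * t0 * real (length all_tuples) * r / g z) / prod_tuple (h n) js <= C * (bias n + rate n) / prod_tuple (h n) js"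
     using Pp by (intro divide_right_mono) auto
    then have "\<bar>u - v\<bar> <= C * (bias n / prod_tuple (h n) js + rate n / prod_tuple (h n) js)"
     using u(2) by (simp add: add_divide_distrib[symmetric])
    then show "est_err js n \<omega> z
     <= ennreal (C * (bias n / prod_tuple (h n) js + rate n / prod_tuple (h n) js))"
     unfolding u(1) est_error_def v_def option.case by (rule ennreal_leI)
   qed
  qed
 qed
 show ?thesis
  unfolding bigOp_def
 proof (intro allI impI exI[of _ C] conjI C0)
  fix \<delta> :: real assume "0 < \<delta>"
  with main have "\<forall>\<^sub>F n in sequentially. \<exists>E\<in>sets M. prob E <= \<delta> \<and> {\<omega>\<in>space M. \<not> (\<forall>z\<in>region n.
   est_err js n \<omega> z
    <= ennreal (C * (bias n / prod_tuple (h n) js + rate n / prod_tuple (h n) js)))} \<subseteq> E"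
   unfolding whp_def by blast
  then show "\<forall>\<^sub>F n in sequentially. \<exists>E\<in>sets M. prob E <= \<delta> \<and>
   {\<omega>\<in>space M. ennreal (C * (bias n / prod_tuple (h n) js + sqrt (ln (real n) / (Avol n * hvol n * (prod_tuple (h n) js)\<^sup>2))))
    < (SUP z\<in>region n. est_err js n \<omega> z)} \<subseteq> E"
   using eventually_ge_at_top[of 1]
  proof eventually_elim
   case (elim n)
   from elim(1) obtain E where E: "E \<in> sets M" "prob E <= \<delta>" and sub: "{\<omega>\<in>space M. \<not> (\<forall>z\<in>region n.
    est_err js n \<omega> z
     <= ennreal (C * (bias n / prod_tuple (h n) js + rate n / prod_tuple (h n) js)))} \<subseteq> E" by (elim bexE conjE)
   show ?case unfolding rate_over_tuple[OF elim(2)]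
   proof (intro bexI[of _ E] conjI E subset_trans[OF _ sub] subsetI, elim CollectE conjE, intro CollectI conjI notI)
    fix \<omega> assume lt: "ennreal (C * (bias n / prod_tuple (h n) js + rate n / prod_tuple (h n) js))
     < (SUP z\<in>region n. est_err js n \<omega> z)"
     and all: "\<forall>z\<in>region n. est_err js n \<omega> z
     <= ennreal (C * (bias n / prod_tuple (h n) js + rate n / prod_tuple (h n) js))"
    have le: "(SUP z\<in>region n. est_err js n \<omega> z)
     <= ennreal (C * (bias n / prod_tuple (h n) js + rate n / prod_tuple (h n) js))"
     using all by (intro SUP_least) blast
    show False by (rule notE[OF leD[OF le] lt])
   qed
  qed
 qed
qed

end

theorem theorem5p1:
  fixes M :: "'a measure"
    and p q1 q2 :: nat
    and A A1 A2 h :: "nat \<Rightarrow> 'd::{finite,linorder} \<Rightarrow> real"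
    and X :: "nat \<Rightarrow> nat \<Rightarrow> 'a \<Rightarrow> real ^ 'd::{finite,linorder}"
    and e :: "real ^ 'd::{finite,linorder} \<Rightarrow> 'a \<Rightarrow> real"
    and eps :: "nat \<Rightarrow> 'a \<Rightarrow> real"
    and Y :: "nat \<Rightarrow> nat \<Rightarrow> 'a \<Rightarrow> real"
    and m \<eta> \<sigma>\<^sub>\<epsilon> g K :: "real ^ 'd::{finite,linorder} \<Rightarrow> real"
    and \<kappa> C\<^sub>K :: real
    and \<beta>\<^sub>1 \<omega>\<^sub>2 :: "real \<Rightarrow> real"
  assumes p: "p \<ge> 1"
    and M: "prob_space M"
    \<comment> \<open>model\<close>
    and A_pos: "\<And>n j. n \<ge> 1 \<Longrightarrow> A n j > 0"
    and A_lim: "\<And>j. filterlim (\<lambda>n. A n j) at_top sequentially"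
    and h_pos: "\<And>n j. n \<ge> 1 \<Longrightarrow> h n j > 0"
    and Y: "\<And>n i \<omega>. 1 \<le> i \<Longrightarrow> i \<le> n \<Longrightarrow> \<omega> \<in> space M \<Longrightarrow>
        Y n i \<omega> = m (cdiv (X n i \<omega>) (A n))
          + \<eta> (cdiv (X n i \<omega>) (A n)) * e (X n i \<omega>) \<omega>
          + \<sigma>\<^sub>\<epsilon> (cdiv (X n i \<omega>) (A n)) * eps i \<omega>"
    and e_field: "random_field M e"
    and e_mean: "\<And>x. integrable M (e x)" "\<And>x. (LINT \<omega>|M. e x \<omega>) = 0"
    and e_var: "\<And>x. integrable M (\<lambda>\<omega>. (e x \<omega>)\<^sup>2)" "\<And>x. (LINT \<omega>|M. (e x \<omega>)\<^sup>2) = 1"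
    \<comment> \<open>mean, variance functions and measurement errors\<close>
    and m: "cont_partially_diff_on (p + 1) R0 m"
    and \<eta>: "\<And>z. z \<in> R0 \<Longrightarrow> \<eta> z > 0" "continuous_on R0 \<eta>" "(INF z\<in>R0. \<eta> z) > 0"
    and eps_iid: "prob_space.indep_vars M (\<lambda>_. borel) eps {1..}"
      "\<And>i. i \<ge> 1 \<Longrightarrow> distr M borel (eps i) = distr M borel (eps 1)"
    and eps_mean: "integrable M (eps 1)" "(LINT \<omega>|M. eps 1 \<omega>) = 0"
    and eps_var: "integrable M (\<lambda>\<omega>. (eps 1 \<omega>)\<^sup>2)" "(LINT \<omega>|M. (eps 1 \<omega>)\<^sup>2) = 1"
    and eps_moment: "q1 > 4" "integrable M (\<lambda>\<omega>. \<bar>eps 1 \<omega>\<bar> ^ q1)"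
    and \<sigma>\<^sub>\<epsilon>: "\<And>z. z \<in> R0 \<Longrightarrow> \<sigma>\<^sub>\<epsilon> z > 0" "continuous_on R0 \<sigma>\<^sub>\<epsilon>" "(INF z\<in>R0. \<sigma>\<^sub>\<epsilon> z) > 0"
    \<comment> \<open>sampling\<close>
    and \<kappa>: "\<kappa> \<ge> 0" "(\<lambda>n. cprod (A n) / real n) \<longlonglongrightarrow> \<kappa>"
    and g: "\<And>z. g z \<ge> 0" "integrable lborel g" "(LINT z|lborel. g z) = 1"
      "closure {z. g z \<noteq> 0} = R0" "continuous_on R0 g" "\<And>z. z \<in> R0 \<Longrightarrow> g z > 0"
    and X_indep: "\<And>n. n \<ge> 1 \<Longrightarrow> prob_space.indep_vars M (\<lambda>_. borel) (X n) {1..n}"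
    and X_density: "\<And>n i. 1 \<le> i \<Longrightarrow> i \<le> n \<Longrightarrow>
        distributed M lborel (X n i) (\<lambda>x. ennreal (g (cdiv x (A n)) / cprod (A n)))"
    and indep: "\<And>n. n \<ge> 1 \<Longrightarrow> prob_space.indep_sets M
        (\<lambda>k. [gen_sigma M (X n) {1..n}, gen_sigma M e UNIV, gen_sigma M eps {1..n}] ! k) {..<3}"
    \<comment> \<open>random field and bandwidths\<close>
    and A12_pos: "\<And>n j. n \<ge> 1 \<Longrightarrow> A1 n j > 0" "\<And>n j. n \<ge> 1 \<Longrightarrow> A2 n j > 0"
    and e_stationary: "stationary M e"
    and e_moment: "q2 > 4" "integrable M (\<lambda>\<omega>. \<bar>e 0 \<omega>\<bar> ^ q2)"
    and e_cov: "integrable lborel (\<lambda>v. LINT \<omega>|M. e 0 \<omega> * e v \<omega>)"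
    and blocks: "\<And>j. filterlim
        (\<lambda>n. min (A2 n j) (min (A1 n j / A2 n j) (A n j * h n j / A1 n j))) at_top sequentially"
    and \<beta>\<^sub>1: "antimono_on {0<..} \<beta>\<^sub>1" "(\<beta>\<^sub>1 \<longlongrightarrow> 0) at_top"
    and \<omega>\<^sub>2: "mono_on {0<..} \<omega>\<^sub>2"
    and mixing: "\<And>a b. a > 0 \<Longrightarrow> b > 0 \<Longrightarrow> beta_mix M e a b \<le> \<beta>\<^sub>1 a * \<omega>\<^sub>2 b"
    and h_lim: "\<And>j. (\<lambda>n. h n j) \<longlonglongrightarrow> 0"
    and block_shape: "(\<lambda>n. cprod (A1 n) / Max (range (A1 n)) ^ CARD('d::{finite,linorder})) \<in> \<Theta>(\<lambda>_. 1)"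
    and bandwidth: "\<exists>\<iota>>0. (\<lambda>_. 1) \<in> O(\<lambda>n. cprod (A n) powr (1 / 2) * cprod (h n) powr (1 / 2) /
        (real n powr (1 / real q2) * Max (range (A1 n)) ^ CARD('d::{finite,linorder}) * ln (real n) powr (1 / 2 + \<iota>)))"
    and mixing_rate: "(\<lambda>n. real n ^ CARD('d::{finite,linorder}) * cprod (A n) powr (1 - real CARD('d::{finite,linorder}) / 2) * cprod (h n) powr (real CARD('d::{finite,linorder}) / 2) /
        (ln (real n) powr (real CARD('d::{finite,linorder}) / 2) * cprod (A1 n)) * \<beta>\<^sub>1 (Min (range (A2 n))) * \<omega>\<^sub>2 (cprod (A n) * cprod (h n))) \<longlonglongrightarrow> 0"
    \<comment> \<open>kernel\<close>
    and K_int: "integrable lborel K" "(LINT z|lborel. K z) = 1"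
    and K_bounded: "bounded (range K)"
    and K_supp: "C\<^sub>K > 0" "{z. K z \<noteq> 0} \<subseteq> cbox (\<chi> j. - C\<^sub>K) (\<chi> j. C\<^sub>K)"
      "cbox (\<chi> j. - C\<^sub>K) (\<chi> j. C\<^sub>K) \<subseteq> (R0 :: (real ^ 'd::{finite,linorder}) set)"
    and K_Lipschitz: "\<exists>L>0. \<forall>v1 v2. \<bar>K v1 - K v2\<bar> \<le> L * norm1 (v1 - v2)"
    and S: "invertible_mat (moment_matrix p K)"
    and q: "q1 \<ge> q2"
  shows "\<forall>js. sorted js \<and> length js \<le> p \<longrightarrow>
    bigOp M
      (\<lambda>n \<omega>. SUP z\<in>trimmed_box C\<^sub>K (h n).
         est_error (lp_deriv p K (A n) (h n) n (\<lambda>i. X n i \<omega>) (\<lambda>i. Y n i \<omega>) js z)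
                   (iter_partial R0 js m z))
      (\<lambda>n. (\<Sum>ks | sorted ks \<and> length ks = p + 1. prod_tuple (h n) ks) / prod_tuple (h n) js
         + sqrt (ln (real n) / (cprod (A n) * cprod (h n) * (prod_tuple (h n) js)\<^sup>2)))"
proof (intro allI impI)
 fix js :: "'d list" assume js: "sorted js \<and> length js \<le> p"
 interpret spatial_regression M p q1 q2 A A1 A2 h X e eps Y m \<eta> \<sigma>\<^sub>\<epsilon> g K \<kappa> C\<^sub>K \<beta>\<^sub>1 \<omega>\<^sub>2
  by (intro spatial_regression.intro spatial_regression_axioms.intro) (fact assms)+
 show "bigOp M
   (\<lambda>n \<omega>. SUP z\<in>trimmed_box C\<^sub>K (h n).
     est_error (lp_deriv p K (A n) (h n) n (\<lambda>i. X n i \<omega>) (\<lambda>i. Y n i \<omega>) js z) (iter_partial R0 js m z))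
   (\<lambda>n. (\<Sum>ks | sorted ks \<and> length ks = p + 1. prod_tuple (h n) ks) / prod_tuple (h n) js
     + sqrt (ln (real n) / (cprod (A n) * cprod (h n) * (prod_tuple (h n) js)\<^sup>2)))"
  using js by (intro uniform_rate) auto
qed

end
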